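(* In each of the two cases (odd case and even case), there is a monomorphism $\chi_*:\mathcal{B}\to\mathcal{A}_{BCR}$ of $\mathbb{Q}$-vector spaces, namely the linear map $\chi_*$ induced on quotients by the inclusion $\chi:\mathcal{C}\to\mathcal{D}$ which regards a colored hairy graph as a colored BCR graph without solid edges.
   Context: All graphs are finite; loops and multiple edges are allowed unless excluded, and a loop at a vertex counts twice among the edges at that vertex. **BCR graphs.** A BCR graph is a connected graph such that: (1) there are (at most) two types of vertices, external and internal, and there is at least one external vertex; (2) there are (at most) two types of edges, dashed and solid; (3) each internal vertex has exactly three dashed edges and no solid edge; (4) each external vertex has exactly one dashed edge and at most two solid edges; (5) the subgraph formed by the external vertices and the solid edges is a disjoint union of broken lines, i.e. of paths (a single vertex is allowed); in particular there are no solid cycles, no solid loops and no double solid edges. **Hairy graphs.** A hairy graph is a BCR graph with no solid edges: a connected graph with at least one external vertex, all edges dashed, each external vertex having exactly one edge and each internal vertex exactly three. **Colorings.** Fix one of two cases. Odd case: a coloring is an orientation of every edge together with a labelling of the vertices by $1,\dots,n$ ($n$ the number of vertices). Even case: a coloring is a numbering of all edges (solid and dashed) by $1,\dots,m$ ($m$ the number of edges). Two colorings of isomorphic underlying graphs (isomorphisms preserve the types of vertices and edges) have the same (resp. opposite) orientation if they are related by an even (resp. odd) change, where the parity is the parity of the permutation of vertex labels plus the number of edges whose orientation is reversed (odd case), or the parity of the permutation of edge numbers (even case). $\mathcal{D}$ (resp. $\mathcal{C}$) is the $\mathbb{Q}$-vector space generated by colored BCR graphs (resp. colored hairy graphs).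 Orientation relations: $D=D'$ if $D,D'$ have isomorphic underlying graphs and the same orientation; $D=-D'$ if they have opposite orientation. **Contraction.** For a non-loop edge $e$, the contraction of a colored graph along $e$ is defined, up to orientation relations, as follows. Odd case: change the coloring, recording the sign, so that $e$ is oriented from vertex $1$ to vertex $2$; collapse $e$, label the merged vertex $1$, decrease the labels of the vertices $3,4,\dots$ by one, and keep the orientations of the other edges. Even case: change the coloring, recording the sign, so that $e$ has number $1$; collapse $e$ and decrease all other edge numbers by one. **IHX relations.** Let $e$ be a dashed edge joining two distinct internal vertices. Contracting $e$ gives a vertex with four dashed half-edges. Let $D_1,D_2,D_3$ be the three graphs obtained by expanding this vertex into two internal vertices joined by a dashed edge (one graph for each partition of the four half-edges into two pairs), colored so that contracting the new edge gives the same oriented graph in all three cases. The IHX relation is $D_1+D_2+D_3=0$ (also written $D_1=D_2-D_3$ with the sign absorbed in the coloring). **STU relations.** Let $S$ be a colored BCR graph with a dashed edge $e$ joining an external vertex $v$ and an internal vertex $w$, and let $x,y$ be the other two dashed half-edges at $w$. (I) Suppose $v$ has one or two solid edges. Let $T,U$ be obtained from the contraction of $S$ along $e$ by replacing the merged vertex by two external vertices $p,q$ joined by a new solid edge; if $v$ has two solid half-edges $a,b$, then $a$ is attached to $p$ and $b$ to $q$; if $v$ has a single solid half-edge $a$, it is attached to $p$. In $T$, $x$ is attached to $p$ and $y$ to $q$; in $U$, $y$ is attached to $p$ and $x$ to $q$. Color $T$ and $U$ so that the contraction of each along the edge $pq$ gives the same oriented graph as the contraction of $S$ along $e$. The relation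 is $S+T+U=0$ (also written $S=T-U$ with the signs absorbed in the colorings). (II) Suppose $v$ has no solid edge. Let $T$ be obtained by replacing the merged vertex by two external vertices $p,q$ joined by a new solid edge, with $x$ attached to $p$ and $y$ to $q$, colored by the same rule. The relation is $S+T=0$ (also written $S=T$ with the sign absorbed). **Quotients.** $\mathcal{A}_{BCR}$ is the quotient of $\mathcal{D}$ by the IHX, STU and orientation relations. $\mathcal{B}$ is the quotient of $\mathcal{C}$ by the orientation and IHX relations and, in the odd case only, additionally by the relation that a hairy graph containing an internal vertex which carries a loop and whose third edge goes to an external vertex is zero. *)

theory Defs
  imports
    Complex_Main
    "HOL-Library.Poly_Mapping"
    "HOL-Combinatorics.Permutations"
    "HOL-Algebra.Module"
begin

text \<open>
  Graphs are given by half-edges: an edge \<open>e\<close> consists of the two half-edges \<open>(e, False)\<close> and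
  \<open>(e, True)\<close>, and \<open>vat G h\<close> is the vertex at which the half-edge \<open>h\<close> is attached. Loops and
  multiple edges are allowed, and a loop contributes two half-edges to its vertex. The order of
  the two half-edges of an edge is only a naming device: isomorphisms may exchange them.
  Vertices that are not external are internal, edges that are not solid are dashed.
  Taking names of vertices and edges in \<open>nat\<close> is no restriction, as graphs are finite and
  only matter up to isomorphism.
\<close>

type_synonym half_edge = "nat \<times> bool"

record graph =
  verts :: "nat set"
  edges :: "nat set"
  vat :: "half_edge \<Rightarrow> nat"
  externals :: "nat set"
  solids :: "nat set"

definition internals :: "graph \<Rightarrow> nat set" where
  "internals G = verts G - externals G"

definition dashed :: "graph \<Rightarrow> nat set" where
  "dashed G = edges G - solids G"

definition half_edges :: "graph \<Rightarrow> half_edge set" where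
  "half_edges G = edges G \<times> UNIV"

definition halves_at :: "graph \<Rightarrow> nat \<Rightarrow> half_edge set" where
  "halves_at G u = {h \<in> half_edges G. vat G h = u}"

definition solid_halves_at :: "graph \<Rightarrow> nat \<Rightarrow> half_edge set" where
  "solid_halves_at G u = {h \<in> halves_at G u. fst h \<in> solids G}"

definition dashed_halves_at :: "graph \<Rightarrow> nat \<Rightarrow> half_edge set" where
  "dashed_halves_at G u = {h \<in> halves_at G u. fst h \<in> dashed G}"

definition opp :: "half_edge \<Rightarrow> half_edge" where
  "opp h = (fst h, \<not> snd h)"

definition finite_graph :: "graph \<Rightarrow> bool" where
  "finite_graph G \<longleftrightarrow> finite (verts G) \<and> finite (edges G) \<and> vat G ` half_edges G \<subseteq> verts G
     \<and> externals G \<subseteq> verts G \<and> solids G \<subseteq> edges G"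

definition adjacent :: "graph \<Rightarrow> (nat \<times> nat) set" where
  "adjacent G = {(vat G h, vat G (opp h)) | h. h \<in> half_edges G}"

definition connected_graph :: "graph \<Rightarrow> bool" where
  "connected_graph G \<longleftrightarrow> verts G \<noteq> {} \<and> (\<forall>u\<in>verts G. \<forall>v\<in>verts G. (u, v) \<in> (adjacent G)\<^sup>*)"

definition broken_line :: "graph \<Rightarrow> nat list \<Rightarrow> nat list \<Rightarrow> bool" where
  "broken_line G vs es \<longleftrightarrow> distinct vs \<and> distinct es \<and> length vs = Suc (length es)
     \<and> (\<forall>i<length es. {vat G (es ! i, False), vat G (es ! i, True)} = {vs ! i, vs ! Suc i})"

definition disjoint_broken_lines :: "graph \<Rightarrow> bool" where
  "disjoint_broken_lines G \<longleftrightarrow> (\<exists>P. (\<forall>(vs, es)\<in>P. broken_line G vs es)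
     \<and> (\<forall>p\<in>P. \<forall>q\<in>P. p \<noteq> q \<longrightarrow> set (fst p) \<inter> set (fst q) = {})
     \<and> (\<Union>p\<in>P. set (fst p)) = externals G
     \<and> (\<Union>p\<in>P. set (snd p)) = solids G)"

definition bcr_graph :: "graph \<Rightarrow> bool" where
  "bcr_graph G \<longleftrightarrow> finite_graph G \<and> connected_graph G \<and> externals G \<noteq> {}
     \<and> (\<forall>u\<in>internals G. card (dashed_halves_at G u) = 3 \<and> solid_halves_at G u = {})
     \<and> (\<forall>u\<in>externals G. card (dashed_halves_at G u) = 1 \<and> card (solid_halves_at G u) \<le> 2)
     \<and> disjoint_broken_lines G"

definition hairy_graph :: "graph \<Rightarrow> bool" where
  "hairy_graph G \<longleftrightarrow> bcr_graph G \<and> solids G = {}"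

datatype parity = OddCase | EvenCase

text \<open>
  In an odd coloring, the edge \<open>e\<close> is oriented so that \<open>(e, dir e)\<close> is the half-edge at its
  source, and \<open>lab\<close> labels the vertices. In an even coloring \<open>num\<close> numbers the edges.
\<close>

datatype coloring =
    OddColoring (dir: "nat \<Rightarrow> bool") (lab: "nat \<Rightarrow> nat")
  | EvenColoring (num: "nat \<Rightarrow> nat")

type_synonym colored_graph = "graph \<times> coloring"

fun is_coloring :: "parity \<Rightarrow> graph \<Rightarrow> coloring \<Rightarrow> bool" where
  "is_coloring OddCase G (OddColoring d l) = bij_betw l (verts G) {1..card (verts G)}"
| "is_coloring EvenCase G (EvenColoring n) = bij_betw n (edges G) {1..card (edges G)}"
| "is_coloring _ G _ = False"

definition graph_iso :: "graph \<Rightarrow> graph \<Rightarrow> (nat \<Rightarrow> nat) \<Rightarrow> (half_edge \<Rightarrow> half_edge) \<Rightarrow> bool" where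
  "graph_iso G G' f h \<longleftrightarrow> bij_betw f (verts G) (verts G') \<and> f ` externals G = externals G'
     \<and> bij_betw h (half_edges G) (half_edges G')
     \<and> (\<forall>x\<in>half_edges G. h (opp x) = opp (h x) \<and> vat G' (h x) = f (vat G x)
          \<and> (fst (h x) \<in> solids G' \<longleftrightarrow> fst x \<in> solids G))"

text \<open>The permutation taking the number of \<open>a \<in> A\<close> under \<open>l\<close> to its number under \<open>l'\<close>.\<close>

definition renumbering :: "nat set \<Rightarrow> (nat \<Rightarrow> nat) \<Rightarrow> (nat \<Rightarrow> nat) \<Rightarrow> nat \<Rightarrow> nat" where
  "renumbering A l l' = (\<lambda>i. if i \<in> l ` A then l' (inv_into A l i) else i)"

text \<open>
  The sign of the change between a coloring of \<open>G\<close> and a coloring of a second graph that is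
  identified with \<open>G\<close> by the isomorphism given by \<open>f\<close> on vertices and \<open>h\<close> on half-edges.
  The value \<open>0\<close> for colorings of different kinds is never used.
\<close>

fun change_sign ::
  "graph \<Rightarrow> (nat \<Rightarrow> nat) \<Rightarrow> (half_edge \<Rightarrow> half_edge) \<Rightarrow> coloring \<Rightarrow> coloring \<Rightarrow> int" where
  "change_sign G f h (OddColoring d l) (OddColoring d' l') =
     sign (renumbering (verts G) l (l' \<circ> f))
     * (-1) ^ card {e \<in> edges G. snd (h (e, d e)) \<noteq> d' (fst (h (e, d e)))}"
| "change_sign G f h (EvenColoring n) (EvenColoring n') =
     sign (renumbering (edges G) n (\<lambda>e. n' (fst (h (e, False)))))"
| "change_sign G f h _ _ = 0"

definition same_orientation :: "colored_graph \<Rightarrow> colored_graph \<Rightarrow> bool" where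
  "same_orientation D D' \<longleftrightarrow>
     (\<exists>f h. graph_iso (fst D) (fst D') f h \<and> change_sign (fst D) f h (snd D) (snd D') = 1)"

definition opposite_orientation :: "colored_graph \<Rightarrow> colored_graph \<Rightarrow> bool" where
  "opposite_orientation D D' \<longleftrightarrow>
     (\<exists>f h. graph_iso (fst D) (fst D') f h \<and> change_sign (fst D) f h (snd D) (snd D') = -1)"

definition colored_bcr_graphs :: "parity \<Rightarrow> colored_graph set" where
  "colored_bcr_graphs par = {(G, c). bcr_graph G \<and> is_coloring par G c}"

definition colored_hairy_graphs :: "parity \<Rightarrow> colored_graph set" where
  "colored_hairy_graphs par = {(G, c). hairy_graph G \<and> is_coloring par G c}"

text \<open>
  The contraction of \<open>G\<close> along a non-loop edge \<open>e\<close>: the endpoint of \<open>(e, True)\<close> is merged into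
  the endpoint of \<open>(e, False)\<close>. The merged vertex is external iff one of the endpoints is, so
  that in an STU relation the contractions of both sides are the same graph.
\<close>

definition merge :: "graph \<Rightarrow> nat \<Rightarrow> nat \<Rightarrow> nat" where
  "merge G e u = (if u = vat G (e, True) then vat G (e, False) else u)"

definition contract :: "graph \<Rightarrow> nat \<Rightarrow> graph" where
  "contract G e = \<lparr>verts = merge G e ` verts G, edges = edges G - {e}, vat = merge G e \<circ> vat G,
     externals = merge G e ` externals G, solids = solids G - {e}\<rparr>"

fun normal_at :: "graph \<Rightarrow> nat \<Rightarrow> coloring \<Rightarrow> bool" where
  "normal_at G e (OddColoring d l) \<longleftrightarrow> l (vat G (e, d e)) = 1 \<and> l (vat G (e, \<not> d e)) = 2"
| "normal_at G e (EvenColoring n) \<longleftrightarrow> n e = 1"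

fun collapse :: "graph \<Rightarrow> nat \<Rightarrow> coloring \<Rightarrow> coloring" where
  "collapse G e (OddColoring d l) =
     OddColoring d (\<lambda>u. if u = vat G (e, False) then 1 else l u - 1)"
| "collapse G e (EvenColoring n) = EvenColoring (\<lambda>e'. n e' - 1)"

text \<open>
  The contraction of \<open>(G, c)\<close> along \<open>e\<close> is \<open>s\<close> times \<open>(contract G e, c')\<close>.
\<close>

definition contracts_to ::
  "parity \<Rightarrow> graph \<Rightarrow> coloring \<Rightarrow> nat \<Rightarrow> int \<Rightarrow> coloring \<Rightarrow> bool" where
  "contracts_to par G c e s c' \<longleftrightarrow> (\<exists>b. is_coloring par G b \<and> normal_at G e b
     \<and> s = change_sign G id id c b \<and> c' = collapse G e b)"

text \<open>
  Two colored graphs have the same oriented contraction along \<open>e\<close>. The underlying contracted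
  graphs have to be equal, not just isomorphic: in the IHX and STU relations the remaining
  half-edges at the merged vertex are the same ones in all terms, and an orientation reversing
  automorphism of the contracted graph would otherwise leave the signs undetermined.
\<close>

definition same_contraction :: "parity \<Rightarrow> nat \<Rightarrow> colored_graph \<Rightarrow> colored_graph \<Rightarrow> bool" where
  "same_contraction par e D D' \<longleftrightarrow> contract (fst D) e = contract (fst D') e
     \<and> (\<exists>s c s' c'. contracts_to par (fst D) (snd D) e s c
          \<and> contracts_to par (fst D') (snd D') e s' c'
          \<and> s * s' * change_sign (contract (fst D) e) id id c c' = 1)"

type_synonym chain = "colored_graph \<Rightarrow>\<^sub>0 rat"

abbreviation gen :: "colored_graph \<Rightarrow> chain" where
  "gen D \<equiv> Poly_Mapping.single D 1"

definition orientation_relators :: "colored_graph set \<Rightarrow> chain set" where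
  "orientation_relators X =
     {gen D - gen D' | D D'. D \<in> X \<and> D' \<in> X \<and> same_orientation D D'}
   \<union> {gen D + gen D' | D D'. D \<in> X \<and> D' \<in> X \<and> opposite_orientation D D'}"

definition attach :: "half_edge \<Rightarrow> nat \<Rightarrow> graph \<Rightarrow> graph" where
  "attach h u G = G\<lparr>vat := (vat G)(h := u)\<rparr>"

text \<open>
  The two ends of \<open>e\<close> and \<open>e\<close> itself are reused as the vertices and the edge of each
  expansion. If the half-edges at the two ends of \<open>e\<close> are paired as \<open>h h'\<close> and \<open>k k'\<close> in \<open>G\<close>,
  then they are paired as \<open>h k\<close>, \<open>h' k'\<close> in \<open>G2\<close> and as \<open>h k'\<close>, \<open>h' k\<close> in \<open>G3\<close>.
\<close>

definition ihx_expansions :: "graph \<Rightarrow> nat \<Rightarrow> graph \<Rightarrow> graph \<Rightarrow> bool" where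
  "ihx_expansions G e G2 G3 \<longleftrightarrow> (\<exists>u v h h' k k'. e \<in> dashed G
     \<and> vat G (e, False) = u \<and> vat G (e, True) = v \<and> u \<in> internals G \<and> v \<in> internals G \<and> u \<noteq> v
     \<and> halves_at G u - {(e, False)} = {h, h'} \<and> h \<noteq> h'
     \<and> halves_at G v - {(e, True)} = {k, k'} \<and> k \<noteq> k'
     \<and> G2 = attach h' v (attach k u G)
     \<and> G3 = attach h' v (attach k' u G))"

definition ihx_relators :: "parity \<Rightarrow> colored_graph set \<Rightarrow> chain set" where
  "ihx_relators par X = {gen (G, c) + gen (G2, c2) + gen (G3, c3) | G c G2 c2 G3 c3.
     (G, c) \<in> X \<and> is_coloring par G2 c2 \<and> is_coloring par G3 c3
     \<and> (\<exists>e. ihx_expansions G e G2 G3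
          \<and> same_contraction par e (G, c) (G2, c2) \<and> same_contraction par e (G, c) (G3, c3))}"

definition stu_site ::
  "graph \<Rightarrow> nat \<Rightarrow> nat \<Rightarrow> nat \<Rightarrow> half_edge \<Rightarrow> half_edge \<Rightarrow> bool" where
  "stu_site G e v w x y \<longleftrightarrow> e \<in> dashed G \<and> v \<in> externals G \<and> w \<in> internals G
     \<and> (\<exists>i. vat G (e, i) = v \<and> vat G (e, \<not> i) = w
          \<and> halves_at G w - {(e, \<not> i)} = {x, y} \<and> x \<noteq> y)"

text \<open>
  The merged vertex is replaced by \<open>p = v\<close> and \<open>q = w\<close>, joined by \<open>e\<close> as the new solid edge.
  Before any reattachment, all half-edges from \<open>v\<close> are at \<open>p\<close>, and \<open>x\<close>, \<open>y\<close> are at \<open>q\<close>.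
\<close>

definition stu_split :: "graph \<Rightarrow> nat \<Rightarrow> nat \<Rightarrow> graph" where
  "stu_split G e w = G\<lparr>externals := insert w (externals G), solids := insert e (solids G)\<rparr>"

definition stu_I_expansions :: "graph \<Rightarrow> nat \<Rightarrow> graph \<Rightarrow> graph \<Rightarrow> bool" where
  "stu_I_expansions G e T U \<longleftrightarrow> (\<exists>v w x y. stu_site G e v w x y
     \<and> ((\<exists>a. solid_halves_at G v = {a}
           \<and> T = attach x v (stu_split G e w)
           \<and> U = attach y v (stu_split G e w))
      \<or> (\<exists>a b. solid_halves_at G v = {a, b} \<and> a \<noteq> b
           \<and> T = attach b w (attach x v (stu_split G e w))
           \<and> U = attach b w (attach y v (stu_split G e w)))))"

definition stu_II_expansion :: "graph \<Rightarrow> nat \<Rightarrow> graph \<Rightarrow> bool" where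
  "stu_II_expansion G e T \<longleftrightarrow> (\<exists>v w x y. stu_site G e v w x y
     \<and> solid_halves_at G v = {} \<and> T = attach x v (stu_split G e w))"

definition stu_relators :: "parity \<Rightarrow> colored_graph set \<Rightarrow> chain set" where
  "stu_relators par X =
     {gen (S, c) + gen (T, cT) + gen (U, cU) | S c T cT U cU.
        (S, c) \<in> X \<and> is_coloring par T cT \<and> is_coloring par U cU
        \<and> (\<exists>e. stu_I_expansions S e T U
             \<and> same_contraction par e (S, c) (T, cT) \<and> same_contraction par e (S, c) (U, cU))}
   \<union> {gen (S, c) + gen (T, cT) | S c T cT.
        (S, c) \<in> X \<and> is_coloring par T cT
        \<and> (\<exists>e. stu_II_expansion S e T \<and> same_contraction par e (S, c) (T, cT))}"

definition has_hair_with_loop :: "graph \<Rightarrow> bool" where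
  "has_hair_with_loop G \<longleftrightarrow> (\<exists>w\<in>internals G. \<exists>l\<in>edges G. \<exists>h\<in>half_edges G.
     vat G (l, False) = w \<and> vat G (l, True) = w \<and> vat G h = w \<and> vat G (opp h) \<in> externals G)"

definition loop_relators :: "colored_graph set \<Rightarrow> chain set" where
  "loop_relators X = {gen (G, c) | G c. (G, c) \<in> X \<and> has_hair_with_loop G}"

definition qscale :: "rat \<Rightarrow> chain \<Rightarrow> chain" where
  "qscale q x = Poly_Mapping.map ((*) q) x"

lemma lookup_qscale [simp]:
  "Poly_Mapping.lookup (qscale q x) D = q * Poly_Mapping.lookup x D"
  by (simp add: qscale_def Poly_Mapping.map.rep_eq when_def)

interpretation chains: vector_space qscale
  by standard (auto intro!: poly_mapping_eqI simp: lookup_add algebra_simps)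

definition free_space :: "colored_graph set \<Rightarrow> chain set" where
  "free_space X = {x. Poly_Mapping.keys x \<subseteq> X}"

definition rat_field :: "rat ring" where
  "rat_field = \<lparr>carrier = UNIV, monoid.mult = (*), one = 1, zero = 0, add = (+)\<rparr>"

text \<open>
  The quotient of a subspace \<open>V\<close> of chains by a subspace \<open>N\<close>, as a space of cosets. The fields
  of the record for a multiplication are irrelevant.
\<close>

definition coset_rel :: "chain set \<Rightarrow> chain set \<Rightarrow> (chain \<times> chain) set" where
  "coset_rel V N = {(x, y). x \<in> V \<and> y \<in> V \<and> x - y \<in> N}"

definition coset :: "chain set \<Rightarrow> chain set \<Rightarrow> chain \<Rightarrow> chain set" where
  "coset V N x = coset_rel V N `` {x}"

definition quotient_space :: "chain set \<Rightarrow> chain set \<Rightarrow> (rat, chain set) module" where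
  "quotient_space V N = \<lparr>carrier = V // coset_rel V N, monoid.mult = undefined, one = undefined,
     zero = coset V N 0, add = (\<lambda>X Y. \<Union>x\<in>X. \<Union>y\<in>Y. coset V N (x + y)),
     smult = (\<lambda>q X. \<Union>x\<in>X. coset V N (qscale q x))\<rparr>"

definition linear_map ::
  "('r, 'm) ring_scheme \<Rightarrow> ('r, 'a, 'k) module_scheme \<Rightarrow> ('r, 'b, 'l) module_scheme
     \<Rightarrow> ('a \<Rightarrow> 'b) \<Rightarrow> bool" where
  "linear_map R V W f \<longleftrightarrow> Module.module R V \<and> Module.module R W \<and> f \<in> carrier V \<rightarrow> carrier W
     \<and> (\<forall>x\<in>carrier V. \<forall>y\<in>carrier V. f (x \<oplus>\<^bsub>V\<^esub> y) = f x \<oplus>\<^bsub>W\<^esub> f y)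
     \<and> (\<forall>r\<in>carrier R. \<forall>x\<in>carrier V. f (r \<odot>\<^bsub>V\<^esub> x) = r \<odot>\<^bsub>W\<^esub> f x)"

definition D_space :: "parity \<Rightarrow> chain set" where
  "D_space par = free_space (colored_bcr_graphs par)"

definition C_space :: "parity \<Rightarrow> chain set" where
  "C_space par = free_space (colored_hairy_graphs par)"

definition A_relations :: "parity \<Rightarrow> chain set" where
  "A_relations par = chains.span (orientation_relators (colored_bcr_graphs par)
     \<union> ihx_relators par (colored_bcr_graphs par) \<union> stu_relators par (colored_bcr_graphs par))"

definition B_relations :: "parity \<Rightarrow> chain set" where
  "B_relations par = chains.span (orientation_relators (colored_hairy_graphs par)
     \<union> ihx_relators par (colored_hairy_graphs par)
     \<union> (if par = OddCase then loop_relators (colored_hairy_graphs par) else {}))"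

definition A_BCR :: "parity \<Rightarrow> (rat, chain set) module" where
  "A_BCR par = quotient_space (D_space par) (A_relations par)"

definition B_hairy :: "parity \<Rightarrow> (rat, chain set) module" where
  "B_hairy par = quotient_space (C_space par) (B_relations par)"

definition A_class :: "parity \<Rightarrow> chain \<Rightarrow> chain set" where
  "A_class par = coset (D_space par) (A_relations par)"

definition B_class :: "parity \<Rightarrow> chain \<Rightarrow> chain set" where
  "B_class par = coset (C_space par) (B_relations par)"

lemma C_space_subset_D_space: "C_space par \<subseteq> D_space par"
  by (auto simp: C_space_def D_space_def free_space_def colored_hairy_graphs_def
      colored_bcr_graphs_def hairy_graph_def)

text \<open>The inclusion \<open>\<chi>\<close>: both spaces consist of chains, and a hairy graph is a BCR graph.\<close>

definition chi :: "chain \<Rightarrow> chain" where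
  "chi x = x"

end

theory Submission
  imports Defs "HOL-Combinatorics.Multiset_Permutations"
begin

text \<open>Injectivity is proved dually. A linear functional that vanishes on the relations of \<open>\<B>\<close> is
  given by its values on hairy graphs, a weight. It extends to BCR graphs as follows. A broken line
  with legs \<open>x\<^sub>1, \<dots>, x\<^sub>k\<close> is treated as a word in a universal enveloping algebra, in which the STU
  relation expresses commutators by brackets, and the inverse of the Poincare-Birkhoff-Witt map
  followed by the projection to the primitive part is the first Eulerian idempotent. So the value
  of a graph is defined by replacing a line with the corresponding combination of iterated
  brackets, that is, of caterpillars ending in one hair, and the STU relation becomes the
  compatibility of the idempotent with replacing two neighbouring letters by their bracket. The
  brackets satisfy antisymmetry and the Jacobi identity because of the orientation and IHX
  relations, which also implies that the direction of the line does not matter. Lines are replaced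
  one after the other, in an order that is irrelevant. The extended functional vanishes on the
  relations of \<open>\<A>\<^sub>B\<^sub>C\<^sub>R\<close>, so a chain of hairy graphs that is zero in the target is killed by all
  functionals on \<open>\<B>\<close>.\<close>

section \<open>Eulerian idempotents\<close>

text \<open>All graph operations keep the sets of vertices and edges: they reattach half-edges and
  change which vertices are external and which edges are solid. So one coloring serves for all terms
  of a relation, and both parity cases run in parallel. In return the letters become odd: the
  bracket is symmetric, and the Jacobi identity and STU have only plus signs. Hence the Eulerian
  coefficients are accompanied by signs of permutations. For \<open>d < n\<close> the coefficient of
  a word of \<open>n\<close> letters with \<open>d\<close> descents is
  \<open>(-1)^d d! (n-1-d)! / n!\<close>. A multilinear Lie element is recovered from its
  coefficients at the words with a fixed last letter \<open>m\<close>, each replaced by its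
  right-nested bracket; this is why only words ending in \<open>m\<close> are summed. A weight sees
  the whole graph, so there is no algebra at hand in which the classical theorems could be applied.
  Independence of \<open>m\<close> and of the direction is not visible in the expansion. It follows
  because the difference of two such values is alternating by STU, while sums of Eulerian values
  with alternating signs vanish.\<close>

fun precedes :: "'a list \<Rightarrow> 'a \<Rightarrow> 'a \<Rightarrow> bool" where
  "precedes [] a b = False"
| "precedes (x # xs) a b = (x = a \<and> b \<in> set xs \<or> precedes xs a b)"

fun inversions :: "('a \<Rightarrow> 'a \<Rightarrow> bool) \<Rightarrow> 'a list \<Rightarrow> nat" where
  "inversions lt [] = 0"
| "inversions lt (a # v) = length (filter (\<lambda>b. lt b a) v) + inversions lt v"

fun descents :: "('a \<Rightarrow> 'a \<Rightarrow> bool) \<Rightarrow> 'a list \<Rightarrow> nat" where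
  "descents lt (a # b # v) = (if lt b a then 1 else 0) + descents lt (b # v)"
| "descents lt v = 0"

section \<open>Order, inversions and descents under concatenation and renaming\<close>

lemma precedes_append:
  "precedes (xs @ ys) a b \<longleftrightarrow> precedes xs a b \<or> precedes ys a b \<or> (a \<in> set xs \<and> b \<in> set ys)"
  by (induction xs) auto

lemma precedes_in_set: "precedes xs a b \<Longrightarrow> a \<in> set xs \<and> b \<in> set xs"
  by (induction xs) auto

lemma precedes_map:
  "inj_on f (set xs) \<Longrightarrow> a \<in> set xs \<Longrightarrow> b \<in> set xs \<Longrightarrow>
    precedes (map f xs) (f a) (f b) = precedes xs a b"
proof (induction xs)
  case (Cons x xs)
  have eq: "f x = f c \<longleftrightarrow> x = c" if "c \<in> set (x # xs)" for c
    using Cons.prems(1) that by (auto simp: inj_on_def)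
  have mem: "f c \<in> f ` set xs \<longleftrightarrow> c \<in> set xs" if "c \<in> set (x # xs)" for c
    using Cons.prems(1) that by (auto simp: inj_on_def)
  show ?case
  proof (cases "a \<in> set xs \<and> b \<in> set xs")
    case True
    then show ?thesis using Cons eq[of a] mem[of b] by auto
  next
    case False
    then have "\<not> precedes xs a b" using precedes_in_set[of xs a b] by auto
    moreover have "\<not> precedes (map f xs) (f a) (f b)"
      using precedes_in_set[of "map f xs" "f a" "f b"] mem[of a] mem[of b] Cons.prems False by auto
    ultimately show ?thesis using eq[of a] mem[of b] Cons.prems by auto
  qed
qed simp

lemma inversions_append:
  "inversions lt (A @ B) = inversions lt A + inversions lt B + (\<Sum>a\<leftarrow>A. length (filter (\<lambda>b. lt b a) B))"
  by (induction A) auto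

lemma inversions_cong:
  "(\<And>a b. a \<in> set v \<Longrightarrow> b \<in> set v \<Longrightarrow> lt a b = lt' a b) \<Longrightarrow> inversions lt v = inversions lt' v"
proof (induction v)
  case (Cons a v)
  then have "filter (\<lambda>b. lt b a) v = filter (\<lambda>b. lt' b a) v"
    by (intro filter_cong) auto
  then show ?case using Cons by auto
qed simp

lemma inversions_map: "inversions lt (map f v) = inversions (\<lambda>a b. lt (f a) (f b)) v"
  by (induction v) (auto simp: filter_map o_def)

lemma descents_cong:
  "(\<And>a b. a \<in> set v \<Longrightarrow> b \<in> set v \<Longrightarrow> lt a b = lt' a b) \<Longrightarrow> descents lt v = descents lt' v"
  by (induction lt v rule: descents.induct) auto

lemma descents_map: "descents lt (map f v) = descents (\<lambda>a b. lt (f a) (f b)) v"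
  by (induction "\<lambda>a b. lt (f a) (f b)" v rule: descents.induct) auto

lemma descents_snoc:
  "descents lt (A @ [a]) = descents lt A + (if A \<noteq> [] \<and> lt a (last A) then 1 else 0)"
  by (induction lt A rule: descents.induct) auto

lemma descents_Cons:
  "descents lt (a # B) = descents lt B + (if B \<noteq> [] \<and> lt (hd B) a then 1 else 0)"
  by (cases B) auto

lemma descents_append:
  "descents lt (A @ a # B) = descents lt (A @ [a]) + descents lt (a # B)"
  by (induction lt A rule: descents.induct) auto

text \<open>The coefficients of the first Eulerian idempotent, as functions of the number of descents.
  They are determined by \<open>coeff_diff\<close> up to a constant, which is chosen such that
  \<open>sum_coeff_descents\<close> holds; the closed form is not needed.\<close>

fun coeff :: "nat \<Rightarrow> nat \<Rightarrow> rat" where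
  "coeff 0 d = 0"
| "coeff (Suc 0) d = 1"
| "coeff (Suc (Suc n)) d =
     (\<Sum>p\<in>permutations_of_set {0..<Suc (Suc n)}.
        \<Sum>j<descents (precedes p) [0..<Suc (Suc n)]. coeff (Suc n) j) / fact (Suc (Suc n))
     - (\<Sum>j<d. coeff (Suc n) j)"

declare coeff.simps(3) [simp del]

lemma coeff_diff: "k > 0 \<Longrightarrow> coeff (Suc k) d - coeff (Suc k) (Suc d) = coeff k d"
  by (cases k) (simp_all add: coeff.simps(3) del: upt_Suc)

text \<open>Naming each letter by its position in \<open>v\<close> turns \<open>v\<close> into
  \<open>[0..<n]\<close> and the orders \<open>xs\<close> into all permutations of this set. The
  constant in \<open>coeff\<close> is the average of the partial sums over these permutations, so
  the total cancels. In other words, the first Eulerian idempotent kills symmetrized words with at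
  least two letters.\<close>

lemma sum_coeff_descents:
  assumes v: "v \<in> permutations_of_set A" and k: "card A \<ge> 2"
  shows "(\<Sum>xs\<in>permutations_of_set A. coeff (card A) (descents (precedes xs) v)) = 0"
proof -
  from k obtain n where n: "card A = Suc (Suc n)" by (metis add_2_eq_Suc le_Suc_ex)
  from v have dv: "distinct v" and sv: "set v = A" by (auto simp: permutations_of_set_def)
  have len: "length v = Suc (Suc n)" using dv sv n distinct_card by fastforce
  define g where "g a = (THE i. i < length v \<and> v ! i = a)" for a
  have g: "g (v ! i) = i" if "i < length v" for i
    unfolding g_def using that dv by (intro the_equality) (auto simp: nth_eq_iff_index_eq)
  have mapg: "map g v = [0..<Suc (Suc n)]"
    using g len by (intro nth_equalityI) (auto simp del: upt_Suc)
  have injg: "inj_on g A"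
    using g sv by (auto simp: inj_on_def in_set_conv_nth)
  have imgg: "g ` A = {0..<Suc (Suc n)}"
    using mapg sv by (metis atLeast_upt list.set_map set_upt)
  have key: "descents (precedes (map g xs)) [0..<Suc (Suc n)] = descents (precedes xs) v"
    if "xs \<in> permutations_of_set A" for xs
  proof -
    have sx: "set xs = A" using that by (auto simp: permutations_of_set_def)
    have "descents (precedes (map g xs)) [0..<Suc (Suc n)]
        = descents (\<lambda>a b. precedes (map g xs) (g a) (g b)) v"
      by (simp only: mapg[symmetric] descents_map)
    also have "\<dots> = descents (precedes xs) v"
      using injg sx sv by (intro descents_cong) (simp add: precedes_map)
    finally show ?thesis .
  qed
  let ?f = "\<lambda>p. \<Sum>j<descents (precedes p) [0..<Suc (Suc n)]. coeff (Suc n) j"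
  let ?P = "permutations_of_set {0..<Suc (Suc n)}"
  have inj: "inj_on (map g) (permutations_of_set A)"
  proof (rule inj_onI)
    fix xs ys assume "xs \<in> permutations_of_set A" "ys \<in> permutations_of_set A" "map g xs = map g ys"
    then show "xs = ys"
      using injg by (auto simp: permutations_of_set_def intro: map_inj_on)
  qed
  have img: "?P = map g ` permutations_of_set A"
    using permutations_of_set_image_inj[OF injg] imgg by simp
  have "(\<Sum>xs\<in>permutations_of_set A. coeff (card A) (descents (precedes xs) v))
      = (\<Sum>p\<in>?P. coeff (Suc (Suc n)) (descents (precedes p) [0..<Suc (Suc n)]))"
    unfolding img by (subst sum.reindex[OF inj]) (simp add: key n del: upt_Suc coeff.simps)
  also have "\<dots> = (\<Sum>p\<in>?P. (\<Sum>q\<in>?P. ?f q) / fact (Suc (Suc n))) - (\<Sum>p\<in>?P. ?f p)"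
    by (simp only: coeff.simps sum_subtractf)
  also have "(\<Sum>p\<in>?P. (\<Sum>q\<in>?P. ?f q) / fact (Suc (Suc n))) = (\<Sum>q\<in>?P. ?f q)"
    by (simp del: upt_Suc fact_Suc)
  finally show ?thesis by simp
qed

text \<open>The two coefficients have sum 0 and difference 1. This value is the origin of the factor
  2 in \<open>line_value\<close>.\<close>

lemma coeff_2_0: "coeff 2 0 = 1 / 2"
proof -
  have two: "2 = Suc (Suc 0)" by simp
  have "permutations_of_set {0, 1 :: nat} = {[0, 1], [1, 0]}"
    by (simp add: permutations_of_set_doubleton)
  then have "coeff (Suc (Suc 0)) 0 + coeff (Suc (Suc 0)) 1 = 0"
    using sum_coeff_descents[of "[0, 1 :: nat]" "{0, 1}"] by simp
  moreover have "coeff (Suc (Suc 0)) 0 - coeff (Suc (Suc 0)) 1 = 1"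
    using coeff_diff[of "Suc 0" 0] by simp
  ultimately show ?thesis unfolding two by simp
qed

text \<open>The sign of the permutation that reorders \<open>xs\<close> into \<open>v\<close>, that
  is, the Koszul sign for odd letters.\<close>

definition word_sgn :: "'a list \<Rightarrow> 'a list \<Rightarrow> rat" where
  "word_sgn xs v = (-1) ^ inversions (precedes xs) v"

text \<open>If \<open>C v\<close> is the value of the iterated bracket \<open>[v\<^sub>1, [v\<^sub>2, \<dots> [v\<^sub>k\<^sub>-\<^sub>1, v\<^sub>k]]]\<close>, this is the
  value of the first Eulerian idempotent on the word \<open>xs\<close>, expanded in the brackets with
  innermost letter \<open>m\<close>.\<close>

definition euler :: "('a list \<Rightarrow> rat) \<Rightarrow> 'a list \<Rightarrow> 'a \<Rightarrow> rat" where
  "euler C xs m = (\<Sum>v\<in>{v \<in> permutations_of_set (set xs). last v = m}.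
     word_sgn xs v * coeff (length xs) (descents (precedes xs) v) * C v)"

lemma euler_cong:
  "(\<And>v. v \<in> permutations_of_set (set xs) \<Longrightarrow> C v = D v) \<Longrightarrow> euler C xs m = euler D xs m"
  by (simp add: euler_def)

text \<open>Signs and coefficients depend only on the positions of the letters, so an injective
  renaming passes to the argument of \<open>C\<close>. Isomorphisms of graphs act on legs in this
  way.\<close>

lemma euler_map:
  assumes inj: "inj_on f (set xs)" and m: "m \<in> set xs"
  shows "euler C (map f xs) (f m) = euler (\<lambda>v. C (map f v)) xs m"
proof -
  have inj': "inj_on (map f) {v \<in> permutations_of_set (set xs). last v = m}"
    using inj by (intro inj_onI) (auto simp: permutations_of_set_def intro: map_inj_on)
  have "{v \<in> permutations_of_set (set (map f xs)). last v = f m}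
      = map f ` {v \<in> permutations_of_set (set xs). last v = m}" (is "?l = ?r")
  proof -
    have "last (map f v) = f m \<longleftrightarrow> last v = m" if "v \<in> permutations_of_set (set xs)" for v
    proof -
      have "set v = set xs" "v \<noteq> []" using that m by (auto simp: permutations_of_set_def)
      then show ?thesis using inj m by (metis inj_on_eq_iff last_in_set last_map)
    qed
    then show ?thesis using permutations_of_set_image_inj[OF inj] by auto
  qed
  moreover have "word_sgn (map f xs) (map f v) = word_sgn xs v"
      "descents (precedes (map f xs)) (map f v) = descents (precedes xs) v"
    if "v \<in> permutations_of_set (set xs)" for v
    using that inj
    by (auto simp: permutations_of_set_def word_sgn_def inversions_map descents_map precedes_map
        intro!: arg_cong[where f = "\<lambda>n. (-1) ^ n"] inversions_cong descents_cong)
  ultimately show ?thesis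
    unfolding euler_def by (simp add: sum.reindex[OF inj'])
qed

section \<open>Two neighbouring letters exchanged, or replaced by a single letter\<close>

context
  fixes X Y :: "'a list" and x y z :: 'a
  assumes dist: "distinct (X @ x # y # Y)" and z: "z \<notin> set (X @ Y)"
begin

abbreviation (input) "prec_xy \<equiv> precedes (X @ x # y # Y)"
abbreviation (input) "prec_yx \<equiv> precedes (X @ y # x # Y)"
abbreviation (input) "prec_z \<equiv> precedes (X @ z # Y)"

lemma swap_precedes:
  "a \<in> set (X @ x # y # Y) \<Longrightarrow> b \<in> set (X @ x # y # Y) \<Longrightarrow> {a, b} \<noteq> {x, y} \<Longrightarrow> prec_yx a b = prec_xy a b"
  using dist by (auto simp: precedes_append dest: precedes_in_set)

lemma swap_precedes':
  assumes "a \<in> set (X @ Y)" "b \<in> set (X @ x # y # Y)"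
  shows "prec_yx a b = prec_xy a b" "prec_yx b a = prec_xy b a"
proof -
  have "{a, b} \<noteq> {x, y}" "{b, a} \<noteq> {x, y}" using assms(1) dist by (auto simp: doubleton_eq_iff)
  then show "prec_yx a b = prec_xy a b" "prec_yx b a = prec_xy b a"
    using assms by (intro swap_precedes; force)+
qed

lemma swap_precedes_xy: "prec_xy x y" "\<not> prec_xy y x" "prec_yx y x" "\<not> prec_yx x y"
  using dist by (auto simp: precedes_append dest: precedes_in_set)

lemma fuse_precedes:
  "a \<in> set (X @ Y) \<Longrightarrow> b \<in> set (X @ Y) \<Longrightarrow> prec_z a b = prec_xy a b"
  "a \<in> set (X @ Y) \<Longrightarrow> prec_z a z = prec_xy a x" "a \<in> set (X @ Y) \<Longrightarrow> prec_z a z = prec_xy a y"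
  "a \<in> set (X @ Y) \<Longrightarrow> prec_z z a = prec_xy x a" "a \<in> set (X @ Y) \<Longrightarrow> prec_z z a = prec_xy y a"
  using dist z by (auto simp: precedes_append dest: precedes_in_set)

text \<open>Descents compare neighbours in \<open>v\<close> only, and the two reference orders
  disagree on no pair other than \<open>x\<close>, \<open>y\<close>.\<close>

lemma swap_descents_nonadjacent:
  assumes "set v \<subseteq> set (X @ x # y # Y)" "distinct v"
    and "\<nexists>A B. v = A @ x # y # B \<or> v = A @ y # x # B"
  shows "descents prec_yx v = descents prec_xy v"
  using assms
proof (induction v rule: induct_list012)
  case (3 a b v)
  have "{a, b} \<noteq> {x, y}"
    using 3(5) by (auto simp: doubleton_eq_iff dest: spec[of _ "[]"])
  then have "prec_yx b a = prec_xy b a" using 3(3) by (intro swap_precedes) auto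
  moreover have "\<nexists>A B. b # v = A @ x # y # B \<or> b # v = A @ y # x # B"
  proof
    assume "\<exists>A B. b # v = A @ x # y # B \<or> b # v = A @ y # x # B"
    then obtain A B where "b # v = A @ x # y # B \<or> b # v = A @ y # x # B" by blast
    then have "a # b # v = (a # A) @ x # y # B \<or> a # b # v = (a # A) @ y # x # B" by auto
    then show False using 3(5) by blast
  qed
  then have "descents prec_yx (b # v) = descents prec_xy (b # v)" using 3 by auto
  ultimately show ?case by simp
qed auto

text \<open>Exactly one comparison, that of \<open>x\<close> with \<open>y\<close>, changes, so the
  two inversion numbers differ by one.\<close>

lemma swap_word_sgn:
  assumes "set v = set (X @ x # y # Y)" "distinct v"
  shows "word_sgn (X @ y # x # Y) v = - word_sgn (X @ x # y # Y) v"
proof -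
  obtain a b A B where ab: "{a, b} = {x, y}" "a \<noteq> b" and v: "v = A @ [a] @ B" "b \<in> set B"
  proof -
    have "x \<in> set v" using assms by auto
    then obtain A B where AB: "v = A @ x # B" by (auto dest: split_list)
    show ?thesis
    proof (cases "y \<in> set B")
      case True then show ?thesis using that[of x y A B] AB dist by auto
    next
      case False
      then have "y \<in> set A" using assms AB dist by auto
      then obtain A1 A2 where "A = A1 @ y # A2" by (auto simp: in_set_conv_decomp)
      then show ?thesis using that[of y x A1 "A2 @ x # B"] AB dist by auto
    qed
  qed
  obtain B1 B2 where B: "B = B1 @ b # B2" using v(2) by (auto simp: in_set_conv_decomp)
  have sub: "set (A @ B1 @ B2) \<subseteq> set (X @ Y)" using assms ab v(1) B by auto
  have eqs: "prec_yx c d = prec_xy c d" if "c \<in> set (A @ B1 @ B2)" "d \<in> set (X @ x # y # Y)" for c d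
    using that sub dist by (intro swap_precedes) (auto simp: doubleton_eq_iff)
  have eqs': "prec_yx d c = prec_xy d c" if "c \<in> set (A @ B1 @ B2)" "d \<in> set (X @ x # y # Y)" for c d
    using that sub dist by (intro swap_precedes) (auto simp: doubleton_eq_iff)
  have abm: "a \<in> set (X @ x # y # Y)" "b \<in> set (X @ x # y # Y)" using ab by auto
  have AB: "c \<in> set (X @ x # y # Y)" if "c \<in> set (A @ B1 @ B2)" for c using that sub by auto
  \<comment> \<open>Isolates the single comparison of \<open>b\<close> with \<open>a\<close>; all
    other summands agree for the two orders.\<close>
  have split: "inversions lt v = inversions lt (A @ B1 @ B2)
      + (\<Sum>c\<leftarrow>A. (if lt a c then 1 else 0) + (if lt b c then 1 else 0))
      + length (filter (\<lambda>c. lt c a) (B1 @ B2)) + (if lt b a then 1 else 0)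
      + (\<Sum>c\<leftarrow>B1. if lt b c then 1 else 0) + length (filter (\<lambda>c. lt c b) B2)" for lt
  proof -
    have cnt: "(\<Sum>c\<leftarrow>C. length (filter (\<lambda>e. lt e c) (D @ b # E))) = (\<Sum>c\<leftarrow>C. length (filter (\<lambda>e. lt e c) (D @ E)))
      + (\<Sum>c\<leftarrow>C. if lt b c then 1 else 0)" for b C D E
      by (induction C) auto
    note cnt[where C = B1 and D = "[]" and E = B2 and b = b] cnt[where C = A and D = B1 and E = B2 and b = b]
      cnt[where C = A and D = "[]" and E = "B1 @ b # B2" and b = a]
    then show ?thesis unfolding v(1) B by (simp add: inversions_append sum_list_addf)
  qed
  have "inversions prec_yx v + (if prec_xy b a then 1 else 0) = inversions prec_xy v + (if prec_yx b a then 1 else 0)"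
  proof -
    have "inversions prec_yx (A @ B1 @ B2) = inversions prec_xy (A @ B1 @ B2)"
      using AB eqs by (intro inversions_cong) auto
    moreover have "(\<Sum>c\<leftarrow>A. (if prec_yx a c then 1 else 0) + (if prec_yx b c then 1 else 0 :: nat))
        = (\<Sum>c\<leftarrow>A. (if prec_xy a c then 1 else 0) + (if prec_xy b c then 1 else 0))"
      using eqs' abm by (intro arg_cong[where f = sum_list] map_cong) auto
    moreover have "filter (\<lambda>c. prec_yx c a) (B1 @ B2) = filter (\<lambda>c. prec_xy c a) (B1 @ B2)"
        "filter (\<lambda>c. prec_yx c b) B2 = filter (\<lambda>c. prec_xy c b) B2"
      using eqs abm by (intro filter_cong; simp)+
    moreover have "(\<Sum>c\<leftarrow>B1. if prec_yx b c then 1 else 0 :: nat) = (\<Sum>c\<leftarrow>B1. if prec_xy b c then 1 else 0)"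
      using eqs' abm by (intro arg_cong[where f = sum_list] map_cong) auto
    ultimately show ?thesis by (simp only: split)
  qed
  moreover have "(prec_xy b a \<and> \<not> prec_yx b a) \<or> (\<not> prec_xy b a \<and> prec_yx b a)"
    using ab swap_precedes_xy by (auto simp: doubleton_eq_iff)
  ultimately have "inversions prec_yx v = Suc (inversions prec_xy v) \<or> inversions prec_xy v = Suc (inversions prec_yx v)"
    by auto
  then show ?thesis by (auto simp: word_sgn_def)
qed

context
  fixes A B
  assumes AB: "set (A @ B) = set (X @ Y)" "distinct (A @ B)"
begin

lemma AB_aux: "set A \<subseteq> set (X @ Y)" "set B \<subseteq> set (X @ Y)" "x \<notin> set A" "x \<notin> set B"
  "y \<notin> set A" "y \<notin> set B" "x \<noteq> y"
  using AB(1) dist by auto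

text \<open>As \<open>x\<close> and \<open>y\<close> are neighbours in the reference word, both
  compare with the remaining letters exactly as \<open>z\<close> does. Only the comparison inside
  the pair can add a descent.\<close>

lemma fuse_descents:
  "descents prec_xy (A @ x # y # B) = descents prec_z (A @ z # B)"
  "descents prec_xy (A @ y # x # B) = Suc (descents prec_z (A @ z # B))"
  "descents prec_yx (A @ x # y # B) = Suc (descents prec_z (A @ z # B))"
  "descents prec_yx (A @ y # x # B) = descents prec_z (A @ z # B)"
proof -
  have mem: "a \<in> set (X @ Y)" if "a \<in> set A \<or> a \<in> set B" for a using that AB_aux(1,2) by auto
  have eqA: "descents prec_xy A = descents prec_z A" "descents prec_yx A = descents prec_z A"
    using mem fuse_precedes(1) swap_precedes'(1) by (auto intro!: descents_cong)
  have eqB: "descents prec_xy B = descents prec_z B" "descents prec_yx B = descents prec_z B"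
    using mem fuse_precedes(1) swap_precedes'(1) by (auto intro!: descents_cong)
  have lA: "last A \<in> set (X @ Y)" if "A \<noteq> []" using that AB_aux(1) last_in_set by blast
  have hB: "hd B \<in> set (X @ Y)" if "B \<noteq> []" using that AB_aux(2) list.set_sel(1) by blast
  have sA: "descents prec_xy (A @ [x]) = descents prec_z (A @ [z])" "descents prec_xy (A @ [y]) = descents prec_z (A @ [z])"
     "descents prec_yx (A @ [x]) = descents prec_z (A @ [z])" "descents prec_yx (A @ [y]) = descents prec_z (A @ [z])"
    unfolding descents_snoc eqA using lA fuse_precedes(4,5) swap_precedes'(2) by auto
  have sB: "descents prec_xy (x # B) = descents prec_z (z # B)" "descents prec_xy (y # B) = descents prec_z (z # B)"
     "descents prec_yx (x # B) = descents prec_z (z # B)" "descents prec_yx (y # B) = descents prec_z (z # B)"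
    unfolding descents_Cons eqB using hB fuse_precedes(2,3) swap_precedes'(1) by auto
  have "descents lt (A @ c # d # B) = descents lt (A @ [c]) + (if lt d c then 1 else 0)
      + descents lt (d # B)" for c d and lt :: "'a \<Rightarrow> 'a \<Rightarrow> bool"
    using descents_append[of lt A c "d # B"] by simp
  note exp = this
  show "descents prec_xy (A @ x # y # B) = descents prec_z (A @ z # B)"
    using descents_append[of prec_z A z B] unfolding exp by (simp only: swap_precedes_xy sA sB) simp
  show "descents prec_xy (A @ y # x # B) = Suc (descents prec_z (A @ z # B))"
    using descents_append[of prec_z A z B] unfolding exp by (simp only: swap_precedes_xy sA sB) simp
  show "descents prec_yx (A @ x # y # B) = Suc (descents prec_z (A @ z # B))"
    using descents_append[of prec_z A z B] unfolding exp by (simp only: swap_precedes_xy sA sB) simp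
  show "descents prec_yx (A @ y # x # B) = descents prec_z (A @ z # B)"
    using descents_append[of prec_z A z B] unfolding exp by (simp only: swap_precedes_xy sA sB) simp
qed

text \<open>Replacing \<open>z\<close> by two letters counts the inversions of \<open>z\<close> once
  more. They are the letters of \<open>A\<close> outside \<open>X\<close> and the letters of
  \<open>B\<close> inside \<open>X\<close>, and their number has the parity of
  \<open>length X + length A\<close>.\<close>

lemma fuse_word_sgn:
  "word_sgn (X @ x # y # Y) (A @ x # y # B)
     = (-1) ^ (length X + length A) * word_sgn (X @ z # Y) (A @ z # B)"
  "word_sgn (X @ x # y # Y) (A @ y # x # B)
     = - ((-1) ^ (length X + length A) * word_sgn (X @ z # Y) (A @ z # B))"
proof -
  let ?a = "length (filter (\<lambda>c. prec_z z c) A)" and ?b = "length (filter (\<lambda>c. prec_z c z) B)"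
  have exp2: "inversions prec_xy (A @ c # d # B) = inversions prec_xy (A @ B)
      + length (filter (\<lambda>e. prec_xy c e) A) + length (filter (\<lambda>e. prec_xy d e) A)
      + (if prec_xy d c then 1 else 0) + length (filter (\<lambda>e. prec_xy e c) B) + length (filter (\<lambda>e. prec_xy e d) B)"
    for c d
    by (simp add: inversions_append sum_list_addf)
     (induction A; simp)
  have exp1: "inversions prec_z (A @ z # B) = inversions prec_z (A @ B) + ?a + ?b"
    by (simp add: inversions_append sum_list_addf) (induction A; simp)
  have AB': "inversions prec_xy (A @ B) = inversions prec_z (A @ B)"
    using AB(1) fuse_precedes(1) by (intro inversions_cong) auto
  have fA: "filter (\<lambda>e. prec_xy x e) A = filter (\<lambda>e. prec_z z e) A" "filter (\<lambda>e. prec_xy y e) A = filter (\<lambda>e. prec_z z e) A"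
    using AB_aux(1) fuse_precedes(4,5) by (auto intro!: filter_cong)
  have fB: "filter (\<lambda>e. prec_xy e x) B = filter (\<lambda>e. prec_z e z) B" "filter (\<lambda>e. prec_xy e y) B = filter (\<lambda>e. prec_z e z) B"
    using AB_aux(2) fuse_precedes(2,3) by (auto intro!: filter_cong)
  have i1: "inversions prec_xy (A @ x # y # B) = inversions prec_z (A @ z # B) + ?a + ?b"
    unfolding exp2 exp1 AB' fA fB using swap_precedes_xy by simp
  have i2: "inversions prec_xy (A @ y # x # B) = Suc (inversions prec_z (A @ z # B) + ?a + ?b)"
    unfolding exp2 exp1 AB' fA fB using swap_precedes_xy by simp
  have Sz: "prec_z z c \<longleftrightarrow> c \<notin> set X" "prec_z c z \<longleftrightarrow> c \<in> set X" if "c \<in> set (X @ Y)" for c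
    using that z dist by (auto simp: precedes_append dest: precedes_in_set)
  have e1: "?a + length (filter (\<lambda>c. c \<in> set X) A) = length A"
  proof -
    have "filter (\<lambda>c. prec_z z c) A = filter (\<lambda>c. c \<notin> set X) A"
      using AB_aux(1) Sz by (intro filter_cong) auto
    then show ?thesis using sum_length_filter_compl[of "\<lambda>c. c \<in> set X" A] by simp
  qed
  have e2: "length (filter (\<lambda>c. c \<in> set X) A) + ?b = length X"
  proof -
    have "filter (\<lambda>c. prec_z c z) B = filter (\<lambda>c. c \<in> set X) B"
      using AB_aux(2) Sz by (intro filter_cong) auto
    then have "length (filter (\<lambda>c. c \<in> set X) A) + ?b = length (filter (\<lambda>c. c \<in> set X) (A @ B))"
      by simp
    also have "\<dots> = card (set (filter (\<lambda>c. c \<in> set X) (A @ B)))"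
      using AB(2) by (metis distinct_card distinct_filter)
    also have "set (filter (\<lambda>c. c \<in> set X) (A @ B)) = set X" using AB(1) by auto
    finally show ?thesis using dist distinct_card by fastforce
  qed
  have "a + b + (m + n) = 2 * (a + m)" if "a + f = n" "f + b = m" for a b f m n :: nat
    using that by simp
  from this[OF e1 e2] have "?a + ?b + (length X + length A) = 2 * (?a + length X)" .
  then have "even (?a + ?b + (length X + length A))" by (metis dvd_triv_left)
  then have "(-1 :: rat) ^ (?a + ?b) = (-1) ^ (length X + length A)"
    by (metis even_add minus_one_power_iff)
  then show "word_sgn (X @ x # y # Y) (A @ x # y # B)
     = (-1) ^ (length X + length A) * word_sgn (X @ z # Y) (A @ z # B)"
   "word_sgn (X @ x # y # Y) (A @ y # x # B)
     = - ((-1) ^ (length X + length A) * word_sgn (X @ z # Y) (A @ z # B))"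
    unfolding word_sgn_def i1 i2 by (simp_all add: power_add algebra_simps)
qed

end

end

lemma split_at_inj:
  assumes "A @ x # B = A' @ x # B'" "x \<notin> set A" "x \<notin> set A'"
  shows "A = A' \<and> B = B'"
  using assms
proof (induction A arbitrary: A')
  case Nil
  then show ?case by (cases A') auto
next
  case (Cons a A)
  then show ?case by (cases A') auto
qed

text \<open>The compatibility of the Eulerian idempotent with commutators. The two words give
  opposite signs, so each \<open>v\<close> receives a difference of coefficients. It vanishes unless
  \<open>x\<close> and \<open>y\<close> are neighbours in \<open>v\<close>, and then it is a
  coefficient for one letter less by \<open>coeff_diff\<close>. The hypotheses \<open>jac\<close>
  and \<open>br\<close> are the Jacobi identity and the symmetry of the innermost bracket for odd
  letters, with \<open>z\<close> in the role of the bracket of \<open>x\<close> and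
  \<open>y\<close>.\<close>

lemma euler_swap:
  assumes dist: "distinct (X @ x # y # Y)" and z: "z \<notin> set (X @ Y)"
    and m: "m \<in> set (X @ x # y # Y)"
    and jac: "\<And>A B. distinct (A @ B) \<Longrightarrow> set (A @ B) = set (X @ Y) \<Longrightarrow> B \<noteq> [] \<Longrightarrow>
      C (A @ x # y # B) + C (A @ y # x # B) = (-1) ^ (length X + length A) * C' (A @ z # B)"
    and br: "\<And>A. distinct A \<Longrightarrow> set A = set (X @ Y) \<Longrightarrow>
      C (A @ [x, y]) = (-1) ^ (length X + length A) * C' (A @ [z])"
      "\<And>A. distinct A \<Longrightarrow> set A = set (X @ Y) \<Longrightarrow>
      C (A @ [y, x]) = (-1) ^ (length X + length A) * C' (A @ [z])"
  shows "euler C (X @ x # y # Y) m + euler C (X @ y # x # Y) m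
       = euler C' (X @ z # Y) (if m \<in> {x, y} then z else m)"
proof -
  define P where "P = {v \<in> permutations_of_set (set (X @ x # y # Y)). last v = m}"
  define N where "N = {v \<in> P. \<exists>A B. v = A @ x # y # B \<or> v = A @ y # x # B}"
  define k where "k = Suc (length (X @ Y))"
  define D where "D v = word_sgn (X @ x # y # Y) v
      * (coeff (Suc k) (descents (precedes (X @ x # y # Y)) v)
         - coeff (Suc k) (descents (precedes (X @ y # x # Y)) v)) * C v" for v
  define s where "s A B = word_sgn (X @ z # Y) (A @ z # B)
      * coeff k (descents (precedes (X @ z # Y)) (A @ z # B))" for A B
  have finP: "finite P" by (simp add: P_def)
  have Pv: "set v = set (X @ x # y # Y)" "distinct v" if "v \<in> P" for v
    using that by (auto simp: P_def permutations_of_set_def)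
  have "euler C (X @ x # y # Y) m + euler C (X @ y # x # Y) m = (\<Sum>v\<in>P. D v)"
  proof -
    have P': "{v \<in> permutations_of_set (set (X @ y # x # Y)). last v = m} = P"
      by (simp add: P_def insert_commute)
    have "euler C (X @ y # x # Y) m = (\<Sum>v\<in>P. - word_sgn (X @ x # y # Y) v
        * coeff (Suc k) (descents (precedes (X @ y # x # Y)) v) * C v)"
      unfolding euler_def P'
    proof (rule sum.cong[OF refl])
      fix v assume "v \<in> P"
      then have "word_sgn (X @ y # x # Y) v = - word_sgn (X @ x # y # Y) v"
        using Pv by (intro swap_word_sgn[OF dist z])
      then show "word_sgn (X @ y # x # Y) v * coeff (length (X @ y # x # Y)) (descents (precedes (X @ y # x # Y)) v) * C v
         = - word_sgn (X @ x # y # Y) v * coeff (Suc k) (descents (precedes (X @ y # x # Y)) v) * C v"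
        by (simp add: k_def)
    qed
    moreover have "euler C (X @ x # y # Y) m = (\<Sum>v\<in>P. word_sgn (X @ x # y # Y) v
        * coeff (Suc k) (descents (precedes (X @ x # y # Y)) v) * C v)"
      unfolding euler_def P_def k_def by simp
    ultimately show ?thesis
      by (simp add: D_def algebra_simps flip: sum.distrib sum_negf)
  qed
  also have "\<dots> = (\<Sum>v\<in>N. D v)"
  proof (rule sum.mono_neutral_right[OF finP])
    show "\<forall>v\<in>P - N. D v = 0"
    proof
      fix v assume v: "v \<in> P - N"
      then have "descents (precedes (X @ y # x # Y)) v = descents (precedes (X @ x # y # Y)) v"
        using Pv[of v] by (intro swap_descents_nonadjacent[OF dist z]) (auto simp: N_def)
      then show "D v = 0" by (simp add: D_def)
    qed
  qed (auto simp: N_def)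
  also have "\<dots> = euler C' (X @ z # Y) (if m \<in> {x, y} then z else m)"
  proof -
    have D1: "D (A @ x # y # B) = (-1) ^ (length X + length A) * s A B * C (A @ x # y # B)"
      and D2: "D (A @ y # x # B) = (-1) ^ (length X + length A) * s A B * C (A @ y # x # B)"
      if "set (A @ B) = set (X @ Y)" "distinct (A @ B)" for A B
    proof -
      have c: "coeff (Suc k) d - coeff (Suc k) (Suc d) = coeff k d" for d
        by (rule coeff_diff) (simp add: k_def)
      then have c': "coeff (Suc k) (Suc d) - coeff (Suc k) d = - coeff k d" for d
        by (metis minus_diff_eq)
      show "D (A @ x # y # B) = (-1) ^ (length X + length A) * s A B * C (A @ x # y # B)"
        "D (A @ y # x # B) = (-1) ^ (length X + length A) * s A B * C (A @ y # x # B)"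
        unfolding D_def s_def fuse_word_sgn[OF dist z that] fuse_descents[OF dist z that] c c'
        by simp_all
    qed
    \<comment> \<open>The sign \<open>(-1) ^ (length X + length A)\<close> arises twice, from the
      inversions in \<open>fuse_word_sgn\<close> and from the hypotheses on
      \<open>C\<close>.\<close>
    have sgn2: "(-1 :: rat) ^ n * (-1) ^ n = 1" for n by (simp flip: power_mult_distrib)
    show ?thesis
    proof (cases "m \<in> {x, y}")
      case False
      then have mXY: "m \<in> set (X @ Y)" using m by auto
      \<comment> \<open>The last letter is neither \<open>x\<close> nor \<open>y\<close>, so the
        pair occurs in both orders at the same place and \<open>jac\<close> combines the two
        terms.\<close>
      define AB where "AB = {(A, B). distinct (A @ B) \<and> set (A @ B) = set (X @ Y) \<and> B \<noteq> [] \<and> last B = m}"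
      define f where "f c = (\<lambda>(A, B). A @ c @ B)" for c :: "'a list"
      have mem: "w \<notin> set A" "w \<notin> set B" if "(A, B) \<in> AB" "w \<in> {x, y, z}" for A B w
      proof -
        have "set (A @ B) = set (X @ Y)" using that by (auto simp: AB_def)
        moreover have "w \<notin> set (X @ Y)" using that(2) dist z by auto
        ultimately show "w \<notin> set A" "w \<notin> set B" by auto
      qed
      have inj: "inj_on (f (w # c)) AB" if "w \<in> {x, y, z}" for w c
      proof (rule inj_onI)
        fix p q assume pq: "p \<in> AB" "q \<in> AB" "f (w # c) p = f (w # c) q"
        obtain A B A' B' where "p = (A, B)" "q = (A', B')" by (cases p; cases q) auto
        then show "p = q"
          using pq mem[of A B w] mem[of A' B' w] that split_at_inj[of A w "c @ B" A' "c @ B'"]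
          by (auto simp: f_def)
      qed
      have inP: "f [x, y] p \<in> P" "f [y, x] p \<in> P" if "p \<in> AB" for p
      proof -
        obtain A B where p: "p = (A, B)" by force
        then have "set (A @ B) = set (X @ Y)" "distinct (A @ B)" "B \<noteq> []" "last B = m"
          using that by (auto simp: AB_def)
        then show "f [x, y] p \<in> P" "f [y, x] p \<in> P" using dist mem[of A B] that p
          by (auto simp: P_def f_def permutations_of_set_def)
      qed
      have finAB: "finite AB"
        using inP finP inj[of x "[y]"] by (metis finite_imageD finite_subset image_subsetI insertI1)
      have N: "N = f [x, y] ` AB \<union> f [y, x] ` AB"
      proof
        show "f [x, y] ` AB \<union> f [y, x] ` AB \<subseteq> N" using inP by (fastforce simp: N_def f_def)
        show "N \<subseteq> f [x, y] ` AB \<union> f [y, x] ` AB"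
        proof
          fix v assume v: "v \<in> N"
          then have "\<exists>A B. v = A @ x # y # B \<or> v = A @ y # x # B"
            unfolding N_def mem_Collect_eq by (rule conjunct2)
          then obtain A B where AB: "v = A @ x # y # B \<or> v = A @ y # x # B" by (elim exE)
          have *: "distinct v" "set v = set (X @ x # y # Y)" "last v = m"
            using Pv[of v] v unfolding N_def mem_Collect_eq by (simp_all add: P_def)
          have "set (A @ B) = set v - {x, y}" using AB *(1) by auto
          also have "\<dots> = set (X @ Y)" unfolding *(2) using dist by auto
          finally have "(A, B) \<in> AB"
            using * AB False by (auto simp: AB_def split: if_splits)
          then show "v \<in> f [x, y] ` AB \<union> f [y, x] ` AB" using AB by (force simp: f_def)
        qed
      qed
      have disj: "f [x, y] ` AB \<inter> f [y, x] ` AB = {}"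
      proof (rule ccontr)
        assume "f [x, y] ` AB \<inter> f [y, x] ` AB \<noteq> {}"
        then obtain A B A' B' where *: "(A, B) \<in> AB" "(A', B') \<in> AB" "A @ x # y # B = (A' @ [y]) @ x # B'"
          by (auto simp: f_def)
        then have "A = A' @ [y]"
          using split_at_inj[OF *(3)] mem[of A B x] mem[of A' B' x] dist by auto
        then show False using mem[OF *(1), of y] by auto
      qed
      have M: "{v \<in> permutations_of_set (set (X @ z # Y)). last v = m} = f [z] ` AB"
      proof
        show "f [z] ` AB \<subseteq> {v \<in> permutations_of_set (set (X @ z # Y)). last v = m}"
        proof
          fix v assume "v \<in> f [z] ` AB"
          then obtain A B where p: "(A, B) \<in> AB" "v = A @ z # B" by (auto simp: f_def)
          then have "set (A @ B) = set (X @ Y)" "distinct (A @ B)" "B \<noteq> []" "last B = m"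
            by (auto simp: AB_def)
          then show "v \<in> {v \<in> permutations_of_set (set (X @ z # Y)). last v = m}"
            using p(2) mem[OF p(1), of z] by (auto simp: permutations_of_set_def)
        qed
        show "{v \<in> permutations_of_set (set (X @ z # Y)). last v = m} \<subseteq> f [z] ` AB"
        proof
          fix v assume "v \<in> {v \<in> permutations_of_set (set (X @ z # Y)). last v = m}"
          then have v: "set v = set (X @ z # Y)" "distinct v" "last v = m"
            by (auto simp: permutations_of_set_def)
          then have "z \<in> set v" by auto
          then obtain A B where AB: "v = A @ z # B" by (auto dest: split_list)
          have "set (A @ B) = set v - {z}" using AB v(2) by auto
          also have "\<dots> = set (X @ Y)" unfolding v(1) using z by auto
          finally have "(A, B) \<in> AB" using v AB mXY z by (auto simp: AB_def split: if_splits)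
          then show "v \<in> f [z] ` AB" using AB by (force simp: f_def)
        qed
      qed
      have "(\<Sum>v\<in>N. D v) = (\<Sum>p\<in>AB. D (f [x, y] p)) + (\<Sum>p\<in>AB. D (f [y, x] p))"
        unfolding N using finAB disj
        by (simp add: sum.union_disjoint sum.reindex[OF inj] o_def)
      also have "\<dots> = (\<Sum>p\<in>AB. case p of (A, B) \<Rightarrow> s A B * C' (A @ z # B))"
        unfolding sum.distrib[symmetric]
      proof (rule sum.cong[OF refl])
        fix p assume p: "p \<in> AB"
        obtain A B where AB: "p = (A, B)" by force
        then have *: "set (A @ B) = set (X @ Y)" "distinct (A @ B)" "B \<noteq> []"
          using p by (auto simp: AB_def)
        have "D (f [x, y] p) + D (f [y, x] p)
            = (-1) ^ (length X + length A) * s A B * (C (A @ x # y # B) + C (A @ y # x # B))"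
          using D1[OF *(1,2)] D2[OF *(1,2)] by (simp add: AB f_def algebra_simps)
        also have "\<dots> = ((-1) ^ (length X + length A) * (-1) ^ (length X + length A)) * (s A B * C' (A @ z # B))"
          using jac[OF *(2,1,3)] by (simp only: mult_ac)
        finally show "D (f [x, y] p) + D (f [y, x] p) = (case p of (A, B) \<Rightarrow> s A B * C' (A @ z # B))"
          unfolding sgn2 by (simp add: AB)
      qed
      also have "\<dots> = euler C' (X @ z # Y) m"
        unfolding euler_def M using inj[of z "[]"]
        by (simp add: sum.reindex o_def f_def s_def k_def case_prod_unfold)
      finally show ?thesis using False by simp
    next
      case True
      \<comment> \<open>The last letter \<open>m\<close> belongs to the pair, so the pair must close
        the word and its order is forced. Here \<open>br\<close> is needed instead of
        \<open>jac\<close>.\<close>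
      then obtain w where w: "{w, m} = {x, y}" "w \<noteq> m" using dist by fastforce
      define AA where "AA = {A. distinct A \<and> set A = set (X @ Y)}"
      have ni: "w \<notin> set A" "m \<notin> set A" "z \<notin> set A" if "A \<in> AA" for A
        using that w dist z by (auto simp: AA_def doubleton_eq_iff)
      have N: "N = (\<lambda>A. A @ [w, m]) ` AA"
      proof
        show "(\<lambda>A. A @ [w, m]) ` AA \<subseteq> N"
        proof
          fix v assume "v \<in> (\<lambda>A. A @ [w, m]) ` AA"
          then obtain A where A: "A \<in> AA" "v = A @ [w, m]" by auto
          have "set v = set (X @ x # y # Y)" using A w by (auto simp: AA_def)
          moreover have "distinct v" using A ni[OF A(1)] w by (auto simp: AA_def)
          moreover have "v = A @ x # y # [] \<or> v = A @ y # x # []"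
            using w A(2) by (auto simp: doubleton_eq_iff)
          ultimately show "v \<in> N" using A by (auto simp: N_def P_def permutations_of_set_def)
        qed
        show "N \<subseteq> (\<lambda>A. A @ [w, m]) ` AA"
        proof
          fix v assume v: "v \<in> N"
          then have "\<exists>A B. v = A @ x # y # B \<or> v = A @ y # x # B"
            unfolding N_def mem_Collect_eq by (rule conjunct2)
          then obtain A B where AB: "v = A @ x # y # B \<or> v = A @ y # x # B" by (elim exE)
          have *: "distinct v" "set v = set (X @ x # y # Y)" "last v = m"
            using Pv[of v] v unfolding N_def mem_Collect_eq by (simp_all add: P_def)
          have B: "B = []"
          proof (rule ccontr)
            assume "B \<noteq> []"
            then have "m \<in> set B" using *(3) AB last_in_set[of B] by auto
            then show False using *(1) AB True by auto
          qed
          have "set A = set v - {x, y}" using AB *(1) B by auto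
          also have "\<dots> = set (X @ Y)" unfolding *(2) using dist by auto
          finally have "A \<in> AA" using * AB by (auto simp: AA_def)
          moreover have "v = A @ [w, m]" using AB B *(3) w by (auto simp: doubleton_eq_iff)
          ultimately show "v \<in> (\<lambda>A. A @ [w, m]) ` AA" by blast
        qed
      qed
      have M: "{v \<in> permutations_of_set (set (X @ z # Y)). last v = z} = (\<lambda>A. A @ [z]) ` AA"
      proof
        show "(\<lambda>A. A @ [z]) ` AA \<subseteq> {v \<in> permutations_of_set (set (X @ z # Y)). last v = z}"
          using ni by (auto simp: AA_def permutations_of_set_def)
        show "{v \<in> permutations_of_set (set (X @ z # Y)). last v = z} \<subseteq> (\<lambda>A. A @ [z]) ` AA"
        proof
          fix v assume "v \<in> {v \<in> permutations_of_set (set (X @ z # Y)). last v = z}"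
          then have v: "set v = set (X @ z # Y)" "distinct v" "last v = z"
            by (auto simp: permutations_of_set_def)
          then have "v \<noteq> []" by auto
          then obtain A where A: "v = A @ [z]" using v(3) by (metis append_butlast_last_id)
          have "set A = set v - {z}" using A v(2) by auto
          also have "\<dots> = set (X @ Y)" unfolding v(1) using z by auto
          finally show "v \<in> (\<lambda>A. A @ [z]) ` AA" using A v by (auto simp: AA_def)
        qed
      qed
      have "(\<Sum>v\<in>N. D v) = (\<Sum>A\<in>AA. D (A @ [w, m]))"
        unfolding N by (subst sum.reindex) (auto simp: inj_on_def)
      also have "\<dots> = (\<Sum>A\<in>AA. s A [] * C' (A @ [z]))"
      proof (rule sum.cong[OF refl])
        fix A assume A: "A \<in> AA"
        then have *: "set A = set (X @ Y)" "distinct A" by (auto simp: AA_def)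
        have "D (A @ [w, m]) = (-1) ^ (length X + length A) * s A [] * C (A @ [w, m])"
          using D1[of A "[]"] D2[of A "[]"] * w by (auto simp: doubleton_eq_iff)
        also have "C (A @ [w, m]) = (-1) ^ (length X + length A) * C' (A @ [z])"
          using br[of A] * w by (auto simp: doubleton_eq_iff)
        also have "(-1) ^ (length X + length A) * s A [] * ((-1) ^ (length X + length A) * C' (A @ [z]))
          = ((-1) ^ (length X + length A) * (-1) ^ (length X + length A)) * (s A [] * C' (A @ [z]))"
          by (simp only: mult_ac)
        finally show "D (A @ [w, m]) = s A [] * C' (A @ [z])" unfolding sgn2 by simp
      qed
      also have "\<dots> = euler C' (X @ z # Y) z"
        unfolding euler_def M by (subst sum.reindex) (auto simp: inj_on_def s_def k_def)
      finally show ?thesis using True by simp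
    qed
  qed
  finally show ?thesis .
qed

section \<open>Alternating functions on the orderings of a set\<close>

lemma permutations_adjacent_induct:
  assumes "distinct xs" "distinct ys" "set xs = set ys" "Q xs"
    and swap: "\<And>X x y Y. distinct (X @ x # y # Y) \<Longrightarrow> set (X @ x # y # Y) = set xs \<Longrightarrow>
      Q (X @ x # y # Y) \<Longrightarrow> Q (X @ y # x # Y)"
  shows "Q ys"
proof -
  have "Q (Z @ ys)" if "distinct (Z @ ws)" "distinct ys" "set ws = set ys" "set (Z @ ws) = set xs" "Q (Z @ ws)"
    for Z ws ys
    using that
  proof (induction ys arbitrary: Z ws)
    case (Cons y ys)
    \<comment> \<open>The target word is built from the left: behind the finished prefix
      \<open>Z\<close>, its next letter is moved to the front by exchanges of neighbours.\<close>
    have front: "Q (Z @ y # A @ B)" if "distinct (Z @ A @ y # B)" "set (Z @ A @ y # B) = set xs"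
        "Q (Z @ A @ y # B)" for A B
      using that
    proof (induction A arbitrary: B rule: rev_induct)
      case (snoc a A)
      have "Q ((Z @ A) @ y # a # B)"
        using snoc.prems by - (rule swap, auto)
      then have "Q (Z @ y # A @ a # B)" using snoc.prems by (intro snoc.IH) auto
      then show ?case by simp
    qed simp
    have "y \<in> set ws" using Cons.prems by auto
    then obtain A B where ws: "ws = A @ y # B" by (auto dest: split_list)
    have "Q (Z @ y # A @ B)" using front[of A B] Cons.prems ws by auto
    then have "Q ((Z @ [y]) @ ys)"
      using Cons.prems ws by (intro Cons.IH[of "Z @ [y]" "A @ B"]) auto
    then show ?case by simp
  qed simp
  from this[of "[]" xs ys] show ?thesis using assms(1-4) by auto
qed

text \<open>Restricted to exchanges of neighbours, since these are what STU moves provide. They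
  generate all reorderings, so one value determines the function.\<close>

definition alternating :: "'a set \<Rightarrow> ('a list \<Rightarrow> rat) \<Rightarrow> bool" where
  "alternating A e \<longleftrightarrow> (\<forall>X x y Y. distinct (X @ x # y # Y) \<longrightarrow> set (X @ x # y # Y) = A \<longrightarrow>
     e (X @ y # x # Y) = - e (X @ x # y # Y))"

lemma alternatingD:
  "alternating A e \<Longrightarrow> distinct (X @ x # y # Y) \<Longrightarrow> set (X @ x # y # Y) = A \<Longrightarrow>
    e (X @ y # x # Y) = - e (X @ x # y # Y)"
  unfolding alternating_def by blast

text \<open>The two sign changes cancel at every exchange of neighbours.\<close>

lemma alternating_mult_const:
  assumes "alternating A e" "alternating A e'" "xs \<in> permutations_of_set A" "ys \<in> permutations_of_set A"
  shows "e xs * e' xs = e ys * e' ys"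
proof -
  have xy: "distinct xs" "distinct ys" "set xs = A" "set ys = A"
    using assms by (auto simp: permutations_of_set_def)
  have "e ys * e' ys = e xs * e' xs"
  proof (rule permutations_adjacent_induct[of xs ys])
    fix X x y Y
    assume "distinct (X @ x # y # Y)" "set (X @ x # y # Y) = set xs"
      and IH: "e (X @ x # y # Y) * e' (X @ x # y # Y) = e xs * e' xs"
    then have "e (X @ y # x # Y) = - e (X @ x # y # Y)" "e' (X @ y # x # Y) = - e' (X @ x # y # Y)"
      using assms(1,2)[THEN alternatingD, of X x y Y] unfolding xy by simp_all
    then show "e (X @ y # x # Y) * e' (X @ y # x # Y) = e xs * e' xs"
      using IH by simp
  qed (use xy in auto)
  then show ?thesis by simp
qed

lemma alternating_word_sgn:
  assumes "v \<in> permutations_of_set A"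
  shows "alternating A (\<lambda>xs. word_sgn xs v)"
  unfolding alternating_def
proof (intro allI impI)
  fix X x y Y assume *: "distinct (X @ x # y # Y)" "set (X @ x # y # Y) = A"
  then have "x \<notin> set (X @ Y)" "set v = set (X @ x # y # Y)" "distinct v"
    using assms by (auto simp: permutations_of_set_def)
  then show "word_sgn (X @ y # x # Y) v = - word_sgn (X @ x # y # Y) v"
    by (rule swap_word_sgn[OF *(1)])
qed

lemma alternating_rev:
  assumes "alternating A e"
  shows "alternating A (\<lambda>xs. e (rev xs))"
  unfolding alternating_def
proof (intro allI impI)
  fix X x y Y assume "distinct (X @ x # y # Y)" "set (X @ x # y # Y) = A"
  then have "e (rev Y @ x # y # rev X) = - e (rev Y @ y # x # rev X)"
    by (intro alternatingD[OF assms]) auto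
  then show "e (rev (X @ y # x # Y)) = - e (rev (X @ x # y # Y))" by simp
qed

text \<open>For a fixed \<open>v\<close> the product \<open>e xs * word_sgn xs v\<close> is the same
  for all \<open>xs\<close>. What remains is the vanishing sum of coefficients in
  \<open>sum_coeff_descents\<close>.\<close>

lemma sum_alternating_euler:
  assumes e: "alternating A e" and card: "card A \<ge> 2"
  shows "(\<Sum>xs\<in>permutations_of_set A. e xs * euler C xs m) = 0"
proof -
  let ?P = "permutations_of_set A"
  define M where "M = {v \<in> ?P. last v = m}"
  have "(\<Sum>xs\<in>?P. e xs * euler C xs m)
      = (\<Sum>xs\<in>?P. \<Sum>v\<in>M. e xs * word_sgn xs v * coeff (card A) (descents (precedes xs) v) * C v)"
  proof (rule sum.cong[OF refl])
    fix xs assume "xs \<in> ?P"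
    then have "set xs = A" "length xs = card A" by (auto simp: permutations_of_set_def distinct_card)
    then show "e xs * euler C xs m
       = (\<Sum>v\<in>M. e xs * word_sgn xs v * coeff (card A) (descents (precedes xs) v) * C v)"
      by (simp add: euler_def M_def sum_distrib_left mult_ac)
  qed
  also have "\<dots> = (\<Sum>v\<in>M. \<Sum>xs\<in>?P. e xs * word_sgn xs v * coeff (card A) (descents (precedes xs) v) * C v)"
    by (rule sum.swap)
  also have "\<dots> = (\<Sum>v\<in>M. e v * word_sgn v v * C v * (\<Sum>xs\<in>?P. coeff (card A) (descents (precedes xs) v)))"
  proof (rule sum.cong[OF refl])
    fix v assume "v \<in> M"
    then have v: "v \<in> ?P" by (simp add: M_def)
    have "e xs * word_sgn xs v = e v * word_sgn v v" if "xs \<in> ?P" for xs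
      using alternating_mult_const[OF e alternating_word_sgn[OF v] that v] .
    then have "(\<Sum>xs\<in>?P. e xs * word_sgn xs v * coeff (card A) (descents (precedes xs) v) * C v)
       = (\<Sum>xs\<in>?P. e v * word_sgn v v * coeff (card A) (descents (precedes xs) v) * C v)"
      by (intro sum.cong) auto
    then show "(\<Sum>xs\<in>?P. e xs * word_sgn xs v * coeff (card A) (descents (precedes xs) v) * C v)
       = e v * word_sgn v v * C v * (\<Sum>xs\<in>?P. coeff (card A) (descents (precedes xs) v))"
      by (simp add: sum_distrib_left mult_ac)
  qed
  also have "\<dots> = 0"
    using sum_coeff_descents[OF _ card] by (intro sum.neutral) (auto simp: M_def)
  finally show ?thesis .
qed

text \<open>After multiplication by a sign, all values of the difference are equal; yet they add up
  to zero, because the sums for \<open>C\<close> and for \<open>D\<close> vanish separately. This is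
  the tool for reversing a line.\<close>

lemma alternating_euler_diff_zero:
  assumes alt: "alternating A (\<lambda>xs. euler C xs m - euler D (rev xs) m')"
    and card: "card A \<ge> 2" and xs: "xs \<in> permutations_of_set A"
  shows "euler C xs m = euler D (rev xs) m'"
proof -
  let ?P = "permutations_of_set A"
  let ?e = "\<lambda>ys. word_sgn ys xs"
  have e: "alternating A ?e" by (rule alternating_word_sgn[OF xs])
  have "(\<Sum>ys\<in>?P. ?e ys * euler D (rev ys) m') = (\<Sum>ys\<in>?P. ?e (rev ys) * euler D ys m')"
    by (rule sum.reindex_bij_witness[of _ rev rev]) (auto simp: permutations_of_set_def)
  also have "\<dots> = 0" by (rule sum_alternating_euler[OF alternating_rev[OF e] card])
  finally have "(\<Sum>ys\<in>?P. ?e ys * (euler C ys m - euler D (rev ys) m')) = 0"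
    using sum_alternating_euler[OF e card, of C m] by (simp add: algebra_simps sum_subtractf)
  moreover have "?e ys * (euler C ys m - euler D (rev ys) m') = ?e xs * (euler C xs m - euler D (rev xs) m')"
    if "ys \<in> ?P" for ys
    using alternating_mult_const[OF e alt that xs] .
  ultimately have "of_nat (card ?P) * (?e xs * (euler C xs m - euler D (rev xs) m')) = 0"
    by simp
  moreover have "finite A" using card by (intro card_ge_0_finite) simp
  then have "card ?P \<noteq> 0" by simp
  moreover have "?e xs \<noteq> 0" by (simp add: word_sgn_def)
  ultimately show ?thesis by simp
qed

section \<open>Broken lines and STU moves\<close>

lemma opp_simps [simp]:
  "opp (opp h) = h" "fst (opp h) = fst h" "opp h \<noteq> h" "h \<noteq> opp h" "opp h = opp g \<longleftrightarrow> h = g"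
  by (auto simp: opp_def prod_eq_iff)

lemma same_edge_iff: "fst h = fst g \<longleftrightarrow> h = g \<or> h = opp g"
  by (cases h; cases g) (auto simp: opp_def)

lemma opp_half_edges [simp]: "opp h \<in> half_edges G \<longleftrightarrow> h \<in> half_edges G"
  by (cases h) (auto simp: half_edges_def opp_def)

lemma in_half_edges: "h \<in> half_edges G \<longleftrightarrow> fst h \<in> edges G"
  by (cases h) (auto simp: half_edges_def)

definition override :: "('a \<Rightarrow> 'b) \<Rightarrow> 'a list \<Rightarrow> 'b list \<Rightarrow> 'a \<Rightarrow> 'b" where
  "override f ks us h = (case map_of (zip ks us) h of None \<Rightarrow> f h | Some u \<Rightarrow> u)"

lemma override_notin [simp]: "h \<notin> set ks \<Longrightarrow> override f ks us h = f h"
  by (auto simp: override_def split: option.splits dest!: map_of_SomeD set_zip_leftD)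

lemma override_map [simp]:
  assumes "distinct ks" "length ks = length us"
  shows "map (override f ks us) ks = us"
  using assms by (intro nth_equalityI) (auto simp: override_def map_of_zip_nth)

lemma override_eqI:
  assumes "distinct ks" "length ks = length us" "map g ks = us" "\<And>h. h \<notin> set ks \<Longrightarrow> g h = f h"
  shows "override f ks us = g"
proof
  fix h
  show "override f ks us h = g h"
  proof (cases "h \<in> set ks")
    case True
    have "map (override f ks us) ks = map g ks" using assms by simp
    then show ?thesis using True by (simp add: map_eq_conv)
  qed (use assms in auto)
qed

lemma override_natural:
  assumes "inj h" "length ks = length us" "x \<notin> set ks \<Longrightarrow> g (h x) = f (e x)"
  shows "override g (map h ks) (map f us) (h x) = f (override e ks us x)"
proof -
  have "map_of (zip (map h ks) (map f us)) (h x) = map_option f (map_of (zip ks us) x)"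
    using assms(1) by (induction ks us rule: list_induct2') (auto simp: inj_eq)
  moreover have "map_of (zip ks us) x = None \<longleftrightarrow> x \<notin> set ks"
    using assms(2) by (simp add: map_of_zip_is_None)
  ultimately show ?thesis
    using assms(3) unfolding override_def by (cases "map_of (zip ks us) x") auto
qed

text \<open>A broken line starting at \<open>r\<close> is given by the list of its links \<open>(a, p)\<close>: an edge with
  the half-edge \<open>a\<close> at the previous vertex and \<open>opp a\<close> at the next vertex \<open>p\<close>.\<close>

type_synonym link = "half_edge \<times> nat"

fun last_vert :: "nat \<Rightarrow> link list \<Rightarrow> nat" where
  "last_vert r [] = r"
| "last_vert r (l # L) = last_vert (snd l) L"

fun sources :: "nat \<Rightarrow> link list \<Rightarrow> nat list" where
  "sources r [] = []"
| "sources r (l # L) = r # sources (snd l) L"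

abbreviation line_verts :: "nat \<Rightarrow> link list \<Rightarrow> nat list" where
  "line_verts r L \<equiv> r # map snd L"

abbreviation link_edges :: "link list \<Rightarrow> nat list" where
  "link_edges L \<equiv> map (fst \<circ> fst) L"

lemma length_sources [simp]: "length (sources r L) = length L"
  by (induction L arbitrary: r) auto

lemma sources_append [simp]: "sources r (L @ M) = sources r L @ sources (last_vert r L) M"
  by (induction L arbitrary: r) auto

lemma last_vert_append [simp]: "last_vert r (L @ M) = last_vert (last_vert r L) M"
  by (induction L arbitrary: r) auto

lemma last_vert_last: "last_vert r L = last (line_verts r L)"
  by (induction L arbitrary: r) auto

lemma last_vert_in: "last_vert r L \<in> insert r (snd ` set L)"
  by (induction L arbitrary: r) auto

lemma sources_last: "line_verts r L = sources r L @ [last_vert r L]"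
  by (induction L arbitrary: r) auto

text \<open>The legs \<open>xs\<close> are the dashed half-edges at the vertices in their order
  along the line; they are the letters of its word. The last clause makes the line maximal: no
  further solid edge meets it.\<close>

definition line :: "graph \<Rightarrow> nat \<Rightarrow> link list \<Rightarrow> half_edge list \<Rightarrow> bool" where
  "line G r L xs \<longleftrightarrow> distinct (line_verts r L) \<and> distinct (link_edges L)
     \<and> set (line_verts r L) \<subseteq> externals G \<and> set (link_edges L) \<subseteq> solids G
     \<and> map (vat G \<circ> fst) L = sources r L \<and> map (vat G \<circ> opp \<circ> fst) L = map snd L
     \<and> map (vat G) xs = line_verts r L \<and> fst ` set xs \<subseteq> dashed G
     \<and> (\<forall>h\<in>half_edges G. fst h \<in> solids G \<longrightarrow> vat G h \<in> set (line_verts r L)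
          \<longrightarrow> fst h \<in> set (link_edges L))"

text \<open>The existence of a line through each external vertex replaces the global decomposition
  into broken lines, so that validity can be checked vertex by vertex.\<close>

definition vertex_ok :: "graph \<Rightarrow> nat \<Rightarrow> bool" where
  "vertex_ok G u \<longleftrightarrow> (if u \<in> externals G
     then card (dashed_halves_at G u) = 1 \<and> (\<exists>r L xs. line G r L xs \<and> u \<in> set (line_verts r L))
     else card (dashed_halves_at G u) = 3 \<and> solid_halves_at G u = {})"

text \<open>An equivalent of \<open>bcr_graph\<close> in which the broken lines are maximal by definition.\<close>

definition ok :: "graph \<Rightarrow> bool" where
  "ok G \<longleftrightarrow> finite_graph G \<and> connected_graph G \<and> externals G \<noteq> {} \<and> (\<forall>u\<in>verts G. vertex_ok G u)"

lemma okD: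
  assumes "ok G"
  shows "finite (verts G)" "finite (edges G)" "h \<in> half_edges G \<Longrightarrow> vat G h \<in> verts G"
    "externals G \<subseteq> verts G" "solids G \<subseteq> edges G" "connected_graph G" "finite (solids G)"
    "u \<in> verts G \<Longrightarrow> vertex_ok G u" "finite_graph G" "externals G \<noteq> {}" "finite (half_edges G)"
proof -
  have fin: "finite_graph G" using assms by (simp add: ok_def)
  then show "finite (verts G)" "finite (edges G)" "externals G \<subseteq> verts G" "solids G \<subseteq> edges G"
    "finite (solids G)" "finite (half_edges G)"
    by (auto simp: finite_graph_def half_edges_def intro: finite_subset)
  show "h \<in> half_edges G \<Longrightarrow> vat G h \<in> verts G"
    using fin unfolding finite_graph_def by blast
  show "connected_graph G" "u \<in> verts G \<Longrightarrow> vertex_ok G u" "finite_graph G" "externals G \<noteq> {}"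
    using assms by (auto simp: ok_def)
qed

lemma line_legs_length: "line G r L xs \<Longrightarrow> length xs = Suc (length L)"
  unfolding line_def by (metis length_Cons length_map)

lemma line_distinct_legs: "line G r L xs \<Longrightarrow> distinct xs"
  unfolding line_def by (metis distinct_map)

lemma lineD:
  assumes "line G r L xs"
  shows "distinct (line_verts r L)" "distinct (link_edges L)" "set (line_verts r L) \<subseteq> externals G"
    "set (link_edges L) \<subseteq> solids G" "map (vat G \<circ> fst) L = sources r L"
    "map (vat G \<circ> opp \<circ> fst) L = map snd L" "map (vat G) xs = line_verts r L"
    "fst ` set xs \<subseteq> dashed G"
    "h \<in> half_edges G \<Longrightarrow> fst h \<in> solids G \<Longrightarrow> vat G h \<in> set (line_verts r L) \<Longrightarrow> fst h \<in> set (link_edges L)"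
  using assms unfolding line_def by blast+

lemma line_legs_at: "line G r L xs \<Longrightarrow> vat G ` set xs = set (line_verts r L)"
  by (metis lineD(7) list.set_map)

lemma dashed_at_external:
  assumes "ok G" "u \<in> externals G" "h \<in> half_edges G" "fst h \<in> dashed G" "vat G h = u"
    "h' \<in> half_edges G" "fst h' \<in> dashed G" "vat G h' = u"
  shows "h = h'"
proof -
  have "vertex_ok G u" using assms(1,2) okD by blast
  then have "card (dashed_halves_at G u) = 1" using assms(2) by (simp add: vertex_ok_def)
  moreover have "h \<in> dashed_halves_at G u" "h' \<in> dashed_halves_at G u"
    using assms by (auto simp: dashed_halves_at_def halves_at_def)
  ultimately show ?thesis by (metis card_1_singletonE singletonD)
qed

lemma leg_unique:
  assumes "ok G" "line G r L xs" "h \<in> half_edges G" "fst h \<in> dashed G" "vat G h \<in> set (line_verts r L)"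
  shows "h \<in> set xs"
proof -
  obtain x where x: "x \<in> set xs" "vat G x = vat G h"
    using assms(5) line_legs_at[OF assms(2)] by (metis imageE)
  have "fst x \<in> dashed G" "vat G x \<in> externals G"
    using x lineD(8)[OF assms(2)] lineD(3)[OF assms(2)] assms(5) by auto
  moreover have "x \<in> half_edges G" using \<open>fst x \<in> dashed G\<close> by (simp add: in_half_edges dashed_def)
  ultimately show ?thesis using dashed_at_external[OF assms(1)] x assms by metis
qed

lemma line_link:
  assumes "line G r (L @ l # M) xs"
  shows "vat G (fst l) = last_vert r L" "vat G (opp (fst l)) = snd l"
    "fst (fst l) \<in> solids G" "fst (fst l) \<notin> set (link_edges (L @ M))"
    "snd l \<notin> set (line_verts r (L @ M))" "last_vert r L \<noteq> snd l"
proof -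
  have "map (vat G \<circ> fst) L @ vat G (fst l) # map (vat G \<circ> fst) M
      = sources r L @ last_vert r L # sources (snd l) M"
    using lineD(5)[OF assms] by simp
  then show "vat G (fst l) = last_vert r L" by (simp add: append_eq_append_conv)
  have "map (vat G \<circ> opp \<circ> fst) L @ vat G (opp (fst l)) # map (vat G \<circ> opp \<circ> fst) M
      = map snd L @ snd l # map snd M"
    using lineD(6)[OF assms] by simp
  then show "vat G (opp (fst l)) = snd l" by (simp add: append_eq_append_conv)
  show "fst (fst l) \<in> solids G" using lineD(4)[OF assms] by auto
  show "fst (fst l) \<notin> set (link_edges (L @ M))" using lineD(2)[OF assms] by auto
  show *: "snd l \<notin> set (line_verts r (L @ M))" using lineD(1)[OF assms] by auto
  have "last_vert r L \<in> set (line_verts r (L @ M))" using last_vert_in[of r L] by auto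
  then show "last_vert r L \<noteq> snd l" using * by metis
qed

lemma last_vert_prefix_inj:
  assumes "distinct (line_verts r (L @ M))" "L @ M = L' @ M'" "last_vert r L = last_vert r L'"
  shows "L = L' \<and> M = M'"
proof -
  have nth: "last_vert r A = line_verts r (A @ B) ! length A" for A B
    by (induction A arbitrary: r) auto
  have "line_verts r (L @ M) ! length L = line_verts r (L @ M) ! length L'"
    using nth[of L M] nth[of L' M'] assms(2,3) by simp
  moreover have "length L < length (line_verts r (L @ M))" by simp
  moreover have "length L' < length (line_verts r (L @ M))" unfolding assms(2) by simp
  ultimately have "length L = length L'" using assms(1) by (simp only: nth_eq_iff_index_eq)
  then show ?thesis using assms(2) by simp
qed

text \<open>Every solid edge at a vertex of the line is one of its links, and as the vertices are
  distinct, only the links just before and just after the cut end there.\<close>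

lemma line_solid_at:
  assumes "line G r (L @ M) xs" "h \<in> half_edges G" "fst h \<in> solids G" "vat G h = last_vert r L"
  shows "(L \<noteq> [] \<and> h = opp (fst (last L))) \<or> (M \<noteq> [] \<and> h = fst (hd M))"
proof -
  have "last_vert r L \<in> set (line_verts r (L @ M))" using last_vert_in[of r L] by auto
  then have "fst h \<in> set (link_edges (L @ M))" using lineD(9)[OF assms(1-3)] assms(4) by simp
  then obtain l where l: "l \<in> set (L @ M)" "fst h = fst (fst l)" by auto
  then obtain A B where AB: "L @ M = A @ l # B" by (meson split_list)
  note link = line_link[OF assms(1)[unfolded AB]]
  from l(2) consider "h = fst l" | "h = opp (fst l)" by (auto simp: same_edge_iff)
  then show ?thesis
  proof cases
    case 1
    then have "last_vert r L = last_vert r A" using link(1) assms(4) by metis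
    then have "L = A \<and> M = l # B" by (rule last_vert_prefix_inj[OF lineD(1)[OF assms(1)] AB])
    then show ?thesis using 1 by simp
  next
    case 2
    then have "last_vert r L = last_vert r (A @ [l])" using link(2) assms(4) by simp
    moreover have "L @ M = (A @ [l]) @ B" using AB by (simp only: append_assoc append_Cons append_Nil)
    ultimately have "L = A @ [l] \<and> M = B"
      using last_vert_prefix_inj[OF lineD(1)[OF assms(1)]] by blast
    then show ?thesis using 2 by simp
  qed
qed

section \<open>Validity of local modifications\<close>

lemma halves_at_congI:
  assumes "edges G' = edges G" "\<And>h. h \<in> half_edges G \<Longrightarrow> vat G' h = u \<longleftrightarrow> vat G h = u"
  shows "halves_at G' u = halves_at G u"
  using assms by (auto simp: halves_at_def half_edges_def)

lemma adjacent_sym: "(u, v) \<in> (adjacent G)\<^sup>* \<Longrightarrow> (v, u) \<in> (adjacent G)\<^sup>*"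
proof -
  have "(v, u) \<in> adjacent G" if uv: "(u, v) \<in> adjacent G" for u v
  proof -
    obtain h where "h \<in> half_edges G" "u = vat G h" "v = vat G (opp h)"
      using uv unfolding adjacent_def by blast
    then show ?thesis unfolding adjacent_def by (intro CollectI exI[of _ "opp h"]) simp
  qed
  then have "adjacent G = (adjacent G)\<inverse>" by auto
  then show "(u, v) \<in> (adjacent G)\<^sup>* \<Longrightarrow> (v, u) \<in> (adjacent G)\<^sup>*"
    by (metis rtrancl_converseI)
qed

text \<open>Membership in \<open>Q\<close> passes along each link in both directions, so a line lies
  inside \<open>Q\<close> or avoids it.\<close>

lemma line_in_closed:
  assumes G: "ok G" and l: "line G r L xs"
    and closed: "\<And>h. h \<in> half_edges G \<Longrightarrow> fst h \<in> solids G \<Longrightarrow> vat G h \<in> Q \<Longrightarrow> vat G (opp h) \<in> Q"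
    and p: "p \<in> set (line_verts r L)"
  shows "p \<in> Q \<longleftrightarrow> r \<in> Q"
proof -
  have step: "snd l' \<in> Q \<longleftrightarrow> last_vert r A \<in> Q" if "L = A @ l' # B" for A l' B
  proof -
    note link = line_link[OF l[unfolded that]]
    have "fst l' \<in> half_edges G" using link(3) okD(5)[OF G] by (auto simp: in_half_edges)
    then show ?thesis using closed[of "fst l'"] closed[of "opp (fst l')"] link(1-3) by auto
  qed
  have pre: "last_vert r A \<in> Q \<longleftrightarrow> r \<in> Q" if "L = A @ B" for A B
    using that
  proof (induction A arbitrary: B rule: rev_induct)
    case (snoc a A)
    then show ?case using step[of A a B] by simp
  qed simp
  show ?thesis
  proof (cases "p = r")
    case False
    then obtain l' where "l' \<in> set L" "p = snd l'" using p(1) by auto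
    then obtain A B where "L = A @ l' # B" by (meson split_list)
    then show ?thesis using pre[of "A @ [l']" B] \<open>p = snd l'\<close> by simp
  qed simp
qed

text \<open>A modification inside a vertex set \<open>Q\<close> that stays connected and is not crossed by broken
  lines only has to be inspected on \<open>Q\<close>.\<close>

lemma ok_local:
  assumes G: "ok G" and same: "verts G' = verts G" "edges G' = edges G"
    and Q: "Q \<subseteq> verts G"
    and moved: "\<And>h. h \<in> half_edges G \<Longrightarrow> vat G' h = vat G h \<or> (vat G h \<in> Q \<and> vat G' h \<in> Q)"
    and reach: "\<And>u v. u \<in> Q \<Longrightarrow> v \<in> Q \<Longrightarrow> (u, v) \<in> (adjacent G')\<^sup>*"
    and ext: "externals G' \<noteq> {}" "externals G' \<subseteq> verts G" "solids G' \<subseteq> edges G"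
      "\<And>u. u \<in> verts G - Q \<Longrightarrow> u \<in> externals G' \<longleftrightarrow> u \<in> externals G"
    and sol: "\<And>h. h \<in> half_edges G \<Longrightarrow> vat G h \<notin> Q \<Longrightarrow> fst h \<in> solids G' \<longleftrightarrow> fst h \<in> solids G"
    and closed: "\<And>h. h \<in> half_edges G \<Longrightarrow> fst h \<in> solids G \<Longrightarrow> vat G h \<in> Q \<Longrightarrow> vat G (opp h) \<in> Q"
    and local: "\<And>u. u \<in> Q \<Longrightarrow> vertex_ok G' u"
  shows "ok G'"
proof -
  have he: "half_edges G' = half_edges G" using same by (simp add: half_edges_def)
  have out: "vat G' h = vat G h" if "h \<in> half_edges G" "vat G h \<notin> Q" for h using moved that by blast
  have fin: "finite_graph G'"
    using okD[OF G] same ext moved Q unfolding finite_graph_def he by (auto; metis subsetD)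
  have con: "connected_graph G'"
  proof -
    \<comment> \<open>An old edge still joins its possibly moved ends, and each moved end is
      connected with its old place within \<open>Q\<close>.\<close>
    have step: "(u, v) \<in> (adjacent G')\<^sup>*" if uv: "(u, v) \<in> adjacent G" for u v
    proof -
      obtain h where h: "h \<in> half_edges G" "u = vat G h" "v = vat G (opp h)"
        using uv unfolding adjacent_def by blast
      let ?u = "vat G' h" and ?v = "vat G' (opp h)"
      have "(?u, ?v) \<in> adjacent G'" using h he unfolding adjacent_def by blast
      moreover have "(u, ?u) \<in> (adjacent G')\<^sup>*" "(?v, v) \<in> (adjacent G')\<^sup>*"
        using moved[of h] moved[of "opp h"] h reach by (metis opp_half_edges rtrancl.rtrancl_refl)+
      ultimately show ?thesis by (meson r_into_rtrancl rtrancl_trans)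
    qed
    have "(u, v) \<in> (adjacent G')\<^sup>*" if "(u, v) \<in> (adjacent G)\<^sup>*" for u v
      using that by (induction rule: rtrancl_induct) (auto intro: rtrancl_trans step)
    then show ?thesis using okD(6)[OF G] same unfolding connected_graph_def by metis
  qed
  have "vertex_ok G' u" if u: "u \<in> verts G" "u \<notin> Q" for u
  proof -
    have at: "halves_at G' u = halves_at G u"
      using moved u(2) same by (intro halves_at_congI) metis+
    have sat: "solid_halves_at G' u = solid_halves_at G u"
      unfolding solid_halves_at_def at using sol u(2) by (auto simp: halves_at_def)
    have dat: "dashed_halves_at G' u = dashed_halves_at G u"
      unfolding dashed_halves_at_def at using sol u(2) same by (auto simp: halves_at_def dashed_def)
    have ok: "vertex_ok G u" using okD(8)[OF G u(1)] .
    have line: "line G' r L xs" if l: "line G r L xs" "u \<in> set (line_verts r L)" for r L xs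
    proof -
      \<comment> \<open>The whole line through \<open>u\<close> stays outside \<open>Q\<close> by
        \<open>closed\<close>, so nothing that defines it has been changed.\<close>
      have nQ: "p \<notin> Q" if "p \<in> set (line_verts r L)" for p
        using line_in_closed[OF G l(1) closed that] line_in_closed[OF G l(1) closed l(2)] u(2) by blast
      have mem: "fst l \<in> half_edges G" "vat G (fst l) \<in> set (line_verts r L)"
          "vat G (opp (fst l)) \<in> set (line_verts r L)" if "l \<in> set L" for l
      proof -
        obtain A B where AB: "L = A @ l # B" using \<open>l \<in> set L\<close> by (meson split_list)
        note link = line_link[OF l(1)[unfolded AB]]
        show "fst l \<in> half_edges G" using link(3) okD(5)[OF G] by (auto simp: in_half_edges)
        show "vat G (fst l) \<in> set (line_verts r L)" "vat G (opp (fst l)) \<in> set (line_verts r L)"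
          using link(1,2) last_vert_in[of r A] AB by auto
      qed
      have legs: "x \<in> half_edges G" "vat G x \<in> set (line_verts r L)" if "x \<in> set xs" for x
        using that lineD(8)[OF l(1)] line_legs_at[OF l(1)] by (auto simp: in_half_edges dashed_def)
      show ?thesis unfolding line_def
      proof (intro conjI)
        show "distinct (line_verts r L)" "distinct (link_edges L)" using lineD[OF l(1)] by simp_all
        show "set (line_verts r L) \<subseteq> externals G'"
        proof
          fix p assume p: "p \<in> set (line_verts r L)"
          then have "p \<in> externals G" using lineD(3)[OF l(1)] by blast
          then show "p \<in> externals G'" using ext(4) nQ[OF p] okD(4)[OF G] by blast
        qed
        show "set (link_edges L) \<subseteq> solids G'"
        proof
          fix e assume e: "e \<in> set (link_edges L)"
          then obtain l where m: "l \<in> set L" "e = fst (fst l)" by auto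
          then show "e \<in> solids G'"
            using sol[OF mem(1)[OF m(1)] nQ[OF mem(2)[OF m(1)]]] lineD(4)[OF l(1)] e by blast
        qed
        show "map (vat G' \<circ> fst) L = sources r L"
        proof -
          have "map (vat G' \<circ> fst) L = map (vat G \<circ> fst) L"
          proof (rule map_cong[OF refl])
            fix l assume m: "l \<in> set L"
            show "(vat G' \<circ> fst) l = (vat G \<circ> fst) l"
              using out[OF mem(1)[OF m] nQ[OF mem(2)[OF m]]] by simp
          qed
          then show ?thesis using lineD(5)[OF l(1)] by simp
        qed
        show "map (vat G' \<circ> opp \<circ> fst) L = map snd L"
        proof -
          have "map (vat G' \<circ> opp \<circ> fst) L = map (vat G \<circ> opp \<circ> fst) L"
          proof (rule map_cong[OF refl])
            fix l assume m: "l \<in> set L"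
            have "opp (fst l) \<in> half_edges G" using mem(1)[OF m] by simp
            then show "(vat G' \<circ> opp \<circ> fst) l = (vat G \<circ> opp \<circ> fst) l"
              using out[OF _ nQ[OF mem(3)[OF m]]] by simp
          qed
          then show ?thesis using lineD(6)[OF l(1)] by simp
        qed
        show "map (vat G') xs = line_verts r L"
        proof -
          have "map (vat G') xs = map (vat G) xs"
            using out[OF legs(1) nQ[OF legs(2)]] by (intro map_cong[OF refl]) blast
          then show ?thesis using lineD(7)[OF l(1)] by simp
        qed
        show "fst ` set xs \<subseteq> dashed G'"
        proof
          fix e assume "e \<in> fst ` set xs"
          then obtain x where x: "x \<in> set xs" "e = fst x" by auto
          then have "e \<in> dashed G" using lineD(8)[OF l(1)] by blast
          then show "e \<in> dashed G'"
            using sol[OF legs(1)[OF x(1)] nQ[OF legs(2)[OF x(1)]]] same x(2) by (simp add: dashed_def)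
        qed
        show "\<forall>h\<in>half_edges G'. fst h \<in> solids G' \<longrightarrow> vat G' h \<in> set (line_verts r L) \<longrightarrow>
            fst h \<in> set (link_edges L)"
        proof (intro ballI impI)
          fix h assume h: "h \<in> half_edges G'" "fst h \<in> solids G'" "vat G' h \<in> set (line_verts r L)"
          then have h': "h \<in> half_edges G" "vat G' h \<notin> Q" using he nQ by auto
          then have "vat G h \<notin> Q" "vat G' h = vat G h" using moved[of h] by auto
          then show "fst h \<in> set (link_edges L)" using h h' sol[of h] lineD(9)[OF l(1), of h] by auto
        qed
      qed
    qed
    have eu: "u \<in> externals G' \<longleftrightarrow> u \<in> externals G" using ext(4) u by blast
    show ?thesis
    proof (cases "u \<in> externals G")
      case True
      then obtain r L xs where l: "line G r L xs" "u \<in> set (line_verts r L)"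
        using ok unfolding vertex_ok_def by auto
      from line[OF this] l(2) show ?thesis
        using ok True eu dat unfolding vertex_ok_def by (simp only: if_True) blast
    qed (use ok eu dat sat in \<open>simp add: vertex_ok_def\<close>)
  qed
  then show ?thesis
    unfolding ok_def using fin con ext(1) local same by metis
qed

lemma last_vert_in_line_verts [simp]: "last_vert r L \<in> set (line_verts r (L @ M))"
  unfolding set_simps set_map set_append image_Un using last_vert_in[of r L] by blast

lemma link_edge_in: "l \<in> set L \<Longrightarrow> fst (fst l) \<in> set (link_edges L)"
  by (metis comp_apply image_eqI list.set_map)

lemma line_link_ne:
  assumes "line G r (L @ M) xs" "M \<noteq> []" "l \<in> set (L @ tl M)"
  shows "fst (fst l) \<noteq> fst (fst (hd M))"
proof -
  have "L @ M = L @ hd M # tl M" using assms(2) by simp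
  from line_link(4)[OF assms(1)[unfolded this]] show ?thesis using link_edge_in[OF assms(3)] by metis
qed

lemma line_reach:
  assumes "map (vat G \<circ> fst) L = sources r L" "map (vat G \<circ> opp \<circ> fst) L = map snd L"
    "set (link_edges L) \<subseteq> edges G" "u \<in> set (line_verts r L)" "v \<in> set (line_verts r L)"
  shows "(u, v) \<in> (adjacent G)\<^sup>*"
proof -
  have from_r: "(r, u) \<in> (adjacent G)\<^sup>*" if "u \<in> set (line_verts r L)" for u
    using that assms(1-3)
  proof (induction L arbitrary: r)
    case (Cons l L)
    have "fst l \<in> half_edges G" using Cons.prems(4) by (simp add: in_half_edges)
    then have "(vat G (fst l), vat G (opp (fst l))) \<in> adjacent G" unfolding adjacent_def by blast
    then have "(r, snd l) \<in> adjacent G" using Cons.prems(2,3) by simp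
    moreover have "(snd l, u) \<in> (adjacent G)\<^sup>*" if "u \<noteq> r"
      using Cons.prems that by (intro Cons.IH) auto
    ultimately show ?case by (cases "u = r") (auto intro: converse_rtrancl_into_rtrancl)
  qed auto
  show ?thesis using adjacent_sym[OF from_r[OF assms(4)]] from_r[OF assms(5)] by (rule rtrancl_trans)
qed

lemma line_closed:
  assumes l: "line G r L xs" and h: "h \<in> half_edges G" "fst h \<in> solids G"
    "vat G h \<in> set (line_verts r L)"
  shows "vat G (opp h) \<in> set (line_verts r L)"
proof -
  obtain l' where "l' \<in> set L" and e: "fst h = fst (fst l')" using lineD(9)[OF l h] by auto
  then obtain A B where AB: "L = A @ l' # B" by (meson split_list)
  note link = line_link[OF l[unfolded AB]]
  have v: "last_vert r A \<in> set (line_verts r L)" unfolding AB by (rule last_vert_in_line_verts)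
  from e consider "h = fst l'" | "h = opp (fst l')" by (auto simp: same_edge_iff)
  then show ?thesis
  proof cases
    case 1
    then show ?thesis using link(2) AB by simp
  next
    case 2
    then show ?thesis using link(1) v by simp
  qed
qed

lemma line_verts_split:
  "line_verts r (L @ l # M) = sources r L @ last_vert r L # snd l # map snd M"
  "line_verts r (L @ M) = sources r L @ last_vert r L # map snd M"
  using sources_last[of r L] by simp_all

text \<open>In the terminology of the STU relation, \<open>fuse\<close> turns \<open>T\<close> into \<open>S\<close>, and \<open>split_leg\<close> turns
  \<open>S\<close> into \<open>T\<close>: the half-edge \<open>a\<close> at \<open>v\<close> and \<open>opp a\<close> at \<open>w\<close> form the edge of the move, and \<open>M\<close>
  is the rest of the line after \<open>w\<close> (in \<open>T\<close>) or \<open>v\<close> (in \<open>S\<close>).\<close>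

definition fuse :: "graph \<Rightarrow> nat \<Rightarrow> half_edge \<Rightarrow> nat \<Rightarrow> half_edge \<Rightarrow> link list \<Rightarrow> graph" where
  "fuse G v a w x M = G\<lparr>vat := (if M = [] then (vat G)(x := w) else (vat G)(x := w, fst (hd M) := v)),
     externals := externals G - {w}, solids := solids G - {fst a}\<rparr>"

definition split_leg :: "graph \<Rightarrow> nat \<Rightarrow> half_edge \<Rightarrow> nat \<Rightarrow> half_edge \<Rightarrow> link list \<Rightarrow> graph" where
  "split_leg G v a w x M = G\<lparr>vat := (if M = [] then (vat G)(x := v) else (vat G)(x := v, fst (hd M) := w)),
     externals := insert w (externals G), solids := insert (fst a) (solids G)\<rparr>"

section \<open>The two directions of an STU move\<close>

lemma half_edges_update [simp]:
  "half_edges (G\<lparr>vat := vt, externals := E, solids := F\<rparr>) = half_edges G"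
  "half_edges (G\<lparr>vat := vt\<rparr>) = half_edges G"
  by (simp_all add: half_edges_def)

lemma fuse_simps [simp]:
  "verts (fuse G v a w x M) = verts G" "edges (fuse G v a w x M) = edges G"
  "half_edges (fuse G v a w x M) = half_edges G"
  "externals (fuse G v a w x M) = externals G - {w}" "solids (fuse G v a w x M) = solids G - {fst a}"
  by (simp_all add: fuse_def)

lemma split_leg_simps [simp]:
  "verts (split_leg G v a w x M) = verts G" "edges (split_leg G v a w x M) = edges G"
  "half_edges (split_leg G v a w x M) = half_edges G"
  "externals (split_leg G v a w x M) = insert w (externals G)"
  "solids (split_leg G v a w x M) = insert (fst a) (solids G)"
  by (simp_all add: split_leg_def)

lemma in_line_half_edges:
  assumes "ok G" "line G r L xs"
  shows "l \<in> set L \<Longrightarrow> fst l \<in> half_edges G" "x \<in> set xs \<Longrightarrow> x \<in> half_edges G"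
    "x \<in> set xs \<Longrightarrow> fst x \<notin> solids G" "l \<in> set L \<Longrightarrow> fst (fst l) \<in> solids G"
    "l \<in> set L \<Longrightarrow> x \<in> set xs \<Longrightarrow> fst x \<noteq> fst (fst l)"
proof -
  show s: "fst (fst l) \<in> solids G" if "l \<in> set L" for l using that lineD(4)[OF assms(2)] by auto
  then show "l \<in> set L \<Longrightarrow> fst l \<in> half_edges G" using okD(5)[OF assms(1)] by (metis in_half_edges subsetD)
  show d: "x \<in> set xs \<Longrightarrow> x \<in> half_edges G" "x \<in> set xs \<Longrightarrow> fst x \<notin> solids G"
    using lineD(8)[OF assms(2)] by (auto simp: in_half_edges dashed_def)
  show "l \<in> set L \<Longrightarrow> x \<in> set xs \<Longrightarrow> fst x \<noteq> fst (fst l)" using s[of l] d(2) by metis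
qed

text \<open>The graph \<open>G\<close> is the term \<open>T\<close> of an STU relation. The
  condition on lengths says that \<open>x\<close> and \<open>y\<close> are the legs at the two ends
  of the link \<open>(a, w)\<close>.\<close>

locale fused =
  fixes G r L a w M X x y Y
  assumes G: "ok G" and l: "line G r (L @ (a, w) # M) (X @ x # y # Y)" and len: "length X = length L"
begin

definition "v = last_vert r L"

lemma vats:
  "map (vat G) X = sources r L" "vat G x = v" "vat G y = w" "map (vat G) Y = map snd M"
  "vat G a = v" "vat G (opp a) = w" "v \<noteq> w"
  "M \<noteq> [] \<Longrightarrow> vat G (fst (hd M)) = w"
proof -
  have "map (vat G) X @ vat G x # vat G y # map (vat G) Y = sources r L @ v # w # map snd M"
    using lineD(7)[OF l] line_verts_split(1)[of r L "(a, w)" M] by (simp add: v_def)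
  then show "map (vat G) X = sources r L" "vat G x = v" "vat G y = w" "map (vat G) Y = map snd M"
    using len by (simp_all add: append_eq_append_conv)
  show "vat G a = v" "vat G (opp a) = w" "v \<noteq> w" using line_link[OF l] by (simp_all add: v_def)
  show "vat G (fst (hd M)) = w" if "M \<noteq> []"
  proof -
    have "L @ (a, w) # M = (L @ [(a, w)]) @ hd M # tl M" using that by simp
    from line_link(1)[OF l[unfolded this]] show ?thesis by simp
  qed
qed

lemma halves:
  "x \<in> half_edges G" "y \<in> half_edges G" "a \<in> half_edges G" "fst x \<notin> solids G" "fst y \<notin> solids G"
  "fst a \<in> solids G" "x \<noteq> y" "fst x \<noteq> fst a" "fst y \<noteq> fst a"
  "x \<notin> set (X @ Y)" "y \<notin> set (X @ Y)" "a \<notin> set (X @ Y)" "distinct (X @ Y)"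
proof -
  note i = in_line_half_edges[OF G l]
  show "x \<in> half_edges G" "y \<in> half_edges G" "fst x \<notin> solids G" "fst y \<notin> solids G"
    "a \<in> half_edges G" "fst a \<in> solids G"
    using i(1)[of "(a, w)"] i(2)[of x] i(2)[of y] i(3)[of x] i(3)[of y] i(4)[of "(a, w)"] by auto
  then show "fst x \<noteq> fst a" "fst y \<noteq> fst a" by metis+
  show "x \<noteq> y" "x \<notin> set (X @ Y)" "y \<notin> set (X @ Y)" "distinct (X @ Y)"
    using line_distinct_legs[OF l] by auto
  show "a \<notin> set (X @ Y)" using i(3)[of a] \<open>fst a \<in> solids G\<close> by auto
qed

lemma M_halves:
  assumes "M \<noteq> []"
  shows "fst (hd M) \<in> half_edges G" "fst (fst (hd M)) \<in> solids G" "fst (fst (hd M)) \<noteq> fst a"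
    "fst (hd M) \<noteq> x" "fst (hd M) \<noteq> y" "fst (hd M) \<noteq> a" "fst (hd M) \<noteq> opp a"
proof -
  note i = in_line_half_edges[OF G l]
  have m: "hd M \<in> set M" using assms by simp
  then show s: "fst (hd M) \<in> half_edges G" "fst (fst (hd M)) \<in> solids G"
    using i(1)[of "hd M"] i(4)[of "hd M"] by simp_all
  show ne: "fst (fst (hd M)) \<noteq> fst a" using line_link(4)[OF l] link_edge_in[of "hd M" "L @ M"] m
    by (metis Un_iff fst_conv set_append)
  show "fst (hd M) \<noteq> x" "fst (hd M) \<noteq> y" using s halves by metis+
  show "fst (hd M) \<noteq> a" "fst (hd M) \<noteq> opp a" using ne by auto
qed

abbreviation "S \<equiv> fuse G v a w x M"

lemma vat_S:
  "vat S h = (if M \<noteq> [] \<and> h = fst (hd M) then v else if h = x then w else vat G h)"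
  by (simp add: fuse_def)

lemma vat_S_other: "h \<noteq> x \<Longrightarrow> (M \<noteq> [] \<Longrightarrow> h \<noteq> fst (hd M)) \<Longrightarrow> vat S h = vat G h"
  by (auto simp: vat_S)

lemma vat_S_spec: "vat S a = v" "vat S (opp a) = w" "vat S x = w" "vat S y = w"
  using vats halves M_halves by (auto simp: vat_S)

lemma dashed_at:
  assumes "h \<in> half_edges G" "fst h \<notin> solids G"
  shows "vat G h = v \<Longrightarrow> h = x" "vat G h = w \<Longrightarrow> h = y"
proof -
  have e: "v \<in> externals G" "w \<in> externals G"
    using lineD(3)[OF l] last_vert_in_line_verts[of r L "(a, w) # M"] unfolding v_def by auto
  have "fst h \<in> dashed G" "fst x \<in> dashed G" "fst y \<in> dashed G"
    using assms halves by (auto simp: dashed_def in_half_edges)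
  then show "vat G h = v \<Longrightarrow> h = x" "vat G h = w \<Longrightarrow> h = y"
    using dashed_at_external[OF G e(1) assms(1), of x] dashed_at_external[OF G e(2) assms(1), of y]
      vats halves by auto
qed

lemma solid_at_w:
  assumes "h \<in> half_edges G" "fst h \<in> solids G" "vat G h = w"
  shows "h = opp a \<or> (M \<noteq> [] \<and> h = fst (hd M))"
  using line_solid_at[of G r "L @ [(a, w)]" M, OF _ assms(1,2)] l assms(3) by auto

lemma solid_at_v:
  assumes "h \<in> half_edges G" "fst h \<in> solids G" "vat G h = v"
  shows "h = a \<or> (L \<noteq> [] \<and> h = opp (fst (last L)))"
  using line_solid_at[of G r L "(a, w) # M", OF _ assms(1,2)] l assms(3) by (auto simp: v_def)

lemma map_S_line:
  "map (vat S \<circ> fst) L = sources r L" "map (vat S \<circ> fst) M = sources v M"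
  "map (vat S \<circ> opp \<circ> fst) (L @ M) = map snd (L @ M)"
proof -
  note i = in_line_half_edges[OF G l]
  have src: "map (vat G \<circ> fst) L = sources r L" "map (vat G \<circ> fst) M = sources w M"
    using lineD(5)[OF l] by (simp_all add: append_eq_append_conv)
  have nx: "fst l \<noteq> x" "opp (fst l) \<noteq> x" if "l \<in> set (L @ M)" for l
    using i(5)[of l x] that by auto
  have nhd: "M \<noteq> [] \<Longrightarrow> fst (fst l) \<noteq> fst (fst (hd M))" if "l \<in> set (L @ tl M)" for l
  proof -
    have l': "line G r ((L @ [(a, w)]) @ M) (X @ x # y # Y)" using l by simp
    show "M \<noteq> [] \<Longrightarrow> fst (fst l) \<noteq> fst (fst (hd M))"
      by (rule line_link_ne[OF l']) (use that in auto)
  qed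
  have "map (vat S \<circ> fst) L = map (vat G \<circ> fst) L"
  proof (rule map_cong[OF refl])
    fix l assume "l \<in> set L"
    then show "(vat S \<circ> fst) l = (vat G \<circ> fst) l"
      using nx[of l] nhd[of l] by (auto intro!: vat_S_other)
  qed
  then show "map (vat S \<circ> fst) L = sources r L" using src by simp
  show "map (vat S \<circ> fst) M = sources v M"
  proof (cases M)
    case (Cons m M')
    have "map (vat S \<circ> fst) M' = map (vat G \<circ> fst) M'"
    proof (rule map_cong[OF refl])
      fix l assume "l \<in> set M'"
      then show "(vat S \<circ> fst) l = (vat G \<circ> fst) l"
        using nx[of l] nhd[of l] Cons vat_S[of "fst l"] by auto
    qed
    moreover have "map (vat G \<circ> fst) M' = sources (snd m) M'" using src(2) Cons by simp
    moreover have "vat S (fst m) = v" using vat_S[of "fst m"] Cons by simp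
    moreover have "map (vat S \<circ> fst) M = map (vat S \<circ> fst) (m # M')" using Cons by (rule arg_cong)
    ultimately show ?thesis unfolding Cons by simp
  qed simp
  have "map (vat S \<circ> opp \<circ> fst) (L @ M) = map (vat G \<circ> opp \<circ> fst) (L @ M)"
  proof (rule map_cong[OF refl])
    fix l assume m: "l \<in> set (L @ M)"
    have "opp (fst l) \<noteq> fst (hd M)" if "M \<noteq> []"
    proof (cases "l = hd M")
      case False
      then have "l \<in> set (L @ tl M)" using m that by (cases M) auto
      then show ?thesis using nhd[of l] that by (metis opp_simps(2))
    qed simp
    then show "(vat S \<circ> opp \<circ> fst) l = (vat G \<circ> opp \<circ> fst) l"
      using nx[OF m] by (auto intro!: vat_S_other)
  qed
  also have "\<dots> = map snd (L @ M)"
    using lineD(6)[OF l] by (simp add: append_eq_append_conv)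
  finally show "map (vat S \<circ> opp \<circ> fst) (L @ M) = map snd (L @ M)" .
qed

text \<open>The fused line bypasses \<open>w\<close>: its rest \<open>M\<close> starts at
  \<open>v\<close>, and the former solid edge supplies the new leg \<open>a\<close> of
  \<open>v\<close>.\<close>

lemma line_S: "line S r (L @ M) (X @ a # Y)"
  unfolding line_def
proof (intro conjI)
  note i = in_line_half_edges[OF G l]
  show "distinct (line_verts r (L @ M))" "distinct (link_edges (L @ M))"
    using lineD(1,2)[OF l] by auto
  show "set (line_verts r (L @ M)) \<subseteq> externals S"
    using lineD(3)[OF l] line_link(5)[OF l] by auto
  have "set (link_edges (L @ M)) \<subseteq> set (link_edges (L @ (a, w) # M))" by auto
  moreover have "fst a \<notin> set (link_edges (L @ M))" using line_link(4)[OF l] by simp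
  ultimately show "set (link_edges (L @ M)) \<subseteq> solids S"
    using lineD(4)[OF l] unfolding fuse_simps by blast
  show "map (vat S \<circ> fst) (L @ M) = sources r (L @ M)"
    using map_S_line(1,2) by (simp add: v_def)
  show "map (vat S \<circ> opp \<circ> fst) (L @ M) = map snd (L @ M)" by (rule map_S_line(3))
  have leg: "vat S z = vat G z" if "z \<in> set (X @ Y)" for z
  proof (rule vat_S_other)
    show "z \<noteq> x" using that halves by auto
    show "z \<noteq> fst (hd M)" if "M \<noteq> []" using i(3)[of z] M_halves(2)[OF that] \<open>z \<in> set (X @ Y)\<close> by auto
  qed
  have "map (vat S) X = map (vat G) X" "map (vat S) Y = map (vat G) Y"
    using leg by (auto intro!: map_cong)
  then show "map (vat S) (X @ a # Y) = line_verts r (L @ M)"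
    using vats vat_S_spec line_verts_split(2)[of r L M] by (simp add: v_def)
  show "fst ` set (X @ a # Y) \<subseteq> dashed S"
    using lineD(8)[OF l] halves by (auto simp: dashed_def in_half_edges)
  show "\<forall>h\<in>half_edges S. fst h \<in> solids S \<longrightarrow> vat S h \<in> set (line_verts r (L @ M)) \<longrightarrow>
      fst h \<in> set (link_edges (L @ M))"
  proof (intro ballI impI)
    fix h assume h: "h \<in> half_edges S" "fst h \<in> solids S" "vat S h \<in> set (line_verts r (L @ M))"
    then have "h \<noteq> x" using halves by auto
    then have "vat G h \<in> set (line_verts r (L @ (a, w) # M))"
      using h(3) vats(8) by (auto simp: vat_S split: if_splits)
    then have "fst h \<in> set (link_edges (L @ (a, w) # M))"
      using lineD(9)[OF l, of h] h by simp
    then show "fst h \<in> set (link_edges (L @ M))" using h(2) by auto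
  qed
qed

lemma halves_at_w: "halves_at S w = {opp a, x, y}"
proof -
  have at: "h \<in> {opp a, x, y}" if h: "h \<in> half_edges G" "vat S h = w" for h
  proof (cases "h = x")
    case False
    then have "vat G h = w" and ne: "M \<noteq> [] \<Longrightarrow> h \<noteq> fst (hd M)"
      using h(2) vats(7) by (auto simp: vat_S split: if_splits)
    then show ?thesis
      using dashed_at(2)[OF h(1)] solid_at_w[OF h(1)] by (cases "fst h \<in> solids G") auto
  qed simp
  show "halves_at S w = {opp a, x, y}"
    using at vat_S_spec halves by (auto simp: halves_at_def)
qed

text \<open>All changes take place on the vertices of the old line, so \<open>ok_local\<close>
  applies. Connectedness survives since \<open>w\<close> hangs on \<open>v\<close> by the edge of
  \<open>a\<close>, which has become dashed.\<close>

lemma ok_S: "ok S"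
proof (rule ok_local[OF G, where Q = "set (line_verts r (L @ (a, w) # M))"])
  let ?Q = "set (line_verts r (L @ (a, w) # M))"
  have Q: "?Q = insert w (set (line_verts r (L @ M)))" by auto
  have vQ: "v \<in> set (line_verts r (L @ M))" unfolding v_def by (rule last_vert_in_line_verts)
  show "verts S = verts G" "edges S = edges G" by simp_all
  show "?Q \<subseteq> verts G" using lineD(3)[OF l] okD(4)[OF G] by blast
  show "vat S h = vat G h \<or> vat G h \<in> ?Q \<and> vat S h \<in> ?Q" for h
    using vats vQ by (auto simp: vat_S Q)
  have "(v', w) \<in> (adjacent S)\<^sup>*" if "v' \<in> set (line_verts r (L @ M))" for v'
  proof -
    have "(v', v) \<in> (adjacent S)\<^sup>*"
    proof (rule line_reach[OF lineD(5,6)[OF line_S] _ that vQ])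
      show "set (link_edges (L @ M)) \<subseteq> edges S"
        using lineD(4)[OF line_S] okD(5)[OF G] unfolding fuse_simps by blast
    qed
    moreover have "(v, w) \<in> adjacent S"
      unfolding adjacent_def using vat_S_spec(1,2) halves(3) by (intro CollectI exI[of _ a]) simp
    ultimately show ?thesis by simp
  qed
  note to_w = this
  show "(u, u') \<in> (adjacent S)\<^sup>*" if "u \<in> ?Q" "u' \<in> ?Q" for u u'
  proof -
    have "(u, w) \<in> (adjacent S)\<^sup>*" "(u', w) \<in> (adjacent S)\<^sup>*" using that to_w unfolding Q by auto
    then show ?thesis by (meson adjacent_sym rtrancl_trans)
  qed
  show "externals S \<noteq> {}" using lineD(3)[OF line_S] by auto
  show "externals S \<subseteq> verts G" "solids S \<subseteq> edges G" using okD[OF G] by auto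
  show "u \<in> externals S \<longleftrightarrow> u \<in> externals G" if "u \<in> verts G - ?Q" for u using that by auto
  show "fst h \<in> solids S \<longleftrightarrow> fst h \<in> solids G" if "h \<in> half_edges G" "vat G h \<notin> ?Q" for h
  proof -
    have "vat G a \<in> ?Q" "vat G (opp a) \<in> ?Q" using vats vQ unfolding Q by simp_all
    then have "h \<noteq> a" "h \<noteq> opp a" using that by metis+
    then show ?thesis by (auto simp: same_edge_iff)
  qed
  show "vat G (opp h) \<in> ?Q" if "h \<in> half_edges G" "fst h \<in> solids G" "vat G h \<in> ?Q" for h
    using line_closed[OF l that] .
  show "vertex_ok S u" if u: "u \<in> ?Q" for u
  proof (cases "u = w")
    case True
    note halves_at_w
    moreover have "fst h \<in> edges S \<and> fst h \<notin> solids S" if "h \<in> {opp a, x, y}" for h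
      using that halves by (auto simp: in_half_edges)
    ultimately have "dashed_halves_at S w = {opp a, x, y}" "solid_halves_at S w = {}"
      unfolding dashed_halves_at_def solid_halves_at_def dashed_def by blast+
    moreover have "card {opp a, x, y} = 3" using halves by (auto simp: same_edge_iff)
    ultimately show ?thesis using True by (simp add: vertex_ok_def)
  next
    case False
    then have uL: "u \<in> set (line_verts r (L @ M))" using u unfolding Q by simp
    then have ue: "u \<in> externals S" using lineD(3)[OF line_S] by blast
    have "card (dashed_halves_at S u) = 1"
    proof (cases "u = v")
      case True
      have "dashed_halves_at S v = {a}"
      proof (intro equalityI subsetI)
        fix h assume "h \<in> dashed_halves_at S v"
        then have h: "h \<in> half_edges G" "vat S h = v" "fst h \<notin> solids G \<or> fst h = fst a"
          by (auto simp: dashed_halves_at_def halves_at_def dashed_def)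
        show "h \<in> {a}"
        proof (cases "fst h = fst a")
          case True
          then show ?thesis using h(2) vat_S_spec vats(7) by (auto simp: same_edge_iff)
        next
          case False
          then have "vat G h = v" "h \<noteq> x"
            using h vats(7) M_halves(2) by (auto simp: vat_S split: if_splits)
          then show ?thesis using dashed_at(1)[OF h(1)] h(3) False by blast
        qed
      next
        fix h assume "h \<in> {a}"
        then show "h \<in> dashed_halves_at S v"
          using vat_S_spec halves(3) by (auto simp: dashed_halves_at_def halves_at_def dashed_def in_half_edges)
      qed
      then show ?thesis using True by simp
    next
      case False
      have at: "halves_at S u = halves_at G u"
        using False \<open>u \<noteq> w\<close> vats by (intro halves_at_congI) (auto simp: vat_S)
      have "h \<noteq> a \<and> h \<noteq> opp a" if "h \<in> halves_at G u" for h
        using that vats False \<open>u \<noteq> w\<close> by (auto simp: halves_at_def)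
      then have "dashed_halves_at S u = dashed_halves_at G u"
        unfolding dashed_halves_at_def at by (auto simp: dashed_def same_edge_iff)
      moreover have "u \<in> externals G" using ue by simp
      moreover have "vertex_ok G u" using okD(8)[OF G] okD(4)[OF G] \<open>u \<in> externals G\<close> by blast
      ultimately show ?thesis by (simp add: vertex_ok_def)
    qed
    then show ?thesis using ue uL line_S unfolding vertex_ok_def by (simp only: if_True) blast
  qed
qed

end

text \<open>The graph \<open>G\<close> is the term \<open>S\<close> of an STU relation: the leg
  \<open>a\<close> leads to the internal vertex \<open>w\<close> with the further half-edges
  \<open>x\<close> and \<open>y\<close>. The cut of the line determines which part stays at
  \<open>v\<close>, namely \<open>L\<close>, and which part moves to \<open>w\<close>, namely
  \<open>M\<close>.\<close>

locale leg_split =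
  fixes G r L a w M X x y Y
  assumes G: "ok G" and l: "line G r (L @ M) (X @ a # Y)" and len: "length X = length L"
    and w: "w \<in> verts G" "w \<notin> externals G" and at_w: "halves_at G w = {opp a, x, y}"
    and ne: "x \<noteq> y" "opp a \<noteq> x" "opp a \<noteq> y"
begin

definition "v = last_vert r L"

lemma vats:
  "map (vat G) X = sources r L" "vat G a = v" "map (vat G) Y = map snd M"
  "vat G (opp a) = w" "vat G x = w" "vat G y = w" "v \<noteq> w" "v \<in> externals G"
  "M \<noteq> [] \<Longrightarrow> vat G (fst (hd M)) = v"
proof -
  have "map (vat G) X @ vat G a # map (vat G) Y = sources r L @ v # map snd M"
    using lineD(7)[OF l] line_verts_split(2)[of r L M] by (simp add: v_def)
  then show "map (vat G) X = sources r L" "vat G a = v" "map (vat G) Y = map snd M"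
    using len by (simp_all add: append_eq_append_conv)
  show "vat G (opp a) = w" "vat G x = w" "vat G y = w" using at_w by (auto simp: halves_at_def)
  have "v \<in> set (line_verts r (L @ M))" unfolding line_verts_split by (simp add: v_def)
  then show "v \<in> externals G" using lineD(3)[OF l] by blast
  then show "v \<noteq> w" using w by metis
  show "vat G (fst (hd M)) = v" if "M \<noteq> []"
  proof -
    have "L @ M = L @ hd M # tl M" using that by simp
    from line_link(1)[OF l[unfolded this]] show ?thesis by (simp add: v_def)
  qed
qed

lemma no_solid_at_w:
  assumes "h \<in> half_edges G" "vat G h = w"
  shows "fst h \<notin> solids G"
proof
  assume "fst h \<in> solids G"
  then have "h \<in> solid_halves_at G w" using assms by (simp add: solid_halves_at_def halves_at_def)
  moreover have "solid_halves_at G w = {}" using okD(8)[OF G w(1)] w(2) by (simp add: vertex_ok_def)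
  ultimately show False by simp
qed

lemma halves:
  "x \<in> half_edges G" "y \<in> half_edges G" "a \<in> half_edges G" "fst x \<notin> solids G" "fst y \<notin> solids G"
  "fst a \<notin> solids G" "fst x \<noteq> fst a" "fst y \<noteq> fst a" "x \<notin> set (X @ Y)" "y \<notin> set (X @ Y)"
proof -
  note i = in_line_half_edges[OF G l]
  show h: "x \<in> half_edges G" "y \<in> half_edges G" using at_w by (auto simp: halves_at_def)
  show "a \<in> half_edges G" "fst a \<notin> solids G" using i(2)[of a] i(3)[of a] by auto
  show "fst x \<notin> solids G" "fst y \<notin> solids G" using no_solid_at_w h vats by auto
  show "fst x \<noteq> fst a" "fst y \<noteq> fst a"
    using ne vats by (auto simp: same_edge_iff)
  have "vat G z \<noteq> w" if "z \<in> set (X @ a # Y)" for z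
    using line_legs_at[OF l] lineD(3)[OF l] w that by blast
  from this[of x] this[of y] show "x \<notin> set (X @ Y)" "y \<notin> set (X @ Y)" using vats(5,6) by auto
qed

lemma M_halves:
  assumes "M \<noteq> []"
  shows "fst (hd M) \<in> half_edges G" "fst (fst (hd M)) \<in> solids G"
    "fst (hd M) \<noteq> x" "fst (hd M) \<noteq> y" "fst (hd M) \<noteq> a" "fst (hd M) \<noteq> opp a"
proof -
  note i = in_line_half_edges[OF G l]
  have m: "hd M \<in> set (L @ M)" using assms by simp
  then show s: "fst (hd M) \<in> half_edges G" "fst (fst (hd M)) \<in> solids G"
    using i(1)[OF m] i(4)[OF m] by simp_all
  show "fst (hd M) \<noteq> x" "fst (hd M) \<noteq> y" "fst (hd M) \<noteq> a" "fst (hd M) \<noteq> opp a"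
    using s halves opp_simps(2) by metis+
qed

abbreviation "T \<equiv> split_leg G v a w x M"

lemma vat_T:
  "vat T h = (if M \<noteq> [] \<and> h = fst (hd M) then w else if h = x then v else vat G h)"
  by (simp add: split_leg_def)

lemma vat_T_other: "h \<noteq> x \<Longrightarrow> (M \<noteq> [] \<Longrightarrow> h \<noteq> fst (hd M)) \<Longrightarrow> vat T h = vat G h"
  by (auto simp: vat_T)

lemma vat_T_spec: "vat T a = v" "vat T (opp a) = w" "vat T x = v" "vat T y = w"
  using vats halves M_halves ne by (auto simp: vat_T)

lemma line_T: "line T r (L @ (a, w) # M) (X @ x # y # Y)"
  unfolding line_def
proof (intro conjI)
  note i = in_line_half_edges[OF G l]
  have wl: "w \<notin> set (line_verts r (L @ M))" using lineD(3)[OF l] w by blast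
  then show "distinct (line_verts r (L @ (a, w) # M))" using lineD(1)[OF l] by auto
  have al: "fst a \<notin> set (link_edges (L @ M))" using lineD(4)[OF l] halves(6) by blast
  then show "distinct (link_edges (L @ (a, w) # M))" using lineD(2)[OF l] by auto
  show "set (line_verts r (L @ (a, w) # M)) \<subseteq> externals T" using lineD(3)[OF l] by auto
  show "set (link_edges (L @ (a, w) # M)) \<subseteq> solids T" using lineD(4)[OF l] by auto
  have src: "map (vat G \<circ> fst) L = sources r L" "map (vat G \<circ> fst) M = sources v M"
    using lineD(5)[OF l] by (simp_all add: append_eq_append_conv v_def)
  have nx: "fst l \<noteq> x" "opp (fst l) \<noteq> x" if "l \<in> set (L @ M)" for l
    using i(4)[OF that] halves(4) by auto
  have nhd: "M \<noteq> [] \<Longrightarrow> fst (fst l) \<noteq> fst (fst (hd M))" if "l \<in> set (L @ tl M)" for l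
    using line_link_ne[OF l _ that] .
  have "map (vat T \<circ> fst) L = map (vat G \<circ> fst) L"
  proof (rule map_cong[OF refl])
    fix l assume "l \<in> set L"
    then show "(vat T \<circ> fst) l = (vat G \<circ> fst) l"
      using nx[of l] nhd[of l] by (auto intro!: vat_T_other)
  qed
  moreover have "map (vat T \<circ> fst) M = sources w M"
  proof (cases M)
    case (Cons m M')
    have "map (vat T \<circ> fst) M' = map (vat G \<circ> fst) M'"
    proof (rule map_cong[OF refl])
      fix l assume "l \<in> set M'"
      then show "(vat T \<circ> fst) l = (vat G \<circ> fst) l"
        using nx[of l] nhd[of l] Cons vat_T[of "fst l"] by auto
    qed
    moreover have "map (vat G \<circ> fst) M' = sources (snd m) M'" using src(2) Cons by simp
    moreover have "vat T (fst m) = w" using vat_T[of "fst m"] Cons by simp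
    moreover have "map (vat T \<circ> fst) M = map (vat T \<circ> fst) (m # M')" using Cons by (rule arg_cong)
    ultimately show ?thesis unfolding Cons by simp
  qed simp
  ultimately show "map (vat T \<circ> fst) (L @ (a, w) # M) = sources r (L @ (a, w) # M)"
    using src(1) vat_T_spec by (simp add: v_def)
  have "map (vat T \<circ> opp \<circ> fst) (L @ M) = map (vat G \<circ> opp \<circ> fst) (L @ M)"
  proof (rule map_cong[OF refl])
    fix l assume m: "l \<in> set (L @ M)"
    have "opp (fst l) \<noteq> fst (hd M)" if "M \<noteq> []"
    proof (cases "l = hd M")
      case False
      then have "l \<in> set (L @ tl M)" using m that by (cases M) auto
      then show ?thesis using nhd[of l] that by (metis opp_simps(2))
    qed simp
    then show "(vat T \<circ> opp \<circ> fst) l = (vat G \<circ> opp \<circ> fst) l"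
      using nx[OF m] by (auto intro!: vat_T_other)
  qed
  also have "\<dots> = map snd (L @ M)" by (rule lineD(6)[OF l])
  finally show "map (vat T \<circ> opp \<circ> fst) (L @ (a, w) # M) = map snd (L @ (a, w) # M)"
    using vat_T_spec by (simp add: append_eq_append_conv)
  have leg: "vat T z = vat G z" if "z \<in> set (X @ Y)" for z
  proof (rule vat_T_other)
    show "z \<noteq> x" using that halves by auto
    show "z \<noteq> fst (hd M)" if "M \<noteq> []" using i(3)[of z] M_halves(2)[OF that] \<open>z \<in> set (X @ Y)\<close> by auto
  qed
  have "map (vat T) X = map (vat G) X" "map (vat T) Y = map (vat G) Y"
    using leg by (auto intro!: map_cong)
  then show "map (vat T) (X @ x # y # Y) = line_verts r (L @ (a, w) # M)"
    using vats vat_T_spec line_verts_split(1)[of r L "(a, w)" M] by (simp add: v_def)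
  have "fst z \<noteq> fst a" if "z \<in> set (X @ Y)" for z
  proof -
    have "z \<noteq> a" using that line_distinct_legs[OF l] by auto
    moreover have "z \<in> set (X @ a # Y)" using that by auto
    then have "vat G z \<in> externals G" using line_legs_at[OF l] lineD(3)[OF l] by blast
    then have "z \<noteq> opp a" using w vats(4) by metis
    ultimately show ?thesis by (simp add: same_edge_iff)
  qed
  then show "fst ` set (X @ x # y # Y) \<subseteq> dashed T"
    using lineD(8)[OF l] halves by (auto simp: dashed_def in_half_edges)
  show "\<forall>h\<in>half_edges T. fst h \<in> solids T \<longrightarrow> vat T h \<in> set (line_verts r (L @ (a, w) # M)) \<longrightarrow>
      fst h \<in> set (link_edges (L @ (a, w) # M))"
  proof (intro ballI impI)
    fix h assume h: "h \<in> half_edges T" "fst h \<in> solids T" "vat T h \<in> set (line_verts r (L @ (a, w) # M))"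
    show "fst h \<in> set (link_edges (L @ (a, w) # M))"
    proof (cases "fst h = fst a")
      case False
      then have s: "h \<in> half_edges G" "fst h \<in> solids G" using h by auto
      then have "h \<noteq> x" "vat G h \<noteq> w" using halves(4) no_solid_at_w[OF s(1)] by metis+
      then have "vat G h \<in> set (line_verts r (L @ M))"
      proof (cases "M \<noteq> [] \<and> h = fst (hd M)")
        case True
        then show ?thesis using vats(9) last_vert_in_line_verts[of r L M] by (simp add: v_def)
      next
        case False
        then have "vat T h = vat G h" using \<open>h \<noteq> x\<close> vat_T_other[of h] by blast
        moreover have "set (line_verts r (L @ (a, w) # M)) = insert w (set (line_verts r (L @ M)))" by auto
        ultimately show ?thesis using h(3) \<open>vat G h \<noteq> w\<close> by (metis insertE)
      qed
      then show ?thesis using lineD(9)[OF l s] by auto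
    qed simp
  qed
qed

lemma ok_T: "ok T"
proof (rule ok_local[OF G, where Q = "set (line_verts r (L @ (a, w) # M))"])
  let ?Q = "set (line_verts r (L @ (a, w) # M))"
  have Q: "?Q = insert w (set (line_verts r (L @ M)))" by auto
  have vQ: "v \<in> set (line_verts r (L @ M))" unfolding v_def by (rule last_vert_in_line_verts)
  show "verts T = verts G" "edges T = edges G" by simp_all
  show "?Q \<subseteq> verts G" using lineD(3)[OF l] okD(4)[OF G] w by auto
  show "vat T h = vat G h \<or> vat G h \<in> ?Q \<and> vat T h \<in> ?Q" for h
    using vats vQ by (auto simp: vat_T Q)
  show "(u, u') \<in> (adjacent T)\<^sup>*" if "u \<in> ?Q" "u' \<in> ?Q" for u u'
  proof (rule line_reach[OF lineD(5,6)[OF line_T] _ that])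
    have "fst a \<in> edges G" using halves(3) by (simp add: in_half_edges)
    then show "set (link_edges (L @ (a, w) # M)) \<subseteq> edges T"
      using lineD(4)[OF line_T] okD(5)[OF G] by auto
  qed
  show "externals T \<noteq> {}" "externals T \<subseteq> verts G" "solids T \<subseteq> edges G"
    using okD[OF G] w halves(3) by (auto simp: in_half_edges)
  show "u \<in> externals T \<longleftrightarrow> u \<in> externals G" if "u \<in> verts G - ?Q" for u using that by auto
  show "fst h \<in> solids T \<longleftrightarrow> fst h \<in> solids G" if "h \<in> half_edges G" "vat G h \<notin> ?Q" for h
  proof -
    have "vat G a \<in> ?Q" "vat G (opp a) \<in> ?Q" using vats vQ unfolding Q by simp_all
    then have "h \<noteq> a" "h \<noteq> opp a" using that by metis+
    then show ?thesis by (auto simp: same_edge_iff)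
  qed
  show "vat G (opp h) \<in> ?Q" if "h \<in> half_edges G" "fst h \<in> solids G" "vat G h \<in> ?Q" for h
  proof -
    have "vat G h \<in> set (line_verts r (L @ M))" using that no_solid_at_w[OF that(1)] unfolding Q by auto
    from line_closed[OF l that(1,2) this] show ?thesis unfolding Q by simp
  qed
  show "vertex_ok T u" if u: "u \<in> ?Q" for u
  proof -
    have ue: "u \<in> externals T" using lineD(3)[OF line_T] u by blast
    have "card (dashed_halves_at T u) = 1"
    proof (cases "u = v \<or> u = w")
      case False
      have at: "halves_at T u = halves_at G u"
        using False vats by (intro halves_at_congI) (auto simp: vat_T)
      have "h \<noteq> a \<and> h \<noteq> opp a" if "h \<in> halves_at G u" for h
        using that vats False by (auto simp: halves_at_def)
      then have "dashed_halves_at T u = dashed_halves_at G u"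
        unfolding dashed_halves_at_def at by (auto simp: dashed_def same_edge_iff)
      moreover have "u \<in> externals G" using ue False by simp
      moreover have "vertex_ok G u" using okD(8)[OF G] okD(4)[OF G] \<open>u \<in> externals G\<close> by blast
      ultimately show ?thesis by (simp add: vertex_ok_def)
    next
      case True
      have "dashed_halves_at T v = {x}"
      proof (intro equalityI subsetI)
        fix h assume "h \<in> dashed_halves_at T v"
        then have h: "h \<in> half_edges G" "vat T h = v" "fst h \<notin> solids G" "fst h \<noteq> fst a" "fst h \<in> edges G"
          by (auto simp: dashed_halves_at_def halves_at_def dashed_def)
        show "h \<in> {x}"
        proof (rule ccontr)
          assume "h \<notin> {x}"
          then have "vat G h = v" using h(2) vats(7) by (auto simp: vat_T split: if_splits)
          then have "h = a"
            using dashed_at_external[OF G vats(8) h(1) _ _ halves(3)] h halves(3,6) vats(2)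
            by (auto simp: dashed_def in_half_edges)
          then show False using h(4) by simp
        qed
      next
        fix h assume "h \<in> {x}"
        then show "h \<in> dashed_halves_at T v"
          using vat_T_spec halves by (auto simp: dashed_halves_at_def halves_at_def dashed_def in_half_edges)
      qed
      moreover have "dashed_halves_at T w = {y}"
      proof (intro equalityI subsetI)
        fix h assume "h \<in> dashed_halves_at T w"
        then have h: "h \<in> half_edges G" "vat T h = w" "fst h \<notin> solids G" "fst h \<noteq> fst a"
          by (auto simp: dashed_halves_at_def halves_at_def dashed_def)
        then have "h \<noteq> x" "vat G h = w"
          using vats(7) M_halves(2) vat_T_spec(3) by (auto simp: vat_T split: if_splits)
        then have "h \<in> {opp a, x, y}" unfolding at_w[symmetric] using h(1) by (simp add: halves_at_def)
        then show "h \<in> {y}" using h(4) \<open>h \<noteq> x\<close> by auto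
      next
        fix h assume "h \<in> {y}"
        then show "h \<in> dashed_halves_at T w"
          using vat_T_spec halves by (auto simp: dashed_halves_at_def halves_at_def dashed_def in_half_edges)
      qed
      ultimately show ?thesis using True by auto
    qed
    then show ?thesis using ue u line_T unfolding vertex_ok_def by (simp only: if_True) blast
  qed
qed

text \<open>With this, results on \<open>fused\<close> apply to an STU relation that is given by its
  term \<open>S\<close>.\<close>

lemma fuse_T: "fuse T v a w x M = G"
proof -
  have "vat (fuse T v a w x M) = vat G"
    using vats M_halves vat_T by (auto simp: fuse_def fun_eq_iff)
  then show ?thesis using w(2) halves(6) by (auto simp: fuse_def split_leg_def)
qed

end

section \<open>Caterpillars\<close>

lemma override_cong:
  assumes "length ks = length us" "\<And>h. h \<notin> set ks \<Longrightarrow> f h = g h"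
  shows "override f ks us = override g ks us"
proof
  fix h show "override f ks us h = override g ks us h"
  proof (cases "h \<in> set ks")
    case True
    then have "map_of (zip ks us) h \<noteq> None" using assms(1) by (simp add: map_of_zip_is_None)
    then show ?thesis by (auto simp: override_def)
  qed (use assms in simp)
qed

text \<open>The caterpillar with hair \<open>r\<close> that is the graph of the iterated bracket
  \<open>[v\<^sub>1, [v\<^sub>2, \<dots> [v\<^sub>k\<^sub>-\<^sub>1, v\<^sub>k]]]\<close>, on the vertices and edges of a line.\<close>

definition cat :: "graph \<Rightarrow> nat \<Rightarrow> link list \<Rightarrow> half_edge list \<Rightarrow> graph" where
  "cat G r L v = G\<lparr>vat := override (vat G) v (map snd L @ [last_vert r L]),
     externals := externals G - snd ` set L, solids := solids G - set (link_edges L)\<rparr>"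

lemma cat_simps [simp]:
  "verts (cat G r L v) = verts G" "edges (cat G r L v) = edges G"
  "half_edges (cat G r L v) = half_edges G"
  "externals (cat G r L v) = externals G - snd ` set L"
  "solids (cat G r L v) = solids G - set (link_edges L)"
  by (simp_all add: cat_def)

lemma vat_cat_notin: "h \<notin> set v \<Longrightarrow> vat (cat G r L v) h = vat G h"
  by (simp add: cat_def)

lemma vat_cat_legs:
  "distinct v \<Longrightarrow> length v = Suc (length L) \<Longrightarrow> map (vat (cat G r L v)) v = map snd L @ [last_vert r L]"
  by (simp add: cat_def)

text \<open>A caterpillar reattaches all legs, so it does not see how they were distributed on the
  line. Hence all orders of the legs have the same caterpillars.\<close>

lemma cat_cong:
  assumes "G' = G\<lparr>vat := vat G'\<rparr>" "\<And>h. h \<notin> set v \<Longrightarrow> vat G' h = vat G h"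
    "length v = Suc (length L)"
  shows "cat G' r L v = cat G r L v"
proof -
  have "override (vat G') v (map snd L @ [last_vert r L]) = override (vat G) v (map snd L @ [last_vert r L])"
    using assms by (intro override_cong) auto
  then show ?thesis using assms(1) by (cases G; cases G') (simp add: cat_def)
qed

lemma permutation_of_legs:
  assumes "line G r L xs" "v \<in> permutations_of_set (set xs)"
  shows "distinct v" "length v = Suc (length L)" "set v = set xs"
proof -
  show v: "distinct v" "set v = set xs" using assms(2) by (auto simp: permutations_of_set_def)
  then have "length v = length xs" using line_distinct_legs[OF assms(1)] by (metis distinct_card)
  then show "length v = Suc (length L)" using line_legs_length[OF assms(1)] by simp
qed

lemma cat_single:
  assumes "line G r [] [x]"
  shows "cat G r [] [x] = G"
proof -
  have "override (vat G) [x] [r] = vat G"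
    using lineD(7)[OF assms] by (intro override_eqI) auto
  then show ?thesis by (simp add: cat_def)
qed

text \<open>The last two legs form the innermost bracket. Fusing them at the end of the line gives a
  shorter line whose last letter is this bracket.\<close>

lemma cat_snoc:
  assumes "fused G r L a w [] X x y []"
  shows "cat G r (L @ [(a, w)]) (X @ [x, y]) = cat (fuse G (last_vert r L) a w x []) r L (X @ [a])"
proof -
  interpret fused G r L a w "[]" X x y "[]" by (rule assms)
  have d: "distinct (X @ [x, y])" using line_distinct_legs[OF l] by simp
  let ?g = "vat (cat S r L (X @ [a]))"
  have len': "length (X @ [a]) = Suc (length L)" using len by simp
  have "distinct (X @ [a])" using d halves by simp
  from vat_cat_legs[OF this len'] have g: "map ?g (X @ [a]) = map snd L @ [v]" by (simp add: v_def)
  have gX: "map ?g X = map snd L" using g len by (simp add: append_eq_append_conv)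
  have "override (vat G) (X @ [x, y]) (map snd (L @ [(a, w)]) @ [last_vert r (L @ [(a, w)])]) = ?g"
  proof (rule override_eqI[OF d])
    show "length (X @ [x, y]) = length (map snd (L @ [(a, w)]) @ [last_vert r (L @ [(a, w)])])"
      using len by simp
    have "x \<notin> set (X @ [a])" "y \<notin> set (X @ [a])" using halves by auto
    then have "?g x = vat S x" "?g y = vat S y" by (auto simp: vat_cat_notin)
    then have "?g x = w" "?g y = w" using vat_S_spec by simp_all
    then show "map ?g (X @ [x, y]) = map snd (L @ [(a, w)]) @ [last_vert r (L @ [(a, w)])]"
      using gX by simp
    fix h assume "h \<notin> set (X @ [x, y])"
    then show "?g h = vat G h"
      using g vats(5) vat_S[of h] by (cases "h = a") (simp_all add: vat_cat_notin)
  qed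
  moreover have "externals G - snd ` set (L @ [(a, w)]) = externals S - snd ` set L"
    "solids G - set (link_edges (L @ [(a, w)])) = solids S - set (link_edges L)" by auto
  ultimately show ?thesis by (simp add: cat_def fuse_def v_def[symmetric])
qed

text \<open>Two neighbouring legs are exchanged by passing from \<open>T\<close> to \<open>U\<close>
  through \<open>S\<close>: they are fused, and the result is split with \<open>x\<close> and
  \<open>y\<close> interchanged. Both moves preserve \<open>ok\<close>, and the other half-edges
  return to their places.\<close>

lemma permute_legs:
  assumes "ok G" "line G r L xs" "ys \<in> permutations_of_set (set xs)"
  shows "\<exists>G'. ok G' \<and> line G' r L ys \<and> G' = G\<lparr>vat := vat G'\<rparr> \<and> (\<forall>h. h \<notin> set xs \<longrightarrow> vat G' h = vat G h)"
proof (rule permutations_adjacent_induct[of xs ys])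
  show "distinct xs" "distinct ys" "set xs = set ys"
    using line_distinct_legs[OF assms(2)] assms(3) by (auto simp: permutations_of_set_def)
  show "\<exists>G'. ok G' \<and> line G' r L xs \<and> G' = G\<lparr>vat := vat G'\<rparr> \<and> (\<forall>h. h \<notin> set xs \<longrightarrow> vat G' h = vat G h)"
    using assms by (intro exI[of _ G]) simp
  fix X x y Y
  assume *: "distinct (X @ x # y # Y)" "set (X @ x # y # Y) = set xs"
    "\<exists>G'. ok G' \<and> line G' r L (X @ x # y # Y) \<and> G' = G\<lparr>vat := vat G'\<rparr> \<and> (\<forall>h. h \<notin> set xs \<longrightarrow> vat G' h = vat G h)"
  then obtain G' where G': "ok G'" "line G' r L (X @ x # y # Y)" "G' = G\<lparr>vat := vat G'\<rparr>"
    "\<And>h. h \<notin> set xs \<Longrightarrow> vat G' h = vat G h" by blast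
  have "length X < length L" using line_legs_length[OF G'(2)] by simp
  then obtain L1 a w M where L: "L = L1 @ (a, w) # M" and len: "length X = length L1"
    by (metis id_take_nth_drop length_take min.absorb4 nat_less_le surj_pair)
  interpret T: fused G' r L1 a w M X x y Y
    using G' len by unfold_locales (simp_all add: L)
  interpret U: leg_split T.S r L1 a w M X y x Y
  proof
    show "ok T.S" "line T.S r (L1 @ M) (X @ a # Y)" using T.ok_S T.line_S .
    show "length X = length L1" by (rule len)
    show "w \<in> verts T.S" "w \<notin> externals T.S"
      using lineD(3)[OF T.l] okD(4)[OF T.G] by auto
    show "halves_at T.S w = {opp a, y, x}" using T.halves_at_w by auto
    show "y \<noteq> x" "opp a \<noteq> y" "opp a \<noteq> x" using T.halves by auto
  qed
  have v: "U.v = T.v" by (simp add: U.v_def T.v_def)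
  have "vat U.T h = vat G h" if "h \<notin> set xs" for h
  proof -
    have "h \<noteq> x" "h \<noteq> y" using that *(2) by auto
    then have "vat U.T h = vat G' h" using T.vats(8) by (auto simp: U.vat_T T.vat_S)
    then show ?thesis using G'(4)[OF that] by simp
  qed
  moreover have "U.T = G\<lparr>vat := vat U.T\<rparr>"
  proof -
    have "w \<in> externals G'" using lineD(3)[OF T.l] by auto
    then have "U.T = G'\<lparr>vat := vat U.T\<rparr>"
      using T.halves(6) by (cases G') (auto simp: split_leg_def fuse_def insert_absorb)
    then show ?thesis by (subst (asm) (3) G'(3)) simp
  qed
  ultimately show "\<exists>G'. ok G' \<and> line G' r L (X @ y # x # Y) \<and> G' = G\<lparr>vat := vat G'\<rparr>
      \<and> (\<forall>h. h \<notin> set xs \<longrightarrow> vat G' h = vat G h)"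
    using U.ok_T U.line_T L by blast
qed

text \<open>The line is consumed from its far end: \<open>cat_snoc\<close> trades the last link for
  a fusion, which preserves \<open>ok\<close>.\<close>

lemma ok_cat_legs: "ok G \<Longrightarrow> line G r L xs \<Longrightarrow> ok (cat G r L xs)"
proof (induction L arbitrary: G xs rule: rev_induct)
  case Nil
  then obtain x where "xs = [x]" using line_legs_length[OF Nil(2)] by (auto simp: length_Suc_conv)
  then show ?case using Nil cat_single by auto
next
  case (snoc l L)
  obtain a w where lw: "l = (a, w)" by (cases l)
  have "length xs = Suc (Suc (length L))" using line_legs_length[OF snoc.prems(2)] by simp
  then obtain X x y where xs: "xs = X @ [x, y]" "length X = length L"
    by (metis append_Cons append_Nil append_assoc diff_Suc_1 length_append_singleton length_butlast
        length_greater_0_conv snoc_eq_iff_butlast zero_less_Suc)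
  interpret fused G r L a w "[]" X x y "[]"
    using snoc.prems xs lw by unfold_locales simp_all
  have "ok (cat S r L (X @ [a]))" using line_S by (intro snoc.IH ok_S) simp
  then show ?case using cat_snoc[OF fused_axioms] xs lw by (simp add: v_def)
qed

lemma ok_cat:
  assumes "ok G" "line G r L xs" "v \<in> permutations_of_set (set xs)"
  shows "ok (cat G r L v)"
proof -
  obtain G' where G': "ok G'" "line G' r L v" "G' = G\<lparr>vat := vat G'\<rparr>"
    "\<forall>h. h \<notin> set xs \<longrightarrow> vat G' h = vat G h"
    using permute_legs[OF assms] by blast
  have "cat G' r L v = cat G r L v"
    using G' permutation_of_legs[OF assms(2,3)] by (intro cat_cong) auto
  then show ?thesis using ok_cat_legs[OF G'(1,2)] by simp
qed

lemma card_solids_cat: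
  assumes "ok G" "line G r L xs"
  shows "card (solids (cat G r L v)) = card (solids G) - length L"
  using card_Diff_subset[of "set (link_edges L)" "solids G"] lineD(2,4)[OF assms(2)] distinct_card
  by fastforce

lemma length_le_solids:
  assumes "ok G" "line G r L xs"
  shows "length L \<le> card (solids G)"
  using card_mono[OF okD(7)[OF assms(1)] lineD(4)[OF assms(2)]] lineD(2)[OF assms(2)] distinct_card
  by fastforce

section \<open>Isomorphisms acting on lines and caterpillars\<close>

lemma map_sources: "map f (sources r L) = sources (f r) (map (map_prod g f) L)"
  by (induction L arbitrary: r) auto

lemma map_last_vert: "last_vert (f r) (map (map_prod g f) L) = f (last_vert r L)"
  by (induction L arbitrary: r) auto

definition links_image :: "(nat \<Rightarrow> nat) \<Rightarrow> (half_edge \<Rightarrow> half_edge) \<Rightarrow> link list \<Rightarrow> link list" where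
  "links_image f h = map (map_prod h f)"

lemma links_image_simps [simp]:
  "links_image f h [] = []" "links_image f h (L @ M) = links_image f h L @ links_image f h M"
  "links_image f h (l # L) = (h (fst l), f (snd l)) # links_image f h L"
  "length (links_image f h L) = length L"
  "map snd (links_image f h L) = map f (map snd L)" "map fst (links_image f h L) = map h (map fst L)"
  "links_image f h L = [] \<longleftrightarrow> L = []"
  "snd ` set (links_image f h L) = f ` snd ` set L"
  by (auto simp: links_image_def map_prod_def case_prod_unfold image_comp)

lemma graph_isoD:
  assumes "graph_iso G G' f h"
  shows "bij_betw f (verts G) (verts G')" "f ` externals G = externals G'"
    "bij_betw h (half_edges G) (half_edges G')"
    "x \<in> half_edges G \<Longrightarrow> h (opp x) = opp (h x)" "x \<in> half_edges G \<Longrightarrow> vat G' (h x) = f (vat G x)"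
    "x \<in> half_edges G \<Longrightarrow> fst (h x) \<in> solids G' \<longleftrightarrow> fst x \<in> solids G"
    "x \<in> half_edges G \<Longrightarrow> h x \<in> half_edges G'"
  using assms unfolding graph_iso_def by (auto dest: bij_betwE)

lemma graph_iso_same_edge:
  assumes "graph_iso G G' f h" "x \<in> half_edges G" "y \<in> half_edges G"
  shows "fst (h x) = fst (h y) \<longleftrightarrow> fst x = fst y"
proof -
  have "inj_on h (half_edges G)" using graph_isoD(3)[OF assms(1)] by (simp add: bij_betw_def)
  then have "h x = h y \<longleftrightarrow> x = y" "h x = h (opp y) \<longleftrightarrow> x = opp y"
    using assms(2,3) by (simp_all add: inj_on_eq_iff)
  then show ?thesis
    unfolding same_edge_iff[of "h x"] same_edge_iff[of x] using graph_isoD(4)[OF assms(1,3)] by simp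
qed

lemma iso_link_edges:
  assumes "graph_iso G G' f h" "x \<in> half_edges G" "fst ` set L \<subseteq> half_edges G"
  shows "fst (h x) \<in> set (link_edges (links_image f h L)) \<longleftrightarrow> fst x \<in> set (link_edges L)"
  using assms(3)
proof (induction L)
  case (Cons l L)
  then show ?case using graph_iso_same_edge[OF assms(1,2), of "fst l"] by auto
qed simp

lemma iso_line:
  assumes iso: "graph_iso G G' f h" and G: "ok G" "line G r L xs"
  shows "line G' (f r) (links_image f h L) (map h xs)"
  unfolding line_def
proof (intro conjI)
  note i = in_line_half_edges[OF G]
  note d = graph_isoD[OF iso]
  have vv: "line_verts (f r) (links_image f h L) = map f (line_verts r L)" by simp
  have injf: "inj_on f (verts G)" using d(1) by (simp add: bij_betw_def)
  have sub: "set (line_verts r L) \<subseteq> verts G" using lineD(3)[OF G(2)] okD(4)[OF G(1)] by blast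
  have hL: "fst ` set L \<subseteq> half_edges G" using i(1) by auto
  have hl: "fst l \<in> half_edges G" if "l \<in> set L" for l using i(1)[OF that] .
  show "distinct (line_verts (f r) (links_image f h L))"
    unfolding vv distinct_map using lineD(1)[OF G(2)] inj_on_subset[OF injf sub] by blast
  have "distinct (link_edges L)" by (rule lineD(2)[OF G(2)])
  then show "distinct (link_edges (links_image f h L))"
    using hL
  proof (induction L)
    case (Cons l L)
    have "fst (h (fst l)) \<notin> set (link_edges (links_image f h L))"
      using iso_link_edges[OF iso, of "fst l" L] Cons.prems by simp
    then show ?case using Cons by simp
  qed simp
  show "set (line_verts (f r) (links_image f h L)) \<subseteq> externals G'"
    unfolding vv list.set_map d(2)[symmetric] by (rule image_mono[OF lineD(3)[OF G(2)]])
  show "set (link_edges (links_image f h L)) \<subseteq> solids G'"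
    using i(4) d(6) hl by (auto simp: links_image_def)
  have "map (vat G' \<circ> fst) (links_image f h L) = map f (map (vat G \<circ> fst) L)"
    using d(5) hl by (auto simp: links_image_def)
  also have "\<dots> = sources (f r) (links_image f h L)"
    unfolding lineD(5)[OF G(2)] links_image_def by (rule map_sources)
  finally show "map (vat G' \<circ> fst) (links_image f h L) = sources (f r) (links_image f h L)" .
  have "map (vat G' \<circ> opp \<circ> fst) (links_image f h L) = map f (map (vat G \<circ> opp \<circ> fst) L)"
    using d(4)[symmetric] d(5)[of "opp _"] hl by (auto simp: links_image_def)
  also have "\<dots> = map snd (links_image f h L)"
    unfolding lineD(6)[OF G(2)] by simp
  finally show "map (vat G' \<circ> opp \<circ> fst) (links_image f h L) = map snd (links_image f h L)" .
  have "map (vat G') (map h xs) = map f (map (vat G) xs)" using d(5) i(2) by auto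
  then show "map (vat G') (map h xs) = line_verts (f r) (links_image f h L)"
    unfolding vv lineD(7)[OF G(2)] .
  have "fst (h x) \<in> dashed G'" if "x \<in> set xs" for x
    using d(6,7)[OF i(2)[OF that]] i(3)[OF that] by (simp add: dashed_def in_half_edges)
  then show "fst ` set (map h xs) \<subseteq> dashed G'" by auto
  show "\<forall>x\<in>half_edges G'. fst x \<in> solids G' \<longrightarrow> vat G' x \<in> set (line_verts (f r) (links_image f h L)) \<longrightarrow>
      fst x \<in> set (link_edges (links_image f h L))"
  proof (intro ballI impI)
    fix x' assume x': "x' \<in> half_edges G'" "fst x' \<in> solids G'"
      "vat G' x' \<in> set (line_verts (f r) (links_image f h L))"
    obtain x where x: "x \<in> half_edges G" "x' = h x"
      using d(3) x'(1) by (metis bij_betw_def imageE)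
    have "f (vat G x) \<in> f ` set (line_verts r L)"
      using x'(3) d(5)[OF x(1)] unfolding vv x(2) list.set_map by simp
    then have "vat G x \<in> set (line_verts r L)"
      using inj_on_image_mem_iff[OF injf okD(3)[OF G(1) x(1)] sub] by simp
    then have "fst x \<in> set (link_edges L)" using lineD(9)[OF G(2) x(1)] d(6)[OF x(1)] x'(2) x(2) by simp
    then show "fst x' \<in> set (link_edges (links_image f h L))"
      using iso_link_edges[OF iso x(1) hL] x(2) by simp
  qed
qed

lemma iso_cat:
  assumes iso: "graph_iso G G' f h" and G: "ok G" "line G r L xs"
    and v: "v \<in> permutations_of_set (set xs)"
  shows "graph_iso (cat G r L v) (cat G' (f r) (links_image f h L) (map h v)) f h"
proof -
  note i = in_line_half_edges[OF G] and d = graph_isoD[OF iso]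
  note pv = permutation_of_legs[OF G(2) v]
  have injf: "inj_on f (verts G)" using d(1) by (simp add: bij_betw_def)
  have injh: "inj_on h (half_edges G)" using d(3) by (simp add: bij_betw_def)
  have hL: "fst ` set L \<subseteq> half_edges G" using i(1) by auto
  have hv: "set v \<subseteq> half_edges G" using i(2) pv(3) by auto
  have sub: "snd ` set L \<subseteq> verts G" using lineD(3)[OF G(2)] okD(4)[OF G(1)] by auto
  have ext: "f ` externals (cat G r L v) = externals (cat G' (f r) (links_image f h L) (map h v))"
  proof -
    have "externals G - snd ` set L \<subseteq> verts G" using okD(4)[OF G(1)] by blast
    then have "f ` (externals G - snd ` set L) = f ` externals G - f ` snd ` set L"
      by (rule inj_on_image_set_diff[OF injf _ sub])
    then show ?thesis unfolding cat_simps links_image_simps d(2) .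
  qed
  have "vat (cat G' (f r) (links_image f h L) (map h v)) (h x) = f (vat (cat G r L v) x)"
    if x: "x \<in> half_edges G" for x
  proof (cases "x \<in> set v")
    case True
    have "distinct (map h v)" using pv(1) hv injh by (simp add: distinct_map inj_on_subset)
    then have "map (vat (cat G' (f r) (links_image f h L) (map h v))) (map h v)
        = map snd (links_image f h L) @ [last_vert (f r) (links_image f h L)]"
      using pv(2) by (intro vat_cat_legs) auto
    also have "\<dots> = map f (map snd L @ [last_vert r L])"
      unfolding links_image_def map_last_vert by simp
    also have "map snd L @ [last_vert r L] = map (vat (cat G r L v)) v"
      using vat_cat_legs[OF pv(1,2)] by simp
    finally show ?thesis using True by simp
  next
    case False
    then have "h x \<notin> set (map h v)" using inj_on_image_mem_iff[OF injh x hv] by simp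
    then show ?thesis using False d(5)[OF x] by (simp add: vat_cat_notin)
  qed
  then show ?thesis
    using iso iso_link_edges[OF iso _ hL] ext unfolding graph_iso_def by auto
qed

section \<open>Reversal of the direction of a line\<close>

fun revl :: "nat \<Rightarrow> link list \<Rightarrow> link list" where
  "revl r [] = []"
| "revl r (l # L) = revl (snd l) L @ [(opp (fst l), r)]"

lemma revl_append: "revl r (L @ M) = revl (last_vert r L) M @ revl r L"
  by (induction L arbitrary: r) auto

lemma length_revl [simp]: "length (revl r L) = length L"
  by (induction L arbitrary: r) auto

lemma map_snd_revl: "map snd (revl r L) = rev (sources r L)"
  by (induction L arbitrary: r) auto

lemma map_fst_revl: "map fst (revl r L) = rev (map (opp \<circ> fst) L)"
  by (induction L arbitrary: r) auto

lemma line_verts_revl: "line_verts (last_vert r L) (revl r L) = rev (line_verts r L)"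
  using sources_last[of r L] by (simp add: map_snd_revl del: rev.simps)

lemma last_vert_revl: "last_vert (last_vert r L) (revl r L) = r"
  unfolding last_vert_last[of _ "revl r L"] line_verts_revl by simp

lemma sources_revl: "sources (last_vert r L) (revl r L) = rev (map snd L)"
  using sources_last[of "last_vert r L" "revl r L"] unfolding line_verts_revl last_vert_revl by simp

lemma link_edges_revl: "link_edges (revl r L) = rev (link_edges L)"
  by (induction L arbitrary: r) auto

lemma line_rev:
  assumes "line G r L xs"
  shows "line G (last_vert r L) (revl r L) (rev xs)"
proof -
  have "map (vat G) (map fst (revl r L)) = rev (map (vat G \<circ> opp \<circ> fst) L)"
    unfolding map_fst_revl by (simp add: rev_map o_def)
  also have "\<dots> = sources (last_vert r L) (revl r L)"
    unfolding lineD(6)[OF assms] sources_revl ..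
  finally have 1: "map (vat G \<circ> fst) (revl r L) = sources (last_vert r L) (revl r L)" by simp
  have "map (vat G \<circ> opp) (map fst (revl r L)) = rev (map (vat G \<circ> fst) L)"
    unfolding map_fst_revl by (simp add: rev_map o_def)
  also have "\<dots> = map snd (revl r L)" unfolding lineD(5)[OF assms] map_snd_revl ..
  finally have 2: "map (vat G \<circ> opp \<circ> fst) (revl r L) = map snd (revl r L)" by (simp add: o_assoc)
  show ?thesis
    using assms 1 2 unfolding line_def line_verts_revl link_edges_revl set_rev distinct_rev
    by (simp add: rev_map[symmetric] del: rev.simps)
qed

section \<open>Weights\<close>

definition flip_edge :: "nat \<Rightarrow> half_edge \<Rightarrow> half_edge" where
  "flip_edge e x = (if fst x = e then opp x else x)"

definition swap_edges :: "half_edge \<Rightarrow> half_edge \<Rightarrow> half_edge \<Rightarrow> half_edge" where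
  "swap_edges a b x = (if x = a then b else if x = opp a then opp b
     else if x = b then a else if x = opp b then opp a else x)"

lemma flip_edge_invol [simp]: "flip_edge e (flip_edge e x) = x"
  by (simp add: flip_edge_def)

lemma swap_edges_invol [simp]: "swap_edges a b (swap_edges a b x) = x"
  by (auto simp: swap_edges_def)

lemma swap_edges_simps:
  "swap_edges a b a = b" "swap_edges a b b = a"
  "fst x \<noteq> fst a \<Longrightarrow> fst x \<noteq> fst b \<Longrightarrow> swap_edges a b x = x"
  "fst a \<noteq> fst b \<Longrightarrow> swap_edges a b (opp a) = opp b"
  "fst a \<noteq> fst b \<Longrightarrow> swap_edges a b (opp b) = opp a"
  by (auto simp: swap_edges_def)

lemma swap_edges_opp: "fst a \<noteq> fst b \<Longrightarrow> swap_edges a b (opp x) = opp (swap_edges a b x)"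
  by (auto simp: swap_edges_def)

lemma fst_swap_edges: "fst a \<noteq> fst b \<Longrightarrow> fst (swap_edges a b x) = transpose (fst a) (fst b) (fst x)"
  by (auto simp: swap_edges_def transpose_def same_edge_iff)

lemma renumbering_transpose:
  assumes "bij_betw l A B" "p \<in> A" "q \<in> A"
  shows "renumbering A l (l \<circ> transpose p q) = transpose (l p) (l q)"
proof
  fix i
  have inj: "inj_on l A" using assms(1) by (simp add: bij_betw_def)
  show "renumbering A l (l \<circ> transpose p q) i = transpose (l p) (l q) i"
  proof (cases "i \<in> l ` A")
    case True
    then obtain u where u: "u \<in> A" "i = l u" by auto
    then have "inv_into A l i = u" using inj by simp
    moreover have "l u = l p \<longleftrightarrow> u = p" "l u = l q \<longleftrightarrow> u = q"
      using inj u assms by (auto simp: inj_on_eq_iff)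
    ultimately show ?thesis using True u by (auto simp: renumbering_def transpose_def)
  next
    case False
    then have "i \<noteq> l p" "i \<noteq> l q" using assms by auto
    then show ?thesis using False by (simp add: renumbering_def)
  qed
qed

lemma renumbering_same: "bij_betw l A B \<Longrightarrow> renumbering A l l = id"
  by (auto simp: renumbering_def fun_eq_iff bij_betw_def f_inv_into_f)

lemma sign_renumbering_transpose:
  assumes "bij_betw l A B" "p \<in> A" "q \<in> A" "p \<noteq> q"
  shows "sign (renumbering A l (l \<circ> transpose p q)) = -1"
proof -
  have "l p \<noteq> l q" using assms by (auto simp: bij_betw_def inj_on_eq_iff)
  then show ?thesis by (simp add: renumbering_transpose[OF assms(1-3)] sign_swap_id)
qed

text \<open>In the odd case the transposition of two vertices and the reversal of one edge
  contribute \<open>-1\<close> each; in the even case no edge number changes.\<close>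

lemma change_sign_flip:
  assumes "is_coloring par G c" "p \<in> verts G" "q \<in> verts G" "p \<noteq> q" "e \<in> edges G"
  shows "change_sign G (transpose p q) (flip_edge e) c c = 1"
proof (cases c)
  case (OddColoring d l)
  then have b: "bij_betw l (verts G) {1..card (verts G)}" using assms(1) by (cases par) auto
  have "{e' \<in> edges G. snd (flip_edge e (e', d e')) \<noteq> d (fst (flip_edge e (e', d e')))} = {e}"
    using assms(5) by (auto simp: flip_edge_def opp_def)
  then show ?thesis using sign_renumbering_transpose[OF b assms(2-4)] by (simp add: OddColoring)
next
  case (EvenColoring k)
  then have b: "bij_betw k (edges G) {1..card (edges G)}" using assms(1) by (cases par) auto
  have "(\<lambda>e'. k (fst (flip_edge e (e', False)))) = k" by (auto simp: flip_edge_def)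
  then show ?thesis using renumbering_same[OF b] by (simp add: EvenColoring)
qed

text \<open>In the odd case the number of reversed edges is 0 or 2, so the transposition of the
  vertices decides; in the even case the transposition of the edge numbers does.\<close>

lemma change_sign_swap:
  assumes "is_coloring par G c" "p \<in> verts G" "q \<in> verts G" "p \<noteq> q"
    "a \<in> half_edges G" "b \<in> half_edges G" "fst a \<noteq> fst b"
  shows "change_sign G (transpose p q) (swap_edges a b) c c = -1"
proof (cases c)
  case (OddColoring d l)
  then have l: "bij_betw l (verts G) {1..card (verts G)}" using assms(1) by (cases par) auto
  let ?E = "{e \<in> edges G. snd (swap_edges a b (e, d e)) \<noteq> d (fst (swap_edges a b (e, d e)))}"
  obtain ea i eb j where ab: "a = (ea, i)" "b = (eb, j)" by (cases a; cases b)
  have "ea \<in> edges G" "eb \<in> edges G" "ea \<noteq> eb" using assms(5-7) ab by (auto simp: half_edges_def)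
  then have "?E = (if (d ea = i) = (d eb = j) then {} else {ea, eb})"
    using ab by (auto simp: swap_edges_def opp_def)
  then have "even (card ?E)" using \<open>ea \<noteq> eb\<close> by simp
  then show ?thesis using sign_renumbering_transpose[OF l assms(2-4)] by (simp add: OddColoring)
next
  case (EvenColoring k)
  then have k: "bij_betw k (edges G) {1..card (edges G)}" using assms(1) by (cases par) auto
  have "(\<lambda>e. k (fst (swap_edges a b (e, False)))) = k \<circ> transpose (fst a) (fst b)"
    using fst_swap_edges[OF assms(7)] by auto
  then show ?thesis
    using sign_renumbering_transpose[OF k, of "fst a" "fst b"] assms by (simp add: EvenColoring in_half_edges)
qed

section \<open>IHX moves at an edge between internal vertices\<close>

lemma internal_halves_at:
  assumes "ok G" "u \<in> verts G" "u \<notin> externals G"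
    "{p, q, s} \<subseteq> half_edges G" "vat G p = u" "vat G q = u" "vat G s = u" "p \<noteq> q" "p \<noteq> s" "q \<noteq> s"
  shows "halves_at G u = {p, q, s}"
proof -
  have v: "card (dashed_halves_at G u) = 3" "solid_halves_at G u = {}"
    using okD(8)[OF assms(1,2)] assms(3) by (simp_all add: vertex_ok_def)
  have "h \<in> dashed_halves_at G u" if "h \<in> halves_at G u" for h
  proof -
    have "h \<notin> solid_halves_at G u" using v by simp
    then show ?thesis
      using that by (simp add: solid_halves_at_def dashed_halves_at_def dashed_def halves_at_def in_half_edges)
  qed
  then have eq: "halves_at G u = dashed_halves_at G u"
    by (auto simp: dashed_halves_at_def)
  have sub: "{p, q, s} \<subseteq> halves_at G u" using assms by (auto simp: halves_at_def)
  have "finite (halves_at G u)" unfolding eq by (rule card_ge_0_finite) (simp add: v)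
  moreover have "card {p, q, s} = card (halves_at G u)" using assms eq v by simp
  ultimately show ?thesis using card_subset_eq[OF _ sub] by simp
qed

lemma no_solid_at_internal:
  assumes "ok G" "u \<in> verts G" "u \<notin> externals G" "h \<in> half_edges G" "vat G h = u"
  shows "fst h \<notin> solids G"
proof
  assume "fst h \<in> solids G"
  then have "h \<in> solid_halves_at G u" using assms by (simp add: solid_halves_at_def halves_at_def)
  moreover have "solid_halves_at G u = {}" using okD(8)[OF assms(1,2)] assms(3) by (simp add: vertex_ok_def)
  ultimately show False by simp
qed

text \<open>The edge is given by its half \<open>b\<close>, so that a move can be started from
  either end. The half-edges \<open>s\<close> and \<open>t\<close> stay in place, while
  \<open>x\<close> and \<open>y\<close> are to be exchanged.\<close>

locale ihx_site =
  fixes G b u p s x y t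
  assumes G: "ok G" and b: "b \<in> half_edges G" "vat G b = u" "vat G (opp b) = p" "u \<noteq> p"
    and up: "u \<notin> externals G" "p \<notin> externals G"
    and at_u: "halves_at G u = {b, s, x}" "b \<noteq> s" "b \<noteq> x" "s \<noteq> x"
    and at_p: "halves_at G p = {opp b, y, t}" "opp b \<noteq> y" "opp b \<noteq> t" "y \<noteq> t"
begin

lemma vats: "vat G s = u" "vat G x = u" "vat G y = p" "vat G t = p"
  and halves: "s \<in> half_edges G" "x \<in> half_edges G" "y \<in> half_edges G" "t \<in> half_edges G"
  using at_u(1) at_p(1) by (auto simp: halves_at_def)

lemma uV: "u \<in> verts G" "p \<in> verts G"
  using okD(3)[OF G, of b] okD(3)[OF G, of "opp b"] b by auto

definition "swapped = G\<lparr>vat := (vat G)(x := p, y := u)\<rparr>"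

lemma swapped_simps [simp]:
  "verts swapped = verts G" "edges swapped = edges G" "externals swapped = externals G"
  "solids swapped = solids G" "half_edges swapped = half_edges G" "dashed swapped = dashed G"
  by (simp_all add: swapped_def dashed_def half_edges_def)

lemma vat_swapped: "vat swapped h = (if h = y then u else if h = x then p else vat G h)"
  by (simp add: swapped_def)

lemma distinct_halves:
  "x \<noteq> y" "x \<noteq> t" "s \<noteq> y" "s \<noteq> t" "b \<noteq> y" "b \<noteq> t" "opp b \<noteq> x" "opp b \<noteq> s"
  using vats b(2-4) by metis+

lemma vat_swapped_spec:
  "vat swapped b = u" "vat swapped (opp b) = p" "vat swapped s = u" "vat swapped y = u"
  "vat swapped x = p" "vat swapped t = p"
  unfolding vat_swapped
  by (simp_all only: vats b(2,3) distinct_halves at_u at_p distinct_halves[symmetric] at_u(2-4)[symmetric]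
      at_p(2-4)[symmetric] if_True if_False refl cong: if_cong)

lemma ok_swapped: "ok swapped"
proof (rule ok_local[OF G, where Q = "{u, p}"])
  show "verts swapped = verts G" "edges swapped = edges G" by simp_all
  show "{u, p} \<subseteq> verts G" using uV by simp
  show "vat swapped h = vat G h \<or> vat G h \<in> {u, p} \<and> vat swapped h \<in> {u, p}" for h
    using vats by (auto simp: vat_swapped)
  have "(u, p) \<in> adjacent swapped"
    using vat_swapped_spec unfolding adjacent_def using b(1) by (intro CollectI exI[of _ b]) simp
  then have up': "(u, p) \<in> (adjacent swapped)\<^sup>*" "(p, u) \<in> (adjacent swapped)\<^sup>*"
    by (auto intro: adjacent_sym)
  then show "(v, v') \<in> (adjacent swapped)\<^sup>*" if "v \<in> {u, p}" "v' \<in> {u, p}" for v v'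
    using that by auto
  show "externals swapped \<noteq> {}" "externals swapped \<subseteq> verts G" "solids swapped \<subseteq> edges G"
    using okD[OF G] by simp_all
  show "v \<in> externals swapped \<longleftrightarrow> v \<in> externals G" for v by simp
  show "fst h \<in> solids swapped \<longleftrightarrow> fst h \<in> solids G" for h by simp
  have ns: "fst h \<notin> solids G" if "h \<in> half_edges G" "vat G h \<in> {u, p}" for h
    using that no_solid_at_internal[OF G _ _ that(1)] uV up by auto
  show "vat G (opp h) \<in> {u, p}" if "h \<in> half_edges G" "fst h \<in> solids G" "vat G h \<in> {u, p}" for h
    using ns[OF that(1,3)] that(2) by simp
  have "halves_at swapped u = {b, s, y}"
  proof (intro equalityI subsetI)
    fix h assume "h \<in> halves_at swapped u"
    then have h: "h \<in> half_edges G" "vat swapped h = u" by (auto simp: halves_at_def)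
    show "h \<in> {b, s, y}"
    proof (cases "h = y")
      case False
      then have "vat G h = u" "h \<noteq> x" using h(2) b(4) by (auto simp: vat_swapped split: if_splits)
      then have "h \<in> halves_at G u" using h(1) by (simp add: halves_at_def)
      then show ?thesis using at_u \<open>h \<noteq> x\<close> by auto
    qed simp
  next
    fix h assume "h \<in> {b, s, y}"
    then show "h \<in> halves_at swapped u"
      using vat_swapped_spec b(1) halves unfolding halves_at_def by auto
  qed
  moreover have "halves_at swapped p = {opp b, x, t}"
  proof (intro equalityI subsetI)
    fix h assume "h \<in> halves_at swapped p"
    then have h: "h \<in> half_edges G" "vat swapped h = p" by (auto simp: halves_at_def)
    show "h \<in> {opp b, x, t}"
    proof (cases "h = x")
      case False
      then have "vat G h = p" "h \<noteq> y" using h(2) b(4) by (auto simp: vat_swapped split: if_splits)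
      then have "h \<in> halves_at G p" using h(1) by (simp add: halves_at_def)
      then show ?thesis using at_p \<open>h \<noteq> y\<close> by auto
    qed simp
  next
    fix h assume "h \<in> {opp b, x, t}"
    then show "h \<in> halves_at swapped p"
      using vat_swapped_spec b(1) halves unfolding halves_at_def by auto
  qed
  ultimately have at: "halves_at swapped u = {b, s, y}" "halves_at swapped p = {opp b, x, t}" .
  have "fst h \<notin> solids swapped \<and> fst h \<in> dashed swapped" if "h \<in> {b, s, y, opp b, x, t}" for h
  proof -
    have "h \<in> half_edges G" "vat G h \<in> {u, p}" using that b(1-3) halves vats by (elim insertE; simp)+
    then show ?thesis using ns by (simp add: dashed_def in_half_edges)
  qed
  then have "dashed_halves_at swapped u = {b, s, y}" "solid_halves_at swapped u = {}"
     "dashed_halves_at swapped p = {opp b, x, t}" "solid_halves_at swapped p = {}"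
    unfolding dashed_halves_at_def solid_halves_at_def at by blast+
  moreover have "card {b, s, y} = 3" "card {opp b, x, t} = 3"
    using at_u at_p distinct_halves by (auto simp: card_insert_if)
  ultimately show "vertex_ok swapped v" if "v \<in> {u, p}" for v
    using that up unfolding vertex_ok_def by auto
qed

end

text \<open>Flips and swaps are involutions on a common set of vertices and half-edges, so
  bijectivity comes for free.\<close>

lemma graph_iso_involution:
  assumes "\<And>v. v \<in> verts G \<Longrightarrow> f v \<in> verts G" "\<And>v. f (f v) = v" "\<And>x. h (h x) = x"
    "\<And>x. h (opp x) = opp (h x)" "\<And>x. x \<in> half_edges G \<Longrightarrow> h x \<in> half_edges G"
    "verts G' = verts G" "edges G' = edges G" "f ` externals G = externals G'"
    "\<And>x. x \<in> half_edges G \<Longrightarrow> vat G' (h x) = f (vat G x)"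
    "\<And>x. x \<in> half_edges G \<Longrightarrow> fst (h x) \<in> solids G' \<longleftrightarrow> fst x \<in> solids G"
  shows "graph_iso G G' f h"
proof -
  have "bij_betw f (verts G) (verts G')"
    using assms(1,2,6) by (intro bij_betw_byWitness[where f' = f]) auto
  moreover have "half_edges G' = half_edges G" using assms(7) by (simp add: half_edges_def)
  then have "bij_betw h (half_edges G) (half_edges G')"
    using assms(3,5) by (intro bij_betw_byWitness[where f' = h]) auto
  ultimately show ?thesis unfolding graph_iso_def using assms(4,8,9,10) by blast
qed

lemma flip_edge_opp: "flip_edge e (opp x) = opp (flip_edge e x)"
  by (simp add: flip_edge_def)

lemma fst_flip_edge [simp]: "fst (flip_edge e x) = fst x"
  by (simp add: flip_edge_def)

lemma transpose_in: "u \<in> V \<Longrightarrow> p \<in> V \<Longrightarrow> v \<in> V \<Longrightarrow> transpose u p v \<in> V"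
  by (auto simp: transpose_def)

text \<open>A functional on graphs with at most \<open>n\<close> solid edges. For
  \<open>n = 0\<close> these are the hairy graphs, and \<open>n\<close> grows by one at each
  extension step. The three graphs in \<open>ihx\<close> carry one and the same coloring, as they
  share their vertices and edges.\<close>

locale weight =
  fixes par :: parity and n :: nat and W :: "colored_graph \<Rightarrow> rat"
  assumes equivariant: "ok G \<Longrightarrow> ok G' \<Longrightarrow> card (solids G) \<le> n \<Longrightarrow> is_coloring par G c \<Longrightarrow>
      is_coloring par G' c' \<Longrightarrow> graph_iso G G' f h \<Longrightarrow>
      W (G', c') = of_int (change_sign G f h c c') * W (G, c)"
    and ihx: "ok G \<Longrightarrow> card (solids G) \<le> n \<Longrightarrow> is_coloring par G c \<Longrightarrow> ihx_expansions G e G2 G3 \<Longrightarrow>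
      W (G, c) + W (G2, c) + W (G3, c) = 0"

lemma is_coloring_cong: "verts G' = verts G \<Longrightarrow> edges G' = edges G \<Longrightarrow> is_coloring par G' c = is_coloring par G c"
  by (cases par; cases c) auto

lemma (in weight) flip_invariant:
  assumes "ok G" "ok G'" "card (solids G) \<le> n" "is_coloring par G c"
    and same: "verts G' = verts G" "edges G' = edges G"
    and e: "p \<in> verts G" "q \<in> verts G" "p \<noteq> q" "e \<in> edges G"
    and iso: "graph_iso G G' (transpose p q) (flip_edge e)"
  shows "W (G', c) = W (G, c)"
  using equivariant[OF assms(1-4) _ iso, of c] is_coloring_cong[OF same] assms(4)
    change_sign_flip[OF assms(4) e] by simp

text \<open>The definition \<open>ihx_expansions\<close> tells the two ends of the edge apart by
  their names. If \<open>b\<close> has the name \<open>True\<close>, the relation has to be read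
  from \<open>p\<close>. Then one of the terms appears with its two ends exchanged, which a flip of
  the edge repairs with sign \<open>+1\<close>.\<close>

lemma (in weight) ihx_move:
  assumes "ihx_site G b u p s x y t" "card (solids G) \<le> n" and c: "is_coloring par G c"
  shows "W (G, c) + W (G\<lparr>vat := (vat G)(x := p, y := u)\<rparr>, c) + W (G\<lparr>vat := (vat G)(x := p, t := u)\<rparr>, c) = 0"
proof -
  interpret A: ihx_site G b u p s x y t by (rule assms(1))
  interpret B: ihx_site G b u p s x t y
    using A.b A.up A.at_u A.at_p by unfold_locales (auto simp: A.G insert_commute)
  interpret C: ihx_site G b u p x s y t
    using A.b A.up A.at_u A.at_p by unfold_locales (auto simp: A.G insert_commute)
  have dash: "fst b \<in> dashed G"
    using no_solid_at_internal[OF A.G A.uV(1) A.up(1) A.b(1,2)] A.b(1) by (simp add: dashed_def in_half_edges)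
  have int: "u \<in> internals G" "p \<in> internals G" using A.uV A.up by (auto simp: internals_def)
  have rest: "halves_at G u - {b} = {s, x}" "halves_at G p - {opp b} = {y, t}"
    using A.at_u A.at_p by auto
  have xy: "x \<noteq> y" "x \<noteq> t" "s \<noteq> y" using A.vats A.b(4) by auto
  show ?thesis
  proof (cases "snd b")
    case False
    then have b: "(fst b, False) = b" "(fst b, True) = opp b" by (auto simp: opp_def prod_eq_iff)
    have "ihx_expansions G (fst b) (attach x p (attach y u G)) (attach x p (attach t u G))"
      unfolding ihx_expansions_def b
      using dash int A.b rest A.at_u A.at_p
      by (intro exI[of _ u] exI[of _ p] exI[of _ s] exI[of _ x] exI[of _ y] exI[of _ t]) simp
    then have "W (G, c) + W (attach x p (attach y u G), c) + W (attach x p (attach t u G), c) = 0"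
      by (rule ihx[OF A.G assms(2) c])
    then show ?thesis using xy by (simp add: attach_def fun_upd_twist)
  next
    case True
    then have b: "(fst b, False) = opp b" "(fst b, True) = b" by (auto simp: opp_def prod_eq_iff)
    have "ihx_expansions G (fst b) (attach y u (attach x p G)) (attach y u (attach s p G))"
      unfolding ihx_expansions_def b
      using dash int A.b rest A.at_u A.at_p
      by (intro exI[of _ p] exI[of _ u] exI[of _ t] exI[of _ y] exI[of _ x] exI[of _ s])
         (simp add: insert_commute)
    then have *: "W (G, c) + W (attach y u (attach x p G), c) + W (attach y u (attach s p G), c) = 0"
      by (rule ihx[OF A.G assms(2) c])
    have sw: "B.swapped = G\<lparr>vat := (vat G)(x := p, t := u)\<rparr>" "A.swapped = attach y u (attach x p G)"
        "C.swapped = attach y u (attach s p G)"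
      by (simp_all add: A.swapped_def B.swapped_def C.swapped_def attach_def)
    \<comment> \<open>Both graphs pair \<open>s\<close> with \<open>t\<close> and \<open>x\<close>
      with \<open>y\<close>; they differ only in which pair is attached to \<open>u\<close>.\<close>
    have "graph_iso B.swapped C.swapped (transpose u p) (flip_edge (fst b))"
    proof (rule graph_iso_involution)
      show "transpose u p v \<in> verts B.swapped" if "v \<in> verts B.swapped" for v
        using that A.uV by (simp add: transpose_in)
      show "flip_edge (fst b) x \<in> half_edges B.swapped" if "x \<in> half_edges B.swapped" for x
        using that by (simp add: in_half_edges)
      show "transpose u p ` externals B.swapped = externals C.swapped"
        using A.up by (auto simp: transpose_def image_iff)
      show "vat C.swapped (flip_edge (fst b) z) = transpose u p (vat B.swapped z)"
        if z: "z \<in> half_edges B.swapped" for z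
      proof -
        consider "z = b" | "z = opp b" | "z = s" | "z = x" | "z = y" | "z = t"
          | "vat G z \<noteq> u" "vat G z \<noteq> p"
        proof (cases "vat G z = u \<or> vat G z = p")
          case True
          then have "z \<in> halves_at G u \<or> z \<in> halves_at G p" using z by (auto simp: halves_at_def)
          then show ?thesis using A.at_u(1) A.at_p(1) that by auto
        qed (use that in auto)
        then show ?thesis
        proof cases
          case 7
          then have "z \<notin> {b, opp b, s, x, y, t}" using A.vats A.b by auto
          then show ?thesis using 7
            by (auto simp: flip_edge_def A.vat_swapped B.vat_swapped C.vat_swapped same_edge_iff)
        qed (use A.vats A.b xy A.at_u A.at_p in
            \<open>auto simp: flip_edge_def B.vat_swapped C.vat_swapped same_edge_iff\<close>)
      qed
    qed (simp_all add: flip_edge_opp)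
    then have "W (C.swapped, c) = W (B.swapped, c)"
      using B.ok_swapped C.ok_swapped assms(2) c is_coloring_cong[of B.swapped G par c] A.uV A.b
      by (intro flip_invariant[of _ _ c u p "fst b"]) (auto simp: in_half_edges)
    then show ?thesis using * xy unfolding sw(2,3)[symmetric] sw(1)[symmetric] A.swapped_def
      by (simp add: add_ac)
  qed
qed

text \<open>The caterpillar with links \<open>N\<close> and legs \<open>v\<close>, in which the leg \<open>fst l\<close> ends in an internal
  vertex \<open>snd l\<close> carrying \<open>x\<close> and \<open>y\<close>. This is the third term of an IHX relation on a
  caterpillar, and also a caterpillar over the fused graph of an STU relation.\<close>

definition zcat :: "graph \<Rightarrow> nat \<Rightarrow> link \<Rightarrow> link list \<Rightarrow> half_edge list \<Rightarrow> half_edge \<Rightarrow> half_edge \<Rightarrow> graph" where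
  "zcat G r l N v x y = G\<lparr>vat := override (vat G) (map fst N @ v @ [x, y])
       (sources r N @ (map snd N @ [last_vert r N]) @ [snd l, snd l]),
     externals := externals G - snd ` set (l # N), solids := solids G - set (link_edges (l # N))\<rparr>"

section \<open>Caterpillars with a fork, and their signs\<close>

lemma zcat_simps [simp]:
  "verts (zcat G r l N v x y) = verts G" "edges (zcat G r l N v x y) = edges G"
  "half_edges (zcat G r l N v x y) = half_edges G"
  "externals (zcat G r l N v x y) = externals G - snd ` set (l # N)"
  "solids (zcat G r l N v x y) = solids G - set (link_edges (l # N))"
  by (simp_all add: zcat_def)

lemma zcat_cong:
  assumes "G' = G\<lparr>vat := vat G'\<rparr>" "\<And>h. h \<notin> set v \<Longrightarrow> h \<noteq> x \<Longrightarrow> h \<noteq> y \<Longrightarrow> vat G' h = vat G h"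
    "length v = Suc (length N)"
  shows "zcat G' r l N v x y = zcat G r l N v x y"
proof -
  have "override (vat G') (map fst N @ v @ [x, y]) (sources r N @ (map snd N @ [last_vert r N]) @ [snd l, snd l])
     = override (vat G) (map fst N @ v @ [x, y]) (sources r N @ (map snd N @ [last_vert r N]) @ [snd l, snd l])"
    using assms(2,3) by (intro override_cong) auto
  then show ?thesis using assms(1) by (cases G; cases G') (simp add: zcat_def)
qed

lemma distinct_link_halves: "distinct (link_edges L) \<Longrightarrow> distinct (map fst L)"
  by (metis distinct_map map_map)

text \<open>The spare link \<open>l\<close> carries the fork with \<open>x\<close> and
  \<open>y\<close>; its half-edge \<open>fst l\<close> is inserted between \<open>A\<close> and
  \<open>B\<close> as a leg of the caterpillar over the other links.\<close>

locale zsite =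
  fixes G r L l M xs A B x y
  assumes G: "ok G" and line: "line G r (L @ l # M) xs"
    and AB: "distinct (A @ B)" "x \<notin> set (A @ B)" "y \<notin> set (A @ B)" "x \<noteq> y"
    and xs: "set xs = insert x (insert y (set (A @ B)))"
begin

abbreviation "Z \<equiv> zcat G r l (L @ M) (A @ fst l # B) x y"

lemma length_AB: "length A + length B = length L + length M"
proof -
  have "length xs = card (set xs)" using line_distinct_legs[OF line] by (simp add: distinct_card)
  also have "\<dots> = Suc (Suc (length (A @ B)))"
    unfolding xs using AB distinct_card[OF AB(1)] by simp
  finally show ?thesis using line_legs_length[OF line] by simp
qed

lemma link_not_leg: "l' \<in> set (L @ l # M) \<Longrightarrow> fst l' \<notin> set xs"
  "l' \<in> set (L @ l # M) \<Longrightarrow> opp (fst l') \<notin> set xs"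
  using in_line_half_edges(3,4)[OF G line] opp_simps(2) by metis+

lemma leg_in: "x \<in> set xs" "y \<in> set xs" "z \<in> set A \<Longrightarrow> z \<in> set xs" "z \<in> set B \<Longrightarrow> z \<in> set xs"
  using xs by auto

lemma link_ne: "l' \<in> set (L @ M) \<Longrightarrow> fst (fst l') \<noteq> fst (fst l)"
  using line_link(4)[OF line] link_edge_in by metis

lemma distinct_keys: "distinct (map fst (L @ M) @ (A @ fst l # B) @ [x, y])"
proof -
  have "distinct (link_edges (L @ M))" using lineD(2)[OF line] by simp
  then have 1: "distinct (map fst (L @ M))" by (rule distinct_link_halves)
  have l: "fst l \<notin> set xs" using link_not_leg(1)[of l] by simp
  have 2: "distinct ((A @ fst l # B) @ [x, y])"
    using AB l xs by auto
  have "set (map fst (L @ M)) \<inter> set ((A @ fst l # B) @ [x, y]) = {}"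
  proof (rule ccontr)
    assume "set (map fst (L @ M)) \<inter> set ((A @ fst l # B) @ [x, y]) \<noteq> {}"
    then obtain z where z: "z \<in> set (map fst (L @ M))" "z \<in> set ((A @ fst l # B) @ [x, y])" by blast
    then obtain l' where l': "l' \<in> set (L @ M)" "z = fst l'" by auto
    then have "z \<notin> set xs" using link_not_leg(1)[of l'] by auto
    then have "z = fst l" using z(2) xs by auto
    then show False using link_ne[OF l'(1)] l'(2) by simp
  qed
  then show ?thesis using 1 2 by (simp only: distinct_append)
qed

lemma length_keys:
  "length (map fst (L @ M) @ (A @ fst l # B) @ [x, y])
   = length (sources r (L @ M) @ (map snd (L @ M) @ [last_vert r (L @ M)]) @ [snd l, snd l])"
  using length_AB by simp

lemma zcat_eqI:
  assumes "G' = G\<lparr>vat := vat G', externals := externals G - snd ` set (L @ l # M),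
      solids := solids G - set (link_edges (L @ l # M))\<rparr>"
    "map (vat G') (map fst (L @ M)) = sources r (L @ M)"
    "map (vat G') (A @ fst l # B) = map snd (L @ M) @ [last_vert r (L @ M)]"
    "vat G' x = snd l" "vat G' y = snd l"
    "\<And>h. h \<notin> set (map fst (L @ M)) \<Longrightarrow> h \<notin> set (A @ fst l # B) \<Longrightarrow> h \<noteq> x \<Longrightarrow> h \<noteq> y \<Longrightarrow> vat G' h = vat G h"
  shows "Z = G'"
proof -
  have "map (vat G') (map fst (L @ M) @ (A @ fst l # B) @ [x, y])
      = sources r (L @ M) @ (map snd (L @ M) @ [last_vert r (L @ M)]) @ [snd l, snd l]"
    unfolding map_append[of "vat G'" "map fst (L @ M)"] map_append[of "vat G'" "A @ fst l # B"] assms(2,3)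
    using assms(4,5) by simp
  then have "override (vat G) (map fst (L @ M) @ (A @ fst l # B) @ [x, y])
      (sources r (L @ M) @ (map snd (L @ M) @ [last_vert r (L @ M)]) @ [snd l, snd l]) = vat G'"
    using assms(6) by (intro override_eqI[OF distinct_keys length_keys]) auto
  moreover have "snd ` set (l # (L @ M)) = snd ` set (L @ l # M)"
     "set (link_edges (l # (L @ M))) = set (link_edges (L @ l # M))" by auto
  ultimately have "Z = G\<lparr>vat := vat G', externals := externals G - snd ` set (L @ l # M),
      solids := solids G - set (link_edges (L @ l # M))\<rparr>"
    by (simp only: zcat_def)
  then show ?thesis using assms(1) by simp
qed

lemma solids_Z: "solids Z = solids G - set (link_edges (L @ l # M))"
  "externals Z = externals G - snd ` set (L @ l # M)"
  by auto

lemma card_solids_Z: "card (solids Z) = card (solids G) - Suc (length (L @ M))"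
  using card_solids_cat[OF G line, of undefined] unfolding solids_Z cat_simps by simp

end

text \<open>Collapsing the fused line leaves \<open>w\<close> as a fork that hangs from the leg
  \<open>a\<close>. So the caterpillars of \<open>S\<close> have the same form as the third terms of
  IHX relations between caterpillars of \<open>T\<close>.\<close>

lemma (in fused) cat_fuse_eq_zcat:
  assumes "distinct (A @ B)" "set (A @ B) = set (X @ Y)"
  shows "cat S r (L @ M) (A @ a # B) = zcat G r (a, w) (L @ M) (A @ a # B) x y"
proof -
  interpret z: zsite G r L "(a, w)" M "X @ x # y # Y" A B x y
    using G l assms halves by unfold_locales auto
  have perm: "A @ a # B \<in> permutations_of_set (set (X @ a # Y))"
    using assms halves by (auto simp: permutations_of_set_def)
  note p = permutation_of_legs[OF line_S perm]
  let ?g = "vat (cat S r (L @ M) (A @ a # B))"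
  have nx: "x \<notin> set (A @ a # B)" "y \<notin> set (A @ a # B)" using halves assms(2) by auto
  have links: "?g (fst l') = vat S (fst l')" if "l' \<in> set (L @ M)" for l'
  proof -
    have "fst l' \<notin> set (X @ x # y # Y)" "fst l' \<noteq> a"
      using that z.link_not_leg(1)[of l'] z.link_ne[of l'] by auto
    then have "fst l' \<notin> set (A @ a # B)" using assms(2) by auto
    then show ?thesis by (rule vat_cat_notin)
  qed
  have "zcat G r (a, w) (L @ M) (A @ fst (a, w) # B) x y = cat S r (L @ M) (A @ a # B)"
  proof (rule z.zcat_eqI)
    have "externals G - snd ` set (L @ (a, w) # M) = externals S - snd ` set (L @ M)"
      "solids G - set (link_edges (L @ (a, w) # M)) = solids S - set (link_edges (L @ M))" by auto
    then show "cat S r (L @ M) (A @ a # B) = G\<lparr>vat := ?g, externals := externals G - snd ` set (L @ (a, w) # M),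
        solids := solids G - set (link_edges (L @ (a, w) # M))\<rparr>"
      by (simp add: cat_def fuse_def)
    have "map ?g (map fst (L @ M)) = map (vat S \<circ> fst) (L @ M)"
      unfolding map_map using links by (intro map_cong) auto
    then show "map ?g (map fst (L @ M)) = sources r (L @ M)"
      unfolding lineD(5)[OF line_S] .
    show "map ?g (A @ fst (a, w) # B) = map snd (L @ M) @ [last_vert r (L @ M)]"
      using vat_cat_legs[OF p(1,2)] by simp
    show "?g x = snd (a, w)" "?g y = snd (a, w)"
      using vat_cat_notin[OF nx(1)] vat_cat_notin[OF nx(2)] vat_S_spec by simp_all
    fix h assume h: "h \<notin> set (map fst (L @ M))" "h \<notin> set (A @ fst (a, w) # B)" "h \<noteq> x" "h \<noteq> y"
    have "h \<noteq> fst (hd M)" if "M \<noteq> []" using h(1) that by (metis in_set_conv_decomp_first append_Cons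
          append_Nil image_eqI list.exhaust_sel list.set_intros(1) list.set_map set_append UnI2)
    then have "vat S h = vat G h" using h(3) by (intro vat_S_other) auto
    then show "?g h = vat G h" using vat_cat_notin h(2) by simp
  qed
  then show ?thesis by simp
qed

text \<open>Reordering the legs puts \<open>x\<close> and \<open>y\<close> at the two ends of
  \<open>l\<close>; then the graph is a caterpillar over a fused graph.\<close>

lemma (in zsite) ok_Z: "ok Z"
proof -
  define X where "X = take (length L) (A @ B)"
  define Y where "Y = drop (length L) (A @ B)"
  have XY: "X @ Y = A @ B" unfolding X_def Y_def by (rule append_take_drop_id)
  have len: "length X = length L" using length_AB by (simp add: X_def)
  have s: "set (X @ Y) = set (A @ B)" "distinct (X @ Y)" unfolding XY using AB by simp_all
  have "X @ x # y # Y \<in> permutations_of_set (set xs)"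
    using s AB xs by (auto simp: permutations_of_set_def)
  then obtain G' where G': "ok G'" "line G' r (L @ l # M) (X @ x # y # Y)" "G' = G\<lparr>vat := vat G'\<rparr>"
    "\<And>h. h \<notin> set xs \<Longrightarrow> vat G' h = vat G h"
    using permute_legs[OF G line] by blast
  interpret f: fused G' r L "fst l" "snd l" M X x y Y
    using G' len by unfold_locales simp_all
  have eq: "cat f.S r (L @ M) (A @ fst l # B) = zcat G' r (fst l, snd l) (L @ M) (A @ fst l # B) x y"
    using AB s by (intro f.cat_fuse_eq_zcat) auto
  have "A @ fst l # B \<in> permutations_of_set (set (X @ fst l # Y))"
    using s f.halves(12) AB by (auto simp: permutations_of_set_def)
  then have "ok (cat f.S r (L @ M) (A @ fst l # B))" by (rule ok_cat[OF f.ok_S f.line_S])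
  moreover have "zcat G' r l (L @ M) (A @ fst l # B) x y = Z"
    using G'(3,4) xs length_AB by (intro zcat_cong) auto
  ultimately show ?thesis using eq by simp
qed

text \<open>Two neighbouring links trade roles: one belongs to the body of the caterpillar, the
  other carries the fork. The shape of the graph is the same, so exchanging the two vertices and the
  two edges is an isomorphism.\<close>

lemma zcat_swap_links:
  assumes "zsite G r L l (l' # M) xs A B x y"
  shows "graph_iso (zcat G r l (L @ l' # M) (A @ fst l # B) x y)
     (zcat G r l' (L @ l # M) (A @ fst l' # B) x y)
     (transpose (snd l) (snd l')) (swap_edges (fst l) (fst l'))"
proof -
  interpret z: zsite G r L l "l' # M" xs A B x y by (rule assms)
  let ?f = "transpose (snd l) (snd l')" and ?h = "swap_edges (fst l) (fst l')"
  have ll': "L @ l # l' # M = (L @ [l]) @ l' # M" by simp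
  note k = line_link[OF z.line]
  note k' = line_link[OF z.line[unfolded ll']]
  have ne: "fst (fst l) \<noteq> fst (fst l')" using z.link_ne[of l'] by auto
  have hfix: "?h z = z" if "fst z \<noteq> fst (fst l)" "fst z \<noteq> fst (fst l')" for z
    using that by (rule swap_edges_simps(3))
  have hlink: "?h (fst m) = fst m" if "m \<in> set (L @ M)" for m
  proof (rule hfix)
    show "fst (fst m) \<noteq> fst (fst l)" using that z.link_ne[of m] by auto
    have "fst (fst l') \<notin> set (link_edges ((L @ [l]) @ M))" by (rule k'(4))
    moreover have "fst (fst m) \<in> set (link_edges ((L @ [l]) @ M))"
      using that by (intro link_edge_in) auto
    ultimately show "fst (fst m) \<noteq> fst (fst l')" by metis
  qed
  have hleg: "?h z = z" if "z \<in> set xs" for z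
    using in_line_half_edges(5)[OF z.G z.line _ that] by (intro hfix) auto
  have ffix: "?f u = u" if "u \<in> set (line_verts r (L @ M))" for u
  proof -
    have "u \<noteq> snd l" "u \<noteq> snd l'" using that k(5) k'(5) by auto
    then show ?thesis by simp
  qed
  have ff: "?f (snd m) = snd m" if "m \<in> set (L @ M)" for m
  proof (rule ffix)
    have "snd m \<in> snd ` set (L @ M)" using that by (rule imageI)
    then show "snd m \<in> set (line_verts r (L @ M))" by (simp only: set_simps list.set_map insert_iff simp_thms)
  qed
  have "map_prod id ?f m = m" if "m \<in> set (L @ M)" for m
    using ff[OF that] by (cases m) simp
  then have idL: "map (map_prod id ?f) L = L" "map (map_prod id ?f) M = M"
    by (auto intro!: map_idI simp del: transpose_apply_other)
  have ks: "map ?h (map fst (L @ l' # M) @ (A @ fst l # B) @ [x, y])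
      = map fst (L @ l # M) @ (A @ fst l' # B) @ [x, y]"
  proof -
    have "map ?h (map fst L) = map fst L" "map ?h (map fst M) = map fst M"
      using hlink by (auto simp: map_idI)
    moreover have "map ?h A = A" "map ?h B = B" "?h x = x" "?h y = y"
      using hleg z.leg_in by (auto intro!: map_idI)
    ultimately show ?thesis using swap_edges_simps(1,2)[of "fst l" "fst l'"] by simp
  qed
  have us: "map ?f (sources r (L @ l' # M) @ (map snd (L @ l' # M) @ [last_vert r (L @ l' # M)]) @ [snd l, snd l])
      = sources r (L @ l # M) @ (map snd (L @ l # M) @ [last_vert r (L @ l # M)]) @ [snd l', snd l']"
  proof -
    have r: "?f r = r" by (rule ffix) simp
    have "map ?f (sources r L) = sources r L"
      using map_sources[of ?f r L id] unfolding idL r .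
    moreover have "?f (last_vert r L) = last_vert r L" by (rule ffix) (rule last_vert_in_line_verts)
    moreover have "map ?f (sources (snd l') M) = sources (snd l) M"
      using map_sources[of ?f "snd l'" M id] unfolding idL by simp
    moreover have "?f (last_vert (snd l') M) = last_vert (snd l) M"
      using map_last_vert[of ?f "snd l'" id M] unfolding idL by simp
    moreover have "map ?f (map snd L) = map snd L" "map ?f (map snd M) = map snd M"
      unfolding map_map using ff by (intro map_cong[OF refl]; simp)+
    ultimately show ?thesis by simp
  qed
  have inj: "inj ?h" by (rule inj_on_inverseI[where g = ?h]) simp
  let ?Z = "zcat G r l (L @ l' # M) (A @ fst l # B) x y"
  let ?Z' = "zcat G r l' (L @ l # M) (A @ fst l' # B) x y"
  have vat: "vat ?Z' (?h z) = ?f (vat ?Z z)" if z: "z \<in> half_edges G" for z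
  proof -
    \<comment> \<open>Among the half-edges that are not reattached, only \<open>opp (fst l)\<close>
      and \<open>opp (fst l')\<close> end in one of the exchanged vertices, and these two are
      exchanged as well.\<close>
    have off: "vat G (?h z) = ?f (vat G z)" if zk: "z \<notin> set (map fst (L @ l' # M) @ (A @ fst l # B) @ [x, y])"
    proof -
      have keys: "z \<notin> set xs" "z \<noteq> fst l" "z \<noteq> fst l'" using zk z.xs by auto
      consider "z = opp (fst l)" | "z = opp (fst l')" | "z \<noteq> opp (fst l)" "z \<noteq> opp (fst l')" by blast
      then show ?thesis
      proof cases
        case 1
        then show ?thesis using swap_edges_simps(4)[OF ne] k(2) k'(2) by simp
      next
        case 2
        then show ?thesis using swap_edges_simps(5)[OF ne] k(2) k'(2) by simp
      next
        case 3
        then have hz: "?h z = z" using keys by (intro hfix) (auto simp: same_edge_iff)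
        have "vat G z \<noteq> snd l \<and> vat G z \<noteq> snd l'"
        proof (cases "fst z \<in> solids G")
          case True
          have l1: "line G r ((L @ [l]) @ l' # M) xs" "line G r ((L @ [l, l']) @ M) xs"
            using z.line by simp_all
          have "vat G z \<noteq> snd l"
            using line_solid_at[OF l1(1) z True] 3 keys by auto
          moreover have "z \<noteq> fst (hd M)" if "M \<noteq> []" using zk that by (cases M) auto
          then have "vat G z \<noteq> snd l'"
            using line_solid_at[OF l1(2) z True] 3 by auto
          ultimately show ?thesis by simp
        next
          case False
          then have "fst z \<in> dashed G" using z by (simp add: dashed_def in_half_edges)
          then show ?thesis using leg_unique[OF z.G z.line z] keys(1) by auto
        qed
        then show ?thesis using hz by simp
      qed
    qed
    have "length (map fst (L @ l' # M) @ (A @ fst l # B) @ [x, y])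
      = length (sources r (L @ l' # M) @ (map snd (L @ l' # M) @ [last_vert r (L @ l' # M)]) @ [snd l, snd l])"
      by (rule z.length_keys)
    from override_natural[OF inj this, where f = ?f and g = "vat G" and e = "vat G" and x = z, OF off]
    show ?thesis unfolding ks us by (simp add: zcat_def)
  qed
  show ?thesis
  proof (rule graph_iso_involution)
    have "snd l \<in> verts G" "snd l' \<in> verts G"
      using lineD(3)[OF z.line] okD(4)[OF z.G] by auto
    then show "?f v \<in> verts ?Z" if "v \<in> verts ?Z" for v using that by (simp add: transpose_in)
    show "?h (opp z) = opp (?h z)" for z by (rule swap_edges_opp[OF ne])
    have e: "fst (fst l) \<in> edges G" "fst (fst l') \<in> edges G"
      using in_line_half_edges(1)[OF z.G z.line] by (auto simp: in_half_edges)
    then show "?h z \<in> half_edges ?Z" if "z \<in> half_edges ?Z" for z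
      using that by (simp add: in_half_edges fst_swap_edges[OF ne] transpose_in)
    have E: "externals ?Z' = externals ?Z" "solids ?Z' = solids ?Z" by auto
    have "?f u = u" if "u \<in> externals ?Z" for u
      using that by (auto simp: transpose_def)
    then show "?f ` externals ?Z = externals ?Z'" unfolding E by (simp add: image_def)
    show "vat ?Z' (?h z) = ?f (vat ?Z z)" if "z \<in> half_edges ?Z" for z using vat that by simp
    show "fst (?h z) \<in> solids ?Z' \<longleftrightarrow> fst z \<in> solids ?Z" for z
      unfolding E fst_swap_edges[OF ne] by (auto simp: transpose_def)
  qed simp_all
qed

lemma (in weight) zcat_swap_sign:
  assumes "zsite G r L l (l' # M) xs A B x y" and c: "is_coloring par G c"
    and n: "card (solids G) \<le> n + length (L @ l # l' # M)"
  shows "W (zcat G r l' (L @ l # M) (A @ fst l' # B) x y, c) = - W (zcat G r l (L @ l' # M) (A @ fst l # B) x y, c)"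
proof -
  interpret z: zsite G r L l "l' # M" xs A B x y by (rule assms)
  interpret z': zsite G r "L @ [l]" l' M xs A B x y
    using z.line z.G z.AB z.xs by unfold_locales simp_all
  let ?Z = "zcat G r l (L @ l' # M) (A @ fst l # B) x y"
  let ?Z' = "zcat G r l' (L @ l # M) (A @ fst l' # B) x y"
  have "change_sign ?Z (transpose (snd l) (snd l')) (swap_edges (fst l) (fst l')) c c = -1"
  proof (rule change_sign_swap)
    show "is_coloring par ?Z c" using c is_coloring_cong[of ?Z G] by simp
    show "snd l \<in> verts ?Z" "snd l' \<in> verts ?Z"
      using lineD(3)[OF z.line] okD(4)[OF z.G] by auto
    show "snd l \<noteq> snd l'" using line_link(5)[OF z.line] by auto
    show "fst l \<in> half_edges ?Z" "fst l' \<in> half_edges ?Z"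
      using in_line_half_edges(1)[OF z.G z.line] by auto
    show "fst (fst l) \<noteq> fst (fst l')" using z.link_ne[of l'] by auto
  qed
  moreover have "is_coloring par ?Z c" "is_coloring par ?Z' c"
    using c is_coloring_cong[of ?Z G] is_coloring_cong[of ?Z' G] by simp_all
  moreover have "ok ?Z" "ok ?Z'" using z.ok_Z z'.ok_Z by simp_all
  moreover have "card (solids ?Z) \<le> n" using z.card_solids_Z n by simp
  ultimately show ?thesis
    using equivariant[OF _ _ _ _ _ zcat_swap_links[OF assms(1)], of c c] by simp
qed

text \<open>The spare link moves from position \<open>q\<close> to position \<open>q'\<close>
  through exchanges of neighbouring links, each of sign \<open>-1\<close>. This is where the sign in
  the hypotheses of \<open>euler_swap\<close> comes from.\<close>

lemma (in weight) zcat_sign: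
  assumes G: "ok G" "line G r K xs" and AB: "distinct (A @ B)" "x \<notin> set (A @ B)" "y \<notin> set (A @ B)" "x \<noteq> y"
      "set xs = insert x (insert y (set (A @ B)))"
    and c: "is_coloring par G c" and n: "card (solids G) \<le> n + length K"
    and q: "q \<le> q'" "q' < length K"
  shows "W (zcat G r (K ! q') (take q' K @ drop (Suc q') K) (A @ fst (K ! q') # B) x y, c)
     = (-1) ^ (q' - q) * W (zcat G r (K ! q) (take q K @ drop (Suc q) K) (A @ fst (K ! q) # B) x y, c)"
  using q
proof (induction q' rule: dec_induct)
  case (step p)
  have K: "K = take p K @ K ! p # K ! Suc p # drop (Suc (Suc p)) K"
    using step.prems by (metis Cons_nth_drop_Suc Suc_lessD append_take_drop_id)
  interpret zsite G r "take p K" "K ! p" "K ! Suc p # drop (Suc (Suc p)) K" xs A B x y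
    using G AB K by unfold_locales simp_all
  have "W (zcat G r (K ! Suc p) (take p K @ K ! p # drop (Suc (Suc p)) K) (A @ fst (K ! Suc p) # B) x y, c)
      = - W (zcat G r (K ! p) (take p K @ K ! Suc p # drop (Suc (Suc p)) K) (A @ fst (K ! p) # B) x y, c)"
    by (rule zcat_swap_sign[OF zsite_axioms c]) (use n K in simp)
  moreover have "take (Suc p) K @ drop (Suc (Suc p)) K = take p K @ K ! p # drop (Suc (Suc p)) K"
    using step.prems by (simp add: take_Suc_conv_app_nth)
  moreover have "K ! Suc p # drop (Suc (Suc p)) K = drop (Suc p) K"
    using step.prems by (simp add: Cons_nth_drop_Suc)
  ultimately show ?case using step by (simp add: Suc_diff_le)
qed simp

lemma (in weight) zcat_sign':
  assumes G: "ok G" "line G r K xs" and AB: "distinct (A @ B)" "x \<notin> set (A @ B)" "y \<notin> set (A @ B)" "x \<noteq> y"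
      "set xs = insert x (insert y (set (A @ B)))"
    and c: "is_coloring par G c" and n: "card (solids G) \<le> n + length K"
    and q: "q < length K" "q' < length K"
  shows "W (zcat G r (K ! q') (take q' K @ drop (Suc q') K) (A @ fst (K ! q') # B) x y, c)
     = (-1) ^ (q + q') * W (zcat G r (K ! q) (take q K @ drop (Suc q) K) (A @ fst (K ! q) # B) x y, c)"
proof -
  have par: "(-1 :: rat) ^ (i + j) = (-1) ^ (j - i)" if "i \<le> j" for i j :: nat
    using that by (simp add: minus_one_power_iff)
  have sq: "(-1 :: rat) ^ i * ((-1) ^ i * z) = z" for i z
    by (simp add: mult.assoc[symmetric] flip: power_mult_distrib)
  show ?thesis
  proof (cases "q \<le> q'")
    case True
    then show ?thesis using zcat_sign[OF assms(1-9) True q(2)] par[OF True] by simp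
  next
    case False
    then have le: "q' \<le> q" by simp
    show ?thesis unfolding zcat_sign[OF assms(1-9) le q(1)] add.commute[of q] par[OF le] sq ..
  qed
qed

text \<open>The last two legs share a vertex, so their order is invisible, and this vertex is a fork
  carried by the last link. This is the symmetry of the innermost bracket.\<close>

lemma cat_last_eq_zcat:
  assumes "zsite G r L l [] xs A [] x y"
  shows "cat G r (L @ [l]) (A @ [x, y]) = zcat G r l L (A @ [fst l]) x y"
    "cat G r (L @ [l]) (A @ [y, x]) = zcat G r l L (A @ [fst l]) x y"
proof -
  interpret zsite G r L l "[]" xs A "[]" x y by (rule assms)
  have len: "length A = length L" using length_AB by simp
  have eq: "zcat G r l (L @ []) (A @ fst l # []) x y = cat G r (L @ [l]) (A @ [x', y'])"
    if xy: "(x', y') = (x, y) \<or> (x', y') = (y, x)" for x' y'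
  proof (rule zcat_eqI)
    let ?g = "vat (cat G r (L @ [l]) (A @ [x', y']))"
    have sub: "set (A @ [x', y']) = set xs" using xy xs by auto
    have d: "distinct (A @ [x', y'])" using xy AB by auto
    have "map ?g (A @ [x', y']) = map snd (L @ [l]) @ [last_vert r (L @ [l])]"
      by (rule vat_cat_legs[OF d]) (simp add: len)
    then have g: "map ?g A = map snd L" "?g x' = snd l" "?g y' = snd l"
      using len by (simp_all add: append_eq_append_conv)
    have links: "?g (fst l') = vat G (fst l')" if "l' \<in> set (L @ [l])" for l'
      by (rule vat_cat_notin) (use sub link_not_leg(1)[OF that] in metis)
    show "cat G r (L @ [l]) (A @ [x', y']) = G\<lparr>vat := ?g, externals := externals G - snd ` set (L @ [l]),
        solids := solids G - set (link_edges (L @ [l]))\<rparr>"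
      by (simp add: cat_def)
    have "map ?g (map fst L) = map (vat G \<circ> fst) L"
      unfolding map_map using links by (intro map_cong) auto
    also have "\<dots> = sources r L" using lineD(5)[OF line] by (simp add: append_eq_append_conv)
    finally show "map ?g (map fst (L @ [])) = sources r (L @ [])" by simp
    have "?g (fst l) = last_vert r L" using links[of l] line_link(1)[OF line] by simp
    then show "map ?g (A @ [fst l]) = map snd (L @ []) @ [last_vert r (L @ [])]" using g by simp
    show "?g x = snd l" "?g y = snd l" using g xy by auto
    fix h assume "h \<notin> set (map fst (L @ []))" "h \<notin> set (A @ [fst l])" "h \<noteq> x" "h \<noteq> y"
    then have "h \<notin> set (A @ [x', y'])" using xy by auto
    then show "?g h = vat G h" by (rule vat_cat_notin)
  qed
  show "cat G r (L @ [l]) (A @ [x, y]) = zcat G r l L (A @ [fst l]) x y"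
    "cat G r (L @ [l]) (A @ [y, x]) = zcat G r l L (A @ [fst l]) x y"
    using eq[of x y] eq[of y x] by simp_all
qed

text \<open>The IHX relation at the edge of \<open>l2\<close>, whose ends carry the neighbouring
  legs \<open>x\<close> and \<open>y\<close>. In the third term both legs end in
  \<open>snd l2\<close>, so \<open>l2\<close> has become the spare link and the rest of the
  caterpillar continues from \<open>snd l1\<close>.\<close>

lemma (in weight) cat_ihx:
  assumes "zsite G r (L @ [l1]) l2 M xs A B x y" and len: "length A = length L"
    and c: "is_coloring par G c" and n: "card (solids G) \<le> n + length (L @ l1 # l2 # M)"
  shows "W (cat G r (L @ l1 # l2 # M) (A @ x # y # B), c) + W (cat G r (L @ l1 # l2 # M) (A @ y # x # B), c)
     + W (zcat G r l2 (L @ l1 # M) (A @ fst l2 # B) x y, c) = 0"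
proof -
  interpret z: zsite G r "L @ [l1]" l2 M xs A B x y by (rule assms(1))
  let ?K = "L @ l1 # l2 # M"
  have line: "line G r ?K xs" using z.line by simp
  have lenB: "length B = Suc (length M)" using z.length_AB len by simp
  note k1 = line_link[OF line]
  note k2 = line_link[OF z.line]
  define H where "H = cat G r ?K (A @ x # y # B)"
  have perm: "A @ x # y # B \<in> permutations_of_set (set xs)"
    using z.AB z.xs by (auto simp: permutations_of_set_def)
  note p = permutation_of_legs[OF line perm]
  have okH: "ok H" unfolding H_def by (rule ok_cat[OF z.G line perm])
  have "map (vat H) (A @ x # y # B) = map snd ?K @ [last_vert r ?K]"
    unfolding H_def by (rule vat_cat_legs[OF p(1,2)])
  then have g: "map (vat H) A = map snd L" "vat H x = snd l1" "vat H y = snd l2"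
      "map (vat H) B = map snd M @ [last_vert (snd l2) M]"
    using len by (simp_all add: append_eq_append_conv)
  have offH: "vat H h = vat G h" if "h \<notin> set xs" for h
    unfolding H_def using that p(3) by (intro vat_cat_notin) auto
  have links: "vat H (fst l') = vat G (fst l')" "vat H (opp (fst l')) = vat G (opp (fst l'))"
    if "l' \<in> set ?K" for l'
    using z.link_not_leg[of l'] that by (auto intro!: offH)
  have ne12: "snd l1 \<noteq> snd l2" using k1(5) by auto
  have fne: "fst (fst l2) \<noteq> fst (fst l1)" using z.link_ne[of l1] by auto
  \<comment> \<open>The third half-edge at \<open>snd l2\<close>: the start of the next link, or the
    last leg if the caterpillar ends there.\<close>
  define t where "t = (if M = [] then hd B else fst (hd M))"
  have t: "vat H t = snd l2" "t \<in> half_edges G" "t \<noteq> y" "t \<noteq> opp (fst l2)" "t \<noteq> x" "t \<noteq> fst l2"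
  proof -
    have "t \<in> half_edges G \<and> vat H t = snd l2 \<and> t \<noteq> y \<and> t \<noteq> x \<and> t \<noteq> opp (fst l2) \<and> t \<noteq> fst l2"
    proof (cases "M = []")
      case True
      then obtain b where B: "B = [b]" using lenB by (auto simp: length_Suc_conv)
      then have tb: "t = b" using True by (simp add: t_def)
      have "b \<in> set xs" using z.xs B by auto
      then have "b \<in> half_edges G" "b \<noteq> opp (fst l2)" "b \<noteq> fst l2"
        using in_line_half_edges(2)[OF z.G line] z.link_not_leg[of l2] by auto
      moreover have "vat H b = snd l2" using g(4) B True by simp
      moreover have "b \<noteq> y" "b \<noteq> x" using z.AB B by auto
      ultimately show ?thesis using tb by simp
    next
      case False
      then have m: "hd M \<in> set ?K" "hd M \<in> set ((L @ [l1]) @ M)" by simp_all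
      have K: "?K = (L @ [l1, l2]) @ hd M # tl M" using False by simp
      have "vat G (fst (hd M)) = snd l2" using line_link(1)[OF line[unfolded K]] by simp
      moreover have "fst (hd M) \<notin> set xs" using z.link_not_leg(1)[of "hd M"] False by simp
      moreover have "fst (fst (hd M)) \<noteq> fst (fst l2)" using z.link_ne[OF m(2)] .
      moreover have "t = fst (hd M)" using False by (simp add: t_def)
      moreover have "x \<in> set xs" "y \<in> set xs" by (rule z.leg_in)+
      ultimately have "vat H t = snd l2" "t \<noteq> y" "t \<noteq> x" "fst t \<noteq> fst (fst l2)" "t \<in> half_edges G"
        using links(1)[OF m(1)] in_line_half_edges(1)[OF z.G line m(1)] by metis+
      then show ?thesis by auto
    qed
    then show "vat H t = snd l2" "t \<in> half_edges G" "t \<noteq> y" "t \<noteq> opp (fst l2)" "t \<noteq> x" "t \<noteq> fst l2"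
      by simp_all
  qed
  have HE: "half_edges H = half_edges G" "verts H = verts G" "edges H = edges G" by (simp_all add: H_def)
  have l2K: "l1 \<in> set ?K" "l2 \<in> set ?K" by simp_all
  have leg: "x \<in> set xs" "y \<in> set xs" using z.leg_in by simp_all
  have half: "fst l1 \<in> half_edges G" "fst l2 \<in> half_edges G" "x \<in> half_edges G" "y \<in> half_edges G"
    using in_line_half_edges(1)[OF z.G line l2K(1)] in_line_half_edges(1)[OF z.G line l2K(2)]
      in_line_half_edges(2)[OF z.G line] leg by auto
  have vH: "vat H (fst l2) = snd l1" "vat H (opp (fst l2)) = snd l2" "vat H (opp (fst l1)) = snd l1"
    using links[OF l2K(1)] links[OF l2K(2)] k1(2) k2(1,2) by simp_all
  have int: "snd l1 \<in> verts H" "snd l2 \<in> verts H" "snd l1 \<notin> externals H" "snd l2 \<notin> externals H"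
    using lineD(3)[OF line] okD(4)[OF z.G] by (auto simp: H_def)
  have nl: "fst l2 \<noteq> x" "fst l2 \<noteq> y" "opp (fst l2) \<noteq> x" "opp (fst l2) \<noteq> y" "opp (fst l1) \<noteq> x"
    using z.link_not_leg[of l2] z.link_not_leg[of l1] leg by auto
  have nb: "fst l2 \<noteq> opp (fst l1)" using fne by auto
  have site: "ihx_site H (fst l2) (snd l1) (snd l2) (opp (fst l1)) x y t"
  proof
    show "ok H" by (rule okH)
    show "fst l2 \<in> half_edges H" "vat H (fst l2) = snd l1" "vat H (opp (fst l2)) = snd l2" "snd l1 \<noteq> snd l2"
      using half vH ne12 HE by simp_all
    show "snd l1 \<notin> externals H" "snd l2 \<notin> externals H" using int by simp_all
    show "halves_at H (snd l1) = {fst l2, opp (fst l1), x}"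
      using internal_halves_at[OF okH int(1,3), of "fst l2" "opp (fst l1)" x] half vH g nl nb HE by simp
    show "fst l2 \<noteq> opp (fst l1)" "fst l2 \<noteq> x" "opp (fst l1) \<noteq> x" using nb nl by simp_all
    show "halves_at H (snd l2) = {opp (fst l2), y, t}"
      using internal_halves_at[OF okH int(2,4), of "opp (fst l2)" y t] half vH g nl t HE by simp
    show "opp (fst l2) \<noteq> y" "opp (fst l2) \<noteq> t" "y \<noteq> t" using nl t by simp_all
  qed
  have "cat G r ?K (A @ y # x # B) = H\<lparr>vat := (vat H)(x := snd l2, y := snd l1)\<rparr>"
  proof -
    let ?g = "(vat H)(x := snd l2, y := snd l1)"
    have "override (vat G) (A @ y # x # B) (map snd ?K @ [last_vert r ?K]) = ?g"
    proof (rule override_eqI)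
      show "distinct (A @ y # x # B)" using z.AB by auto
      show "length (A @ y # x # B) = length (map snd ?K @ [last_vert r ?K])" using len lenB by simp
      have "map ?g A = map (vat H) A" "map ?g B = map (vat H) B"
        using z.AB by (auto intro!: map_cong)
      then show "map ?g (A @ y # x # B) = map snd ?K @ [last_vert r ?K]"
        using g z.AB by simp
      fix h assume "h \<notin> set (A @ y # x # B)"
      then show "?g h = vat G h" using offH[of h] z.xs by auto
    qed
    then show ?thesis by (simp add: cat_def H_def)
  qed
  moreover have "zcat G r l2 (L @ l1 # M) (A @ fst l2 # B) x y = H\<lparr>vat := (vat H)(x := snd l2, t := snd l1)\<rparr>"
  proof -
    let ?g = "(vat H)(x := snd l2, t := snd l1)"
    have "zcat G r l2 ((L @ [l1]) @ M) (A @ fst l2 # B) x y = H\<lparr>vat := ?g\<rparr>"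
    proof (rule z.zcat_eqI)
      show "H\<lparr>vat := ?g\<rparr> = G\<lparr>vat := vat (H\<lparr>vat := ?g\<rparr>), externals := externals G - snd ` set ((L @ [l1]) @ l2 # M),
         solids := solids G - set (link_edges ((L @ [l1]) @ l2 # M))\<rparr>"
        by (simp add: H_def cat_def)
      have src: "map (vat G \<circ> fst) L = sources r L" "vat G (fst l1) = last_vert r L"
          "map (vat G \<circ> fst) M = sources (snd l2) M"
        using lineD(5)[OF line] by (simp_all add: append_eq_append_conv)
      have gl: "?g (fst l') = vat G (fst l')" if "l' \<in> set ?K" "t \<noteq> fst l'" for l'
      proof -
        have "fst l' \<noteq> x" using z.link_not_leg(1)[of l'] that(1) leg by auto
        then show ?thesis using links(1)[OF that(1)] that(2) by auto
      qed
      have tL: "t \<noteq> fst l'" if "l' \<in> set (L @ [l1])" for l'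
      proof (cases "M = []")
        case True
        then have "t \<in> set xs" using z.xs lenB by (cases B) (auto simp: t_def)
        then show ?thesis using z.link_not_leg(1)[of l'] that by auto
      next
        case False
        have "?K = (L @ [l1, l2]) @ hd M # tl M" using False by simp
        from line_link(4)[OF line[unfolded this]]
        have "fst (fst (hd M)) \<notin> set (link_edges ((L @ [l1, l2]) @ tl M))" .
        moreover have "fst (fst l') \<in> set (link_edges ((L @ [l1, l2]) @ tl M))"
          using that by (intro link_edge_in) auto
        ultimately have "fst (hd M) \<noteq> fst l'" by metis
        then show ?thesis using False by (simp add: t_def)
      qed
      have "map (?g \<circ> fst) L = map (vat G \<circ> fst) L"
      proof (rule map_cong[OF refl])
        fix l' assume "l' \<in> set L"
        then have "l' \<in> set ?K" "t \<noteq> fst l'" using tL[of l'] by simp_all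
        then show "(?g \<circ> fst) l' = (vat G \<circ> fst) l'" using gl[of l'] by simp
      qed
      moreover have "?g (fst l1) = last_vert r L"
      proof -
        have "l1 \<in> set ?K" "t \<noteq> fst l1" using tL[of l1] by simp_all
        then show ?thesis using gl[of l1] src(2) by simp
      qed
      moreover have "map (?g \<circ> fst) M = sources (snd l1) M"
      proof (cases M)
        case (Cons m M')
        have K: "?K = (L @ [l1, l2]) @ m # M'" using Cons by simp
        have tm: "t = fst m" using Cons by (simp add: t_def)
        have "map (?g \<circ> fst) M' = map (vat G \<circ> fst) M'"
        proof (rule map_cong[OF refl])
          fix l' assume m': "l' \<in> set M'"
          have "fst (fst m) \<notin> set (link_edges ((L @ [l1, l2]) @ M'))" using line_link(4)[OF line[unfolded K]] .
          moreover have "fst (fst l') \<in> set (link_edges ((L @ [l1, l2]) @ M'))"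
            using m' by (intro link_edge_in) auto
          ultimately have "t \<noteq> fst l'" using tm by metis
          then show "(?g \<circ> fst) l' = (vat G \<circ> fst) l'" using gl[of l'] m' Cons by simp
        qed
        also have "\<dots> = sources (snd m) M'" using src(3) Cons by simp
        finally show ?thesis using Cons tm by simp
      qed simp
      ultimately have "map (?g \<circ> fst) ((L @ [l1]) @ M) = sources r ((L @ [l1]) @ M)"
        unfolding src(1) by (simp del: fun_upd_apply)
      then show "map (vat (H\<lparr>vat := ?g\<rparr>)) (map fst ((L @ [l1]) @ M)) = sources r ((L @ [l1]) @ M)"
        by (simp only: map_map graph.select_convs graph.update_convs graph.surjective)
           (simp add: o_def del: fun_upd_apply)
      have tA: "t \<notin> set A"
      proof (cases "M = []")
        case True
        then show ?thesis using z.AB(1) lenB by (cases B) (auto simp: t_def)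
      next
        case False
        then have "t \<notin> set xs" using z.link_not_leg(1)[of "hd M"] by (simp add: t_def)
        then show ?thesis using z.xs by auto
      qed
      have "map ?g A = map (vat H) A" using z.AB tA by (auto intro!: map_cong)
      moreover have "?g (fst l2) = snd l1" using vH nl t by simp
      moreover have "map ?g B = map snd M @ [last_vert (snd l1) M]"
      proof (cases "M = []")
        case True
        then obtain b where "B = [b]" using lenB by (auto simp: length_Suc_conv)
        then show ?thesis using True by (simp add: t_def)
      next
        case False
        then have "t \<notin> set xs" using z.link_not_leg(1)[of "hd M"] by (simp add: t_def)
        then have "map ?g B = map (vat H) B" using z.AB z.xs by (auto intro!: map_cong)
        then show ?thesis using g(4) False by (cases M) simp_all
      qed
      ultimately show "map (vat (H\<lparr>vat := ?g\<rparr>)) (A @ fst l2 # B)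
          = map snd ((L @ [l1]) @ M) @ [last_vert r ((L @ [l1]) @ M)]"
        using g by simp
      show "vat (H\<lparr>vat := ?g\<rparr>) x = snd l2" "vat (H\<lparr>vat := ?g\<rparr>) y = snd l2"
        using t g z.AB by auto
      fix h assume h: "h \<notin> set (map fst ((L @ [l1]) @ M))" "h \<notin> set (A @ fst l2 # B)" "h \<noteq> x" "h \<noteq> y"
      have "h \<noteq> t" using h lenB by (cases M; cases B) (auto simp: t_def)
      then show "vat (H\<lparr>vat := ?g\<rparr>) h = vat G h" using offH[of h] h z.xs by auto
    qed
    then show ?thesis by simp
  qed
  moreover have "W (H, c) + W (H\<lparr>vat := (vat H)(x := snd l2, y := snd l1)\<rparr>, c)
      + W (H\<lparr>vat := (vat H)(x := snd l2, t := snd l1)\<rparr>, c) = 0"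
  proof (rule ihx_move[OF site])
    show "card (solids H) \<le> n" using card_solids_cat[OF z.G line] n by (simp add: H_def)
    show "is_coloring par H c" using c is_coloring_cong[of H G] HE by simp
  qed
  ultimately show ?thesis unfolding H_def by simp
qed

text \<open>An instance of \<open>euler_swap\<close>: \<open>cat_ihx\<close> provides
  \<open>jac\<close> and \<open>cat_last_eq_zcat\<close> provides \<open>br\<close>. The signs
  compare the position of the spare link, which is \<open>length L\<close> in the fused graph and
  depends on \<open>A\<close> in the other terms.\<close>

lemma (in weight) stu_euler:
  assumes f: "fused G r L a w M X x y Y" and c: "is_coloring par G c"
    and n: "card (solids G) \<le> n + length (L @ (a, w) # M)"
    and m: "m \<in> set (X @ x # y # Y)"
  shows "euler (\<lambda>v. W (cat G r (L @ (a, w) # M) v, c)) (X @ x # y # Y) m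
       + euler (\<lambda>v. W (cat G r (L @ (a, w) # M) v, c)) (X @ y # x # Y) m
       = euler (\<lambda>v. W (cat (fuse G (last_vert r L) a w x M) r (L @ M) v, c)) (X @ a # Y)
           (if m \<in> {x, y} then a else m)"
proof -
  interpret fused G r L a w M X x y Y by (rule f)
  let ?K = "L @ (a, w) # M"
  let ?Z = "\<lambda>A B q. W (zcat G r (?K ! q) (take q ?K @ drop (Suc q) ?K) (A @ fst (?K ! q) # B) x y, c)"
  have C': "W (cat S r (L @ M) (A @ a # B), c) = ?Z A B (length L)"
    if "distinct (A @ B)" "set (A @ B) = set (X @ Y)" for A B
    using cat_fuse_eq_zcat[OF that] by simp
  have sgn: "?Z A B q = (-1) ^ (length L + q) * W (cat S r (L @ M) (A @ a # B), c)"
    if AB: "distinct (A @ B)" "set (A @ B) = set (X @ Y)" and q: "q < length ?K" for A B q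
    unfolding C'[OF AB]
    by (rule zcat_sign'[OF G l AB(1) _ _ _ _ c n _ q]) (use AB halves in auto)
  have lenAB: "length (A @ B) = length L + length M" if "distinct (A @ B)" "set (A @ B) = set (X @ Y)" for A B
    using that halves(13) line_legs_length[OF l] distinct_card[of "A @ B"] distinct_card[of "X @ Y"] by simp
  show ?thesis unfolding v_def[symmetric]
  proof (rule euler_swap)
    show "distinct (X @ x # y # Y)" by (rule line_distinct_legs[OF l])
    show "a \<notin> set (X @ Y)" using halves by simp
    show "m \<in> set (X @ x # y # Y)" by (rule m)
  next
    fix A B assume AB: "distinct (A @ B)" "set (A @ B) = set (X @ Y)" "B \<noteq> []"
    let ?q = "length A"
    have q: "Suc ?q < length ?K" using lenAB[OF AB(1,2)] AB(3) by (cases B) auto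
    have K: "?K = take ?q ?K @ ?K ! ?q # ?K ! Suc ?q # drop (Suc (Suc ?q)) ?K"
      using q by (metis Cons_nth_drop_Suc Suc_lessD append_take_drop_id)
    have "zsite G r (take ?q ?K @ [?K ! ?q]) (?K ! Suc ?q) (drop (Suc (Suc ?q)) ?K) (X @ x # y # Y) A B x y"
    proof (rule zsite.intro[OF G _ AB(1)])
      show "line G r ((take ?q ?K @ [?K ! ?q]) @ ?K ! Suc ?q # drop (Suc (Suc ?q)) ?K) (X @ x # y # Y)"
        using l K by (simp only: append_assoc append_Cons append_Nil)
    qed (use AB halves in auto)
    from cat_ihx[OF this _ c] have "W (cat G r ?K (A @ x # y # B), c) + W (cat G r ?K (A @ y # x # B), c)
       + W (zcat G r (?K ! Suc ?q) (take ?q ?K @ ?K ! ?q # drop (Suc (Suc ?q)) ?K) (A @ fst (?K ! Suc ?q) # B) x y, c) = 0"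
      unfolding K[symmetric] using n q by simp
    moreover have "take ?q ?K @ ?K ! ?q # drop (Suc (Suc ?q)) ?K = take (Suc ?q) ?K @ drop (Suc (Suc ?q)) ?K"
      using q by (simp only: take_Suc_conv_app_nth Suc_lessD append_assoc append_Cons append_Nil)
    ultimately have "W (cat G r ?K (A @ x # y # B), c) + W (cat G r ?K (A @ y # x # B), c) + ?Z A B (Suc ?q) = 0"
      by (simp only:)
    \<comment> \<open>The spare link sits at position \<open>Suc (length A)\<close>; the additional
      sign cancels the one from moving the third IHX term to the other side.\<close>
    then show "W (cat G r ?K (A @ x # y # B), c) + W (cat G r ?K (A @ y # x # B), c)
       = (-1) ^ (length X + length A) * W (cat S r (L @ M) (A @ a # B), c)"
      unfolding sgn[OF AB(1,2) q] len by simp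
  next
    fix A assume A: "distinct A" "set A = set (X @ Y)"
    have AB: "distinct (A @ [])" "set (A @ []) = set (X @ Y)" using A by simp_all
    let ?q = "length A"
    have q: "length ?K = Suc ?q" using lenAB[OF AB] by simp
    have K: "?K = take ?q ?K @ [?K ! ?q]"
      using q by (metis lessI take_Suc_conv_app_nth take_all_iff order_refl)
    have "zsite G r (take ?q ?K) (?K ! ?q) [] (X @ x # y # Y) A [] x y"
    proof (rule zsite.intro[OF G _ AB(1)])
      show "line G r (take ?q ?K @ [?K ! ?q]) (X @ x # y # Y)" using l K by (simp only:)
    qed (use AB halves in auto)
    note last = cat_last_eq_zcat[OF this]
    have dr: "drop (Suc ?q) ?K = []" using q by simp
    have Z: "?Z A [] ?q = (-1) ^ (length L + ?q) * W (cat S r (L @ M) (A @ [a]), c)"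
      using q by (intro sgn[OF AB]) simp
    show "W (cat G r ?K (A @ [x, y]), c) = (-1) ^ (length X + length A) * W (cat S r (L @ M) (A @ [a]), c)"
      using last(1) Z unfolding K[symmetric] dr len append_Nil2 by simp
    show "W (cat G r ?K (A @ [y, x]), c) = (-1) ^ (length X + length A) * W (cat S r (L @ M) (A @ [a]), c)"
      using last(2) Z unfolding K[symmetric] dr len append_Nil2 by simp
  qed
qed

section \<open>Independence of the direction of a line\<close>

lemma (in fused) fused_rev:
  "fused G (last_vert w M) (revl w M) (opp a) v (revl r L) (rev Y) y x (rev X)"
proof
  show "ok G" by (rule G)
  have "revl r (L @ (a, w) # M) = revl w M @ (opp a, v) # revl r L"
    by (simp add: revl_append v_def)
  then show "line G (last_vert w M) (revl w M @ (opp a, v) # revl r L) (rev Y @ y # x # rev X)"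
    using line_rev[OF l] by simp
  show "length (rev Y) = length (revl w M)" using line_legs_length[OF l] len by simp
qed

text \<open>Read backwards, the fusion keeps \<open>w\<close> on the line and makes \<open>v\<close>
  the internal vertex. Exchanging these vertices and reversing the edge between them identifies the
  two results.\<close>

lemma (in fused) fuse_rev_iso:
  "graph_iso S (fuse G w (opp a) v y (revl r L)) (transpose v w) (flip_edge (fst a))"
proof (rule graph_iso_involution)
  interpret R: fused G "last_vert w M" "revl w M" "opp a" v "revl r L" "rev Y" y x "rev X"
    by (rule fused_rev)
  let ?S' = "fuse G w (opp a) v y (revl r L)"
  have Rv: "R.v = w" by (simp add: R.v_def last_vert_revl)
  have vw: "v \<in> verts G" "w \<in> verts G" "v \<in> externals G" "w \<in> externals G"
    using okD(3)[OF G, of a] okD(3)[OF G, of "opp a"] halves(3) vats(5,6) lineD(3)[OF l]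
      lineD(3)[OF R.l] by auto
  show "transpose v w u \<in> verts S" if "u \<in> verts S" for u using that vw by (simp add: transpose_in)
  show "flip_edge (fst a) z \<in> half_edges S" if "z \<in> half_edges S" for z
    using that by (simp add: in_half_edges)
  show "verts ?S' = verts S" "edges ?S' = edges S" by simp_all
  show "transpose v w ` externals S = externals ?S'"
    using vw vats(7) by (auto simp: transpose_def image_iff)
  show "fst (flip_edge (fst a) z) \<in> solids ?S' \<longleftrightarrow> fst z \<in> solids S" for z by simp
  have hdL: "fst (hd (revl r L)) = opp (fst (last L))" if "L \<noteq> []"
    using that by (cases L rule: rev_cases) (auto simp: revl_append)
  have rL: "revl r L = [] \<longleftrightarrow> L = []" by (metis length_0_conv length_revl)
  have vS': "vat ?S' z = (if L \<noteq> [] \<and> z = opp (fst (last L)) then w else if z = y then v else vat G z)" for z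
    using R.vat_S[of z] hdL rL unfolding Rv by auto
  have lastL: "fst (fst (last L)) \<noteq> fst a" "fst (fst (last L)) \<noteq> fst x" "fst (fst (last L)) \<noteq> fst y"
     "vat G (opp (fst (last L))) = v" "M \<noteq> [] \<Longrightarrow> opp (fst (last L)) \<noteq> fst (hd M)" if "L \<noteq> []"
  proof -
    have ne: "revl r L \<noteq> []" using rL that by simp
    show "fst (fst (last L)) \<noteq> fst a" using R.M_halves(3)[OF ne] hdL[OF that] by simp
    show "fst (fst (last L)) \<noteq> fst x" "fst (fst (last L)) \<noteq> fst y"
      using R.M_halves(2)[OF ne] hdL[OF that] halves(4,5) by auto
    show v: "vat G (opp (fst (last L))) = v" using R.vats(8)[OF ne] hdL[OF that] by simp
    show "opp (fst (last L)) \<noteq> fst (hd M)" if "M \<noteq> []" using v vats(7,8) that by auto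
  qed
  have hdM: "vat G (fst (hd M)) = w" "fst (hd M) \<noteq> y" "fst (hd M) \<noteq> x" "fst (fst (hd M)) \<noteq> fst a" if "M \<noteq> []"
    using vats(8) M_halves that by auto
  show "vat ?S' (flip_edge (fst a) z) = transpose v w (vat S z)" if "z \<in> half_edges S" for z
  proof -
    have z: "z \<in> half_edges G" using that by simp
    consider "z = a" | "z = opp a" | "z = x" | "z = y" | "M \<noteq> []" "z = fst (hd M)"
      | "L \<noteq> []" "z = opp (fst (last L))"
      | "vat G z \<noteq> v" "vat G z \<noteq> w"
    proof -
      have "vat G z = v \<or> vat G z = w \<Longrightarrow> z = a \<or> z = opp a \<or> z = x \<or> z = y
          \<or> (M \<noteq> [] \<and> z = fst (hd M)) \<or> (L \<noteq> [] \<and> z = opp (fst (last L)))"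
        using dashed_at[OF z] solid_at_v[OF z] solid_at_w[OF z] by (cases "fst z \<in> solids G") blast+
      then show ?thesis using that by blast
    qed
    then show ?thesis
    proof cases
      case 1
      then have "vat ?S' (opp a) = w" using lastL(1) halves(9) vats(6) by (auto simp: vS')
      then show ?thesis using 1 vat_S_spec(1) by (simp add: flip_edge_def)
    next
      case 2
      then have "vat ?S' a = v" using lastL(1) halves(9) vats(5) by (auto simp: vS')
      then show ?thesis using 2 vat_S_spec(2) by (simp add: flip_edge_def)
    next
      case 3
      then have "vat ?S' x = v" using lastL(2) halves(7) vats(2) by (auto simp: vS')
      then show ?thesis using 3 vat_S_spec(3) halves(8) by (simp add: flip_edge_def)
    next
      case 4
      then have "vat ?S' y = v" using lastL(3) by (auto simp: vS')
      then show ?thesis using 4 vat_S_spec(4) halves(9) by (simp add: flip_edge_def)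
    next
      case 5
      then have "vat ?S' z = w" using lastL(5) hdM[OF 5(1)] by (auto simp: vS')
      moreover have "vat S z = v" using 5 vat_S[of z] by simp
      ultimately show ?thesis using 5 hdM(4)[OF 5(1)] by (simp add: flip_edge_def)
    next
      case 6
      then have "vat ?S' z = w" by (simp add: vS')
      moreover have "z \<noteq> x" using lastL(2)[OF 6(1)] 6(2) by auto
      then have "vat S z = v" using 6 lastL(4,5)[OF 6(1)] vat_S_other[of z] by simp
      ultimately show ?thesis using 6 lastL(1)[OF 6(1)] by (simp add: flip_edge_def)
    next
      case 7
      then have "z \<noteq> x" "z \<noteq> y" "z \<noteq> a" "z \<noteq> opp a" "L \<noteq> [] \<Longrightarrow> z \<noteq> opp (fst (last L))"
        "M \<noteq> [] \<Longrightarrow> z \<noteq> fst (hd M)"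
        using vats lastL(4) by auto
      then have "vat ?S' z = vat G z" "vat S z = vat G z" "flip_edge (fst a) z = z"
        by (auto simp: vS' flip_edge_def same_edge_iff intro: vat_S_other)
      then show ?thesis using 7 by simp
    qed
  qed
qed (simp_all add: flip_edge_opp)

lemma links_image_revl:
  assumes "\<And>x. h (opp x) = opp (h x)"
  shows "links_image f h (revl r L) = revl (f r) (links_image f h L)"
  by (induction L arbitrary: r) (simp_all add: assms)

lemma (in fused) links_image_fuse_rev:
  "links_image (transpose v w) (flip_edge (fst a)) (revl v M @ revl r L) = revl w M @ revl r L"
  "transpose v w (last_vert v M) = last_vert w M"
proof -
  let ?f = "transpose v w" and ?h = "flip_edge (fst a)"
  have dist: "distinct (sources r L @ v # w # map snd M)"
    using lineD(1)[OF l] unfolding line_verts_split(1) v_def by simp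
  have edges: "fst (fst m) \<noteq> fst a" if "m \<in> set (L @ M)" for m
    using line_link(4)[OF l, unfolded fst_conv] link_edge_in[OF that] by metis
  have hM: "?h (fst m) = fst m" if "m \<in> set (L @ M)" for m
    using edges[OF that] by (simp add: flip_edge_def)
  have fM: "?f (snd m) = snd m" if "m \<in> set M" for m
  proof -
    have "snd m \<in> set (map snd M)" using that by simp
    moreover have "v \<notin> set (map snd M)" "w \<notin> set (map snd M)" using dist by simp_all
    ultimately have "snd m \<noteq> v" "snd m \<noteq> w" by metis+
    then show ?thesis by simp
  qed
  have M: "links_image ?f ?h M = M"
    unfolding links_image_def
  proof (rule map_idI)
    fix m assume "m \<in> set M"
    then show "map_prod ?h ?f m = m" using hM[of m] fM[of m] by (simp add: prod_eq_iff)
  qed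
  have L: "links_image ?f ?h (revl r L) = revl r L"
    unfolding links_image_def
  proof (rule map_idI)
    fix m assume m: "m \<in> set (revl r L)"
    have "snd m \<in> set (map snd (revl r L))" using m by simp
    then have "snd m \<in> set (sources r L)" unfolding map_snd_revl by simp
    moreover have "v \<notin> set (sources r L)" "w \<notin> set (sources r L)" using dist by simp_all
    ultimately have "snd m \<noteq> v" "snd m \<noteq> w" by metis+
    moreover have "fst (fst m) \<in> set (link_edges (revl r L))" using m by (rule link_edge_in)
    then have "fst (fst m) \<in> set (link_edges L)" unfolding link_edges_revl by simp
    then have "fst (fst m) \<in> set (link_edges (L @ M))" by simp
    then have "fst (fst m) \<noteq> fst a" using line_link(4)[OF l, unfolded fst_conv] by metis
    ultimately show "map_prod ?h ?f m = m" by (simp add: prod_eq_iff flip_edge_def)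
  qed
  show "links_image ?f ?h (revl v M @ revl r L) = revl w M @ revl r L"
    using L M links_image_revl[of ?h ?f v M] by (simp add: flip_edge_opp)
  have "last_vert (?f v) (links_image ?f ?h M) = ?f (last_vert v M)"
    unfolding links_image_def by (rule map_last_vert)
  then show "?f (last_vert v M) = last_vert w M" unfolding M by simp
qed

lemma is_coloring_fuse [simp]: "is_coloring par (fuse G v a w x M) c = is_coloring par G c"
  by (rule is_coloring_cong) simp_all

lemma is_coloring_cat [simp]: "is_coloring par (cat G r L v) c = is_coloring par G c"
  by (rule is_coloring_cong) simp_all

text \<open>The isomorphism of \<open>fuse_rev_iso\<close> is a flip and so has sign
  \<open>+1\<close>; on legs it only renames \<open>a\<close> to \<open>opp a\<close>.\<close>

lemma (in weight) euler_fuse_rev: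
  assumes f: "fused G r L a w M X x y Y" and c: "is_coloring par G c"
    and n: "card (solids G) \<le> n + length (L @ (a, w) # M)" and m: "m \<in> set (X @ a # Y)"
  shows "euler (\<lambda>u. W (cat (fuse G w (opp a) (last_vert r L) y (revl r L)) (last_vert w M) (revl w M @ revl r L) u, c))
      (rev Y @ opp a # rev X) (flip_edge (fst a) m)
    = euler (\<lambda>u. W (cat (fuse G (last_vert r L) a w x M) (last_vert r (L @ M)) (revl r (L @ M)) u, c))
      (rev (X @ a # Y)) m"
proof -
  interpret fused G r L a w M X x y Y by (rule f)
  interpret R: fused G "last_vert w M" "revl w M" "opp a" v "revl r L" "rev Y" y x "rev X"
    by (rule fused_rev)
  let ?f = "transpose v w" and ?h = "flip_edge (fst a)"
  let ?S' = "fuse G w (opp a) v y (revl r L)" and ?r = "last_vert r (L @ M)" and ?L = "revl r (L @ M)"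
  have Rv: "R.v = w" by (simp add: R.v_def last_vert_revl)
  have rl: "line S ?r ?L (rev (X @ a # Y))" by (rule line_rev[OF line_S])
  have im: "links_image ?f ?h ?L = revl w M @ revl r L" "?f ?r = last_vert w M"
    using links_image_fuse_rev by (simp_all add: revl_append v_def)
  have okS': "ok ?S'" and lineS': "line ?S' (last_vert w M) (revl w M @ revl r L) (rev Y @ opp a # rev X)"
    using R.ok_S R.line_S unfolding Rv by simp_all
  have inj: "inj ?h" by (rule inj_on_inverseI[where g = ?h]) simp
  have hz: "?h z = z" if "z \<in> set (X @ Y)" for z
  proof -
    have "z \<noteq> a" using that halves(12) by auto
    moreover have "z \<noteq> opp a" using that R.halves(12) by auto
    ultimately show ?thesis by (auto simp: flip_edge_def same_edge_iff)
  qed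
  have xs: "map ?h (rev (X @ a # Y)) = rev Y @ opp a # rev X"
  proof -
    have "map ?h (rev X) = rev X" "map ?h (rev Y) = rev Y" using hz by (auto intro!: map_idI)
    then show ?thesis by (simp add: flip_edge_def)
  qed
  have "euler (\<lambda>u. W (cat ?S' (last_vert w M) (revl w M @ revl r L) u, c)) (map ?h (rev (X @ a # Y))) (?h m)
     = euler (\<lambda>u. W (cat ?S' (last_vert w M) (revl w M @ revl r L) (map ?h u), c)) (rev (X @ a # Y)) m"
    using m by (intro euler_map inj_on_subset[OF inj]) auto
  also have "\<dots> = euler (\<lambda>u. W (cat S ?r ?L u, c)) (rev (X @ a # Y)) m"
  proof (rule euler_cong)
    fix u assume u: "u \<in> permutations_of_set (set (rev (X @ a # Y)))"
    have iso: "graph_iso (cat S ?r ?L u) (cat ?S' (last_vert w M) (revl w M @ revl r L) (map ?h u)) ?f ?h"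
      using iso_cat[OF fuse_rev_iso ok_S rl u] unfolding im .
    have "map ?h u \<in> permutations_of_set (set (rev Y @ opp a # rev X))"
      using u permutations_of_set_image_inj[OF inj_on_subset[OF inj subset_UNIV], of "set (rev (X @ a # Y))"]
      unfolding xs[symmetric] set_map by blast
    then have ok': "ok (cat ?S' (last_vert w M) (revl w M @ revl r L) (map ?h u))"
      by (rule ok_cat[OF okS' lineS'])
    have "card (solids (cat S ?r ?L u)) \<le> n"
    proof -
      have "card (solids S) = card (solids G) - 1" using halves(6) okD(7)[OF G] by simp
      then show ?thesis using card_solids_cat[OF ok_S rl] n by simp
    qed
    then show "W (cat ?S' (last_vert w M) (revl w M @ revl r L) (map ?h u), c) = W (cat S ?r ?L u, c)"
      using c vats halves(3) okD(3)[OF G, of a] okD(3)[OF G, of "opp a"]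
      by (intro flip_invariant[OF ok_cat[OF ok_S rl u] ok' _ _ _ _ _ _ _ _ iso]) (auto simp: in_half_edges)
  qed
  finally show ?thesis unfolding xs v_def .
qed

text \<open>By \<open>stu_euler\<close> for both directions, adding the values of two words that
  differ by an exchange of neighbours leads to a shorter line, where the two sides agree by
  induction. So their difference is alternating, and \<open>alternating_euler_diff_zero\<close>
  applies. The marks \<open>m\<close> and \<open>m'\<close> are unrelated, which also yields
  independence of the innermost letter.\<close>

lemma (in weight) euler_rev:
  assumes "ok G" "line G r L xs" "is_coloring par G c" "card (solids G) \<le> n + length L"
    "m \<in> set xs" "m' \<in> set xs"
  shows "euler (\<lambda>v. W (cat G r L v, c)) xs m
       = euler (\<lambda>v. W (cat G (last_vert r L) (revl r L) v, c)) (rev xs) m'"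
  using assms
proof (induction "length L" arbitrary: G r L xs m m')
  case 0
  then have L: "L = []" by simp
  then obtain x where "xs = [x]" using line_legs_length[OF "0.prems"(2)] by (auto simp: length_Suc_conv)
  then show ?case using 0 L by simp
next
  case (Suc k)
  note gr = Suc.prems(1,2) and c = Suc.prems(3) and n = Suc.prems(4)
  let ?C = "\<lambda>v. W (cat G r L v, c)"
  let ?D = "\<lambda>v. W (cat G (last_vert r L) (revl r L) v, c)"
  have card: "card (set xs) = length xs" using line_distinct_legs[OF gr(2)] by (rule distinct_card)
  show ?case
  proof (rule alternating_euler_diff_zero[where A = "set xs"])
    show "card (set xs) \<ge> 2" using card line_legs_length[OF gr(2)] Suc.hyps(2) by simp
    show "xs \<in> permutations_of_set (set xs)"
      using line_distinct_legs[OF gr(2)] by (simp add: permutations_of_set_def)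
    show "alternating (set xs) (\<lambda>xs. euler ?C xs m - euler ?D (rev xs) m')"
      unfolding alternating_def
    proof (intro allI impI)
      fix X x y Y assume *: "distinct (X @ x # y # Y)" "set (X @ x # y # Y) = set xs"
      then have perm: "X @ x # y # Y \<in> permutations_of_set (set xs)" by (simp add: permutations_of_set_def)
      obtain G' where G': "ok G'" "line G' r L (X @ x # y # Y)" "G' = G\<lparr>vat := vat G'\<rparr>"
        "\<And>h. h \<notin> set xs \<Longrightarrow> vat G' h = vat G h"
        using permute_legs[OF gr perm] by blast
      have "length X < length L" using line_legs_length[OF G'(2)] by simp
      then obtain L1 a w M where L: "L = L1 @ (a, w) # M" and len: "length X = length L1"
        by (metis id_take_nth_drop length_take min.absorb4 nat_less_le surj_pair)
      have f: "fused G' r L1 a w M X x y Y" using G' len by unfold_locales (simp_all add: L)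
      interpret fused G' r L1 a w M X x y Y by (rule f)
      have E: "solids G' = solids G" "is_coloring par G' c = is_coloring par G c"
        using G'(3) by (metis (no_types) graph.select_convs graph.update_convs graph.surjective)
           (rule is_coloring_cong; subst G'(3); simp)
      have c': "is_coloring par G' c" and n': "card (solids G') \<le> n + length (L1 @ (a, w) # M)"
        using E c n L by simp_all
      \<comment> \<open>Reordering the legs changes no caterpillar, so all words on these legs can
        be evaluated with the caterpillars of the original graph.\<close>
      have C: "W (cat G' r L v, c) = ?C v" and D: "W (cat G' (last_vert r L) (revl r L) v, c) = ?D v"
        if "v \<in> permutations_of_set (set xs)" for v
      proof -
        note pv = permutation_of_legs[OF gr(2) that]
        have "cat G' r L v = cat G r L v"
          using pv G'(4) by (intro cat_cong[OF G'(3)]) auto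
        moreover have "cat G' (last_vert r L) (revl r L) v = cat G (last_vert r L) (revl r L) v"
          using pv G'(4) by (intro cat_cong[OF G'(3)]) auto
        ultimately show "W (cat G' r L v, c) = ?C v" "W (cat G' (last_vert r L) (revl r L) v, c) = ?D v"
          by simp_all
      qed
      have mx: "m \<in> set (X @ x # y # Y)" "m' \<in> set (rev Y @ y # x # rev X)"
        using Suc.prems(5,6) *(2) by auto
      define z where "z = (if m \<in> {x, y} then a else m)"
      define z' where "z' = (if m' \<in> {x, y} then a else m')"
      have zin: "z \<in> set (X @ a # Y)" "z' \<in> set (X @ a # Y)" using mx by (auto simp: z_def z'_def)
      have "euler ?C (X @ x # y # Y) m + euler ?C (X @ y # x # Y) m
          = euler (\<lambda>v. W (cat S r (L1 @ M) v, c)) (X @ a # Y) z"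
      proof -
        have "euler ?C ys m = euler (\<lambda>v. W (cat G' r L v, c)) ys m" if "set ys = set xs" for ys
          by (rule euler_cong) (simp add: C that)
        then show ?thesis
          using stu_euler[OF f c' n' mx(1)] *(2) unfolding z_def L v_def by (simp add: insert_commute)
      qed
      also have "\<dots> = euler (\<lambda>v. W (cat S (last_vert r (L1 @ M)) (revl r (L1 @ M)) v, c)) (rev (X @ a # Y)) z'"
      proof (rule Suc.hyps(1)[OF _ ok_S line_S _ _ zin])
        show "k = length (L1 @ M)" using Suc.hyps(2) L by simp
        show "is_coloring par S c" using c' by simp
        have "card (solids S) = card (solids G') - 1" using halves(6) okD(7)[OF G'(1)] by simp
        then show "card (solids S) \<le> n + length (L1 @ M)" using n' by simp
      qed
      also have "\<dots> = euler (\<lambda>u. W (cat (fuse G' w (opp a) v y (revl r L1)) (last_vert w M)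
          (revl w M @ revl r L1) u, c)) (rev Y @ opp a # rev X) (flip_edge (fst a) z')"
        using euler_fuse_rev[OF f c' n' zin(2)] unfolding v_def by simp
      also have "\<dots> = euler ?D (rev (X @ x # y # Y)) m' + euler ?D (rev (X @ y # x # Y)) m'"
      proof -
        have rL: "revl w M @ (opp a, v) # revl r L1 = revl r L" "last_vert w M = last_vert r L"
          by (simp_all add: L revl_append v_def)
        have lv: "last_vert (last_vert r L) (revl w M) = w" using last_vert_revl[of w M] rL(2) by simp
        have len': "length (revl w M @ (opp a, v) # revl r L1) = length (L1 @ (a, w) # M)" by simp
        \<comment> \<open>Seen from the other end of the line, the leg produced by the fusion is
          \<open>opp a\<close> instead of \<open>a\<close>.\<close>
        have z': "flip_edge (fst a) z' = (if m' \<in> {y, x} then opp a else m')"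
        proof (cases "m' \<in> {x, y}")
          case False
          then have "m' \<in> set (X @ Y)" using mx(2) by auto
          then have "m' \<in> set (X @ a # Y)" "m' \<noteq> a" using halves(12) by auto
          moreover have "m' \<noteq> opp a"
            using fused.halves(12)[OF fused_rev] \<open>m' \<in> set (X @ Y)\<close> by auto
          ultimately show ?thesis using False by (auto simp: z'_def flip_edge_def same_edge_iff)
        qed (auto simp: z'_def flip_edge_def)
        have "euler ?D ys m' = euler (\<lambda>v. W (cat G' (last_vert r L) (revl r L) v, c)) ys m'"
          if "set ys = set xs" for ys
          by (rule euler_cong) (simp add: D that)
        then have e: "euler ?D (rev Y @ y # x # rev X) m' = euler (\<lambda>v. W (cat G' (last_vert r L) (revl r L) v, c)) (rev Y @ y # x # rev X) m'"
            "euler ?D (rev Y @ x # y # rev X) m' = euler (\<lambda>v. W (cat G' (last_vert r L) (revl r L) v, c)) (rev Y @ x # y # rev X) m'"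
          using *(2) by (simp_all add: insert_commute Un_commute)
        have n'': "card (solids G') \<le> n + length (revl w M @ (opp a, v) # revl r L1)"
          using n' by simp
        from stu_euler[OF fused_rev c' n'' mx(2)]
        have "euler (\<lambda>v. W (cat G' (last_vert r L) (revl r L) v, c)) (rev Y @ y # x # rev X) m'
          + euler (\<lambda>v. W (cat G' (last_vert r L) (revl r L) v, c)) (rev Y @ x # y # rev X) m'
          = euler (\<lambda>u. W (cat (fuse G' w (opp a) v y (revl r L1)) (last_vert w M)
          (revl w M @ revl r L1) u, c)) (rev Y @ opp a # rev X) (flip_edge (fst a) z')"
          unfolding len' rL lv z' by simp
        then show ?thesis using e by simp
      qed
      finally show "euler ?C (X @ y # x # Y) m - euler ?D (rev (X @ y # x # Y)) m'
          = - (euler ?C (X @ x # y # Y) m - euler ?D (rev (X @ x # y # Y)) m')"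
        by simp
    qed
  qed
qed

text \<open>The next link is the only solid half-edge at the current vertex besides the one by which
  it was entered. The common prefix \<open>P\<close> records that one.\<close>

lemma line_root_unique:
  "line G r (P @ L) xs \<Longrightarrow> line G r (P @ L') xs' \<Longrightarrow> ok G \<Longrightarrow> L = L'"
proof (induction L arbitrary: P L')
  case Nil
  show ?case
  proof (cases L')
    case (Cons l' M')
    note k = line_link[OF Nil(2)[unfolded Cons]]
    have "fst l' \<in> half_edges G" using k(3) okD(5)[OF Nil(3)] by (auto simp: in_half_edges)
    from line_solid_at[OF Nil(1) this k(3,1)] have "P \<noteq> []" "fst l' = opp (fst (last P))" by auto
    then have "fst (fst l') \<in> set (link_edges (P @ M'))" by (metis Un_iff last_in_set link_edge_in opp_simps(2) set_append)
    then show ?thesis using k(4) by simp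
  qed simp
next
  case (Cons l M)
  note k = line_link[OF Cons.prems(1)]
  have h: "fst l \<in> half_edges G" using k(3) okD(5)[OF Cons.prems(3)] by (auto simp: in_half_edges)
  have "fst l \<noteq> opp (fst (last P))" if "P \<noteq> []"
    using k(4) that by (metis Un_iff last_in_set link_edge_in opp_simps(2) set_append)
  then have "L' \<noteq> []" "fst l = fst (hd L')"
    using line_solid_at[OF Cons.prems(2) h k(3,1)] by auto
  then obtain l' M' where L': "L' = l' # M'" "fst l = fst l'" by (cases L') auto
  have "snd l = snd l'"
    using k(2) line_link(2)[OF Cons.prems(2)[unfolded L'(1)]] L'(2) by simp
  then have "l' = l" using L'(2) by (simp add: prod_eq_iff)
  then have "M = M'"
    using Cons.prems L'(1) by (intro Cons.IH[of "P @ [l]"]) auto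
  then show ?case using L' \<open>l' = l\<close> by simp
qed

lemma line_legs_unique:
  assumes "ok G" "line G r L xs" "line G r L xs'"
  shows "xs = xs'"
proof -
  have "map (vat G) xs = map (vat G) xs'" using assms(2,3) by (simp add: lineD(7))
  moreover have "inj_on (vat G) (set xs \<union> set xs')"
  proof (rule inj_onI)
    fix z z' assume z: "z \<in> set xs \<union> set xs'" "z' \<in> set xs \<union> set xs'" "vat G z = vat G z'"
    have *: "vat G u \<in> externals G \<and> u \<in> half_edges G \<and> fst u \<in> dashed G" if "u \<in> set xs \<union> set xs'" for u
      using that line_legs_at[OF assms(2)] line_legs_at[OF assms(3)] lineD(3)[OF assms(2)]
        lineD(8)[OF assms(2)] lineD(8)[OF assms(3)]
        in_line_half_edges(2)[OF assms(1,2)] in_line_half_edges(2)[OF assms(1,3)] by blast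
    show "z = z'" using dashed_at_external[OF assms(1)] *[OF z(1)] *[OF z(2)] z(3) by metis
  qed
  ultimately show ?thesis by (rule map_inj_on)
qed

text \<open>The start of the second line lies on the first one. It cannot be an interior vertex,
  where two solid half-edges meet, since the start of a line meets only its first link. So it is one
  of the two ends.\<close>

lemma line_unique:
  assumes G: "ok G" and l: "line G r L xs" "line G r' L' xs'"
    and p: "p \<in> set (line_verts r L)" "p \<in> set (line_verts r' L')"
  shows "(r' = r \<and> L' = L \<and> xs' = xs) \<or> (r' = last_vert r L \<and> L' = revl r L \<and> xs' = rev xs)"
proof -
  have "r' \<in> set (line_verts r L)"
    using line_in_closed[OF G l(2) line_closed[OF l(1)] p(2)] p(1) by blast
  then obtain A B where AB: "L = A @ B" "r' = last_vert r A"
  proof -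
    assume that: "\<And>A B. L = A @ B \<Longrightarrow> r' = last_vert r A \<Longrightarrow> thesis"
    show thesis
    proof (cases "r' = r")
      case True then show ?thesis using that[of "[]" L] by simp
    next
      case False
      then obtain m where m: "m \<in> set L" "r' = snd m" using \<open>r' \<in> set (line_verts r L)\<close> by auto
      then obtain A B where "L = A @ m # B" by (meson split_list)
      then show ?thesis using that[of "A @ [m]" B] m(2) by simp
    qed
  qed
  show ?thesis
  proof (cases "A = [] \<or> B = []")
    case True
    then show ?thesis
    proof
      assume "A = []"
      then have r: "r' = r" using AB by simp
      then have "L' = L" using line_root_unique[of G r "[]" L' xs' L xs] l G by simp
      then show ?thesis using line_legs_unique[OF G l(1)] l(2) r by simp
    next
      assume "B = []"
      then have r: "r' = last_vert r L" using AB by simp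
      have l1: "line G r' (revl r L) (rev xs)" using line_rev[OF l(1)] r by simp
      then have "L' = revl r L"
        using line_root_unique[of G r' "[]" L' xs' "revl r L" "rev xs"] l(2) G by simp
      then show ?thesis using line_legs_unique[OF G l1] l(2) r by simp
    qed
  next
    case False
    define a where "a = opp (fst (last A))"
    define b where "b = fst (hd B)"
    have LA: "L = butlast A @ last A # B" "L = A @ hd B # tl B" using AB False by simp_all
    note kA = line_link[OF l(1)[unfolded LA(1)]] and kB = line_link[OF l(1)[unfolded LA(2)]]
    have "last_vert r A = snd (last A)" using False by (metis append_butlast_last_id last_vert.simps last_vert_append)
    then have va: "vat G a = r'" "fst a \<in> solids G" using kA(2,3) AB by (simp_all add: a_def)
    have vb: "vat G b = r'" "fst b \<in> solids G" using kB(1,3) AB by (simp_all add: b_def)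
    have h: "a \<in> half_edges G" "b \<in> half_edges G"
      using va vb okD(5)[OF G] by (auto simp: in_half_edges)
    have r0: "line G r' ([] @ L') xs'" using l(2) by simp
    have "a = fst (hd L')" "b = fst (hd L')"
      using line_solid_at[OF r0 h(1) va(2)] line_solid_at[OF r0 h(2) vb(2)] va(1) vb(1) by simp_all
    then have "a = b" by simp
    moreover have "fst b \<notin> set (link_edges (A @ tl B))" using kB(4) unfolding b_def .
    moreover have "last A \<in> set (A @ tl B)" using False by simp
    from link_edge_in[OF this] have "fst a \<in> set (link_edges (A @ tl B))" unfolding a_def opp_simps .
    ultimately show ?thesis by metis
  qed
qed

text \<open>The factor is forced by the STU relations: every move changes the sign, and in the first one,
  at a vertex without solid edges, the caterpillar has the coefficient \<open>coeff 2 0 = 1/2\<close>.\<close>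

definition line_value :: "(colored_graph \<Rightarrow> rat) \<Rightarrow> coloring \<Rightarrow> graph \<Rightarrow> nat \<Rightarrow> link list \<Rightarrow> half_edge list \<Rightarrow> rat" where
  "line_value W c G r L xs = (if L = [] then 1 else 2 * (-1) ^ length L)
     * euler (\<lambda>v. W (cat G r L v, c)) xs (last xs)"

section \<open>Values of lines under STU moves\<close>

lemma line_value_single:
  assumes "line G r [] [x]"
  shows "line_value W c G r [] [x] = W (G, c)"
proof -
  have "{v \<in> permutations_of_set {x}. last v = x} = {[x]}"
    by (auto simp: permutations_of_set_singleton)
  then show ?thesis using cat_single[OF assms] by (simp add: line_value_def euler_def word_sgn_def)
qed

text \<open>Both sides equal the value of the reversed word with mark \<open>m\<close>.\<close>

lemma (in weight) euler_mark:
  assumes "ok G" "line G r L xs" "is_coloring par G c" "card (solids G) \<le> n + length L"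
    "m \<in> set xs" "m' \<in> set xs"
  shows "euler (\<lambda>v. W (cat G r L v, c)) xs m = euler (\<lambda>v. W (cat G r L v, c)) xs m'"
  using euler_rev[OF assms(1-5) assms(5)] euler_rev[OF assms(1-4,6) assms(5)] by simp

lemma line_last_leg: "line G r L xs \<Longrightarrow> last xs \<in> set xs"
  using line_legs_length[of G r L xs] by (intro last_in_set) auto

lemma (in weight) line_value_mark:
  assumes "ok G" "line G r L xs" "is_coloring par G c" "card (solids G) \<le> n + length L" "m \<in> set xs"
  shows "line_value W c G r L xs = (if L = [] then 1 else 2 * (-1) ^ length L)
     * euler (\<lambda>v. W (cat G r L v, c)) xs m"
  unfolding line_value_def euler_mark[OF assms(1-4) line_last_leg[OF assms(2)] assms(5)] ..

lemma revl_Nil_iff [simp]: "revl r L = [] \<longleftrightarrow> L = []"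
  by (cases L) auto

lemma (in weight) line_value_rev:
  assumes "ok G" "line G r L xs" "is_coloring par G c" "card (solids G) \<le> n + length L"
  shows "line_value W c G (last_vert r L) (revl r L) (rev xs) = line_value W c G r L xs"
proof -
  have x: "last xs \<in> set xs" "last (rev xs) \<in> set xs"
    using line_last_leg[OF assms(2)] line_last_leg[OF line_rev[OF assms(2)]] by auto
  show ?thesis unfolding line_value_def using euler_rev[OF assms x] by simp
qed

text \<open>The factor changes sign with each link, which turns \<open>stu_euler\<close> into a sum
  of three terms equal to zero. For \<open>L @ M = []\<close> the only word ending in
  \<open>y\<close> has coefficient 1/2 and its caterpillar is the fused graph itself, so the factor
  \<open>-2\<close> produces exactly the negative of the other term.\<close>

lemma (in weight) line_value_stu:
  assumes f: "fused G r L a w M X x y Y" and c: "is_coloring par G c"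
    and n: "card (solids G) \<le> n + length (L @ (a, w) # M)"
    and U: "ok U" "line U r (L @ (a, w) # M) (X @ y # x # Y)" "U = G\<lparr>vat := vat U\<rparr>"
      "\<And>h. h \<noteq> x \<Longrightarrow> h \<noteq> y \<Longrightarrow> vat U h = vat G h"
  shows "L @ M \<noteq> [] \<Longrightarrow> line_value W c G r (L @ (a, w) # M) (X @ x # y # Y)
      + line_value W c U r (L @ (a, w) # M) (X @ y # x # Y)
      + line_value W c (fuse G (last_vert r L) a w x M) r (L @ M) (X @ a # Y) = 0"
    "L @ M = [] \<Longrightarrow> line_value W c G r (L @ (a, w) # M) (X @ x # y # Y)
      + line_value W c (fuse G (last_vert r L) a w x M) r (L @ M) (X @ a # Y) = 0"
proof -
  interpret fused G r L a w M X x y Y by (rule f)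
  let ?K = "L @ (a, w) # M"
  let ?E = "\<lambda>xs m. euler (\<lambda>v. W (cat G r ?K v, c)) xs m"
  have T: "line_value W c G r ?K (X @ x # y # Y) = 2 * (-1) ^ length ?K * ?E (X @ x # y # Y) y"
    using line_value_mark[OF G l c n, of y] by simp
  have S: "line_value W c S r (L @ M) (X @ a # Y) = (if L @ M = [] then 1 else 2 * (-1) ^ length (L @ M))
      * euler (\<lambda>v. W (cat S r (L @ M) v, c)) (X @ a # Y) a"
  proof (rule line_value_mark[OF ok_S line_S])
    show "is_coloring par S c" using c by simp
    have "card (solids S) = card (solids G) - 1" using halves(6) okD(7)[OF G] by simp
    then show "card (solids S) \<le> n + length (L @ M)" using n by simp
  qed simp
  have stu: "?E (X @ x # y # Y) y + ?E (X @ y # x # Y) y = euler (\<lambda>v. W (cat S r (L @ M) v, c)) (X @ a # Y) a"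
    using stu_euler[OF f c n, of y] unfolding v_def by simp
  show "line_value W c G r ?K (X @ x # y # Y) + line_value W c U r ?K (X @ y # x # Y)
      + line_value W c (fuse G (last_vert r L) a w x M) r (L @ M) (X @ a # Y) = 0" if ne: "L @ M \<noteq> []"
  proof -
    have UE: "is_coloring par U c" "card (solids U) \<le> n + length ?K"
      using arg_cong[OF U(3), of verts] arg_cong[OF U(3), of edges] arg_cong[OF U(3), of solids]
        c n is_coloring_cong[of U G par c] by simp_all
    have CU: "cat U r ?K v = cat G r ?K v" if "v \<in> permutations_of_set (set (X @ y # x # Y))" for v
      using permutation_of_legs[OF U(2) that] U(4) by (intro cat_cong[OF U(3)]) auto
    have EU: "euler (\<lambda>v. W (cat U r ?K v, c)) (X @ y # x # Y) y = ?E (X @ y # x # Y) y"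
      by (rule euler_cong) (simp only: CU)
    have "y \<in> set (X @ y # x # Y)" by simp
    from line_value_mark[OF U(1,2) UE this]
    have "line_value W c U r ?K (X @ y # x # Y) = 2 * (-1) ^ length ?K * ?E (X @ y # x # Y) y"
      unfolding EU by simp
    moreover have "(-1 :: rat) ^ length ?K = - ((-1) ^ length (L @ M))" by simp
    moreover have "(if L @ M = [] then 1 else 2 * (-1) ^ length (L @ M)) = (2 * (-1) ^ length (L @ M) :: rat)"
      using ne by simp
    moreover have "2 * - k * A + 2 * - k * B + 2 * k * (A + B) = 0" for k A B :: rat
      by (simp add: algebra_simps)
    ultimately show ?thesis unfolding v_def[symmetric] T S stu[symmetric] by (simp only:)
  qed
  show "line_value W c G r ?K (X @ x # y # Y)
      + line_value W c (fuse G (last_vert r L) a w x M) r (L @ M) (X @ a # Y) = 0" if e: "L @ M = []"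
  proof -
    have LM: "L = []" "M = []" "X = []" using e len by simp_all
    have Y: "Y = []" using line_legs_length[OF l] LM by simp
    have xy: "x \<noteq> y" by (rule halves(7))
    have P: "{v \<in> permutations_of_set (set [x, y]). last v = y} = {[x, y]}"
    proof (intro equalityI subsetI)
      fix v assume "v \<in> {v \<in> permutations_of_set (set [x, y]). last v = y}"
      then have "v = [x, y] \<or> v = [y, x]" "last v = y"
        using permutations_of_set_doubleton[OF xy] by simp_all
      then show "v \<in> {[x, y]}" using xy by (elim disjE) simp_all
    qed (use xy in \<open>simp add: permutations_of_set_doubleton\<close>)
    have "word_sgn [x, y] [x, y] = 1" "descents (precedes [x, y]) [x, y] = 0"
      using xy by (simp_all add: word_sgn_def)
    then have E: "?E [x, y] y = 1 / 2 * W (cat G r ?K [x, y], c)"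
      unfolding euler_def P using coeff_2_0 by (simp add: numeral_2_eq_2)
    have vr: "v = r" unfolding v_def unfolding LM by simp
    have lS: "line S r [] [a]" using line_S LM Y by simp
    have "cat G r ([] @ [(a, w)]) ([] @ [x, y]) = cat (fuse G (last_vert r []) a w x []) r [] ([] @ [a])"
      using fused_axioms unfolding LM Y by (rule cat_snoc)
    then have ca: "cat G r ?K [x, y] = S" using cat_single[OF lS] vr LM by simp
    have "line_value W c S r [] [a] = W (S, c)" by (rule line_value_single[OF lS])
    then show ?thesis unfolding v_def[symmetric] using T E ca LM Y by simp
  qed
qed

section \<open>Independence of disjoint lines\<close>

lemma euler_swap_sums:
  "euler (\<lambda>v. euler (F v) ys m') xs m = euler (\<lambda>v'. euler (\<lambda>v. F v v') xs m) ys m'"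
  unfolding euler_def sum_distrib_left by (subst sum.swap) (simp add: mult_ac)

lemma euler_mult: "euler (\<lambda>v. k * C v) xs m = k * euler C xs m"
  by (simp add: euler_def sum_distrib_left mult_ac)

lemma euler_add: "euler (\<lambda>v. C v + D v) xs m = euler C xs m + euler D xs m"
  by (simp add: euler_def algebra_simps sum.distrib)

lemma override_in:
  assumes "h \<in> set ks" "length ks = length us"
  shows "override f ks us h = override g ks us h"
proof -
  have "map_of (zip ks us) h \<noteq> None" using assms by (simp add: map_of_zip_is_None)
  then show ?thesis by (auto simp: override_def)
qed

lemma override_commute:
  assumes "set ks \<inter> set ks' = {}" "length ks = length us" "length ks' = length us'"
  shows "override (override f ks us) ks' us' = override (override f ks' us') ks us"
proof
  fix h
  consider "h \<in> set ks" "h \<notin> set ks'" | "h \<notin> set ks" "h \<in> set ks'" | "h \<notin> set ks" "h \<notin> set ks'"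
    using assms(1) by blast
  then show "override (override f ks us) ks' us' h = override (override f ks' us') ks us h"
  proof cases
    case 1
    then show ?thesis using override_in[OF 1(1) assms(2)] by simp
  next
    case 2
    then show ?thesis using override_in[OF 2(2) assms(3)] by simp
  qed simp
qed

lemma lines_disjoint:
  assumes G: "ok G" and l: "line G r L xs" "line G r' L' xs'"
    and disj: "set (line_verts r L) \<inter> set (line_verts r' L') = {}"
  shows "set xs \<inter> set xs' = {}" "set (link_edges L) \<inter> set (link_edges L') = {}"
    "l' \<in> set L' \<Longrightarrow> fst l' \<notin> set xs \<and> opp (fst l') \<notin> set xs"
proof -
  have at: "vat G z \<in> set (line_verts r L)" if "z \<in> set xs" for z
    using line_legs_at[OF l(1)] that by blast
  have at': "vat G z \<in> set (line_verts r' L')" if "z \<in> set xs'" for z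
    using line_legs_at[OF l(2)] that by blast
  show "set xs \<inter> set xs' = {}" using at at' disj by blast
  have links: "vat G (fst m) \<in> set (line_verts r L)" "vat G (opp (fst m)) \<in> set (line_verts r L)"
    if "line G r L xs" "m \<in> set L" for m r L xs
  proof -
    obtain A B where AB: "L = A @ m # B" using \<open>m \<in> set L\<close> by (meson split_list)
    note k = line_link[OF that(1)[unfolded AB]]
    show "vat G (fst m) \<in> set (line_verts r L)" unfolding k(1) AB by (rule last_vert_in_line_verts)
    show "vat G (opp (fst m)) \<in> set (line_verts r L)" unfolding k(2) AB by simp
  qed
  show "set (link_edges L) \<inter> set (link_edges L') = {}"
  proof (rule ccontr)
    assume "set (link_edges L) \<inter> set (link_edges L') \<noteq> {}"
    then obtain e where e: "e \<in> set (link_edges L)" "e \<in> set (link_edges L')" by blast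
    obtain m where "m \<in> set L" "e = fst (fst m)" using e(1) by auto
    moreover obtain m' where "m' \<in> set L'" "e = fst (fst m')" using e(2) by auto
    ultimately have m: "m \<in> set L" "m' \<in> set L'" "fst (fst m) = fst (fst m')" by simp_all
    then have "fst m = fst m' \<or> fst m = opp (fst m')" by (simp add: same_edge_iff)
    then show False using links[OF l(1) m(1)] links[OF l(2) m(2)] disj by (metis disjoint_iff)
  qed
  show "l' \<in> set L' \<Longrightarrow> fst l' \<notin> set xs \<and> opp (fst l') \<notin> set xs"
    using links[OF l(2), of l'] at disj by blast
qed

text \<open>A collapse moves only legs of its own line, and only between vertices of that
  line.\<close>

lemma line_cat_other:
  assumes G: "ok G" and l: "line G r L xs" "line G r' L' xs'"
    and disj: "set (line_verts r L) \<inter> set (line_verts r' L') = {}"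
    and v: "v \<in> permutations_of_set (set xs)"
  shows "line (cat G r L v) r' L' xs'"
proof -
  note d = lines_disjoint[OF G l disj]
  note p = permutation_of_legs[OF l(1) v]
  have vat: "vat (cat G r L v) h = vat G h" if "h \<notin> set xs" for h
    using that p(3) by (intro vat_cat_notin) auto
  have targets: "vat (cat G r L v) h \<in> set (line_verts r L)" if "h \<in> set xs" for h
  proof -
    have "vat (cat G r L v) h \<in> set (map (vat (cat G r L v)) v)" using that p(3) by simp
    then have "vat (cat G r L v) h \<in> set (map snd L @ [last_vert r L])"
      unfolding vat_cat_legs[OF p(1,2)] .
    then have "vat (cat G r L v) h \<in> set (map snd L) \<or> vat (cat G r L v) h = last_vert r L" by simp blast
    then show ?thesis
      using last_vert_in_line_verts[of r L "[]"] by (metis append_Nil2 list.set_intros(2))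
  qed
  show ?thesis unfolding line_def
  proof (intro conjI)
    show "distinct (line_verts r' L')" "distinct (link_edges L')" using lineD[OF l(2)] by simp_all
    show "set (line_verts r' L') \<subseteq> externals (cat G r L v)"
      using lineD(3)[OF l(2)] disj by auto
    show "set (link_edges L') \<subseteq> solids (cat G r L v)"
      using lineD(4)[OF l(2)] d(2) unfolding cat_simps by blast
    have "map (vat (cat G r L v) \<circ> fst) L' = map (vat G \<circ> fst) L'"
      by (rule map_cong[OF refl]) (simp add: vat d(3))
    then show "map (vat (cat G r L v) \<circ> fst) L' = sources r' L'" unfolding lineD(5)[OF l(2)] .
    have "map (vat (cat G r L v) \<circ> opp \<circ> fst) L' = map (vat G \<circ> opp \<circ> fst) L'"
      by (rule map_cong[OF refl]) (simp add: vat d(3))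
    then show "map (vat (cat G r L v) \<circ> opp \<circ> fst) L' = map snd L'" unfolding lineD(6)[OF l(2)] .
    have "map (vat (cat G r L v)) xs' = map (vat G) xs'"
      by (rule map_cong[OF refl]) (use vat d(1) in blast)
    then show "map (vat (cat G r L v)) xs' = line_verts r' L'" unfolding lineD(7)[OF l(2)] .
    show "fst ` set xs' \<subseteq> dashed (cat G r L v)" using lineD(8)[OF l(2)] by (auto simp: dashed_def)
    show "\<forall>h\<in>half_edges (cat G r L v). fst h \<in> solids (cat G r L v) \<longrightarrow>
        vat (cat G r L v) h \<in> set (line_verts r' L') \<longrightarrow> fst h \<in> set (link_edges L')"
    proof (intro ballI impI)
      fix h assume h: "h \<in> half_edges (cat G r L v)" "fst h \<in> solids (cat G r L v)"
        "vat (cat G r L v) h \<in> set (line_verts r' L')"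
      have "h \<notin> set xs" using targets[of h] h(3) disj by blast
      then show "fst h \<in> set (link_edges L')"
        using lineD(9)[OF l(2), of h] h vat[of h] by simp
    qed
  qed
qed

lemma cat_commute:
  assumes "set v \<inter> set v' = {}" "length v = Suc (length L)" "length v' = Suc (length L')"
  shows "cat (cat G r L v) r' L' v' = cat (cat G r' L' v') r L v"
proof -
  have "override (override (vat G) v (map snd L @ [last_vert r L])) v' (map snd L' @ [last_vert r' L'])
      = override (override (vat G) v' (map snd L' @ [last_vert r' L'])) v (map snd L @ [last_vert r L])"
    using assms by (intro override_commute) auto
  moreover have "A - B - C = A - C - B" for A B C :: "nat set" by auto
  ultimately show ?thesis by (simp add: cat_def)
qed

section \<open>Collapsing one more line\<close>

lemma change_sign_cong:
  "verts G' = verts G \<Longrightarrow> edges G' = edges G \<Longrightarrow> change_sign G' f h c c' = change_sign G f h c c'"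
  by (cases c; cases c') auto

lemma euler_cong':
  "(\<And>v. v \<in> permutations_of_set (set xs) \<Longrightarrow> C v = k * D v) \<Longrightarrow> euler C xs m = k * euler D xs m"
  unfolding euler_mult[symmetric] by (rule euler_cong)

lemma ihx_expansions_sites:
  assumes G: "ok G" and e: "ihx_expansions G e G2 G3"
  obtains u v h h' k k' where "ihx_site G (e, False) u v h h' k k'" "ihx_site G (e, False) u v h h' k' k"
    "G2 = G\<lparr>vat := (vat G)(h' := v, k := u)\<rparr>" "G3 = G\<lparr>vat := (vat G)(h' := v, k' := u)\<rparr>"
proof -
  obtain u v h h' k k' where e: "e \<in> dashed G" "vat G (e, False) = u" "vat G (e, True) = v"
    "u \<in> internals G" "v \<in> internals G" "u \<noteq> v" "halves_at G u - {(e, False)} = {h, h'}" "h \<noteq> h'"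
    "halves_at G v - {(e, True)} = {k, k'}" "k \<noteq> k'" "G2 = attach h' v (attach k u G)"
    "G3 = attach h' v (attach k' u G)"
    using e unfolding ihx_expansions_def by blast
  have opp: "opp (e, False) = (e, True)" by (simp add: opp_def)
  have he: "(e, False) \<in> half_edges G" "(e, True) \<in> half_edges G" using e(1) by (auto simp: half_edges_def dashed_def)
  have at: "halves_at G u = {(e, False), h, h'}" "halves_at G v = {(e, True), k, k'}"
    using e(2,3,7,9) he by (auto simp: halves_at_def)
  have ne: "(e, False) \<noteq> h" "(e, False) \<noteq> h'" "(e, True) \<noteq> k" "(e, True) \<noteq> k'"
    using e(7,9) by blast+
  have s1: "ihx_site G (e, False) u v h h' k k'"
    using G e ne he at unfolding ihx_site_def opp by (simp add: internals_def)
  have s2: "ihx_site G (e, False) u v h h' k' k"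
    using G e ne he at unfolding ihx_site_def opp by (simp add: internals_def insert_commute)
  have "vat G h' = u" "vat G k = v" "vat G k' = v" using at by (auto simp: halves_at_def)
  then have "h' \<noteq> k" "h' \<noteq> k'" using e(6) by auto
  then have "G2 = G\<lparr>vat := (vat G)(h' := v, k := u)\<rparr>" "G3 = G\<lparr>vat := (vat G)(h' := v, k' := u)\<rparr>"
    using e(11,12) by (simp_all add: attach_def fun_upd_twist)
  then show thesis using that s1 s2 by blast
qed

text \<open>The additional assumption says that within the range of \<open>W\<close> replacing a
  line does not change the value. It is used for a second line inside the caterpillars of a first
  one, and so makes the order of replacement irrelevant.\<close>

locale good_weight = weight +
  assumes line_value: "ok G \<Longrightarrow> card (solids G) \<le> n \<Longrightarrow> is_coloring par G c \<Longrightarrow> line G r L xs \<Longrightarrow>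
    W (G, c) = line_value W c G r L xs"
begin

text \<open>Collapsing a line with at least one link leaves at most \<open>n\<close> solid edges, so
  the second line may be replaced inside each caterpillar of the first.\<close>

lemma line_value_disjoint:
  assumes G: "ok G" "card (solids G) \<le> Suc n" "is_coloring par G c"
    and l: "line G r L xs" "L \<noteq> []" "line G r' L' xs'"
    and disj: "set (line_verts r L) \<inter> set (line_verts r' L') = {}"
  shows "line_value W c G r L xs = (if L = [] then 1 else 2 * (-1) ^ length L)
    * ((if L' = [] then 1 else 2 * (-1) ^ length L') *
      euler (\<lambda>v. euler (\<lambda>v'. W (cat (cat G r L v) r' L' v', c)) xs' (last xs')) xs (last xs))"
proof -
  have "euler (\<lambda>v. W (cat G r L v, c)) xs (last xs) = (if L' = [] then 1 else 2 * (-1) ^ length L')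
      * euler (\<lambda>v. euler (\<lambda>v'. W (cat (cat G r L v) r' L' v', c)) xs' (last xs')) xs (last xs)"
  proof (rule euler_cong')
    fix v assume v: "v \<in> permutations_of_set (set xs)"
    have "card (solids (cat G r L v)) \<le> n" using card_solids_cat[OF G(1) l(1)] G(2) l(2) by (cases L) auto
    then have "W (cat G r L v, c) = line_value W c (cat G r L v) r' L' xs'"
      using G(3) line_cat_other[OF G(1) l(1,3) disj v] by (intro line_value ok_cat[OF G(1) l(1) v]) auto
    then show "W (cat G r L v, c) = (if L' = [] then 1 else 2 * (-1) ^ length L')
      * euler (\<lambda>v'. W (cat (cat G r L v) r' L' v', c)) xs' (last xs')"
      unfolding line_value_def .
  qed
  then show ?thesis unfolding line_value_def[of W c G] by simp
qed

text \<open>For disjoint lines the double sum is symmetric. Lines with a common vertex agree up to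
  direction, which \<open>line_value_rev\<close> covers.\<close>

lemma line_value_unique:
  assumes G: "ok G" "card (solids G) \<le> Suc n" "is_coloring par G c"
    and l: "line G r L xs" "L \<noteq> []" "line G r' L' xs'" "L' \<noteq> []"
  shows "line_value W c G r L xs = line_value W c G r' L' xs'"
proof (cases "set (line_verts r L) \<inter> set (line_verts r' L') = {}")
  case True
  then have True': "set (line_verts r' L') \<inter> set (line_verts r L) = {}" by (simp only: Int_commute)
  have "euler (\<lambda>v. euler (\<lambda>v'. W (cat (cat G r L v) r' L' v', c)) xs' (last xs')) xs (last xs)
      = euler (\<lambda>v. euler (\<lambda>v'. W (cat (cat G r' L' v') r L v, c)) xs' (last xs')) xs (last xs)"
  proof (rule euler_cong, rule euler_cong)
    fix v v' assume v: "v \<in> permutations_of_set (set xs)" "v' \<in> permutations_of_set (set xs')"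
    note p = permutation_of_legs[OF l(1) v(1)] and p' = permutation_of_legs[OF l(3) v(2)]
    have "cat (cat G r L v) r' L' v' = cat (cat G r' L' v') r L v"
      using lines_disjoint(1)[OF G(1) l(1,3) True] p p' by (intro cat_commute) auto
    then show "W (cat (cat G r L v) r' L' v', c) = W (cat (cat G r' L' v') r L v, c)" by simp
  qed
  also have "\<dots> = euler (\<lambda>v'. euler (\<lambda>v. W (cat (cat G r' L' v') r L v, c)) xs (last xs)) xs' (last xs')"
    by (rule euler_swap_sums)
  finally show ?thesis
    unfolding line_value_disjoint[OF G l(1,2,3) True] line_value_disjoint[OF G l(3,4,1) True'] by simp
next
  case False
  then obtain p where "p \<in> set (line_verts r L)" "p \<in> set (line_verts r' L')" by blast
  from line_unique[OF G(1) l(1,3) this] show ?thesis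
  proof
    assume "r' = last_vert r L \<and> L' = revl r L \<and> xs' = rev xs"
    moreover have "card (solids G) \<le> n + length L" using G(2) l(2) by (cases L) auto
    ultimately show ?thesis using line_value_rev[OF G(1) l(1) G(3)] by simp
  qed simp
qed

text \<open>The choice of the line does not matter by \<open>line_value_unique\<close>.\<close>

definition extended :: "colored_graph \<Rightarrow> rat" where
  "extended D = (case D of (G, c) \<Rightarrow> if card (solids G) \<le> n then W (G, c)
     else (case (SOME (r, L, xs). line G r L xs \<and> L \<noteq> []) of (r, L, xs) \<Rightarrow> line_value W c G r L xs))"

lemma extended_low: "card (solids G) \<le> n \<Longrightarrow> extended (G, c) = W (G, c)"
  by (simp add: extended_def)

lemma exists_line:
  assumes "ok G" "solids G \<noteq> {}"
  shows "\<exists>r L xs. line G r L xs \<and> L \<noteq> []"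
proof -
  obtain e where e: "e \<in> solids G" using assms(2) by blast
  let ?h = "(e, False)"
  have h: "?h \<in> half_edges G" using e okD(5)[OF assms(1)] by (auto simp: half_edges_def)
  have ext: "vat G ?h \<in> externals G"
    using no_solid_at_internal[OF assms(1) okD(3)[OF assms(1) h] _ h refl] e by auto
  then have "vertex_ok G (vat G ?h)" using okD(3,8)[OF assms(1)] h by blast
  then obtain r L xs where l: "line G r L xs" "vat G ?h \<in> set (line_verts r L)"
    using ext unfolding vertex_ok_def by auto
  then have "fst ?h \<in> set (link_edges L)" using lineD(9)[OF l(1) h] e by simp
  then have "L \<noteq> []" by auto
  then show ?thesis using l(1) by blast
qed

text \<open>The caterpillars of such a line have at most \<open>n\<close> solid edges, where the
  extension is still \<open>W\<close>.\<close>

lemma line_value_extended: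
  assumes G: "ok G" "card (solids G) \<le> Suc n" and l: "line G r L xs" "L \<noteq> []"
  shows "line_value extended c G r L xs = line_value W c G r L xs"
proof -
  have "card (solids (cat G r L v)) \<le> n" for v
    using card_solids_cat[OF G(1) l(1)] G(2) l(2) by (cases L) auto
  then show ?thesis unfolding line_value_def by (simp add: extended_low)
qed

lemma extended_line_value:
  assumes G: "ok G" "card (solids G) \<le> Suc n" "is_coloring par G c" and l: "line G r L xs" "L \<noteq> []"
  shows "extended (G, c) = line_value W c G r L xs"
proof (cases "card (solids G) \<le> n")
  case True
  then show ?thesis using extended_low[OF True] line_value[OF G(1) True G(3) l(1)] by simp
next
  case False
  obtain r' L' xs' where s: "(SOME (r, L, xs). line G r L xs \<and> L \<noteq> []) = (r', L', xs')"
    by (rule prod_cases3)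
  have "\<exists>p. case p of (r, L, xs) \<Rightarrow> line G r L xs \<and> L \<noteq> []" using l by blast
  from someI_ex[OF this] have "line G r' L' xs' \<and> L' \<noteq> []" unfolding s by simp
  then have "line_value W c G r' L' xs' = line_value W c G r L xs"
    using line_value_unique[OF G _ _ l] by blast
  then show ?thesis using False s by (simp add: extended_def)
qed

text \<open>Every property passes through the sum over caterpillars: isomorphisms carry caterpillars
  to caterpillars, and an IHX move takes place at internal vertices, which lie on no line.\<close>

lemma good_extended: "good_weight par (Suc n) extended"
proof
  fix G :: graph and G' c c' f h
  assume G: "ok G" "ok G'" "card (solids G) \<le> Suc n" "is_coloring par G c" "is_coloring par G' c'"
    and iso: "graph_iso G G' f h"
  note d = graph_isoD[OF iso]
  have card: "card (solids G') = card (solids G)"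
  proof -
    have inj: "inj_on h (half_edges G)" using d(3) by (simp add: bij_betw_def)
    \<comment> \<open>An isomorphism acts on half-edges, so solid edges are counted by their two
      halves.\<close>
    have "solids G' \<times> UNIV = h ` (solids G \<times> UNIV)"
    proof (intro equalityI subsetI)
      fix x assume x: "x \<in> solids G' \<times> (UNIV :: bool set)"
      then have "x \<in> half_edges G'" using okD(5)[OF G(2)] by (auto simp: half_edges_def)
      then obtain y where y: "y \<in> half_edges G" "x = h y" using d(3) by (metis bij_betw_def imageE)
      have "y \<in> solids G \<times> UNIV" using d(6)[OF y(1)] x y(2) by (simp add: mem_Times_iff)
      then show "x \<in> h ` (solids G \<times> UNIV)" using y(2) by blast
    next
      fix x assume "x \<in> h ` (solids G \<times> UNIV)"
      then obtain y where y: "x = h y" "y \<in> solids G \<times> UNIV" by blast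
      then have "fst y \<in> edges G" using okD(5)[OF G(1)] by (auto simp: mem_Times_iff)
      then have "y \<in> half_edges G" by (simp add: in_half_edges)
      then show "x \<in> solids G' \<times> UNIV" using d(6)[of y] y by (simp add: mem_Times_iff)
    qed
    moreover have "inj_on h (solids G \<times> UNIV)"
      using inj okD(5)[OF G(1)] by (auto simp: half_edges_def intro: inj_on_subset)
    ultimately have "card (solids G' \<times> (UNIV :: bool set)) = card (solids G \<times> (UNIV :: bool set))"
      by (simp add: card_image)
    then show ?thesis by (simp add: card_cartesian_product)
  qed
  show "extended (G', c') = of_int (change_sign G f h c c') * extended (G, c)"
  proof (cases "card (solids G) \<le> n")
    case True
    then show ?thesis using equivariant[OF G(1,2) True G(4,5) iso] card by (simp add: extended_low)
  next
    case False
    then have "solids G \<noteq> {}" by auto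
    then obtain r L xs where l: "line G r L xs" "L \<noteq> []" using exists_line[OF G(1)] by blast
    have l': "line G' (f r) (links_image f h L) (map h xs)" by (rule iso_line[OF iso G(1) l(1)])
    have ne: "xs \<noteq> []" using line_legs_length[OF l(1)] by auto
    have "euler (\<lambda>v. W (cat G' (f r) (links_image f h L) v, c')) (map h xs) (h (last xs))
        = euler (\<lambda>v. W (cat G' (f r) (links_image f h L) (map h v), c')) xs (last xs)"
    proof (rule euler_map)
      have "set xs \<subseteq> half_edges G" using in_line_half_edges(2)[OF G(1) l(1)] by blast
      then show "inj_on h (set xs)" using d(3) by (auto simp: bij_betw_def intro: inj_on_subset)
    qed (use ne in simp)
    also have "\<dots> = of_int (change_sign G f h c c') * euler (\<lambda>v. W (cat G r L v, c)) xs (last xs)"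
    proof (rule euler_cong')
      fix v assume v: "v \<in> permutations_of_set (set xs)"
      have inj: "inj_on h (set xs)"
        using d(3) in_line_half_edges(2)[OF G(1) l(1)] by (auto simp: bij_betw_def intro: inj_on_subset)
      have v': "map h v \<in> permutations_of_set (set (map h xs))"
        using permutations_of_set_image_inj[OF inj] v by simp
      have "card (solids (cat G r L v)) \<le> n"
        using card_solids_cat[OF G(1) l(1)] G(3) l(2) by (cases L) auto
      then show "W (cat G' (f r) (links_image f h L) (map h v), c')
          = of_int (change_sign G f h c c') * W (cat G r L v, c)"
        using equivariant[OF ok_cat[OF G(1) l(1) v] ok_cat[OF G(2) l' v'] _ _ _ iso_cat[OF iso G(1) l(1) v]]
          G(4,5) change_sign_cong[of "cat G r L v" G] by simp
    qed
    finally show ?thesis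
      using extended_line_value[OF G(1,3,4) l] extended_line_value[OF G(2) _ G(5) l'] G(3) card l(2) ne
      by (simp add: line_value_def last_map)
  qed
next
  fix G :: graph and c e G2 G3
  assume G: "ok G" "card (solids G) \<le> Suc n" "is_coloring par G c" and e: "ihx_expansions G e G2 G3"
  obtain u v h h' k k' where s: "ihx_site G (e, False) u v h h' k k'" "ihx_site G (e, False) u v h h' k' k"
    "G2 = G\<lparr>vat := (vat G)(h' := v, k := u)\<rparr>" "G3 = G\<lparr>vat := (vat G)(h' := v, k' := u)\<rparr>"
    by (rule ihx_expansions_sites[OF G(1) e])
  interpret A: ihx_site G "(e, False)" u v h h' k k' by (rule s(1))
  interpret B: ihx_site G "(e, False)" u v h h' k' k by (rule s(2))
  have G23: "G2 = A.swapped" "G3 = B.swapped" using s(3,4) by (simp_all add: A.swapped_def B.swapped_def)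
  have same: "verts G2 = verts G" "edges G2 = edges G" "solids G2 = solids G"
     "verts G3 = verts G" "edges G3 = edges G" "solids G3 = solids G" by (simp_all add: G23)
  have col: "is_coloring par G2 c" "is_coloring par G3 c"
    using G(3) is_coloring_cong[of G2 G] is_coloring_cong[of G3 G] same by simp_all
  show "extended (G, c) + extended (G2, c) + extended (G3, c) = 0"
  proof (cases "card (solids G) \<le> n")
    case True
    then show ?thesis using ihx[OF G(1) True G(3) e] same by (simp add: extended_low)
  next
    case False
    then have "solids G \<noteq> {}" by auto
    then obtain r L xs where l: "line G r L xs" "L \<noteq> []" using exists_line[OF G(1)] by blast
    have not_line: "z \<notin> {h', k, k'}" if "vat G z \<in> set (line_verts r L)" for z
      using that A.vats A.up lineD(3)[OF l(1)] by auto
    have other: "line H r L xs" if H: "H = G\<lparr>vat := vat H\<rparr>" "\<And>z. z \<notin> {h', k, k'} \<Longrightarrow> vat H z = vat G z"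
        "\<And>z. z \<in> {h', k, k'} \<Longrightarrow> vat H z \<in> {u, v}" for H
    proof -
      have HE: "externals H = externals G" "solids H = solids G" "half_edges H = half_edges G" "dashed H = dashed G"
        using arg_cong[OF H(1), of externals] arg_cong[OF H(1), of solids] arg_cong[OF H(1), of half_edges]
          arg_cong[OF H(1), of dashed] by (simp_all add: dashed_def)
      have keep: "vat H z = vat G z" if "vat G z \<in> set (line_verts r L)" for z
        using H(2) not_line[OF that] by blast
      have links: "vat G (fst m) \<in> set (line_verts r L)" "vat G (opp (fst m)) \<in> set (line_verts r L)"
        if "m \<in> set L" for m
      proof -
        obtain P Q where PQ: "L = P @ m # Q" using \<open>m \<in> set L\<close> by (meson split_list)
        note kk = line_link[OF l(1)[unfolded PQ]]
        show "vat G (fst m) \<in> set (line_verts r L)" unfolding kk(1) PQ by (rule last_vert_in_line_verts)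
        show "vat G (opp (fst m)) \<in> set (line_verts r L)" unfolding kk(2) PQ by simp
      qed
      have legs: "vat G z \<in> set (line_verts r L)" if "z \<in> set xs" for z
        using line_legs_at[OF l(1)] that by blast
      have m1: "map (vat H \<circ> fst) L = map (vat G \<circ> fst) L" "map (vat H \<circ> opp \<circ> fst) L = map (vat G \<circ> opp \<circ> fst) L"
        "map (vat H) xs = map (vat G) xs"
        using keep links legs by (auto intro!: map_cong simp del: set_simps)
      have stay: "vat G z = vat H z" if "vat H z \<in> set (line_verts r L)" for z
      proof -
        have "vat H z \<notin> {u, v}" using that lineD(3)[OF l(1)] A.up by auto
        then show ?thesis using H(2,3) by metis
      qed
      show ?thesis
        using l(1) stay unfolding line_def HE m1 by metis
    qed
    have vv: "vat G2 z = (if z = k then u else if z = h' then v else vat G z)"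
       "vat G3 z = (if z = k' then u else if z = h' then v else vat G z)" for z
      using s(3,4) by simp_all
    have l2: "line G2 r L xs" "line G3 r L xs"
      by (rule other; use vv A.vats in \<open>auto simp: s(3,4)\<close>)+
    \<comment> \<open>The expansion and the collapse move disjoint sets of half-edges, hence
      commute.\<close>
    have iexp: "ihx_expansions (cat G r L p) e (cat G2 r L p) (cat G3 r L p)"
      if p: "p \<in> permutations_of_set (set xs)" for p
    proof -
      note pp = permutation_of_legs[OF l(1) p]
      have np: "z \<notin> {h', k, k'}" if "z \<in> set p" for z
        using not_line[of z] line_legs_at[OF l(1)] that pp(3) by blast
      have "vat (cat G2 r L p) = (vat (cat G r L p))(h' := v, k := u)"
        "vat (cat G3 r L p) = (vat (cat G r L p))(h' := v, k' := u)"
      proof -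
        have "vat (cat H r L p) z = (if z \<in> {h', k, k'} then vat H z else vat (cat G r L p) z)"
          if "\<And>z. z \<notin> {h', k, k'} \<Longrightarrow> vat H z = vat G z" for H z
        proof (cases "z \<in> set p")
          case True
          have "override (vat H) p (map snd L @ [last_vert r L]) z = override (vat G) p (map snd L @ [last_vert r L]) z"
            using pp(2) by (intro override_in[OF True]) simp
          then show ?thesis using np[OF True] by (simp add: cat_def)
        next
          case False
          then show ?thesis using that by (simp add: vat_cat_notin)
        qed
        note gen = this
        have npk: "k \<notin> set p" "k' \<notin> set p" "h' \<notin> set p" using np by blast+
        show "vat (cat G2 r L p) = (vat (cat G r L p))(h' := v, k := u)"
          using gen[of G2] vv(1) npk A.distinct_halves A.at_p by (auto simp: fun_eq_iff vat_cat_notin)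
        show "vat (cat G3 r L p) = (vat (cat G r L p))(h' := v, k' := u)"
          using gen[of G3] vv(2) npk A.distinct_halves A.at_p by (auto simp: fun_eq_iff vat_cat_notin)
      qed
      then have c23: "cat G2 r L p = (cat G r L p)\<lparr>vat := (vat (cat G r L p))(h' := v, k := u)\<rparr>"
        "cat G3 r L p = (cat G r L p)\<lparr>vat := (vat (cat G r L p))(h' := v, k' := u)\<rparr>"
        by (simp_all add: s(3,4) cat_def)
      let ?H = "cat G r L p"
      have at: "halves_at ?H q = halves_at G q" if q: "q \<notin> externals G" for q
      proof (rule halves_at_congI)
        fix z assume "z \<in> half_edges G"
        show "vat ?H z = q \<longleftrightarrow> vat G z = q"
        proof (cases "z \<in> set p")
          case True
          have "vat ?H z \<in> set (map snd L @ [last_vert r L])"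
            unfolding vat_cat_legs[OF pp(1,2), of G r, symmetric] using True by simp
          moreover have "set (map snd L @ [last_vert r L]) \<subseteq> set (line_verts r L)"
            using last_vert_in[of r L] by auto
          ultimately have "vat ?H z \<in> externals G" using lineD(3)[OF l(1)] by blast
          moreover have "vat G z \<in> externals G"
            using line_legs_at[OF l(1)] lineD(3)[OF l(1)] True pp(3) by blast
          ultimately show ?thesis using q by auto
        qed (simp add: vat_cat_notin)
      qed simp
      have e': "e \<in> dashed ?H" "u \<in> internals ?H" "v \<in> internals ?H"
        "vat ?H (e, False) = u" "vat ?H (e, True) = v"
      proof -
        have "vat G (e, False) = u" "vat G (e, True) = v" using A.b by (simp_all add: opp_def)
        moreover have "(e, False) \<notin> set p" "(e, True) \<notin> set p"
          using calculation line_legs_at[OF l(1)] lineD(3)[OF l(1)] pp(3) A.up by blast+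
        ultimately show "vat ?H (e, False) = u" "vat ?H (e, True) = v" by (simp_all add: vat_cat_notin)
        have "e \<in> dashed G" using e unfolding ihx_expansions_def by blast
        then show "e \<in> dashed ?H" by (simp add: dashed_def)
        show "u \<in> internals ?H" "v \<in> internals ?H" using A.uV A.up by (auto simp: internals_def)
      qed
      have rest: "halves_at ?H u - {(e, False)} = {h, h'}" "halves_at ?H v - {(e, True)} = {k, k'}"
        unfolding at[OF A.up(1)] at[OF A.up(2)] using A.at_u A.at_p by (auto simp: opp_def)
      have ch: "cat G2 r L p = attach h' v (attach k u ?H)" "cat G3 r L p = attach h' v (attach k' u ?H)"
        unfolding c23 using A.distinct_halves by (simp_all add: attach_def fun_upd_twist)
      show "ihx_expansions ?H e (cat G2 r L p) (cat G3 r L p)"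
        unfolding ihx_expansions_def
        using e' rest ch A.b(4) A.at_u(4) A.at_p(4)
        by (intro exI[of _ u] exI[of _ v] exI[of _ h] exI[of _ h'] exI[of _ k] exI[of _ k']) simp
    qed
    have "euler (\<lambda>p. W (cat G r L p, c) + W (cat G2 r L p, c) + W (cat G3 r L p, c)) xs (last xs)
        = 0 * euler (\<lambda>p. 0) xs (last xs)"
    proof (rule euler_cong')
      fix p assume p: "p \<in> permutations_of_set (set xs)"
      have "card (solids (cat G r L p)) \<le> n"
        using card_solids_cat[OF G(1) l(1)] G(2) l(2) by (cases L) auto
      then show "W (cat G r L p, c) + W (cat G2 r L p, c) + W (cat G3 r L p, c) = 0 * 0"
        using ihx[OF ok_cat[OF G(1) l(1) p] _ _ iexp[OF p]] G(3) by simp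
    qed
    then have "euler (\<lambda>p. W (cat G r L p, c)) xs (last xs) + euler (\<lambda>p. W (cat G2 r L p, c)) xs (last xs)
      + euler (\<lambda>p. W (cat G3 r L p, c)) xs (last xs) = 0"
      unfolding euler_add by simp
    then have "line_value W c G r L xs + line_value W c G2 r L xs + line_value W c G3 r L xs = 0"
      unfolding line_value_def distrib_left[symmetric] by simp
    moreover have "ok G2" "ok G3" unfolding G23 by (rule A.ok_swapped B.ok_swapped)+
    ultimately show ?thesis
      using extended_line_value[OF G l] extended_line_value[OF _ _ col(1) l2(1) l(2)]
        extended_line_value[OF _ _ col(2) l2(2) l(2)] G(2) same by simp
  qed
next
  fix G :: graph and c r L xs
  assume G: "ok G" "card (solids G) \<le> Suc n" "is_coloring par G c" and l: "line G r L xs"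
  show "extended (G, c) = line_value extended c G r L xs"
  proof (cases "L = []")
    case True
    then obtain x where "xs = [x]" using line_legs_length[OF l] by (auto simp: length_Suc_conv)
    then show ?thesis using line_value_single[of G r x extended c] l True by simp
  next
    case False
    then show ?thesis
      using extended_line_value[OF G l False] line_value_extended[OF G(1,2) l False] by simp
  qed
qed

end

section \<open>Contraction and recoloring\<close>

lemma renumbering_cong:
  assumes "\<And>u. u \<in> A \<Longrightarrow> l u = m u" "\<And>u. u \<in> A \<Longrightarrow> l' u = m' u"
  shows "renumbering A l l' = renumbering A m m'"
proof
  fix i
  have img: "l ` A = m ` A" using assms(1) by (rule image_cong[OF refl])
  have inv: "inv_into A l i = inv_into A m i"
    unfolding inv_into_def
  proof (rule arg_cong[where f = Eps], rule ext)
    fix u show "(u \<in> A \<and> l u = i) = (u \<in> A \<and> m u = i)" using assms(1) by auto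
  qed
  show "renumbering A l l' i = renumbering A m m' i"
  proof (cases "i \<in> m ` A")
    case True
    then show ?thesis using assms(2)[OF inv_into_into[OF True]] by (simp add: renumbering_def img inv)
  qed (simp add: renumbering_def img)
qed

text \<open>If \<open>v\<close> belongs to \<open>A\<close>, its number is a fixed point of the
  renumbering, and outside the range of numbers a renumbering is the identity anyway.\<close>

lemma renumbering_restrict:
  assumes "inj_on l A" "l v = l' v"
  shows "renumbering (A - {v}) l l' = renumbering A l l'"
proof
  fix i
  have inj: "inj_on l (A - {v})" using assms(1) by (rule inj_on_subset) auto
  show "renumbering (A - {v}) l l' i = renumbering A l l' i"
  proof (cases "i \<in> l ` (A - {v})")
    case True
    then obtain u where "u \<in> A - {v}" "i = l u" by auto
    then show ?thesis using assms(1) inj by (auto simp: renumbering_def)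
  next
    case False
    show ?thesis
    proof (cases "i \<in> l ` A")
      case True
      then have v: "i = l v" "v \<in> A" using False by auto
      then have "renumbering A l l' i = l v"
        using assms inv_into_f_f[OF assms(1) v(2)] by (simp add: renumbering_def)
      then show ?thesis using False v(1) by (simp add: renumbering_def)
    qed (use False in \<open>simp add: renumbering_def\<close>)
  qed
qed

text \<open>The renumbering is \<open>t\<close> transported along \<open>l\<close> from elements to
  numbers, and transport takes transpositions to transpositions.\<close>

lemma sign_renumbering:
  assumes "finite A" "inj_on l A" "t permutes A"
  shows "permutation (renumbering A l (l \<circ> t)) \<and> sign (renumbering A l (l \<circ> t)) = sign t"
  using assms(3,1)
proof (induction rule: permutes_induct)
  case id
  have "renumbering A l (l \<circ> id) = id"
    by (auto simp: renumbering_def fun_eq_iff f_inv_into_f)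
  then show ?case by (simp add: permutation_id)
next
  case (swap a b p)
  have eq: "renumbering A l (l \<circ> (transpose a b \<circ> p)) = transpose (l a) (l b) \<circ> renumbering A l (l \<circ> p)"
  proof
    fix i
    show "renumbering A l (l \<circ> (transpose a b \<circ> p)) i = (transpose (l a) (l b) \<circ> renumbering A l (l \<circ> p)) i"
    proof (cases "i \<in> l ` A")
      case True
      then obtain u where u: "u \<in> A" "i = l u" by auto
      have "p u \<in> A" using swap(4) u(1) by (simp add: permutes_in_image)
      then have "l (p u) = l a \<longleftrightarrow> p u = a" "l (p u) = l b \<longleftrightarrow> p u = b"
        using assms(2) swap(1,2) by (simp_all add: inj_on_eq_iff)
      then show ?thesis using u assms(2) by (auto simp: renumbering_def transpose_def)
    next
      case False
      then have "i \<noteq> l a" "i \<noteq> l b" using swap(1,2) by auto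
      then show ?thesis using False by (simp add: renumbering_def)
    qed
  qed
  have "l a \<noteq> l b" using assms(2) swap(1-3) by (simp add: inj_on_eq_iff)
  moreover have "permutation p" using swap(4) assms(1) by (auto simp: permutation_permutes)
  ultimately show ?case
    unfolding eq using swap(3,5)
    by (simp only: sign_compose permutation_compose permutation_swap_id sign_swap_id if_False simp_thms)
qed

lemma obtain_renumbering:
  assumes "bij_betw l A B" "bij_betw l' A B"
  obtains t where "t permutes A" "\<And>u. u \<in> A \<Longrightarrow> l' u = l (t u)"
proof -
  define t where "t u = (if u \<in> A then inv_into A l (l' u) else u)" for u
  have "bij_betw (inv_into A l \<circ> l') A A"
    using bij_betw_trans[OF assms(2) bij_betw_inv_into[OF assms(1)]] .
  then have "bij_betw t A A" by (simp add: t_def cong: bij_betw_cong)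
  then have "t permutes A" by (intro bij_imp_permutes) (auto simp: t_def)
  moreover have "l' u = l (t u)" if "u \<in> A" for u
  proof -
    have "l' u \<in> l ` A" using assms that by (auto simp: bij_betw_def)
    then show ?thesis using that by (simp add: t_def f_inv_into_f)
  qed
  ultimately show thesis by (rule that)
qed

lemma sign_renumbering_eq:
  assumes "finite A" "inj_on l A" "t permutes A" "\<And>u. u \<in> A \<Longrightarrow> l' u = l (t u)"
  shows "sign (renumbering A l l') = sign t"
proof -
  have "renumbering A l l' = renumbering A l (l \<circ> t)"
    using assms(4) by (intro renumbering_cong) auto
  then show ?thesis using sign_renumbering[OF assms(1-3)] by simp
qed

lemma sign_renumbering_mult:
  assumes A: "finite A" and l: "bij_betw l A B" "bij_betw l' A B" "bij_betw l'' A B"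
  shows "sign (renumbering A l l') * sign (renumbering A l' l'') = sign (renumbering A l l'')"
proof -
  obtain t where t: "t permutes A" "\<And>u. u \<in> A \<Longrightarrow> l' u = l (t u)" by (rule obtain_renumbering[OF l(1,2)], blast)
  obtain s where s: "s permutes A" "\<And>u. u \<in> A \<Longrightarrow> l'' u = l' (s u)" by (rule obtain_renumbering[OF l(2,3)], blast)
  have inj: "inj_on l A" "inj_on l' A" using l by (simp_all add: bij_betw_def)
  have "l'' u = l ((t \<circ> s) u)" if "u \<in> A" for u
    using s t that by (simp add: permutes_in_image)
  then have "sign (renumbering A l l'') = sign (t \<circ> s)"
    using permutes_compose[OF s(1) t(1)] by (intro sign_renumbering_eq[OF A inj(1)])
  also have "\<dots> = sign t * sign s"
    using A s t by (intro sign_compose) (auto simp: permutation_permutes)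
  finally show ?thesis
    using sign_renumbering_eq[OF A inj(1) t] sign_renumbering_eq[OF A inj(2) s] by simp
qed

lemma sign_renumbering_comp:
  assumes A: "finite A" and l: "bij_betw l A B" "bij_betw l' A B" and g: "inj_on g B"
  shows "sign (renumbering A (g \<circ> l) (g \<circ> l')) = sign (renumbering A l l')"
proof -
  obtain t where t: "t permutes A" "\<And>u. u \<in> A \<Longrightarrow> l' u = l (t u)" by (rule obtain_renumbering[OF l], blast)
  have inj: "inj_on l A" "inj_on (g \<circ> l) A" using l g by (auto simp: bij_betw_def intro: comp_inj_on)
  show ?thesis
    using sign_renumbering_eq[OF A inj(1) t] sign_renumbering_eq[OF A inj(2) t(1), of "g \<circ> l'"] t by simp
qed

text \<open>As a product over edges, the sign of the reversals is visibly multiplicative, and the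
  factor of a contracted edge can be split off.\<close>

lemma minus_one_power_card:
  "finite A \<Longrightarrow> (-1 :: int) ^ card {e \<in> A. P e} = (\<Prod>e\<in>A. if P e then -1 else 1)"
proof (induction rule: finite_induct)
  case (insert x A)
  have "{e \<in> insert x A. P e} = (if P x then insert x {e \<in> A. P e} else {e \<in> A. P e})" by auto
  then show ?case using insert by simp
qed simp

section \<open>Signs of recolorings and their behaviour under contraction\<close>

abbreviation recolor_sign :: "graph \<Rightarrow> coloring \<Rightarrow> coloring \<Rightarrow> int" where
  "recolor_sign G \<equiv> change_sign G id id"

lemma recolor_sign_odd:
  "finite (edges G) \<Longrightarrow> recolor_sign G (OddColoring d l) (OddColoring d' l')
     = sign (renumbering (verts G) l l') * (\<Prod>e\<in>edges G. if d e \<noteq> d' e then -1 else 1)"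
  using minus_one_power_card[of "edges G" "\<lambda>e. d e \<noteq> d' e"] by simp

lemma coloring_cases:
  assumes "is_coloring par G c" "is_coloring par G c'"
  obtains d l d' l' where "par = OddCase" "c = OddColoring d l" "c' = OddColoring d' l'"
      "bij_betw l (verts G) {1..card (verts G)}" "bij_betw l' (verts G) {1..card (verts G)}"
    | k k' where "par = EvenCase" "c = EvenColoring k" "c' = EvenColoring k'"
      "bij_betw k (edges G) {1..card (edges G)}" "bij_betw k' (edges G) {1..card (edges G)}"
  using assms by (cases par; cases c; cases c') auto

lemma recolor_sign_mult:
  assumes G: "finite (verts G)" "finite (edges G)"
    and c: "is_coloring par G c" "is_coloring par G c'" "is_coloring par G c''"
  shows "recolor_sign G c c' * recolor_sign G c' c'' = recolor_sign G c c''"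
  using c(1,2)
proof (cases rule: coloring_cases)
  case (1 d l d' l')
  then obtain d'' l'' where c'': "c'' = OddColoring d'' l''" "bij_betw l'' (verts G) {1..card (verts G)}"
    using c(3) by (cases c'') auto
  have "(\<Prod>e\<in>edges G. if d e \<noteq> d' e then -1 else 1) * (\<Prod>e\<in>edges G. if d' e \<noteq> d'' e then -1 else 1)
      = (\<Prod>e\<in>edges G. if d e \<noteq> d'' e then -1 else 1 :: int)"
    unfolding prod.distrib[symmetric] by (intro prod.cong) auto
  then show ?thesis
    using sign_renumbering_mult[OF G(1) 1(4,5) c''(2)]
    unfolding 1(2,3) c''(1) recolor_sign_odd[OF G(2)] by (simp add: mult_ac flip: mult.assoc)
next
  case (2 k k')
  then obtain k'' where "c'' = EvenColoring k''" "bij_betw k'' (edges G) {1..card (edges G)}"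
    using c(3) by (cases c'') auto
  then show ?thesis using sign_renumbering_mult[OF G(2) 2(4,5)] 2 by simp
qed

lemma change_sign_cases:
  assumes "is_coloring par G c" "is_coloring par G' c'"
  shows "change_sign G f h c c' = 1 \<or> change_sign G f h c c' = -1"
proof (cases par)
  case OddCase
  then obtain d l d' l' where "c = OddColoring d l" "c' = OddColoring d' l'"
    using assms by (cases c; cases c') auto
  then show ?thesis
    by (simp add: sign_def minus_one_power_iff)
next
  case EvenCase
  then obtain k k' where "c = EvenColoring k" "c' = EvenColoring k'"
    using assms by (cases c; cases c') auto
  then show ?thesis by (simp add: sign_def)
qed

lemma recolor_sign_refl: "is_coloring par G c \<Longrightarrow> recolor_sign G c c = 1"
  by (cases par; cases c) (auto simp: renumbering_same)

lemma recolor_sign_sym: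
  assumes G: "finite (verts G)" "finite (edges G)" and c: "is_coloring par G c" "is_coloring par G c'"
  shows "recolor_sign G c' c = recolor_sign G c c'"
proof -
  have "recolor_sign G c c' * recolor_sign G c' c = 1"
    using recolor_sign_mult[OF G c c(1)] recolor_sign_refl[OF c(1)] by simp
  then show ?thesis using change_sign_cases[OF c, of id id] by auto
qed

lemma bij_betw_remove: "bij_betw f A B \<Longrightarrow> a \<in> A \<Longrightarrow> bij_betw f (A - {a}) (B - {f a})"
  by (auto simp: bij_betw_def inj_on_def)

text \<open>In the odd case, if the two colorings orient \<open>e\<close> alike, they agree on its
  ends and forgetting one end changes no parity. If they orient \<open>e\<close> oppositely, the
  labels 1 and 2 are exchanged and \<open>e\<close> is reversed, and these two signs cancel. In the
  even case the number 1 of \<open>e\<close> is a fixed point.\<close>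

lemma recolor_sign_contract:
  assumes G: "finite (verts G)" "finite (edges G)" and e: "e \<in> edges G"
      "vat G (e, False) \<in> verts G" "vat G (e, True) \<in> verts G" "vat G (e, False) \<noteq> vat G (e, True)"
    and b: "is_coloring par G b" "is_coloring par G b'" "normal_at G e b" "normal_at G e b'"
  shows "recolor_sign (contract G e) (collapse G e b) (collapse G e b') = recolor_sign G b b'"
  using b(1,2)
proof (cases rule: coloring_cases)
  case (1 d l d' l')
  let ?V = "verts G" and ?p = "vat G (e, False)" and ?q = "vat G (e, True)"
  have V: "verts (contract G e) = ?V - {?q}"
    using e by (auto simp: contract_def merge_def image_iff)
  have E: "edges (contract G e) = edges G - {e}" by (simp add: contract_def)
  let ?red = "\<lambda>l u. if u = ?p then 1 else l u - 1 :: nat"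
  have key: "sign (renumbering (?V - {?q}) (?red l) (?red l')) = sign (renumbering ?V l l')"
    if l: "bij_betw l ?V {1..card ?V}" "bij_betw l' ?V {1..card ?V}" "l ?p = l' ?p" "l ?q = l' ?q"
      "{l ?p, l ?q} = {1, 2}" for l l'
  proof -
    have inj: "inj_on l ?V" "inj_on l' ?V" using l by (simp_all add: bij_betw_def)
    define B where "B = {1..card ?V} - {l ?q}"
    have bij: "bij_betw l (?V - {?q}) B" "bij_betw l' (?V - {?q}) B"
      unfolding B_def using bij_betw_remove[OF l(1) e(3)] bij_betw_remove[OF l(2) e(3)] l(4) by simp_all
    \<comment> \<open>The collapse as a map of labels: the surviving end of \<open>e\<close>,
      labelled 1 or 2, becomes 1, and the labels from 3 on decrease by one.\<close>
    define g where "g i = (if i = l ?p then 1 else i - 1)" for i :: nat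
    have "inj_on g B"
      using l(5) by (auto simp: inj_on_def g_def B_def doubleton_eq_iff)
    then have "sign (renumbering (?V - {?q}) (g \<circ> l) (g \<circ> l')) = sign (renumbering (?V - {?q}) l l')"
      using G by (intro sign_renumbering_comp[OF _ bij]) auto
    moreover have "renumbering (?V - {?q}) l l' = renumbering ?V l l'"
      using l(4) inj by (intro renumbering_restrict) auto
    moreover have "renumbering (?V - {?q}) (?red l) (?red l') = renumbering (?V - {?q}) (g \<circ> l) (g \<circ> l')"
    proof -
      have "(g \<circ> l) u = ?red l u" "(g \<circ> l') u = ?red l' u" if "u \<in> ?V - {?q}" for u
      proof -
        have "l u = l ?p \<longleftrightarrow> u = ?p" using that inj(1) e by (intro inj_on_eq_iff) auto
        moreover have "l' u = l' ?p \<longleftrightarrow> u = ?p" using that inj(2) e by (intro inj_on_eq_iff) auto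
        ultimately show "(g \<circ> l) u = ?red l u" "(g \<circ> l') u = ?red l' u"
          unfolding g_def l(3) by (simp_all add: l(3))
      qed
      then show ?thesis by (intro renumbering_cong) (simp_all only:)
    qed
    ultimately show ?thesis by simp
  qed
  have ends: "{l ?p, l ?q} = {1, 2}" "{l' ?p, l' ?q} = {1, 2}"
    using b(3,4) 1 by (cases "d e"; cases "d' e"; auto)+
  have split: "(\<Prod>f\<in>edges G. if d f \<noteq> d' f then -1 else 1 :: int)
      = (if d e \<noteq> d' e then -1 else 1) * (\<Prod>f\<in>edges G - {e}. if d f \<noteq> d' f then -1 else 1)"
    by (rule prod.remove[OF G(2) e(1)])
  have fin: "finite (edges (contract G e))" using G by (simp add: E)
  show ?thesis
  proof (cases "d e = d' e")
    case True
    then have "l ?p = l' ?p" "l ?q = l' ?q" using b(3,4) 1 by (cases "d e"; simp)+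
    from key[OF 1(4,5) this ends(1)] show ?thesis
      unfolding 1(2,3) collapse.simps recolor_sign_odd[OF fin] recolor_sign_odd[OF G(2)] V E split
      using True by simp
  next
    case False
    \<comment> \<open>Exchanging the labels of the ends makes \<open>l'\<close> agree with
      \<open>l\<close> there, without any effect on the collapsed labels.\<close>
    define k where "k = l' \<circ> transpose ?p ?q"
    have tr: "transpose ?p ?q permutes ?V" using e by (simp add: permutes_swap_id)
    have k: "bij_betw k ?V {1..card ?V}"
      unfolding k_def using bij_betw_trans[OF permutes_imp_bij[OF tr] 1(5)] .
    have "l ?p = k ?p" "l ?q = k ?q" using b(3,4) 1 False by (cases "d e"; cases "d' e"; simp add: k_def)+
    note kk = key[OF 1(4) k this ends(1)]
    have "?red k u = ?red l' u" if "u \<in> ?V - {?q}" for u using that by (simp add: k_def transpose_def)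
    then have "renumbering (?V - {?q}) (?red l) (?red k) = renumbering (?V - {?q}) (?red l) (?red l')"
      by (intro renumbering_cong refl)
    moreover have "sign (renumbering ?V l k) = - sign (renumbering ?V l l')"
    proof -
      have "sign (renumbering ?V l l') * sign (renumbering ?V l' k) = sign (renumbering ?V l k)"
        by (rule sign_renumbering_mult[OF G(1) 1(4,5) k])
      moreover have "sign (renumbering ?V l' k) = -1"
        unfolding k_def by (rule sign_renumbering_transpose[OF 1(5) e(2,3,4)])
      ultimately show ?thesis by simp
    qed
    ultimately show ?thesis
      using kk False
      unfolding 1(2,3) collapse.simps recolor_sign_odd[OF fin] recolor_sign_odd[OF G(2)] V E split
      by simp
  qed
next
  case (2 k k')
  have E: "edges (contract G e) = edges G - {e}" by (simp add: contract_def)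
  have ke: "k e = 1" "k' e = 1" using b(3,4) 2 by simp_all
  have bij: "bij_betw k (edges G - {e}) ({1..card (edges G)} - {1})"
      "bij_betw k' (edges G - {e}) ({1..card (edges G)} - {1})"
    using bij_betw_remove[OF 2(4) e(1)] bij_betw_remove[OF 2(5) e(1)] ke by simp_all
  have "inj_on (\<lambda>i. i - 1 :: nat) ({1..card (edges G)} - {1})" by (auto simp: inj_on_def)
  then have "sign (renumbering (edges G - {e}) ((\<lambda>i. i - 1) \<circ> k) ((\<lambda>i. i - 1) \<circ> k'))
     = sign (renumbering (edges G - {e}) k k')"
    using G(2) by (intro sign_renumbering_comp[OF _ bij]) auto
  also have "renumbering (edges G - {e}) k k' = renumbering (edges G) k k'"
    using 2(4) ke by (intro renumbering_restrict) (auto simp: bij_betw_def)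
  finally show ?thesis using 2 E by (simp add: o_def)
qed

lemma exists_normal:
  assumes G: "finite (verts G)" and e: "e \<in> edges G"
      "vat G (e, False) \<in> verts G" "vat G (e, True) \<in> verts G" "vat G (e, False) \<noteq> vat G (e, True)"
    and c: "is_coloring par G c"
  shows "\<exists>b. is_coloring par G b \<and> normal_at G e b"
proof (cases c)
  case (OddColoring d l)
  then have l: "bij_betw l (verts G) {1..card (verts G)}" and par: "par = OddCase"
    using c by (cases par; simp)+
  let ?u = "vat G (e, d e)" and ?v = "vat G (e, \<not> d e)"
  have uv: "?u \<in> verts G" "?v \<in> verts G" "?u \<noteq> ?v" using e by (cases "d e"; simp)+
  have "card {?u, ?v} \<le> card (verts G)" using uv G by (intro card_mono) auto
  then have N: "1 \<in> {1..card (verts G)}" "2 \<in> {1..card (verts G)}" using uv by auto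
  define l1 where "l1 = transpose (l ?u) 1 \<circ> l"
  have lu: "l ?u \<in> {1..card (verts G)}" using l uv by (auto simp: bij_betw_def)
  have l1: "bij_betw l1 (verts G) {1..card (verts G)}"
    unfolding l1_def
    using bij_betw_trans[OF l permutes_imp_bij[OF permutes_swap_id[OF lu N(1)]]] .
  have l1u: "l1 ?u = 1" by (simp add: l1_def)
  have l1v: "l1 ?v \<in> {1..card (verts G)}" using l1 uv by (auto simp: bij_betw_def)
  have "l1 ?v \<noteq> 1" using l1 uv l1u by (metis bij_betw_def inj_on_eq_iff)
  \<comment> \<open>This second transposition does not disturb the label 1, as both exchanged labels
    differ from 1.\<close>
  define l2 where "l2 = transpose (l1 ?v) 2 \<circ> l1"
  have l2: "bij_betw l2 (verts G) {1..card (verts G)}"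
    unfolding l2_def
    using bij_betw_trans[OF l1 permutes_imp_bij[OF permutes_swap_id[OF l1v N(2)]]] .
  have "l2 ?u = 1" "l2 ?v = 2" using l1u \<open>l1 ?v \<noteq> 1\<close> by (simp_all add: l2_def)
  then show ?thesis using l2 par by (intro exI[of _ "OddColoring d l2"]) simp
next
  case (EvenColoring k)
  then have k: "bij_betw k (edges G) {1..card (edges G)}" and par: "par = EvenCase"
    using c by (cases par; simp)+
  have ke: "k e \<in> {1..card (edges G)}" using k e by (auto simp: bij_betw_def)
  then have 1: "1 \<in> {1..card (edges G)}" by simp
  have "bij_betw (transpose (k e) 1 \<circ> k) (edges G) {1..card (edges G)}"
    using bij_betw_trans[OF k permutes_imp_bij[OF permutes_swap_id[OF ke 1]]] .
  then show ?thesis using par by (intro exI[of _ "EvenColoring (transpose (k e) 1 \<circ> k)"]) simp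
qed

lemma collapse_cong: "vat G' (e, False) = vat G (e, False) \<Longrightarrow> collapse G' e b = collapse G e b"
  by (cases b) simp_all

lemma normal_at_cong:
  "vat G' (e, False) = vat G (e, False) \<Longrightarrow> vat G' (e, True) = vat G (e, True) \<Longrightarrow> normal_at G' e b = normal_at G e b"
  by (cases b; simp; metis (full_types))

text \<open>As the terms of the IHX and STU relations have the same vertices and edges, the sign rule
  amounts to using one coloring for all of them.\<close>

lemma same_contraction_iff:
  assumes G: "finite (verts G)" "finite (edges G)" and e: "e \<in> edges G"
      "vat G (e, False) \<in> verts G" "vat G (e, True) \<in> verts G" "vat G (e, False) \<noteq> vat G (e, True)"
    and same: "verts G' = verts G" "edges G' = edges G" "vat G' (e, False) = vat G (e, False)"
      "vat G' (e, True) = vat G (e, True)"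
    and c: "is_coloring par G c" "is_coloring par G c'"
  shows "same_contraction par e (G, c) (G', c') \<longleftrightarrow> contract G e = contract G' e \<and> recolor_sign G c c' = 1"
proof -
  have sgn: "recolor_sign G c b * recolor_sign G' c' b' * recolor_sign (contract G e) (collapse G e b) (collapse G' e b')
      = recolor_sign G c c'" if b: "is_coloring par G b" "normal_at G e b" "is_coloring par G' b'" "normal_at G' e b'" for b b'
  proof -
    have b': "is_coloring par G b'" "normal_at G e b'"
      using b(3,4) is_coloring_cong[OF same(1,2)] normal_at_cong[OF same(3,4)] by simp_all
    have "recolor_sign G' c' b' = recolor_sign G b' c'"
      using change_sign_cong[OF same(1,2)] recolor_sign_sym[OF G c(2) b'(1)] by simp
    moreover have "recolor_sign (contract G e) (collapse G e b) (collapse G' e b') = recolor_sign G b b'"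
      unfolding collapse_cong[OF same(3)] by (rule recolor_sign_contract[OF G e b(1) b'(1) b(2) b'(2)])
    moreover have "recolor_sign G c b * recolor_sign G b b' * recolor_sign G b' c' = recolor_sign G c c'"
      using recolor_sign_mult[OF G c(1) b(1) b'(1)] recolor_sign_mult[OF G c(1) b'(1) c(2)] by simp
    ultimately show ?thesis by (simp add: mult_ac)
  qed
  show ?thesis
  proof
    assume "same_contraction par e (G, c) (G', c')"
    then obtain b b' where "contract G e = contract G' e" "is_coloring par G b" "normal_at G e b"
       "is_coloring par G' b'" "normal_at G' e b'"
       "recolor_sign G c b * recolor_sign G' c' b' * recolor_sign (contract G e) (collapse G e b) (collapse G' e b') = 1"
      unfolding same_contraction_def contracts_to_def by auto
    then show "contract G e = contract G' e \<and> recolor_sign G c c' = 1" using sgn by simp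
  next
    assume *: "contract G e = contract G' e \<and> recolor_sign G c c' = 1"
    obtain b where b: "is_coloring par G b" "normal_at G e b" using exists_normal[OF G(1) e c(1)] by blast
    then have b': "is_coloring par G' b" "normal_at G' e b"
      using is_coloring_cong[OF same(1,2)] normal_at_cong[OF same(3,4)] by simp_all
    show "same_contraction par e (G, c) (G', c')"
      unfolding same_contraction_def contracts_to_def fst_conv snd_conv
    proof (intro conjI exI)
      show "contract G e = contract G' e" using * by simp
      show "is_coloring par G b" "normal_at G e b" "is_coloring par G' b" "normal_at G' e b" using b b' .
      show "recolor_sign G c b * recolor_sign G' c' b
        * recolor_sign (contract G e) (collapse G e b) (collapse G' e b) = 1"
        using sgn[OF b b'] * by simp
    qed simp_all
  qed
qed

section \<open>The extension of a weight to BCR graphs\<close>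

text \<open>The line through an external vertex is its member of the given decomposition. It is
  maximal because members with a common vertex coincide, so a solid edge that meets it belongs to
  it.\<close>

lemma bcr_graph_ok:
  assumes "bcr_graph G"
  shows "ok G"
proof -
  have G: "finite_graph G" "connected_graph G" "externals G \<noteq> {}"
    "\<And>u. u \<in> internals G \<Longrightarrow> card (dashed_halves_at G u) = 3 \<and> solid_halves_at G u = {}"
    "\<And>u. u \<in> externals G \<Longrightarrow> card (dashed_halves_at G u) = 1"
    using assms unfolding bcr_graph_def by blast+
  have "disjoint_broken_lines G" using assms unfolding bcr_graph_def by simp
  then obtain P where P0: "\<forall>(vs, es)\<in>P. broken_line G vs es"
    "\<forall>p\<in>P. \<forall>q\<in>P. p \<noteq> q \<longrightarrow> set (fst p) \<inter> set (fst q) = {}"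
    "(\<Union>p\<in>P. set (fst p)) = externals G" "(\<Union>p\<in>P. set (snd p)) = solids G"
    unfolding disjoint_broken_lines_def by (elim exE conjE)
  have P: "broken_line G vs es" if "(vs, es) \<in> P" for vs es using P0(1) that by auto
  have ex: "\<exists>vs es. (vs, es) \<in> P \<and> u \<in> set vs" if "u \<in> externals G" for u
    using that unfolding P0(3)[symmetric] by (metis UN_E prod.collapse)
  have so: "\<exists>vs es. (vs, es) \<in> P \<and> e \<in> set es" if "e \<in> solids G" for e
    using that unfolding P0(4)[symmetric] by (metis UN_E prod.collapse)
  have sub: "set vs \<subseteq> externals G" "set es \<subseteq> solids G" if "(vs, es) \<in> P" for vs es
    unfolding P0(3,4)[symmetric] using that by force+
  have "\<exists>r L xs. line G r L xs \<and> u \<in> set (line_verts r L)" if u: "u \<in> externals G" for u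
  proof -
    obtain vs es where p: "(vs, es) \<in> P" "u \<in> set vs" using ex[OF u] by blast
    have bl: "distinct vs" "distinct es" "length vs = Suc (length es)"
      "\<And>i. i < length es \<Longrightarrow> {vat G (es ! i, False), vat G (es ! i, True)} = {vs ! i, vs ! Suc i}"
      using P[OF p(1)] unfolding broken_line_def by blast+
    \<comment> \<open>The half of the \<open>i\<close>-th edge that lies at \<open>vs ! i\<close>;
      the names of the halves need not follow the direction of the line.\<close>
    define a where "a i = (es ! i, vat G (es ! i, False) \<noteq> vs ! i)" for i
    have a: "vat G (a i) = vs ! i" "vat G (opp (a i)) = vs ! Suc i" if "i < length es" for i
    proof -
      have "vs ! i \<noteq> vs ! Suc i" using bl(1,3) that by (simp add: nth_eq_iff_index_eq)
      then show "vat G (a i) = vs ! i" "vat G (opp (a i)) = vs ! Suc i"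
        using bl(4)[OF that] by (auto simp: a_def opp_def doubleton_eq_iff)
    qed
    define L where "L = map (\<lambda>i. (a i, vs ! Suc i)) [0..<length es]"
    define leg where "leg p = (SOME h. h \<in> dashed_halves_at G p)" for p
    have lv: "line_verts (vs ! 0) L = vs"
      using bl(3) by (intro nth_equalityI) (auto simp: L_def nth_Cons split: nat.splits)
    have src: "sources (vs ! 0) L = map (\<lambda>i. vs ! i) [0..<length es]"
    proof -
      have "sources (vs ! 0) L = butlast (line_verts (vs ! 0) L)" by (simp add: sources_last)
      also have "\<dots> = map (\<lambda>i. vs ! i) [0..<length es]"
        unfolding lv using bl(3) by (intro nth_equalityI) (simp_all add: nth_butlast)
      finally show ?thesis .
    qed
    have es: "link_edges L = es" by (intro nth_equalityI) (simp_all add: L_def a_def)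
    have leg: "leg p \<in> dashed_halves_at G p" if "p \<in> set vs" for p
    proof -
      have "p \<in> externals G" using that sub(1)[OF p(1)] by blast
      then have "dashed_halves_at G p \<noteq> {}" using G(5)[of p] by auto
      then show ?thesis unfolding leg_def by (simp add: some_in_eq)
    qed
    have "line G (vs ! 0) L (map leg vs)"
      unfolding line_def lv es src
    proof (intro conjI)
      show "distinct vs" "distinct es" by (rule bl)+
      show "set vs \<subseteq> externals G" "set es \<subseteq> solids G" using sub[OF p(1)] by blast+
      show "map (vat G \<circ> fst) L = map ((!) vs) [0..<length es]" using a by (simp add: L_def)
      show "map (vat G \<circ> opp \<circ> fst) L = map snd L" using a by (simp add: L_def)
      show "map (vat G) (map leg vs) = vs"
        unfolding map_map using leg by (intro map_idI) (simp add: dashed_halves_at_def halves_at_def)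
      show "fst ` set (map leg vs) \<subseteq> dashed G" using leg by (auto simp: dashed_halves_at_def)
      show "\<forall>h\<in>half_edges G. fst h \<in> solids G \<longrightarrow> vat G h \<in> set vs \<longrightarrow> fst h \<in> set es"
      proof (intro ballI impI)
        fix h assume h: "h \<in> half_edges G" "fst h \<in> solids G" "vat G h \<in> set vs"
        obtain vs' es' where q: "(vs', es') \<in> P" "fst h \<in> set es'" using so[OF h(2)] by blast
        then obtain j where j: "j < length es'" "fst h = es' ! j" by (auto simp: in_set_conv_nth)
        have bl': "length vs' = Suc (length es')"
          "{vat G (es' ! j, False), vat G (es' ! j, True)} = {vs' ! j, vs' ! Suc j}"
          using P[OF q(1)] j(1) unfolding broken_line_def by blast+
        have "h = (es' ! j, False) \<or> h = (es' ! j, True)" using j(2) by (cases h) auto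
        then have "vat G h \<in> {vs' ! j, vs' ! Suc j}" using bl'(2) by auto
        moreover have "vs' ! j \<in> set vs'" "vs' ! Suc j \<in> set vs'" using bl'(1) j(1) by simp_all
        ultimately have "vat G h \<in> set vs'" by auto
        then have "(vs', es') = (vs, es)" using P0(2)[rule_format, OF q(1) p(1)] h(3) by auto
        then show "fst h \<in> set es" using q(2) by simp
      qed
    qed
    then show ?thesis using p(2) lv by metis
  qed
  then have "vertex_ok G u" if "u \<in> verts G" for u
    using G(4,5)[of u] that by (simp add: vertex_ok_def internals_def)
  then show ?thesis using G by (simp add: ok_def)
qed

lemma ok_hairy_graph:
  assumes "ok G" "solids G = {}"
  shows "hairy_graph G"
proof -
  have vok: "vertex_ok G u" if "u \<in> verts G" for u using okD(8)[OF assms(1) that] .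
  \<comment> \<open>Without solid edges each external vertex is a broken line by itself.\<close>
  have "disjoint_broken_lines G"
    unfolding disjoint_broken_lines_def
    by (rule exI[of _ "(\<lambda>u. ([u], [])) ` externals G"]) (auto simp: broken_line_def assms(2))
  moreover have "card (dashed_halves_at G u) = 3 \<and> solid_halves_at G u = {}" if "u \<in> internals G" for u
    using vok[of u] that by (auto simp: internals_def vertex_ok_def)
  moreover have "card (dashed_halves_at G u) = 1 \<and> card (solid_halves_at G u) \<le> 2" if "u \<in> externals G" for u
    using vok[of u] that okD(4)[OF assms(1)] assms(2) by (auto simp: vertex_ok_def solid_halves_at_def)
  ultimately show ?thesis
    using okD[OF assms(1)] assms(2) by (simp add: hairy_graph_def bcr_graph_def)
qed

section \<open>Iterated extension and its limit\<close>

fun extension :: "parity \<Rightarrow> (colored_graph \<Rightarrow> rat) \<Rightarrow> nat \<Rightarrow> colored_graph \<Rightarrow> rat" where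
  "extension par W 0 = W"
| "extension par W (Suc n) = good_weight.extended n (extension par W n)"

lemma good_extension:
  assumes "weight par 0 W"
  shows "good_weight par n (extension par W n)"
proof (induction n)
  case 0
  interpret weight par 0 W by (rule assms)
  show ?case
  proof (simp, unfold_locales)
    fix G c r L xs
    assume G: "ok G" "card (solids G) \<le> 0" and l: "line G r L xs"
    then have L: "L = []" using length_le_solids[OF G(1) l] by simp
    then obtain x where "xs = [x]" using line_legs_length[OF l] by (auto simp: length_Suc_conv)
    then show "W (G, c) = line_value W c G r L xs" using line_value_single[of G r x W c] l L by simp
  qed
next
  case (Suc n)
  then show ?case using good_weight.good_extended by simp
qed

text \<open>Each graph is evaluated at the first stage that covers its number of solid edges; later
  stages do not change the value, see \<open>extension_eq_limit\<close>.\<close>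

definition limit_weight :: "parity \<Rightarrow> (colored_graph \<Rightarrow> rat) \<Rightarrow> colored_graph \<Rightarrow> rat" where
  "limit_weight par W D = extension par W (card (solids (fst D))) D"

lemma extension_eq_limit:
  assumes "weight par 0 W" "card (solids G) \<le> n"
  shows "extension par W n (G, c) = limit_weight par W (G, c)"
  using assms(2)
proof (induction n rule: dec_induct)
  case base
  then show ?case by (simp add: limit_weight_def)
next
  case (step m)
  interpret good_weight par m "extension par W m" by (rule good_extension[OF assms(1)])
  show ?case using step extended_low[of G c] by simp
qed

text \<open>By \<open>fuse_T\<close> the graph \<open>S\<close> is the fusion of its first
  splitting, and the second splitting has the same line with the two legs exchanged, so
  \<open>line_value_stu\<close> applies. The strict bound leaves room for the new solid
  edge.\<close>

lemma (in good_weight) stu_value: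
  assumes s: "leg_split S r L a w M X x y Y" and n: "card (solids S) < n" and c: "is_coloring par S c"
  shows "L @ M \<noteq> [] \<Longrightarrow> W (S, c) + W (split_leg S (last_vert r L) a w x M, c)
      + W (split_leg S (last_vert r L) a w y M, c) = 0"
    "L @ M = [] \<Longrightarrow> W (S, c) + W (split_leg S (last_vert r L) a w x M, c) = 0"
proof -
  interpret A: leg_split S r L a w M X x y Y by (rule s)
  interpret B: leg_split S r L a w M X y x Y
    using A.G A.l A.len A.w A.at_w A.ne by unfold_locales auto
  have v: "A.v = last_vert r L" "B.v = last_vert r L" by (simp_all add: A.v_def B.v_def)
  have f: "fused A.T r L a w M X x y Y"
    using A.ok_T A.line_T A.len by unfold_locales
  have cT: "is_coloring par A.T c" "is_coloring par B.T c"
    using c is_coloring_cong[of A.T S] is_coloring_cong[of B.T S] by simp_all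
  have card: "card (solids A.T) \<le> n" "card (solids B.T) \<le> n"
    using n okD(7)[OF A.G] by (simp_all add: card_insert_if)
  have S: "W (S, c) = line_value W c S r (L @ M) (X @ a # Y)"
    using n by (intro line_value[OF A.G _ c A.l]) simp
  have T: "W (A.T, c) = line_value W c A.T r (L @ (a, w) # M) (X @ x # y # Y)"
    by (rule line_value[OF A.ok_T card(1) cT(1) A.line_T])
  have U: "W (B.T, c) = line_value W c B.T r (L @ (a, w) # M) (X @ y # x # Y)"
    by (rule line_value[OF B.ok_T card(2) cT(2) B.line_T])
  have fuse: "fuse A.T (last_vert r L) a w x M = S" using A.fuse_T v by simp
  have rec: "B.T = A.T\<lparr>vat := vat B.T\<rparr>" unfolding v by (simp add: split_leg_def)
  have off: "vat B.T h = vat A.T h" if "h \<noteq> x" "h \<noteq> y" for h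
    using that by (simp add: A.vat_T B.vat_T)
  have n': "card (solids A.T) \<le> n + length (L @ (a, w) # M)" using card by simp
  note stu = line_value_stu[OF f cT(1) n' B.ok_T B.line_T rec off]
  show "L @ M \<noteq> [] \<Longrightarrow> W (S, c) + W (split_leg S (last_vert r L) a w x M, c)
      + W (split_leg S (last_vert r L) a w y M, c) = 0"
    using stu(1) S T U fuse unfolding v by simp
  show "L @ M = [] \<Longrightarrow> W (S, c) + W (split_leg S (last_vert r L) a w x M, c) = 0"
    using stu(2) S T fuse unfolding v by simp
qed

text \<open>Both directions of the line through \<open>v\<close> are provided, because only the type
  of the relation decides which part of the line stays at \<open>v\<close>.\<close>

lemma stu_site_leg_split:
  assumes S: "ok S" and site: "stu_site S e v w x y"
  obtains r L a M X Y where "leg_split S r L a w M X x y Y" "last_vert r L = v" "fst a = e"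
    "leg_split S (last_vert r (L @ M)) (revl v M) a w (revl r L) (rev Y) x y (rev X)"
    "last_vert (last_vert r (L @ M)) (revl v M) = v"
    "\<And>b. b \<in> solid_halves_at S v \<longleftrightarrow> (L \<noteq> [] \<and> b = opp (fst (last L))) \<or> (M \<noteq> [] \<and> b = fst (hd M))"
proof -
  obtain i where e: "e \<in> dashed S" "v \<in> externals S" "w \<in> internals S" "vat S (e, i) = v" "vat S (e, \<not> i) = w"
    "halves_at S w - {(e, \<not> i)} = {x, y}" "x \<noteq> y"
    using site unfolding stu_site_def by blast
  define a where "a = (e, i)"
  have opp: "opp a = (e, \<not> i)" by (simp add: a_def opp_def)
  have ah: "a \<in> half_edges S" "fst a \<in> dashed S" "vat S a = v" "opp a \<in> half_edges S"
    using e by (auto simp: a_def half_edges_def dashed_def opp_def)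
  have "v \<in> verts S" using e(2) okD(4)[OF S] by blast
  then obtain r L0 xs where l: "line S r L0 xs" "v \<in> set (line_verts r L0)"
    using okD(8)[OF S] e(2) unfolding vertex_ok_def by metis
  have "\<exists>L M. L0 = L @ M \<and> last_vert r L = v"
  proof (cases "v = r")
    case True
    then show ?thesis by (intro exI[of _ "[]"] exI[of _ L0]) simp
  next
    case False
    then obtain l' where "l' \<in> set L0" "v = snd l'" using l(2) by auto
    then obtain P Q where "L0 = P @ l' # Q" by (meson split_list)
    then show ?thesis using \<open>v = snd l'\<close> by (intro exI[of _ "P @ [l']"] exI[of _ Q]) simp
  qed
  then obtain L M where LM: "L0 = L @ M" "last_vert r L = v" by blast
  have len: "length L < length xs" using line_legs_length[OF l(1)] LM by simp
  define X where "X = take (length L) xs"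
  define Y where "Y = drop (Suc (length L)) xs"
  have xs: "xs = X @ xs ! length L # Y" using len by (simp add: X_def Y_def id_take_nth_drop[symmetric])
  have lX: "length X = length L" using len by (simp add: X_def)
  have "map (vat S) (X @ xs ! length L # Y) = sources r L @ last_vert r L # map snd M"
    using lineD(7)[OF l(1)] line_verts_split(2)[of r L M] xs LM(1) by simp
  then have "vat S (xs ! length L) = v" using lX LM(2) by (simp add: append_eq_append_conv)
  moreover have "xs ! length L \<in> set xs" using len by simp
  then have "xs ! length L \<in> half_edges S" "fst (xs ! length L) \<in> dashed S"
    using in_line_half_edges(2)[OF S l(1)] lineD(8)[OF l(1)] by auto
  ultimately have leg: "xs ! length L = a"
    using dashed_at_external[OF S e(2) _ _ _ ah(1-3)] by simp
  have line: "line S r (L @ M) (X @ a # Y)" using l(1) xs leg LM(1) by simp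
  have w: "w \<in> verts S" "w \<notin> externals S" using e(3) by (auto simp: internals_def)
  have "opp a \<in> halves_at S w" using ah(4) e(5) opp by (simp add: halves_at_def)
  moreover have "halves_at S w - {opp a} = {x, y}" using e(6) unfolding opp .
  ultimately have at: "halves_at S w = {opp a, x, y}" "opp a \<noteq> x" "opp a \<noteq> y" by blast+
  have s1: "leg_split S r L a w M X x y Y"
    using S line lX w at e(7) by unfold_locales
  have rl: "line S (last_vert r (L @ M)) (revl v M @ revl r L) (rev Y @ a # rev X)"
    using line_rev[OF line] LM(2) by (simp add: revl_append)
  have "length (rev Y) = length (revl v M)"
    using line_legs_length[OF line] lX by simp
  then have s2: "leg_split S (last_vert r (L @ M)) (revl v M) a w (revl r L) (rev Y) x y (rev X)"
    using S rl w at e(7) by unfold_locales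
  have lv: "last_vert (last_vert r (L @ M)) (revl v M) = v" using last_vert_revl[of v M] LM(2) by simp
  have sol: "b \<in> solid_halves_at S v \<longleftrightarrow> (L \<noteq> [] \<and> b = opp (fst (last L))) \<or> (M \<noteq> [] \<and> b = fst (hd M))" for b
  proof
    assume "b \<in> solid_halves_at S v"
    then have "b \<in> half_edges S" "fst b \<in> solids S" "vat S b = last_vert r L"
      using LM(2) by (auto simp: solid_halves_at_def halves_at_def)
    then show "(L \<noteq> [] \<and> b = opp (fst (last L))) \<or> (M \<noteq> [] \<and> b = fst (hd M))"
      using line_solid_at[OF line] by blast
  next
    assume "(L \<noteq> [] \<and> b = opp (fst (last L))) \<or> (M \<noteq> [] \<and> b = fst (hd M))"
    then show "b \<in> solid_halves_at S v"
    proof (elim disjE conjE)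
      assume L: "L \<noteq> []" "b = opp (fst (last L))"
      have LL: "L @ M = butlast L @ last L # M" using L(1) by simp
      note k = line_link[OF line[unfolded LL]]
      have "snd (last L) = v" using LM(2) L(1) by (metis append_butlast_last_id last_vert.simps last_vert_append)
      then show ?thesis using k(2,3) L(2) okD(5)[OF S]
        by (auto simp: solid_halves_at_def halves_at_def in_half_edges)
    next
      assume M: "M \<noteq> []" "b = fst (hd M)"
      have LL: "L @ M = L @ hd M # tl M" using M(1) by simp
      note k = line_link[OF line[unfolded LL]]
      show ?thesis using k(1,3) M(2) LM(2) okD(5)[OF S]
        by (auto simp: solid_halves_at_def halves_at_def in_half_edges)
    qed
  qed
  show thesis by (rule that[OF s1 LM(2) _ s2 lv sol]) (simp add: a_def)
qed

lemma split_leg_attach: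
  "fst a = e \<Longrightarrow> split_leg S v a w x [] = attach x v (stu_split S e w)"
  "fst a = e \<Longrightarrow> M \<noteq> [] \<Longrightarrow> fst (hd M) = b \<Longrightarrow>
     split_leg S v a w x M = attach b w (attach x v (stu_split S e w))"
  by (simp_all add: split_leg_def attach_def stu_split_def)

text \<open>The solid half-edge that moves to \<open>w\<close> has to be the beginning of
  \<open>M\<close>, which fixes the direction of the line. With a single solid half-edge,
  \<open>v\<close> is an end of the line; this half-edge stays at \<open>v\<close>, so the direction
  with nothing after \<open>v\<close> is taken.\<close>

lemma stu_I_expansionsE:
  assumes S: "ok S" and e: "stu_I_expansions S e T U"
  obtains r L a w M X x y Y where "leg_split S r L a w M X x y Y" "fst a = e" "L @ M \<noteq> []"
    "T = split_leg S (last_vert r L) a w x M" "U = split_leg S (last_vert r L) a w y M"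
proof -
  note that' = that
  obtain v w x y where site: "stu_site S e v w x y"
    and TU: "(\<exists>a. solid_halves_at S v = {a} \<and> T = attach x v (stu_split S e w) \<and> U = attach y v (stu_split S e w))
      \<or> (\<exists>a b. solid_halves_at S v = {a, b} \<and> a \<noteq> b \<and> T = attach b w (attach x v (stu_split S e w))
           \<and> U = attach b w (attach y v (stu_split S e w)))"
    using e unfolding stu_I_expansions_def by blast
  obtain r L a M X Y where s: "leg_split S r L a w M X x y Y" "last_vert r L = v" "fst a = e"
    "leg_split S (last_vert r (L @ M)) (revl v M) a w (revl r L) (rev Y) x y (rev X)"
    "last_vert (last_vert r (L @ M)) (revl v M) = v"
    and sol: "\<And>b. b \<in> solid_halves_at S v \<longleftrightarrow> (L \<noteq> [] \<and> b = opp (fst (last L))) \<or> (M \<noteq> [] \<and> b = fst (hd M))"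
    using stu_site_leg_split[OF S(1) site] by blast
  have forward: thesis if "L @ M \<noteq> []" "T = split_leg S v a w x M" "U = split_leg S v a w y M"
    using that(2,3) by (intro that'[OF s(1,3) that(1)]) (simp_all add: s(2))
  have backward: thesis if "L @ M \<noteq> []" "T = split_leg S v a w x (revl r L)" "U = split_leg S v a w y (revl r L)"
  proof -
    have "revl v M @ revl r L \<noteq> []" using that(1) by (cases L; cases M) auto
    then show thesis using that'[OF s(4,3)] that(2,3) unfolding s(5) by blast
  qed
  have hdL: "fst (hd (revl r L)) = opp (fst (last L))" if "L \<noteq> []"
    using that by (cases L rule: rev_cases) (auto simp: revl_append)
  interpret leg_split S r L a w M X x y Y by (rule s(1))
  have two: "opp (fst (last L)) \<noteq> fst (hd M)" if "L \<noteq> []" "M \<noteq> []"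
  proof
    assume eq: "opp (fst (last L)) = fst (hd M)"
    have "L @ M = L @ hd M # tl M" using that by simp
    from line_link(4)[OF l[unfolded this]] have "fst (fst (hd M)) \<notin> set (link_edges (L @ tl M))" .
    moreover have "fst (fst (last L)) \<in> set (link_edges (L @ tl M))"
      using that by (intro link_edge_in) simp
    ultimately show False using arg_cong[OF eq, of fst] by simp
  qed
  show thesis
    using TU
  proof (elim disjE exE conjE)
    fix b assume b: "solid_halves_at S v = {b}" "T = attach x v (stu_split S e w)" "U = attach y v (stu_split S e w)"
    have ne: "L @ M \<noteq> []" using sol[of b] b(1) by auto
    have "M = [] \<or> L = []"
    proof (rule ccontr)
      assume "\<not> (M = [] \<or> L = [])"
      moreover from this have "opp (fst (last L)) \<in> solid_halves_at S v" "fst (hd M) \<in> solid_halves_at S v"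
        using sol by blast+
      ultimately show False using two b(1) by simp
    qed
    then show thesis
    proof
      assume "M = []"
      then show thesis using b s(3) by (intro forward ne) (simp_all add: split_leg_attach)
    next
      assume "L = []"
      then show thesis using b s(3) by (intro backward ne) (simp_all add: split_leg_attach)
    qed
  next
    fix b b' assume b: "solid_halves_at S v = {b, b'}" "b \<noteq> b'"
      "T = attach b' w (attach x v (stu_split S e w))" "U = attach b' w (attach y v (stu_split S e w))"
    have ne: "L @ M \<noteq> []" using sol[of b] b(1) by auto
    have "b' \<in> solid_halves_at S v" using b(1) by simp
    then show thesis unfolding sol
    proof (elim disjE conjE)
      assume "L \<noteq> []" "b' = opp (fst (last L))"
      then show thesis using b s(3) hdL by (intro backward ne) (simp_all add: split_leg_attach(2))
    next
      assume "M \<noteq> []" "b' = fst (hd M)"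
      then show thesis using b s(3) by (intro forward ne) (simp_all add: split_leg_attach(2))
    qed
  qed
qed

lemma stu_II_expansionE:
  assumes S: "ok S" and e: "stu_II_expansion S e T"
  obtains r a w X x y Y where "leg_split S r [] a w [] X x y Y" "fst a = e"
    "T = split_leg S r a w x []"
proof -
  obtain v w x y where site: "stu_site S e v w x y"
    and T: "solid_halves_at S v = {}" "T = attach x v (stu_split S e w)"
    using e unfolding stu_II_expansion_def by blast
  obtain r L a M X Y where s: "leg_split S r L a w M X x y Y" "last_vert r L = v" "fst a = e"
    "leg_split S (last_vert r (L @ M)) (revl v M) a w (revl r L) (rev Y) x y (rev X)"
    "last_vert (last_vert r (L @ M)) (revl v M) = v"
    and sol: "\<And>b. b \<in> solid_halves_at S v \<longleftrightarrow> (L \<noteq> [] \<and> b = opp (fst (last L))) \<or> (M \<noteq> [] \<and> b = fst (hd M))"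
    using stu_site_leg_split[OF S site] by blast
  have L: "L = []" using sol[of "opp (fst (last L))"] T(1) by simp
  have M: "M = []" using sol[of "fst (hd M)"] T(1) by simp
  have "v = r" using s(2) L by simp
  then show thesis using that[of r a w X x y Y] s(1,3) T(2) unfolding L M by (simp add: split_leg_attach)
qed

section \<open>The limit weight on the relators\<close>

lemma limit_equivariant:
  assumes W: "weight par 0 W" and G: "ok G" "ok G'" and c: "is_coloring par G c" "is_coloring par G' c'"
    and iso: "graph_iso G G' f h"
  shows "limit_weight par W (G', c') = of_int (change_sign G f h c c') * limit_weight par W (G, c)"
proof -
  define n where "n = max (card (solids G)) (card (solids G'))"
  interpret good_weight par n "extension par W n" by (rule good_extension[OF W])
  show ?thesis
    using equivariant[OF G _ c iso] extension_eq_limit[OF W, of G n] extension_eq_limit[OF W, of G' n]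
    by (simp add: n_def)
qed

lemma limit_recolor:
  assumes W: "weight par 0 W" and G: "ok G" and same: "verts G = verts S" "edges G = edges S"
    and c: "is_coloring par S c" "is_coloring par S c'" "recolor_sign S c c' = 1"
  shows "limit_weight par W (G, c') = limit_weight par W (G, c)"
proof -
  have iso: "graph_iso G G id id" by (simp add: graph_iso_def)
  have c': "is_coloring par G c" "is_coloring par G c'"
    using c(1,2) is_coloring_cong[OF same] by simp_all
  have "recolor_sign G c c' = 1" using change_sign_cong[OF same] c(3) by simp
  then show ?thesis using limit_equivariant[OF W G G c' iso] by simp
qed

text \<open>Having the same contraction as \<open>c\<close> means that \<open>c2\<close> and
  \<open>c3\<close> are even changes of \<open>c\<close>. So all terms can be recolored by
  \<open>c\<close>, and the relation is that of a single stage.\<close>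

lemma limit_ihx:
  assumes W: "weight par 0 W" and G: "ok G" and c: "is_coloring par G c" "is_coloring par G2 c2" "is_coloring par G3 c3"
    and e: "ihx_expansions G e G2 G3"
    and sc: "same_contraction par e (G, c) (G2, c2)" "same_contraction par e (G, c) (G3, c3)"
  shows "limit_weight par W (G, c) + limit_weight par W (G2, c2) + limit_weight par W (G3, c3) = 0"
proof -
  obtain u v h h' k k' where s: "ihx_site G (e, False) u v h h' k k'" "ihx_site G (e, False) u v h h' k' k"
    "G2 = G\<lparr>vat := (vat G)(h' := v, k := u)\<rparr>" "G3 = G\<lparr>vat := (vat G)(h' := v, k' := u)\<rparr>"
    by (rule ihx_expansions_sites[OF G e])
  interpret A: ihx_site G "(e, False)" u v h h' k k' by (rule s(1))
  interpret B: ihx_site G "(e, False)" u v h h' k' k by (rule s(2))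
  have G23: "G2 = A.swapped" "G3 = B.swapped" using s(3,4) by (simp_all add: A.swapped_def B.swapped_def)
  have opp: "opp (e, False) = (e, True)" by (simp add: opp_def)
  have eG: "e \<in> edges G" "vat G (e, False) = u" "vat G (e, True) = v" using A.b opp by (simp_all add: half_edges_def)
  have vs: "vat G2 (e, False) = u" "vat G2 (e, True) = v" "vat G3 (e, False) = u" "vat G3 (e, True) = v"
    using A.vat_swapped_spec(1,2) B.vat_swapped_spec(1,2) G23 opp by simp_all
  note iff = same_contraction_iff[OF okD(1,2)[OF G] eG(1), unfolded eG(2,3), OF A.uV A.b(4)]
  have c': "is_coloring par G c2" "is_coloring par G c3"
    using c(2,3) is_coloring_cong[of G2 G] is_coloring_cong[of G3 G] G23 by simp_all
  have r: "recolor_sign G c c2 = 1" "recolor_sign G c c3 = 1"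
    using iff[of G2 par c c2] iff[of G3 par c c3] sc vs c(1) c' G23 by simp_all
  define n where "n = card (solids G)"
  interpret good_weight par n "extension par W n" by (rule good_extension[OF W])
  have "extension par W n (G, c) + extension par W n (G2, c) + extension par W n (G3, c) = 0"
    using ihx[OF G _ c(1) e] by (simp add: n_def)
  then have "limit_weight par W (G, c) + limit_weight par W (G2, c) + limit_weight par W (G3, c) = 0"
    using extension_eq_limit[OF W, of G n] extension_eq_limit[OF W, of G2 n] extension_eq_limit[OF W, of G3 n] G23
    by (simp add: n_def)
  moreover have "limit_weight par W (G2, c2) = limit_weight par W (G2, c)"
    using A.ok_swapped by (intro limit_recolor[OF W _ _ _ c(1) c'(1) r(1)]) (simp_all add: G23)
  moreover have "limit_weight par W (G3, c3) = limit_weight par W (G3, c)"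
    using B.ok_swapped by (intro limit_recolor[OF W _ _ _ c(1) c'(2) r(2)]) (simp_all add: G23)
  ultimately show ?thesis by simp
qed

lemma leg_split_swap: "leg_split S r L a w M X x y Y \<Longrightarrow> leg_split S r L a w M X y x Y"
  by (auto simp: leg_split_def)

lemma limit_recolor_split:
  assumes W: "weight par 0 W" and s: "leg_split S r L a w M X x y Y"
    and T: "T = split_leg S (last_vert r L) a w x M"
    and c: "is_coloring par S c" "is_coloring par T c'"
    and sc: "same_contraction par (fst a) (S, c) (T, c')"
  shows "limit_weight par W (T, c') = limit_weight par W (T, c)"
proof -
  interpret A: leg_split S r L a w M X x y Y by (rule s)
  have TA: "T = A.T" by (simp add: T A.v_def)
  have same: "verts T = verts S" "edges T = edges S" by (simp_all add: TA)
  \<comment> \<open>The half-edge \<open>a\<close> may be either half of its edge, so the two ends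
    are treated as a set.\<close>
  have ends: "(fst a, False) \<in> {a, opp a}" "(fst a, True) \<in> {a, opp a}"
     "{(fst a, False), (fst a, True)} = {a, opp a}"
    by (cases a; auto simp: opp_def)+
  have eq: "vat T h = vat S h" if "h \<in> {a, opp a}" for h
    using that A.vats(2,4) A.vat_T_spec(1,2) by (auto simp: TA)
  have "vat S h \<in> verts S" if "h \<in> {a, opp a}" for h
    using that A.vats(2,4,8) A.w(1) okD(4)[OF A.G] by auto
  then have V: "vat S (fst a, False) \<in> verts S" "vat S (fst a, True) \<in> verts S" using ends(1,2) by blast+
  have "{vat S (fst a, False), vat S (fst a, True)} = {A.v, w}"
    using arg_cong[OF ends(3), of "image (vat S)"] A.vats(2,4) by simp
  then have ne: "vat S (fst a, False) \<noteq> vat S (fst a, True)" using A.vats(7) by auto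
  have c': "is_coloring par S c'" using c(2) is_coloring_cong[OF same] by simp
  have "recolor_sign S c c' = 1"
    using same_contraction_iff[OF okD(1,2)[OF A.G] _ V ne same eq[OF ends(1)] eq[OF ends(2)] c(1) c']
      sc A.halves(3) by (simp add: half_edges_def mem_Times_iff)
  then show ?thesis using A.ok_T by (intro limit_recolor[OF W _ same c(1) c']) (simp add: TA)
qed

lemma limit_stu:
  assumes W: "weight par 0 W" and s: "leg_split S r L a w M X x y Y" and c: "is_coloring par S c"
    and T: "T = split_leg S (last_vert r L) a w x M" "is_coloring par T cT"
      "same_contraction par (fst a) (S, c) (T, cT)"
  shows "L @ M = [] \<Longrightarrow> limit_weight par W (S, c) + limit_weight par W (T, cT) = 0"
    "L @ M \<noteq> [] \<Longrightarrow> U = split_leg S (last_vert r L) a w y M \<Longrightarrow> is_coloring par U cU \<Longrightarrow>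
      same_contraction par (fst a) (S, c) (U, cU) \<Longrightarrow>
      limit_weight par W (S, c) + limit_weight par W (T, cT) + limit_weight par W (U, cU) = 0"
proof -
  interpret A: leg_split S r L a w M X x y Y by (rule s)
  \<comment> \<open>The splittings have one solid edge more than \<open>S\<close>.\<close>
  define n where "n = Suc (card (solids S))"
  interpret good_weight par n "extension par W n" by (rule good_extension[OF W])
  have fin: "finite (solids S)" by (rule okD(7)[OF A.G])
  have lim: "extension par W n (S, c) = limit_weight par W (S, c)"
    "extension par W n (split_leg S (last_vert r L) a w z M, c)
       = limit_weight par W (split_leg S (last_vert r L) a w z M, c)" for z
    using extension_eq_limit[OF W, of S n] extension_eq_limit[OF W, of "split_leg S (last_vert r L) a w z M" n]
      fin by (simp_all add: n_def card_insert_if split_leg_def)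
  have n: "card (solids S) < n" by (simp add: n_def)
  note v = stu_value[OF s n c, unfolded lim, folded T(1)]
  note t = limit_recolor_split[OF W s T(1) c T(2,3)]
  show "L @ M = [] \<Longrightarrow> limit_weight par W (S, c) + limit_weight par W (T, cT) = 0"
    using v(2) t by simp
  show "limit_weight par W (S, c) + limit_weight par W (T, cT) + limit_weight par W (U, cU) = 0"
    if "L @ M \<noteq> []" "U = split_leg S (last_vert r L) a w y M" "is_coloring par U cU"
      "same_contraction par (fst a) (S, c) (U, cU)"
    using v(1)[OF that(1)] t limit_recolor_split[OF W leg_split_swap[OF s] that(2) c that(3,4)] that(2) by simp
qed

section \<open>Functionals and quotients\<close>

definition functional :: "(colored_graph \<Rightarrow> rat) \<Rightarrow> chain \<Rightarrow> rat" where
  "functional W x = (\<Sum>D\<in>Poly_Mapping.keys x. Poly_Mapping.lookup x D * W D)"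

lemma functional_superset:
  "finite K \<Longrightarrow> Poly_Mapping.keys x \<subseteq> K \<Longrightarrow> functional W x = (\<Sum>D\<in>K. Poly_Mapping.lookup x D * W D)"
  unfolding functional_def by (intro sum.mono_neutral_left) (auto simp: in_keys_iff)

lemma functional_add: "functional W (x + y) = functional W x + functional W y"
proof -
  define K where "K = Poly_Mapping.keys x \<union> Poly_Mapping.keys y"
  have "finite K" "Poly_Mapping.keys x \<subseteq> K" "Poly_Mapping.keys y \<subseteq> K" "Poly_Mapping.keys (x + y) \<subseteq> K"
    using keys_add[of x y] by (auto simp: K_def)
  then show ?thesis
    by (simp add: functional_superset[of K] lookup_add distrib_right sum.distrib)
qed

lemma functional_qscale: "functional W (qscale q x) = q * functional W x"
proof -
  have "Poly_Mapping.keys (qscale q x) \<subseteq> Poly_Mapping.keys x" by (auto simp: in_keys_iff)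
  then show ?thesis
    by (simp add: functional_superset[of "Poly_Mapping.keys x" "qscale q x"]) (simp add: functional_def sum_distrib_left mult.assoc)
qed

lemma functional_gen: "functional W (gen D) = W D"
  by (simp add: functional_def)

lemma functional_uminus: "functional W (- x) = - functional W x"
  using functional_add[of W x "- x"] by (simp add: functional_def)

lemma functional_diff: "functional W (x - y) = functional W x - functional W y"
  using functional_add[of W x "- y"] by (simp add: functional_uminus)

lemma functional_span:
  assumes "x \<in> chains.span B" "\<And>b. b \<in> B \<Longrightarrow> functional W b = 0"
  shows "functional W x = 0"
proof -
  have "chains.subspace {x. functional W x = 0}"
    unfolding chains.subspace_def by (simp add: functional_add functional_qscale) (simp add: functional_def)
  then have "chains.span B \<subseteq> {x. functional W x = 0}" using assms(2) by (intro chains.span_minimal) auto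
  then show ?thesis using assms(1) by blast
qed

lemma chain_expansion: "x = (\<Sum>D\<in>Poly_Mapping.keys x. qscale (Poly_Mapping.lookup x D) (gen D))"
  by (rule poly_mapping_eqI) (simp add: lookup_sum lookup_single when_def if_distrib sum.delta' in_keys_iff cong: if_cong)

text \<open>A basis of the span remains independent when \<open>x\<close> is added, so some linear
  functional is 1 at \<open>x\<close> and 0 on this basis. It is given by its values on generators,
  since chains are finite combinations of them.\<close>

lemma separating_functional:
  assumes "x \<notin> chains.span B"
  obtains W where "functional W x \<noteq> 0" "\<And>b. b \<in> chains.span B \<Longrightarrow> functional W b = 0"
proof -
  interpret P: vector_space_pair qscale "(*) :: rat \<Rightarrow> rat \<Rightarrow> rat"
    by unfold_locales (auto simp: algebra_simps)
  obtain A where A: "A \<subseteq> B" "chains.independent A" "B \<subseteq> chains.span A"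
    by (rule chains.maximal_independent_subset)
  have sp: "chains.span B \<subseteq> chains.span A" using A(3) chains.subspace_span by (rule chains.span_minimal)
  have x: "x \<notin> chains.span A" using assms A(1) chains.span_mono by blast
  then have "chains.independent (insert x A)" using A(2) by (rule chains.independent_insertI)
  then obtain g where g: "Vector_Spaces.linear qscale (*) g" "\<forall>b\<in>insert x A. g b = (if b = x then 1 else 0)"
    using P.linear_independent_extend[of "insert x A" "\<lambda>b. if b = x then 1 else 0"] by blast
  interpret g: Vector_Spaces.linear qscale "(*) :: rat \<Rightarrow> rat \<Rightarrow> rat" g by (rule g(1))
  have fg: "functional (\<lambda>D. g (gen D)) y = g y" for y
    by (subst (2) chain_expansion) (simp add: functional_def g.sum g.scale)
  have "g b = 0" if "b \<in> A" for b
    using g(2) that x chains.span_base by auto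
  then have z: "functional (\<lambda>D. g (gen D)) b = 0" if "b \<in> chains.span B" for b
    using that sp by (intro functional_span[of b A]) (auto simp: fg)
  show thesis by (rule that[OF _ z]) (use g(2) in \<open>simp_all add: fg\<close>)
qed

lemma change_sign_orientation:
  assumes "graph_iso G G' f h" "is_coloring par G c" "is_coloring par G' c'"
  obtains "same_orientation (G, c) (G', c')" "change_sign G f h c c' = 1"
  | "opposite_orientation (G, c) (G', c')" "change_sign G f h c c' = -1"
  using assms(1) change_sign_cases[OF assms(2,3), of f h]
  unfolding same_orientation_def opposite_orientation_def by auto

lemma no_solids_iso: "graph_iso G G' f h \<Longrightarrow> ok G' \<Longrightarrow> solids G = {} \<Longrightarrow> solids G' = {}"
proof (rule ccontr)
  assume iso: "graph_iso G G' f h" and G: "ok G'" "solids G = {}" and "solids G' \<noteq> {}"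
  then obtain e where e: "e \<in> solids G'" by blast
  then have "(e, False) \<in> half_edges G'" using okD(5)[OF G(1)] by (auto simp: half_edges_def)
  moreover have "h ` half_edges G = half_edges G'" using iso by (simp add: graph_iso_def bij_betw_def)
  ultimately obtain x where x: "x \<in> half_edges G" "h x = (e, False)" by (metis imageE)
  then have "fst x \<in> solids G" using iso e by (auto simp: graph_iso_def)
  then show False using G(2) by simp
qed

text \<open>Without solid edges the \<open>ok\<close> graphs are the hairy graphs, and the two
  axioms of a weight are the vanishing on orientation and IHX relators. For the latter, the three
  graphs with one common coloring do form a relator.\<close>

lemma hairy_weight:
  assumes "\<And>x. x \<in> B_relations par \<Longrightarrow> functional W x = 0"
  shows "weight par 0 W"
proof
  fix G G' c c' f h
  assume G: "ok G" "ok G'" "card (solids G) \<le> 0" and c: "is_coloring par G c" "is_coloring par G' c'"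
    and iso: "graph_iso G G' f h"
  have s: "solids G = {}" using G(3) okD(7)[OF G(1)] by simp
  have D: "(G, c) \<in> colored_hairy_graphs par" "(G', c') \<in> colored_hairy_graphs par"
    using c ok_hairy_graph[OF G(1) s] ok_hairy_graph[OF G(2) no_solids_iso[OF iso G(2) s]]
    by (simp_all add: colored_hairy_graphs_def)
  from iso c show "W (G', c') = of_int (change_sign G f h c c') * W (G, c)"
  proof (rule change_sign_orientation)
    assume o: "same_orientation (G, c) (G', c')" "change_sign G f h c c' = 1"
    have "gen (G, c) - gen (G', c') \<in> B_relations par"
      unfolding B_relations_def orientation_relators_def
      by (rule chains.span_base) (use o(1) D in blast)
    from assms[OF this] show ?thesis using o(2) by (simp add: functional_diff functional_gen)
  next
    assume o: "opposite_orientation (G, c) (G', c')" "change_sign G f h c c' = -1"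
    have "gen (G, c) + gen (G', c') \<in> B_relations par"
      unfolding B_relations_def orientation_relators_def
      by (rule chains.span_base) (use o(1) D in blast)
    from assms[OF this] show ?thesis using o(2) by (simp add: functional_add functional_gen)
  qed
next
  fix G c e G2 G3
  assume G: "ok G" "card (solids G) \<le> 0" and c: "is_coloring par G c" and e: "ihx_expansions G e G2 G3"
  have s: "solids G = {}" using G(2) okD(7)[OF G(1)] by simp
  have D: "(G, c) \<in> colored_hairy_graphs par"
    using c ok_hairy_graph[OF G(1) s] by (simp add: colored_hairy_graphs_def)
  obtain u v h h' k k' where s: "ihx_site G (e, False) u v h h' k k'" "ihx_site G (e, False) u v h h' k' k"
    "G2 = G\<lparr>vat := (vat G)(h' := v, k := u)\<rparr>" "G3 = G\<lparr>vat := (vat G)(h' := v, k' := u)\<rparr>"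
    by (rule ihx_expansions_sites[OF G(1) e])
  have sc: "same_contraction par e (G, c) (G', c)" "is_coloring par G' c"
    if "ihx_site G (e, False) u v h h' k k'" "G' = G\<lparr>vat := (vat G)(h' := v, k := u)\<rparr>" for G' k k'
  proof -
    interpret A: ihx_site G "(e, False)" u v h h' k k' by (rule that(1))
    have G': "G' = A.swapped" using that(2) by (simp add: A.swapped_def)
    have opp: "opp (e, False) = (e, True)" by (simp add: opp_def)
    have eG: "e \<in> edges G" "vat G (e, False) = u" "vat G (e, True) = v" using A.b opp by (simp_all add: half_edges_def)
    have vs: "vat G' (e, False) = u" "vat G' (e, True) = v"
      using A.vat_swapped_spec(1,2) G' opp by simp_all
    have same: "verts G' = verts G" "edges G' = edges G" "externals G' = externals G" "solids G' = solids G"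
      by (simp_all add: G')
    show c': "is_coloring par G' c" using c is_coloring_cong[OF same(1,2)] by simp
    have m: "merge G' e = merge G e" using eG vs by (simp add: merge_def fun_eq_iff)
    \<comment> \<open>Half-edges were moved only between \<open>u\<close> and \<open>v\<close>, and
      these are merged.\<close>
    have "merge G e (vat G' x) = merge G e (vat G x)" for x
      using A.vats eG by (auto simp: G' A.vat_swapped merge_def)
    then have "contract G e = contract G' e" by (simp add: contract_def m same fun_eq_iff)
    then show "same_contraction par e (G, c) (G', c)"
      using same_contraction_iff[OF okD(1,2)[OF G(1)] eG(1), of G' par c c] A.uV A.b(4) eG(2,3) vs same c
      by (simp add: recolor_sign_refl)
  qed
  note sc2 = sc[OF s(1,3)] and sc3 = sc[OF s(2,4)]
  have "gen (G, c) + gen (G2, c) + gen (G3, c) \<in> ihx_relators par (colored_hairy_graphs par)"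
    unfolding ihx_relators_def using D e sc2 sc3 by blast
  then have "gen (G, c) + gen (G2, c) + gen (G3, c) \<in> B_relations par"
    unfolding B_relations_def by (intro chains.span_base) blast
  from assms[OF this] show "W (G, c) + W (G2, c) + W (G3, c) = 0"
    by (simp add: functional_add functional_gen)
qed

lemma limit_kills_A_relations:
  assumes W: "weight par 0 W" and x: "x \<in> A_relations par"
  shows "functional (limit_weight par W) x = 0"
proof (rule functional_span[OF x[unfolded A_relations_def]], elim UnE)
  fix b assume "b \<in> orientation_relators (colored_bcr_graphs par)"
  then consider G c G' c' where "b = gen (G, c) - gen (G', c')" "(G, c) \<in> colored_bcr_graphs par"
      "(G', c') \<in> colored_bcr_graphs par" "same_orientation (G, c) (G', c')"
    | G c G' c' where "b = gen (G, c) + gen (G', c')" "(G, c) \<in> colored_bcr_graphs par"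
      "(G', c') \<in> colored_bcr_graphs par" "opposite_orientation (G, c) (G', c')"
    unfolding orientation_relators_def by auto
  then show "functional (limit_weight par W) b = 0"
  proof cases
    case (1 G c G' c')
    then obtain f h where "graph_iso G G' f h" "change_sign G f h c c' = 1"
      by (auto simp: same_orientation_def)
    then show ?thesis using 1(1-3) limit_equivariant[OF W, of G G' c c' f h]
      by (simp add: functional_diff functional_gen colored_bcr_graphs_def bcr_graph_ok)
  next
    case (2 G c G' c')
    then obtain f h where "graph_iso G G' f h" "change_sign G f h c c' = -1"
      by (auto simp: opposite_orientation_def)
    then show ?thesis using 2(1-3) limit_equivariant[OF W, of G G' c c' f h]
      by (simp add: functional_add functional_gen colored_bcr_graphs_def bcr_graph_ok)
  qed
next
  fix b assume "b \<in> ihx_relators par (colored_bcr_graphs par)"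
  then obtain G c G2 c2 G3 c3 e where b: "b = gen (G, c) + gen (G2, c2) + gen (G3, c3)"
    "(G, c) \<in> colored_bcr_graphs par" "is_coloring par G2 c2" "is_coloring par G3 c3"
    "ihx_expansions G e G2 G3" "same_contraction par e (G, c) (G2, c2)" "same_contraction par e (G, c) (G3, c3)"
    unfolding ihx_relators_def by blast
  have "ok G" "is_coloring par G c" using b(2) by (simp_all add: colored_bcr_graphs_def bcr_graph_ok)
  from limit_ihx[OF W this b(3-7)] show "functional (limit_weight par W) b = 0"
    by (simp add: b(1) functional_add functional_gen)
next
  fix b assume "b \<in> stu_relators par (colored_bcr_graphs par)"
  then consider S c T cT U cU e where "b = gen (S, c) + gen (T, cT) + gen (U, cU)"
      "(S, c) \<in> colored_bcr_graphs par" "is_coloring par T cT" "is_coloring par U cU"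
      "stu_I_expansions S e T U" "same_contraction par e (S, c) (T, cT)" "same_contraction par e (S, c) (U, cU)"
    | S c T cT e where "b = gen (S, c) + gen (T, cT)" "(S, c) \<in> colored_bcr_graphs par" "is_coloring par T cT"
      "stu_II_expansion S e T" "same_contraction par e (S, c) (T, cT)"
    unfolding stu_relators_def by blast
  then show "functional (limit_weight par W) b = 0"
  proof cases
    case (1 S c T cT U cU e)
    have S: "ok S" "is_coloring par S c" using 1(2) by (simp_all add: colored_bcr_graphs_def bcr_graph_ok)
    obtain r L a w M X x y Y where s: "leg_split S r L a w M X x y Y" "fst a = e" "L @ M \<noteq> []"
      "T = split_leg S (last_vert r L) a w x M" "U = split_leg S (last_vert r L) a w y M"
      by (rule stu_I_expansionsE[OF S(1) 1(5)])
    show ?thesis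
      using limit_stu(2)[OF W s(1) S(2) s(4) 1(3) _ s(3,5) 1(4)] 1(6,7) s(2)
      by (simp add: 1(1) functional_add functional_gen)
  next
    case (2 S c T cT e)
    have S: "ok S" "is_coloring par S c" using 2(2) by (simp_all add: colored_bcr_graphs_def bcr_graph_ok)
    obtain r a w X x y Y where s: "leg_split S r [] a w [] X x y Y" "fst a = e" "T = split_leg S r a w x []"
      by (rule stu_II_expansionE[OF S(1) 2(4)])
    show ?thesis
      using limit_stu(1)[OF W s(1) S(2), of T cT] s(2,3) 2(3,5)
      by (simp add: 2(1) functional_add functional_gen)
  qed
qed

lemma A_relations_C_space:
  assumes "x \<in> C_space par" "x \<in> A_relations par"
  shows "x \<in> B_relations par"
proof (rule ccontr)
  assume "x \<notin> B_relations par"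
  then obtain W where W: "functional W x \<noteq> 0" "\<And>b. b \<in> B_relations par \<Longrightarrow> functional W b = 0"
    unfolding B_relations_def by (rule separating_functional) blast
  \<comment> \<open>Only graphs without solid edges occur in \<open>x\<close>, and at those the
    limit is stage 0, which is \<open>W\<close> itself.\<close>
  have "functional (limit_weight par W) x = functional W x"
    unfolding functional_def
  proof (rule sum.cong[OF refl])
    fix D assume "D \<in> Poly_Mapping.keys x"
    then have "solids (fst D) = {}"
      using assms(1) by (auto simp: C_space_def free_space_def colored_hairy_graphs_def hairy_graph_def)
    then show "Poly_Mapping.lookup x D * limit_weight par W D = Poly_Mapping.lookup x D * W D"
      by (simp add: limit_weight_def)
  qed
  then show False using W(1) limit_kills_A_relations[OF hairy_weight[OF W(2)] assms(2)] by simp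
qed

text \<open>In the odd case, reversing the loop of a hair with a loop reverses the orientation.\<close>

lemma loop_relator_A_relations:
  assumes "(G, c) \<in> colored_hairy_graphs OddCase" "has_hair_with_loop G"
  shows "gen (G, c) \<in> A_relations OddCase"
proof -
  have G: "ok G" "bcr_graph G" "is_coloring OddCase G c"
    using assms(1) by (auto simp: colored_hairy_graphs_def hairy_graph_def bcr_graph_ok)
  obtain d l where c: "c = OddColoring d l" using G(3) by (cases c) auto
  then have l: "bij_betw l (verts G) {1..card (verts G)}" using G(3) by simp
  obtain e where e: "e \<in> edges G" "vat G (e, False) = vat G (e, True)"
    using assms(2) unfolding has_hair_with_loop_def by metis
  have "vat G (e, \<not> b) = vat G (e, b)" for b using e(2) by (cases b) simp_all
  then have "graph_iso G G id (flip_edge e)"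
    using e(1) by (intro graph_iso_involution)
      (auto simp: flip_edge_opp flip_edge_def opp_def half_edges_def split: if_splits)
  moreover have "change_sign G id (flip_edge e) c c = -1"
  proof -
    have "{e' \<in> edges G. snd (flip_edge e (e', d e')) \<noteq> d (fst (flip_edge e (e', d e')))} = {e}"
      using e(1) by (auto simp: flip_edge_def opp_def)
    then show ?thesis using l by (simp add: c renumbering_same bij_betw_def)
  qed
  ultimately have "opposite_orientation (G, c) (G, c)" by (auto simp: opposite_orientation_def)
  moreover have "(G, c) \<in> colored_bcr_graphs OddCase" using G by (simp add: colored_bcr_graphs_def)
  ultimately have "gen (G, c) + gen (G, c) \<in> A_relations OddCase"
    unfolding A_relations_def orientation_relators_def by (intro chains.span_base) blast
  \<comment> \<open>The orientation relation only kills twice the generator; over the rationals this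
    suffices.\<close>
  then have "qscale (1/2) (gen (G, c) + gen (G, c)) \<in> A_relations OddCase"
    unfolding A_relations_def by (rule chains.span_scale)
  moreover have "qscale (1/2) (gen (G, c) + gen (G, c)) = gen (G, c)"
    by (rule poly_mapping_eqI) (simp add: lookup_add)
  ultimately show ?thesis by simp
qed

text \<open>This is what makes the induced map well defined; injectivity is the converse inclusion
  on \<open>C_space\<close>.\<close>

lemma B_relations_subset_A_relations: "B_relations par \<subseteq> A_relations par"
  unfolding B_relations_def
proof (rule chains.span_minimal)
  show "chains.subspace (A_relations par)" unfolding A_relations_def by (rule chains.subspace_span)
  have sub: "colored_hairy_graphs par \<subseteq> colored_bcr_graphs par"
    by (auto simp: colored_hairy_graphs_def colored_bcr_graphs_def hairy_graph_def)
  have "orientation_relators (colored_hairy_graphs par) \<subseteq> orientation_relators (colored_bcr_graphs par)"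
    unfolding orientation_relators_def using sub by blast
  moreover have "ihx_relators par (colored_hairy_graphs par) \<subseteq> ihx_relators par (colored_bcr_graphs par)"
    unfolding ihx_relators_def using sub by blast
  moreover have "loop_relators (colored_hairy_graphs par) \<subseteq> A_relations par" if "par = OddCase"
    using loop_relator_A_relations that by (auto simp: loop_relators_def)
  moreover have "orientation_relators (colored_bcr_graphs par) \<subseteq> A_relations par"
    "ihx_relators par (colored_bcr_graphs par) \<subseteq> A_relations par"
    unfolding A_relations_def by (rule order_trans[OF _ chains.span_superset], blast)+
  ultimately show "orientation_relators (colored_hairy_graphs par) \<union> ihx_relators par (colored_hairy_graphs par)
      \<union> (if par = OddCase then loop_relators (colored_hairy_graphs par) else {}) \<subseteq> A_relations par"
    by (intro Un_least) (simp_all split: if_split)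
qed

section \<open>Quotients as modules over the rationals\<close>

lemma cring_rat_field: "cring rat_field"
  by (intro cringI abelian_groupI comm_monoidI)
    (auto simp: rat_field_def algebra_simps intro: exI[of _ "- _"])

context
  fixes V N :: "chain set"
  assumes V: "chains.subspace V" and N: "chains.subspace N"
begin

lemma equiv_coset_rel: "equiv V (coset_rel V N)"
proof (rule equivI)
  show "coset_rel V N \<subseteq> V \<times> V" by (auto simp: coset_rel_def)
  show "refl_on V (coset_rel V N)"
    using chains.subspace_0[OF N] by (auto simp: refl_on_def coset_rel_def)
  show "sym (coset_rel V N)"
  proof (rule symI)
    fix x y assume "(x, y) \<in> coset_rel V N"
    then show "(y, x) \<in> coset_rel V N"
      using chains.subspace_neg[OF N, of "x - y"] by (simp add: coset_rel_def)
  qed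
  show "trans (coset_rel V N)"
  proof (rule transI)
    fix x y z assume "(x, y) \<in> coset_rel V N" "(y, z) \<in> coset_rel V N"
    then show "(x, z) \<in> coset_rel V N"
      using chains.subspace_add[OF N, of "x - y" "y - z"] by (simp add: coset_rel_def)
  qed
qed

lemma coset_eq_iff: "x \<in> V \<Longrightarrow> y \<in> V \<Longrightarrow> coset V N x = coset V N y \<longleftrightarrow> x - y \<in> N"
  unfolding coset_def using eq_equiv_class_iff[OF equiv_coset_rel, of x y] by (simp add: coset_rel_def)

lemma in_coset_iff: "x \<in> V \<Longrightarrow> y \<in> coset V N x \<longleftrightarrow> y \<in> V \<and> x - y \<in> N"
  by (auto simp: coset_def coset_rel_def)

lemma carrier_quotient: "carrier (quotient_space V N) = coset V N ` V"
  by (auto simp: quotient_space_def quotient_def coset_def)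

text \<open>Addition is encoded as a union over all representatives, so the members of this union
  have to be shown equal.\<close>

lemma add_quotient:
  assumes "x \<in> V" "y \<in> V"
  shows "coset V N x \<oplus>\<^bsub>quotient_space V N\<^esub> coset V N y = coset V N (x + y)"
proof -
  have "coset V N (x' + y') = coset V N (x + y)" if "x' \<in> coset V N x" "y' \<in> coset V N y" for x' y'
  proof -
    have "x' \<in> V" "y' \<in> V" "x - x' \<in> N" "y - y' \<in> N" using that assms by (simp_all add: in_coset_iff)
    moreover from this have "- (x - x' + (y - y')) \<in> N"
      by (intro chains.subspace_neg[OF N] chains.subspace_add[OF N])
    then have "x' + y' - (x + y) \<in> N" by (simp add: algebra_simps)
    ultimately show ?thesis using assms by (subst coset_eq_iff) (auto intro: chains.subspace_add[OF V])
  qed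
  note eq = this
  have m: "x \<in> coset V N x" "y \<in> coset V N y"
    using assms chains.subspace_0[OF N] by (simp_all add: in_coset_iff)
  have "(\<Union>y'\<in>coset V N y. coset V N (x' + y')) = coset V N (x + y)" if "x' \<in> coset V N x" for x'
    by (rule UN_constant_eq[OF m(2)]) (use eq[OF that] in blast)
  then have "(\<Union>x'\<in>coset V N x. \<Union>y'\<in>coset V N y. coset V N (x' + y')) = coset V N (x + y)"
    by (intro UN_constant_eq[OF m(1)]) blast
  then show ?thesis by (simp add: quotient_space_def)
qed

lemma smult_quotient:
  assumes "x \<in> V"
  shows "q \<odot>\<^bsub>quotient_space V N\<^esub> coset V N x = coset V N (qscale q x)"
proof -
  have "coset V N (qscale q x') = coset V N (qscale q x)" if "x' \<in> coset V N x" for x'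
  proof -
    have x': "x' \<in> V" "x - x' \<in> N" using that assms by (simp_all add: in_coset_iff)
    have "- qscale q (x - x') \<in> N" by (intro chains.subspace_neg[OF N] chains.subspace_scale[OF N] x')
    then have "qscale q x' - qscale q x \<in> N" by (simp add: chains.scale_right_diff_distrib)
    then show ?thesis using assms x'(1) by (subst coset_eq_iff) (auto intro: chains.subspace_scale[OF V])
  qed
  note eq = this
  have "x \<in> coset V N x" using assms chains.subspace_0[OF N] by (simp add: in_coset_iff)
  then have "(\<Union>x'\<in>coset V N x. coset V N (qscale q x')) = coset V N (qscale q x)"
    by (rule UN_constant_eq) (use eq in blast)
  then show ?thesis by (simp add: quotient_space_def)
qed

lemma zero_quotient: "\<zero>\<^bsub>quotient_space V N\<^esub> = coset V N 0"
  by (simp add: quotient_space_def)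

lemma module_quotient: "Module.module rat_field (quotient_space V N)"
proof -
  note V' = chains.subspace_0[OF V] chains.subspace_add[OF V] chains.subspace_scale[OF V] chains.subspace_neg[OF V]
  note simps = carrier_quotient add_quotient smult_quotient zero_quotient V'
  have "abelian_group (quotient_space V N)"
  proof (rule abelian_groupI)
    fix x assume "x \<in> carrier (quotient_space V N)"
    then obtain a where a: "x = coset V N a" "a \<in> V" by (auto simp: carrier_quotient)
    show "\<exists>y\<in>carrier (quotient_space V N). y \<oplus>\<^bsub>quotient_space V N\<^esub> x = \<zero>\<^bsub>quotient_space V N\<^esub>"
      using a by (intro bexI[of _ "coset V N (- a)"]) (simp_all add: simps)
  qed (auto simp: simps add_ac)
  then show ?thesis
    by (intro moduleI cring_rat_field) (auto simp: simps rat_field_def chains.scale_left_distrib chains.scale_right_distrib)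
qed

end

lemma subspace_free_space: "chains.subspace (free_space X)"
  unfolding chains.subspace_def free_space_def
proof (intro conjI ballI allI)
  show "x + y \<in> {x. Poly_Mapping.keys x \<subseteq> X}" if "x \<in> {x. Poly_Mapping.keys x \<subseteq> X}" "y \<in> {x. Poly_Mapping.keys x \<subseteq> X}" for x y
    using that keys_add[of x y] by auto
  show "qscale q x \<in> {x. Poly_Mapping.keys x \<subseteq> X}" if "x \<in> {x. Poly_Mapping.keys x \<subseteq> X}" for q x
    using that by (auto simp: in_keys_iff)
qed simp

theorem theorem0p1:
  fixes par :: parity
  shows "\<exists>chi_star. linear_map rat_field (B_hairy par) (A_BCR par) chi_star
           \<and> (\<forall>x\<in>C_space par. chi_star (B_class par x) = A_class par (chi x))
           \<and> inj_on chi_star (carrier (B_hairy par))"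
proof -
  have C: "chains.subspace (C_space par)" and D: "chains.subspace (D_space par)"
    by (simp_all add: C_space_def D_space_def subspace_free_space)
  have A: "chains.subspace (A_relations par)" and B: "chains.subspace (B_relations par)"
    by (simp_all add: A_relations_def B_relations_def chains.subspace_span)
  have CD: "x \<in> D_space par" if "x \<in> C_space par" for x using that C_space_subset_D_space by blast
  \<comment> \<open>From right to left this is well-definedness of the induced map, from left to
    right its injectivity.\<close>
  have iff: "A_class par x = A_class par y \<longleftrightarrow> B_class par x = B_class par y"
    if "x \<in> C_space par" "y \<in> C_space par" for x y
  proof -
    have "x - y \<in> C_space par" using chains.subspace_diff[OF C that] .
    then have "x - y \<in> A_relations par \<longleftrightarrow> x - y \<in> B_relations par"
      using A_relations_C_space B_relations_subset_A_relations by blast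
    then show ?thesis
      using coset_eq_iff[OF C B that] coset_eq_iff[OF D A CD[OF that(1)] CD[OF that(2)]]
      by (simp add: A_class_def B_class_def)
  qed
  \<comment> \<open>The map is defined through a chosen representative; by \<open>iff\<close> the
    choice does not affect the class.\<close>
  define chi_star where "chi_star X = A_class par (chi (SOME x. x \<in> C_space par \<and> B_class par x = X))" for X
  have star: "chi_star (B_class par x) = A_class par x" if "x \<in> C_space par" for x
  proof -
    let ?y = "SOME y. y \<in> C_space par \<and> B_class par y = B_class par x"
    have "?y \<in> C_space par \<and> B_class par ?y = B_class par x" by (rule someI_ex) (use that in blast)
    then show ?thesis using iff[of ?y x] that by (simp add: chi_star_def chi_def)
  qed
  have carrier: "carrier (B_hairy par) = B_class par ` C_space par" "carrier (A_BCR par) = A_class par ` D_space par"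
    using carrier_quotient[OF C B] carrier_quotient[OF D A]
    by (simp_all add: B_hairy_def A_BCR_def A_class_def B_class_def)
  have "linear_map rat_field (B_hairy par) (A_BCR par) chi_star"
    unfolding linear_map_def carrier
  proof (intro conjI ballI Pi_I)
    show "Module.module rat_field (B_hairy par)" "Module.module rat_field (A_BCR par)"
      unfolding B_hairy_def A_BCR_def by (intro module_quotient C B D A)+
    show "chi_star X \<in> A_class par ` D_space par" if "X \<in> B_class par ` C_space par" for X
      using that star CD by auto
    fix X assume "X \<in> B_class par ` C_space par"
    then obtain x where x: "x \<in> C_space par" "X = B_class par x" by blast
    show "chi_star (X \<oplus>\<^bsub>B_hairy par\<^esub> Y) = chi_star X \<oplus>\<^bsub>A_BCR par\<^esub> chi_star Y"
      if Y: "Y \<in> B_class par ` C_space par" for Y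
    proof -
      obtain y where y: "y \<in> C_space par" "Y = B_class par y" using Y by blast
      have "X \<oplus>\<^bsub>B_hairy par\<^esub> Y = B_class par (x + y)"
        using add_quotient[OF C B x(1) y(1)] by (simp add: B_hairy_def B_class_def x y)
      moreover have "A_class par x \<oplus>\<^bsub>A_BCR par\<^esub> A_class par y = A_class par (x + y)"
        using add_quotient[OF D A CD[OF x(1)] CD[OF y(1)]] by (simp add: A_BCR_def A_class_def)
      ultimately show ?thesis using x y star chains.subspace_add[OF C x(1) y(1)] by simp
    qed
    show "chi_star (q \<odot>\<^bsub>B_hairy par\<^esub> X) = q \<odot>\<^bsub>A_BCR par\<^esub> chi_star X" for q
    proof -
      have "q \<odot>\<^bsub>B_hairy par\<^esub> X = B_class par (qscale q x)"
        using smult_quotient[OF C B x(1)] by (simp add: B_hairy_def B_class_def x)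
      moreover have "q \<odot>\<^bsub>A_BCR par\<^esub> A_class par x = A_class par (qscale q x)"
        using smult_quotient[OF D A CD[OF x(1)]] by (simp add: A_BCR_def A_class_def)
      ultimately show ?thesis using x star chains.subspace_scale[OF C x(1)] by simp
    qed
  qed
  moreover have "inj_on chi_star (carrier (B_hairy par))"
    unfolding carrier by (rule inj_onI) (use star iff in auto)
  ultimately show ?thesis using star by (intro exI[of _ chi_star]) (simp add: chi_def)
qed

end
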